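(* Given an instance $(G,\mathcal{L},x)$ of the laminar thin tree problem with nonnegative edge costs $c$, such that $x$ is $\mathcal{L}$-aligned, one can find in polynomial time a spanning tree $T$ of $G$ with $c(T)\le c(x)$ and $$|T\cap\delta(S)| \le 2\lceil x(\delta(S))\rceil + 1 \le 2x(\delta(S))+3 \quad\text{for all } S\in\mathcal{L}.$$
   Context: Let $G=(V,E)$ be a connected undirected graph with nonnegative edge costs $c:E\to\mathbb{R}_{\ge 0}$. For $S\subseteq V$, $\delta(S)$ is the set of edges with exactly one endpoint in $S$, $E(S)$ is the set of edges with both endpoints in $S$, $G[S]$ is the induced subgraph, and for $F\subseteq E$, $x(F)=\sum_{e\in F}x_e$; $c(x)=\sum_e c_e x_e$, $c(T)=\sum_{e\in T}c_e$. A family $\mathcal{L}\subseteq 2^V$ is laminar if for all $S,T\in\mathcal{L}$, $S\cap T\in\{\emptyset,S,T\}$; it is assumed $V\in\mathcal{L}$. Each $S\in\mathcal{L}$ has a degree bound $b_S\in\mathbb{Z}_{\ge 0}$. The spanning tree polytope of a graph $H=(W,F)$ is $P_{\mathrm{st}}(H)=\{y\in\mathbb{R}^F_{\ge0}: y(F)=|W|-1,\ y(F(U))\le |U|-1\ \forall U\subseteq W\}$. An instance $(G,\mathcal{L},x)$ consists of $G$, $\mathcal{L}$, and a point $x$ feasible for the LP $\min\sum_e c_ex_e$ subject to $x(\delta(S))\le b_S$ for all $S\in\mathcal{L}$ and $x\in P_{\mathrm{st}}(G)$. A point $x\in P_{\mathrm{st}}(G)$ is $\mathcal{L}$-aligned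 if for every $S\in\mathcal{L}$, the restriction $x_{\mid E(S)}$ lies in $P_{\mathrm{st}}(G[S])$. *)

theory Defs
  imports
    Complex_Main
    "HOL-Library.Log_Nat"
    "HOL-Computational_Algebra.Polynomial"
begin

section \<open>Graphs and spanning trees\<close>

definition ugraph :: "'v set \<Rightarrow> 'v set set \<Rightarrow> bool" where
  "ugraph V E \<longleftrightarrow> finite V \<and> (\<forall>e\<in>E. e \<subseteq> V \<and> card e = 2)"

definition connected_on :: "'v set \<Rightarrow> 'v set set \<Rightarrow> bool" where
  "connected_on V E \<longleftrightarrow> V \<noteq> {} \<and> (\<forall>u\<in>V. \<forall>v\<in>V. (u, v) \<in> {(a, b). {a, b} \<in> E}\<^sup>*)"

text \<open>A cycle is given by the list of its (at least three) distinct vertices in cyclic order.\<close>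

definition has_cycle :: "'v set set \<Rightarrow> bool" where
  "has_cycle E \<longleftrightarrow>
    (\<exists>p. 3 \<le> length p \<and> distinct p \<and>
         (\<forall>i<length p. {p ! i, p ! (Suc i mod length p)} \<in> E))"

definition spanning_tree :: "'v set \<Rightarrow> 'v set set \<Rightarrow> 'v set set \<Rightarrow> bool" where
  "spanning_tree V E T \<longleftrightarrow> T \<subseteq> E \<and> connected_on V T \<and> \<not> has_cycle T"

definition cut_edges :: "'v set set \<Rightarrow> 'v set \<Rightarrow> 'v set set" where
  "cut_edges E S = {e \<in> E. card (e \<inter> S) = 1}"

definition induced_edges :: "'v set set \<Rightarrow> 'v set \<Rightarrow> 'v set set" where
  "induced_edges E S = {e \<in> E. e \<subseteq> S}"

text \<open>
  A vector indexed by the edge set \<open>F\<close> is a function on all vertex sets of which only the values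
  on \<open>F\<close> matter; so no restriction operator is needed for passing to an induced subgraph.
  The rank constraint is imposed for nonempty \<open>U\<close> only: for \<open>U = {}\<close> it would read \<open>0 \<le> -1\<close>.
\<close>

definition spanning_tree_polytope :: "'v set \<Rightarrow> 'v set set \<Rightarrow> ('v set \<Rightarrow> real) set" where
  "spanning_tree_polytope W F =
    {y. (\<forall>e\<in>F. 0 \<le> y e) \<and> sum y F = real (card W) - 1 \<and>
        (\<forall>U. U \<subseteq> W \<and> U \<noteq> {} \<longrightarrow> sum y (induced_edges F U) \<le> real (card U) - 1)}"


section \<open>The laminar thin tree problem\<close>

definition laminar_on :: "'v set \<Rightarrow> 'v set set \<Rightarrow> bool" where
  "laminar_on V L \<longleftrightarrow>
    L \<subseteq> Pow V \<and> V \<in> L \<and> (\<forall>S\<in>L. \<forall>T\<in>L. S \<inter> T \<in> {{}, S, T})"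

definition laminar_instance ::
  "'v set \<Rightarrow> 'v set set \<Rightarrow> 'v set set \<Rightarrow> ('v set \<Rightarrow> nat) \<Rightarrow> ('v set \<Rightarrow> real) \<Rightarrow> bool" where
  "laminar_instance V E L b x \<longleftrightarrow>
    ugraph V E \<and> connected_on V E \<and> laminar_on V L \<and>
    x \<in> spanning_tree_polytope V E \<and>
    (\<forall>S\<in>L. sum x (cut_edges E S) \<le> real (b S))"

definition aligned :: "'v set set \<Rightarrow> 'v set set \<Rightarrow> ('v set \<Rightarrow> real) \<Rightarrow> bool" where
  "aligned E L x \<longleftrightarrow> (\<forall>S\<in>L. x \<in> spanning_tree_polytope S (induced_edges E S))"

definition thin_tree ::
  "'v set \<Rightarrow> 'v set set \<Rightarrow> 'v set set \<Rightarrow> ('v set \<Rightarrow> real) \<Rightarrow> ('v set \<Rightarrow> real) \<Rightarrow> 'v set set \<Rightarrow> bool"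
where
  "thin_tree V E L x c T \<longleftrightarrow>
    spanning_tree V E T \<and>
    sum c T \<le> (\<Sum>e\<in>E. c e * x e) \<and>
    (\<forall>S\<in>L.
      int (card (T \<inter> cut_edges E S)) \<le> 2 * \<lceil>sum x (cut_edges E S)\<rceil> + 1 \<and>
      real_of_int (2 * \<lceil>sum x (cut_edges E S)\<rceil> + 1) \<le> 2 * sum x (cut_edges E S) + 3)"


section \<open>Polynomial time\<close>

text \<open>
  Machine model: a first-order functional language over integers and pairs, call-by-value, with the
  logarithmic cost measure. An arithmetic operation costs one plus the binary lengths of its operands,
  every other step costs one. Since pairs cannot be compared as a whole and the length of the result
  of an operation is bounded by its cost, a run of cost \<open>t\<close> is simulated in time polynomial in \<open>t\<close>
  and the input length by a Turing machine that stores values as pointer structures; conversely, a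
  Turing machine step is simulated at constant cost. So the polynomial-time functions are the usual
  ones.

  Variables are de Bruijn indices into the environment. A program is the list of the bodies of its
  functions; each function has one parameter, and function 0 is the entry point.
\<close>

datatype val = VNum int | VPair val val

datatype arith = Plus | Minus | Times | Div | Less

datatype expr =
    Var nat
  | Lit int
  | Arith arith expr expr
  | MkPair expr expr
  | First expr
  | Second expr
  | IsPair expr
  | Cond expr expr expr
  | LetIn expr expr
  | Call nat expr

type_synonym program = "expr list"

fun arith_op :: "arith \<Rightarrow> int \<Rightarrow> int \<Rightarrow> int" where
  "arith_op Plus i j = i + j"
| "arith_op Minus i j = i - j"
| "arith_op Times i j = i * j"
| "arith_op Div i j = i div j"
| "arith_op Less i j = (if i < j then 1 else 0)"

definition bit_length :: "int \<Rightarrow> nat" where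
  "bit_length i = nat (bitlen \<bar>i\<bar>)"

fun is_pair :: "val \<Rightarrow> bool" where
  "is_pair (VNum i) = False"
| "is_pair (VPair v w) = True"

text \<open>\<open>eval P env e v t\<close>: under program \<open>P\<close>, expression \<open>e\<close> evaluates to \<open>v\<close> at cost \<open>t\<close>.\<close>

inductive eval :: "program \<Rightarrow> val list \<Rightarrow> expr \<Rightarrow> val \<Rightarrow> nat \<Rightarrow> bool" for P :: program where
  Var: "i < length env \<Longrightarrow> eval P env (Var i) (env ! i) 1"
| Lit: "eval P env (Lit k) (VNum k) 1"
| Arith: "\<lbrakk>eval P env e1 (VNum i) t1; eval P env e2 (VNum j) t2\<rbrakk> \<Longrightarrow>
    eval P env (Arith f e1 e2) (VNum (arith_op f i j)) (t1 + t2 + bit_length i + bit_length j + 1)"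
| MkPair: "\<lbrakk>eval P env e1 v t1; eval P env e2 w t2\<rbrakk> \<Longrightarrow>
    eval P env (MkPair e1 e2) (VPair v w) (t1 + t2 + 1)"
| First: "eval P env e (VPair v w) t \<Longrightarrow> eval P env (First e) v (t + 1)"
| Second: "eval P env e (VPair v w) t \<Longrightarrow> eval P env (Second e) w (t + 1)"
| IsPair: "eval P env e v t \<Longrightarrow>
    eval P env (IsPair e) (VNum (if is_pair v then 1 else 0)) (t + 1)"
| Cond: "\<lbrakk>eval P env e (VNum i) t1; eval P env (if i \<noteq> 0 then e1 else e2) v t2\<rbrakk> \<Longrightarrow>
    eval P env (Cond e e1 e2) v (t1 + t2 + 1)"
| LetIn: "\<lbrakk>eval P env e1 w t1; eval P (w # env) e2 v t2\<rbrakk> \<Longrightarrow>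
    eval P env (LetIn e1 e2) v (t1 + t2 + 1)"
| Call: "\<lbrakk>eval P env e w t1; f < length P; eval P [w] (P ! f) v t2\<rbrakk> \<Longrightarrow>
    eval P env (Call f e) v (t1 + t2 + 1)"

definition computes_in :: "program \<Rightarrow> val \<Rightarrow> val \<Rightarrow> nat \<Rightarrow> bool" where
  "computes_in P d r t \<longleftrightarrow> eval P [d] (Call 0 (Var 0)) r t"

lemma eval_deterministic:
  "eval P env e v t \<Longrightarrow> eval P env e v' t' \<Longrightarrow> v' = v \<and> t' = t"
proof (induction arbitrary: v' t' rule: eval.induct)
  case (Var i env)
  then show ?case by (auto elim: eval.cases)
next
  case (Lit env k)
  then show ?case by (auto elim: eval.cases)
next
  case (Arith env e1 i t1 e2 j t2 f)
  from Arith.prems show ?case by cases (use Arith.IH in blast)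
next
  case (MkPair env e1 v t1 e2 w t2)
  from MkPair.prems show ?case by cases (use MkPair.IH in blast)
next
  case (First env e v w t)
  from First.prems show ?case by cases (use First.IH in blast)
next
  case (Second env e v w t)
  from Second.prems show ?case by cases (use Second.IH in blast)
next
  case (IsPair env e v t)
  from IsPair.prems show ?case by cases (use IsPair.IH in blast)
next
  case (Cond env e i t1 e1 e2 v t2)
  from Cond.prems show ?case by cases (use Cond.IH in blast)
next
  case (LetIn env e1 w t1 e2 v t2)
  from LetIn.prems show ?case by cases (use LetIn.IH in blast)
next
  case (Call env e w t1 f v t2)
  from Call.prems show ?case by cases (use Call.IH in blast)
qed


section \<open>Encodings\<close>

fun val_size :: "val \<Rightarrow> nat" where
  "val_size (VNum i) = bit_length i + 1"
| "val_size (VPair v w) = val_size v + val_size w + 1"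

definition enc_nat :: "nat \<Rightarrow> val" where
  "enc_nat n = VNum (int n)"

definition enc_rat :: "rat \<Rightarrow> val" where
  "enc_rat q = (case quotient_of q of (m, n) \<Rightarrow> VPair (VNum m) (VNum n))"

definition enc_pair :: "('a \<Rightarrow> val) \<Rightarrow> ('b \<Rightarrow> val) \<Rightarrow> 'a \<times> 'b \<Rightarrow> val" where
  "enc_pair f g p = VPair (f (fst p)) (g (snd p))"

definition enc_list :: "('a \<Rightarrow> val) \<Rightarrow> 'a list \<Rightarrow> val" where
  "enc_list f xs = foldr VPair (map f xs) (VNum 0)"

definition edge_of :: "nat \<times> nat \<Rightarrow> nat set" where
  "edge_of p = {fst p, snd p}"

text \<open>
  The input lists, each item once and in arbitrary order: the vertices; the edges, each with its
  rational values of \<open>x\<close> and \<open>c\<close>; the sets of the laminar family, each as a vertex list with its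
  degree bound. Numbers are in binary, rationals as reduced fractions. Only instances with rational
  \<open>x\<close> and \<open>c\<close> have an encoding.
\<close>

definition encodes_instance ::
  "val \<Rightarrow> nat set \<Rightarrow> nat set set \<Rightarrow> nat set set \<Rightarrow> (nat set \<Rightarrow> nat) \<Rightarrow> (nat set \<Rightarrow> real) \<Rightarrow>
   (nat set \<Rightarrow> real) \<Rightarrow> bool" where
  "encodes_instance d V E L b x c \<longleftrightarrow>
    (\<exists>(vs :: nat list) (es :: ((nat \<times> nat) \<times> (rat \<times> rat)) list) (ls :: (nat list \<times> nat) list).
      distinct vs \<and> V = set vs \<and>
      distinct (map (edge_of \<circ> fst) es) \<and> E = set (map (edge_of \<circ> fst) es) \<and>
      (\<forall>(p, q, r) \<in> set es. x (edge_of p) = of_rat q \<and> c (edge_of p) = of_rat r) \<and>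
      distinct (map (set \<circ> fst) ls) \<and> L = set (map (set \<circ> fst) ls) \<and>
      (\<forall>(S, k) \<in> set ls. distinct S \<and> b (set S) = k) \<and>
      d = VPair (enc_list enc_nat vs)
           (VPair (enc_list (enc_pair (enc_pair enc_nat enc_nat) (enc_pair enc_rat enc_rat)) es)
                  (enc_list (enc_pair (enc_list enc_nat) enc_nat) ls)))"

definition encodes_edge_set :: "val \<Rightarrow> nat set set \<Rightarrow> bool" where
  "encodes_edge_set r T \<longleftrightarrow>
    (\<exists>ps. distinct (map edge_of ps) \<and> T = set (map edge_of ps) \<and>
          r = enc_list (enc_pair enc_nat enc_nat) ps)"

end

theory Submission
  imports Defs "HOL-Library.FuncSet"
begin

text \<open>
  The tree is found by iterative relaxation. Let \<open>k S\<close> be the rounded-up value of the cut of \<open>S\<close>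
  in the given point. A set of \<open>L\<close> is active as long as more than \<open>2 * k S + 1\<close> edges of its cut are
  in the support; for active sets the cut value is kept at most \<open>k S\<close>, inactive sets are dropped. All
  sets of \<open>L\<close> stay tight for the rank constraints.

  The active sets whose cut has value \<open>k S\<close> have at least four fractional cut edges. Group the
  fractional edges into classes lying in the same tight sets; each class has an integral value, hence
  at least two edges. Counting half-edges in the regions of the laminar family shows that the class
  sums and the tight active cuts do not determine the fractional edges, so one can move along a
  nonzero kernel vector without raising the cost until an edge becomes integral, a cut becomes tight or
  inactive, or a new rank constraint becomes tight. Linear independence of the recorded rank
  constraints bounds the number of moves by \<open>2 * card E + card L\<close>.

  For the running time, kernel vectors are primitive solutions of 0/1 systems and therefore small by
  Siegel's lemma, the step length is found by bisection, and violated rank constraints are found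
  by scaling: the constraints of the sets containing \<open>r\<close> hold iff the weight of each edge can be split
  between its ends such that \<open>r\<close> receives nothing and every other vertex at most \<open>1\<close>.
\<close>

section \<open>Polynomial-time functions\<close>

text \<open>The threshold \<open>2 * k S + 1\<close> comes from the count. If \<open>a\<close> cut
  edges of a tight active set have value 1, the fractional ones carry the positive integer
  \<open>k S - a\<close>, so \<open>a \<le> k S - 1\<close> and at least
  \<open>k S + 3 \<ge> 4\<close> of them remain. A set needs four half-edges: two pay for its row,
  two are credited to the surrounding region, where the set acts as a contracted vertex. The
  outermost set \<open>V\<close> has no row; its surplus makes the count strict. The obstacle is a
  region where the general estimate yields only two or three. There every class at the level has
  value exactly 1 and at most one half-edge is not explained by classes. One left over would belong
  to an edge of integral value; none would make the cut row a consequence of the other rows, which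
  is excluded by discarding dependent cuts. There can be exponentially many tight rank constraints.
  A direction respecting all of them exists, but the algorithm imposes only those recorded. A
  direction that breaks an unrecorded tight one is stopped at length 0: the point stays, a new row
  is recorded, and this counts as progress.\<close>

fun shift_calls :: "nat \<Rightarrow> expr \<Rightarrow> expr" where
  "shift_calls k (Var i) = Var i"
| "shift_calls k (Lit i) = Lit i"
| "shift_calls k (Arith f a b) = Arith f (shift_calls k a) (shift_calls k b)"
| "shift_calls k (MkPair a b) = MkPair (shift_calls k a) (shift_calls k b)"
| "shift_calls k (First a) = First (shift_calls k a)"
| "shift_calls k (Second a) = Second (shift_calls k a)"
| "shift_calls k (IsPair a) = IsPair (shift_calls k a)"
| "shift_calls k (Cond a b c) = Cond (shift_calls k a) (shift_calls k b) (shift_calls k c)"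
| "shift_calls k (LetIn a b) = LetIn (shift_calls k a) (shift_calls k b)"
| "shift_calls k (Call f a) = Call (f + k) (shift_calls k a)"

text \<open>Call targets are absolute positions in the program list, so code placed after
  \<open>Q\<close> behaves as before, at the same cost, once every target is raised by
  \<open>length Q\<close>. Linking of programs rests on this.\<close>

lemma eval_shift_calls:
  "eval P env e v t \<Longrightarrow>
   eval (Q @ map (shift_calls (length Q)) P @ R) env (shift_calls (length Q) e) v t"
proof (induction rule: eval.induct)
  case (Cond env e i t1 e1 e2 v t2)
  have "eval (Q @ map (shift_calls (length Q)) P @ R) env
      (if i \<noteq> 0 then shift_calls (length Q) e1 else shift_calls (length Q) e2) v t2"
    using Cond.IH(2) by (cases "i = 0") auto
  from eval.Cond[OF Cond.IH(1) this] show ?case by simp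
next
  case (Call env e w t1 f v t2)
  have "(Q @ map (shift_calls (length Q)) P @ R) ! (f + length Q) = shift_calls (length Q) (P ! f)"
    using Call.hyps by (simp add: nth_append)
  with Call.IH Call.hyps show ?case
    using eval.Call[of "Q @ map (shift_calls (length Q)) P @ R" env "shift_calls (length Q) e" w t1
        "f + length Q" v t2] by simp
qed (auto simp only: shift_calls.simps intro!: eval.intros)

text \<open>With the encoding attached to the type, running times are claimed for typed functions.
  The instances are chosen so that the code of the input triple of lists is the prescribed encoding
  of an instance, and the booleans are the numbers on which \<open>Cond\<close> branches and which
  \<open>Less\<close> returns.\<close>

class encodable =
  fixes encode :: "'a \<Rightarrow> val"

definition sz :: "'a::encodable \<Rightarrow> nat" where
  "sz a = val_size (encode a)"

instantiation int :: encodable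
begin
definition "encode = VNum"
instance ..
end

instantiation nat :: encodable
begin
definition "encode = enc_nat"
instance ..
end

instantiation rat :: encodable
begin
definition "encode = enc_rat"
instance ..
end

instantiation bool :: encodable
begin
definition "encode b = VNum (if b then 1 else 0)"
instance ..
end

instantiation prod :: (encodable, encodable) encodable
begin
definition "encode = enc_pair encode encode"
instance ..
end

instantiation list :: (encodable) encodable
begin
definition "encode = enc_list encode"
instance ..
end

lemma encode_simps:
  "encode (i::int) = VNum i" "encode (n::nat) = VNum (int n)"
  "encode (b::bool) = VNum (if b then 1 else 0)"
  "encode (p::'a::encodable \<times> 'b::encodable) = VPair (encode (fst p)) (encode (snd p))"
  "encode ([]::'a list) = VNum 0" "encode ((x::'a) # xs) = VPair (encode x) (encode xs)"
  by (simp_all add: encode_int_def encode_nat_def enc_nat_def encode_bool_def encode_prod_def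
      encode_list_def enc_list_def enc_pair_def)

lemma bit_length_le_iff: "bit_length i \<le> k \<longleftrightarrow> \<bar>i\<bar> < 2 ^ k"
  using bitlen_le_iff_power[of "\<bar>i\<bar>" "int k"] by (auto simp: bit_length_def)

lemma abs_less_bit_length: "\<bar>i\<bar> < 2 ^ bit_length i"
  using bit_length_le_iff by blast

lemma bit_length_add: "bit_length (i + j) \<le> bit_length i + bit_length j + 1"
proof -
  have "\<bar>i + j\<bar> < 2 ^ bit_length i + 2 ^ bit_length j"
    using abs_less_bit_length[of i] abs_less_bit_length[of j] by linarith
  also have "(2::int) ^ bit_length i \<le> 2 ^ (bit_length i + bit_length j)"
    by (rule power_increasing) auto
  also have "(2::int) ^ bit_length j \<le> 2 ^ (bit_length i + bit_length j)"
    by (rule power_increasing) auto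
  finally show ?thesis by (simp add: bit_length_le_iff)
qed

lemma bit_length_minus [simp]: "bit_length (- i) = bit_length i"
  by (simp add: bit_length_def)

lemma bit_length_0 [simp]: "bit_length 0 = 0"
  using bit_length_le_iff[of 0 0] by simp

lemma bit_length_1 [simp]: "bit_length 1 = 1"
  using bit_length_le_iff[of 1 1] bit_length_le_iff[of 1 0] by simp

lemma bit_length_mult: "bit_length (i * j) \<le> bit_length i + bit_length j"
proof -
  have "\<bar>i\<bar> * \<bar>j\<bar> < 2 ^ bit_length i * 2 ^ bit_length j"
    by (intro mult_strict_mono') (auto simp: abs_less_bit_length)
  then show ?thesis by (simp add: bit_length_le_iff abs_mult power_add)
qed

lemma bit_length_mono: "\<bar>i\<bar> \<le> \<bar>j\<bar> \<Longrightarrow> bit_length i \<le> bit_length j"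
  using abs_less_bit_length[of j] by (simp add: bit_length_le_iff)

lemma bit_length_int_le: "bit_length (int n) \<le> n"
proof -
  have "int n < 2 ^ n" by (rule of_nat_less_two_power)
  then show ?thesis by (simp add: bit_length_le_iff)
qed

lemma abs_div_le: "\<bar>i div j\<bar> \<le> \<bar>i :: int\<bar>"
proof -
  have pos: "\<bar>i div j\<bar> \<le> \<bar>i\<bar>" if "j > 0" for i j :: int
  proof (cases "i \<ge> 0")
    case True
    then have "0 \<le> i div j" "i div j \<le> i div 1"
      using that by (simp add: pos_imp_zdiv_nonneg_iff, intro zdiv_mono2) auto
    then show ?thesis using True by simp
  next
    case False
    then have "i div j < 0" "i div 1 \<le> i div j"
      using that by (simp add: pos_imp_zdiv_neg_iff, intro zdiv_mono2_neg) auto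
    then show ?thesis using False by simp
  qed
  consider "j = 0" | "j > 0" | "- j > 0" by linarith
  then show ?thesis
  proof cases
    case 3
    then show ?thesis using pos[of "- j" "- i"] by simp
  qed (auto intro: pos)
qed

lemma bit_length_div: "bit_length (i div j) \<le> bit_length i"
  by (rule bit_length_mono[OF abs_div_le])

lemma sz_simps [simp]:
  "sz (i::int) = bit_length i + 1" "sz (n::nat) = bit_length (int n) + 1"
  "sz (a::'a::encodable, b::'b::encodable) = sz a + sz b + 1"
  "sz ([]::'a list) = 1" "sz ((x::'a) # xs) = sz x + sz xs + 1"
  by (simp_all add: sz_def encode_simps)

lemma sz_bool: "sz (b::bool) \<le> 2"
  by (simp add: sz_def encode_simps)

lemma sz_pair: "sz p = sz (fst p) + sz (snd p) + 1"
  by (cases p) simp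

lemma sz_append: "sz (xs @ ys) + 1 = sz xs + sz ys"
  by (induction xs) auto

lemma sz_ge_elem: "x \<in> set xs \<Longrightarrow> sz x < sz xs"
  by (induction xs) auto

lemma sz_ge_length: "length xs < sz xs"
  by (induction xs) auto

lemma sz_rev: "sz (rev xs) = sz xs"
proof (induction xs)
  case (Cons a xs)
  then show ?case using sz_append[of "rev xs" "[a]"] by simp
qed simp

lemma sz_take: "sz (take n xs) \<le> sz xs"
proof (induction xs arbitrary: n)
  case (Cons x xs)
  then show ?case by (cases n) auto
qed simp

lemma sz_concat_le: "sz (concat xss) \<le> sz xss"
proof (induction xss)
  case (Cons xs xss)
  then show ?case using sz_append[of xs "concat xss"] by simp
qed simp

lemma sz_list_le: "(\<And>x. x \<in> set xs \<Longrightarrow> sz x \<le> B) \<Longrightarrow> sz xs \<le> 1 + length xs * (B + 1)"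
proof (induction xs)
  case (Cons x xs)
  then have "sz xs \<le> 1 + length xs * (B + 1)" "sz x \<le> B" by auto
  then show ?case by simp
qed simp

subsection \<open>Polynomially bounded quantities\<close>

text \<open>A single power stands for any polynomial: the base is at least 2, so constants and
  factors 2 are absorbed into the exponent.\<close>

definition pbnd :: "('a::encodable \<Rightarrow> nat) \<Rightarrow> bool" where
  "pbnd g \<longleftrightarrow> (\<exists>k. \<forall>a. g a \<le> (sz a + 2) ^ k)"

named_theorems pb
named_theorems pt

lemma pbnd_mono: "pbnd h \<Longrightarrow> (\<And>a. g a \<le> h a) \<Longrightarrow> pbnd g"
  unfolding pbnd_def by (meson le_trans)

lemma pbnd_const [pb]: "pbnd (\<lambda>a. c)"
proof -
  have "c \<le> (sz a + 2) ^ c" for a :: 'a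
    using less_exp[of c] power_mono[of 2 "sz a + 2" c] by linarith
  then show ?thesis unfolding pbnd_def by blast
qed

lemma pbnd_add [pb]: assumes "pbnd g" "pbnd h" shows "pbnd (\<lambda>a. g a + h a)"
proof -
  obtain i j where ij: "\<And>a. g a \<le> (sz a + 2) ^ i" "\<And>a. h a \<le> (sz a + 2) ^ j"
    using assms unfolding pbnd_def by blast
  have "g a + h a \<le> (sz a + 2) ^ (i + j + 1)" for a
  proof -
    let ?N = "sz a + 2"
    have "?N ^ i \<le> ?N ^ (i + j)" "?N ^ j \<le> ?N ^ (i + j)" by (intro power_increasing; simp)+
    then have "g a + h a \<le> 2 * ?N ^ (i + j)" using ij[of a] by linarith
    also have "\<dots> \<le> ?N * ?N ^ (i + j)" by (intro mult_right_mono) auto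
    finally show ?thesis by simp
  qed
  then show ?thesis unfolding pbnd_def by blast
qed

lemma pbnd_mult [pb]: assumes "pbnd g" "pbnd h" shows "pbnd (\<lambda>a. g a * h a)"
proof -
  obtain i j where ij: "\<And>a. g a \<le> (sz a + 2) ^ i" "\<And>a. h a \<le> (sz a + 2) ^ j"
    using assms unfolding pbnd_def by blast
  have "g a * h a \<le> (sz a + 2) ^ (i + j)" for a
    using mult_mono[OF ij(1)[of a] ij(2)[of a]] by (simp add: power_add)
  then show ?thesis unfolding pbnd_def by blast
qed

lemma pbnd_Suc [pb]: "pbnd g \<Longrightarrow> pbnd (\<lambda>a. Suc (g a))"
  using pbnd_add[OF _ pbnd_const[of 1]] by simp

lemma pbnd_power [pb]: "pbnd g \<Longrightarrow> pbnd (\<lambda>a. g a ^ n)"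
  by (induction n) (auto intro: pb)

lemma pbnd_sz [pb]: "pbnd sz"
  unfolding pbnd_def by (rule exI[of _ 1]) auto

lemma pbnd_comp: assumes "pbnd g" "pbnd (\<lambda>a. sz (f a))" shows "pbnd (\<lambda>a. g (f a))"
proof -
  obtain j where j: "\<And>a. g a \<le> (sz a + 2) ^ j" using assms unfolding pbnd_def by blast
  have "pbnd (\<lambda>a. (sz (f a) + 2) ^ j)" by (intro pb assms)
  then show ?thesis by (rule pbnd_mono) (rule j)
qed

subsection \<open>Closure rules\<close>

text \<open>The bound on the result is not implied by the bound on the cost: \<open>MkPair\<close>
  may use the same value twice, so a linear number of steps can build a value of exponential
  \<open>val_size\<close>. Composition needs both bounds.\<close>

definition pt :: "('a::encodable \<Rightarrow> 'b::encodable) \<Rightarrow> bool" where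
  "pt f \<longleftrightarrow> (\<exists>P T. P \<noteq> [] \<and> (\<forall>a. eval P [encode a] (P ! 0) (encode (f a)) (T a)) \<and>
     pbnd T \<and> pbnd (\<lambda>a. sz (f a)))"

definition runs :: "program \<Rightarrow> nat \<Rightarrow> ('a::encodable \<Rightarrow> 'b::encodable) \<Rightarrow> ('a \<Rightarrow> nat) \<Rightarrow> bool" where
  "runs P i f T \<longleftrightarrow> i < length P \<and> (\<forall>a. eval P [encode a] (P ! i) (encode (f a)) (T a))"

lemma ptI:
  assumes "P \<noteq> []" "pbnd g" "pbnd h"
    and "\<And>a. \<exists>t \<le> g a. eval P [encode a] (P ! 0) (encode (f a)) t" "\<And>a. sz (f a) \<le> h a"
  shows "pt f"
proof -
  obtain T where T: "\<forall>a. T a \<le> g a \<and> eval P [encode a] (P ! 0) (encode (f a)) (T a)"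
    using assms(4) by metis
  then show ?thesis unfolding pt_def
    using assms pbnd_mono[of g T] pbnd_mono[of h "\<lambda>a. sz (f a)"] by blast
qed

lemma pbnd_sz_pt: "pt f \<Longrightarrow> pbnd (\<lambda>a. sz (f a))"
  unfolding pt_def by blast

lemma runs_Call:
  "runs P i f T \<Longrightarrow> eval P env e (encode a) t \<Longrightarrow>
   eval P env (Call i e) (encode (f a)) (t + T a + 1)"
  unfolding runs_def by (auto intro!: eval.Call[where f = i, THEN back_subst[where P = "\<lambda>t. eval _ _ _ _ t"]])

lemma eval_Var0: "eval P (v # env) (Var 0) v 1"
  using eval.Var[of 0 "v # env" P] by simp

lemma eval_Cond_true:
  "eval P env e (VNum i) t \<Longrightarrow> i \<noteq> 0 \<Longrightarrow> eval P env e1 v t' \<Longrightarrow> eval P env (Cond e e1 e2) v (t + t' + 1)"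
  by (rule eval.Cond[where i = i]) auto

lemma eval_Cond_false:
  "eval P env e (VNum 0) t \<Longrightarrow> eval P env e2 v t' \<Longrightarrow> eval P env (Cond e e1 e2) v (t + t' + 1)"
  by (rule eval.Cond[where i = 0]) auto

text \<open>The relocated code is fixed before the program around it. A rule can thus first write a
  body that calls position \<open>n\<close> and then append the code.\<close>

lemma link:
  assumes "pt f"
  obtains S T where "pbnd T" "\<And>Q R. length Q = n \<Longrightarrow> runs (Q @ S @ R) n f T"
proof -
  obtain P T where P: "P \<noteq> []" "\<And>a. eval P [encode a] (P ! 0) (encode (f a)) (T a)" "pbnd T"
    using assms unfolding pt_def by blast
  have "runs (Q @ map (shift_calls n) P @ R) n f T" if "length Q = n" for Q R
    using eval_shift_calls[OF P(2), of Q R] that P(1) by (auto simp: runs_def nth_append)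
  then show thesis using that P(3) by blast
qed

text \<open>Three subroutines are the most that a closure rule uses; rules with fewer fill up with
  the identity.\<close>

lemma link3:
  assumes "pt f" "pt g" "pt h"
  obtains S i j k T U W where "pbnd T" "pbnd U" "pbnd W"
    "\<And>Q. length Q = n \<Longrightarrow> runs (Q @ S) i f T \<and> runs (Q @ S) j g U \<and> runs (Q @ S) k h W"
proof -
  obtain S1 T where 1: "pbnd T" "\<And>Q R. length Q = n \<Longrightarrow> runs (Q @ S1 @ R) n f T"
    by (rule link[OF assms(1)]) blast
  obtain S2 U where 2: "pbnd U"
    "\<And>Q R. length Q = n + length S1 \<Longrightarrow> runs (Q @ S2 @ R) (n + length S1) g U"
    by (rule link[OF assms(2)]) blast
  obtain S3 W where 3: "pbnd W"
    "\<And>Q R. length Q = n + length S1 + length S2 \<Longrightarrow> runs (Q @ S3 @ R) (n + length S1 + length S2) h W"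
    by (rule link[OF assms(3)]) blast
  show thesis
  proof (rule that[OF 1(1) 2(1) 3(1), where S = "S1 @ S2 @ S3"])
    fix Q :: "expr list" assume "length Q = n"
    then show "runs (Q @ S1 @ S2 @ S3) n f T \<and> runs (Q @ S1 @ S2 @ S3) (n + length S1) g U \<and>
        runs (Q @ S1 @ S2 @ S3) (n + length S1 + length S2) h W"
      using 1(2)[of Q "S2 @ S3"] 2(2)[of "Q @ S1" S3] 3(2)[of "Q @ S1 @ S2" "[]"] by simp
  qed
qed

text \<open>Covers changes of type that leave the code alone: a natural number read as an integer, a
  rational as its quotient, a pair as a list cell.\<close>

lemma pt_same_code: assumes "\<And>a. encode (f a) = encode a" shows "pt f"
  by (rule ptI[where P = "[Var 0]" and g = "\<lambda>_. 1" and h = sz])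
    (use assms in \<open>auto intro!: pb exI[of _ 1] eval_Var0[simplified] simp: sz_def\<close>)

lemma pt_id [pt]: "pt (\<lambda>a. a)"
  by (rule pt_same_code) simp

lemma pt_comp: assumes "pt g" "pt f" shows "pt (\<lambda>a. g (f a))"
proof -
  obtain S i j k T U W where S: "pbnd T" "pbnd U" "pbnd (W :: 'c \<Rightarrow> nat)"
    "\<And>Q. length Q = 1 \<Longrightarrow> runs (Q @ S) i f T \<and> runs (Q @ S) j g U \<and> runs (Q @ S) k (\<lambda>a. a) W"
    by (rule link3[OF assms(2,1) pt_id]) blast
  let ?P = "[Call j (Call i (Var 0))] @ S"
  have P: "runs ?P i f T" "runs ?P j g U" using S(4)[of "[Call j (Call i (Var 0))]"] by auto
  show ?thesis
  proof (rule ptI[where P = ?P and g = "\<lambda>a. 1 + T a + 1 + U (f a) + 1" and h = "\<lambda>a. sz (g (f a))"])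
    show "\<exists>t\<le>1 + T a + 1 + U (f a) + 1. eval ?P [encode a] (?P ! 0) (encode (g (f a))) t" for a
      using runs_Call[OF P(2) runs_Call[OF P(1) eval_Var0], of a "[]"]
      by (intro exI[of _ "1 + T a + 1 + U (f a) + 1"]) simp
  qed (auto intro!: pb S pbnd_comp[OF S(2)] pbnd_sz_pt assms
      pbnd_comp[OF pbnd_sz_pt[OF assms(1)] pbnd_sz_pt[OF assms(2)]])
qed

lemma pt_Pair [pt]: assumes "pt f" "pt g" shows "pt (\<lambda>a. (f a, g a))"
proof -
  obtain S i j k T U W where S: "pbnd T" "pbnd U" "pbnd (W :: 'c \<Rightarrow> nat)"
    "\<And>Q. length Q = 1 \<Longrightarrow> runs (Q @ S) i f T \<and> runs (Q @ S) j g U \<and> runs (Q @ S) k (\<lambda>a. a) W"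
    by (rule link3[OF assms pt_id]) blast
  let ?P = "[MkPair (Call i (Var 0)) (Call j (Var 0))] @ S"
  have P: "runs ?P i f T" "runs ?P j g U"
    using S(4)[of "[MkPair (Call i (Var 0)) (Call j (Var 0))]"] by auto
  show ?thesis
  proof (rule ptI[where P = ?P and g = "\<lambda>a. 1 + T a + 1 + (1 + U a + 1) + 1" and h = "\<lambda>a. sz (f a) + sz (g a) + 1"])
    show "\<exists>t\<le>1 + T a + 1 + (1 + U a + 1) + 1. eval ?P [encode a] (?P ! 0) (encode (f a, g a)) t" for a
      using eval.MkPair[OF runs_Call[OF P(1) eval_Var0] runs_Call[OF P(2) eval_Var0], of a "[]"]
      by (intro exI[of _ "1 + T a + 1 + (1 + U a + 1) + 1"]) (simp add: encode_simps)
  qed (auto intro!: pb S pbnd_sz_pt assms)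
qed

lemma pt_fst' : "pt fst"
proof (rule ptI[where P = "[First (Var 0)]" and g = "\<lambda>_. 2" and h = sz])
  show "\<exists>t\<le>2. eval [First (Var 0)] [encode a] ([First (Var 0)] ! 0) (encode (fst a)) t" for a :: "'a \<times> 'b"
    using eval.First[OF eval_Var0[of "[First (Var 0)]" "VPair (encode (fst a)) (encode (snd a))" "[]"]]
    by (intro exI[of _ 2]) (auto simp: encode_simps numeral_2_eq_2)
qed (auto intro: pb simp: sz_pair[of "_ :: 'a \<times> 'b"])

lemma pt_snd' : "pt snd"
proof (rule ptI[where P = "[Second (Var 0)]" and g = "\<lambda>_. 2" and h = sz])
  show "\<exists>t\<le>2. eval [Second (Var 0)] [encode a] ([Second (Var 0)] ! 0) (encode (snd a)) t" for a :: "'a \<times> 'b"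
    using eval.Second[OF eval_Var0[of "[Second (Var 0)]" "VPair (encode (fst a)) (encode (snd a))" "[]"]]
    by (intro exI[of _ 2]) (auto simp: encode_simps numeral_2_eq_2)
qed (auto intro: pb simp: sz_pair[of "_ :: 'a \<times> 'b"])

lemmas pt_fst [pt] = pt_comp[OF pt_fst']
lemmas pt_snd [pt] = pt_comp[OF pt_snd']

text \<open>Functions of several arguments are shown to be polynomial in uncurried form; these rules
  bring them back to the shape on which \<open>intro pt\<close> works.\<close>

lemma pt_app2: "pt (\<lambda>p. F (fst p) (snd p)) \<Longrightarrow> pt f \<Longrightarrow> pt g \<Longrightarrow> pt (\<lambda>a. F (f a) (g a))"
  using pt_comp[of "\<lambda>p. F (fst p) (snd p)" "\<lambda>a. (f a, g a)"] pt_Pair[of f g] by simp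

lemma pt_app3: "pt (\<lambda>p. F (fst p) (fst (snd p)) (snd (snd p))) \<Longrightarrow> pt f \<Longrightarrow> pt g \<Longrightarrow> pt h \<Longrightarrow>
    pt (\<lambda>a. F (f a) (g a) (h a))"
  using pt_comp[of "\<lambda>p. F (fst p) (fst (snd p)) (snd (snd p))" "\<lambda>a. (f a, g a, h a)"]
    pt_Pair[of f "\<lambda>a. (g a, h a)"] pt_Pair[of g h] by simp

lemma pt_app4: "pt (\<lambda>p. F (fst p) (fst (snd p)) (fst (snd (snd p))) (snd (snd (snd p)))) \<Longrightarrow>
    pt f \<Longrightarrow> pt g \<Longrightarrow> pt h \<Longrightarrow> pt k \<Longrightarrow> pt (\<lambda>a. F (f a) (g a) (h a) (k a))"
  using pt_comp[of "\<lambda>p. F (fst p) (fst (snd p)) (fst (snd (snd p))) (snd (snd (snd p)))" "\<lambda>a. (f a, g a, h a, k a)"]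
    pt_Pair[of f "\<lambda>a. (g a, h a, k a)"] pt_Pair[of g "\<lambda>a. (h a, k a)"] pt_Pair[of h k] by simp

lemma pt_Let [pt]: "pt f \<Longrightarrow> pt (\<lambda>p. g (fst p) (snd p)) \<Longrightarrow> pt (\<lambda>a. Let (f a) (g a))"
  unfolding Let_def using pt_app2[of g "\<lambda>a. a" f] pt_id by blast

lemma ex_const_expr: "\<exists>e t. \<forall>P env. eval P env e v t"
proof (induction v)
  case (VNum i)
  show ?case by (meson eval.Lit)
next
  case (VPair v1 v2)
  then show ?case by (meson eval.MkPair)
qed

lemma pt_const [pt]: "pt (\<lambda>a. c)"
proof -
  obtain e t where e: "\<And>P env. eval P env e (encode c) t" using ex_const_expr by blast
  show ?thesis by (rule ptI[where P = "[e]" and g = "\<lambda>_. t" and h = "\<lambda>_. sz c"]) (use e in \<open>auto intro: pb\<close>)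
qed

section \<open>Arithmetic, comparisons and branching\<close>

lemma pt_arith: "pt (\<lambda>p. arith_op f (fst p) (snd p))"
proof (rule ptI[where g = "\<lambda>p. 5 + sz p" and h = "\<lambda>p. 3 + sz p"])
  let ?P = "[Arith f (First (Var 0)) (Second (Var 0))]"
  show "?P \<noteq> []" by simp
  show "pbnd (\<lambda>p::int \<times> int. 5 + sz p)" "pbnd (\<lambda>p::int \<times> int. 3 + sz p)" by (intro pb)+
  show "\<exists>t\<le>5 + sz p. eval ?P [encode p] (?P ! 0) (encode (arith_op f (fst p) (snd p))) t" for p
  proof -
    have "eval ?P [VPair (VNum (fst p)) (VNum (snd p))] (Arith f (First (Var 0)) (Second (Var 0)))
        (VNum (arith_op f (fst p) (snd p))) (1 + 1 + (1 + 1) + bit_length (fst p) + bit_length (snd p) + 1)"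
      by (rule eval.Arith[OF eval.First[OF eval_Var0] eval.Second[OF eval_Var0]])
    then show ?thesis
      by (intro exI[of _ "1 + 1 + (1 + 1) + bit_length (fst p) + bit_length (snd p) + 1"])
        (simp add: encode_simps sz_pair[of p])
  qed
  show "sz (arith_op f (fst p) (snd p)) \<le> 3 + sz p" for p
  proof (cases f)
    case Minus
    then show ?thesis using bit_length_add[of "fst p" "- snd p"] by (auto simp: sz_pair[of p])
  qed (use bit_length_add[of "fst p" "snd p"] bit_length_mult[of "fst p" "snd p"]
      bit_length_div[of "fst p" "snd p"] in \<open>auto simp: sz_pair[of p]\<close>)
qed

lemma pt_plus [pt]: "pt f \<Longrightarrow> pt g \<Longrightarrow> pt (\<lambda>a. f a + g a :: int)"
  using pt_app2[OF pt_arith[of Plus]] by simp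

lemma pt_minus [pt]: "pt f \<Longrightarrow> pt g \<Longrightarrow> pt (\<lambda>a. f a - g a :: int)"
  using pt_app2[OF pt_arith[of Minus]] by simp

lemma pt_times [pt]: "pt f \<Longrightarrow> pt g \<Longrightarrow> pt (\<lambda>a. f a * g a :: int)"
  using pt_app2[OF pt_arith[of Times]] by simp

lemma pt_div [pt]: "pt f \<Longrightarrow> pt g \<Longrightarrow> pt (\<lambda>a. f a div g a :: int)"
  using pt_app2[OF pt_arith[of Div]] by simp

lemma pt_less [pt]:
  fixes f g :: "'a::encodable \<Rightarrow> int"
  assumes "pt f" "pt g" shows "pt (\<lambda>a. f a < g a)"
proof -
  have "pt (\<lambda>a. arith_op Less (f a) (g a))" using assms by (rule pt_app2[OF pt_arith])
  moreover have "encode (f a < g a) = encode (arith_op Less (f a) (g a))" for a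
    by (simp add: encode_simps)
  ultimately show ?thesis unfolding pt_def sz_def by simp
qed

lemma pt_uminus [pt]: "pt f \<Longrightarrow> pt (\<lambda>a. - f a :: int)"
  using pt_minus[OF pt_const[of 0], of f] by simp

lemma pt_If [pt]: assumes "pt b" "pt f" "pt g" shows "pt (\<lambda>a. if b a then f a else g a)"
proof -
  obtain S i j k T U W where S: "pbnd T" "pbnd U" "pbnd W"
    "\<And>Q. length Q = 1 \<Longrightarrow> runs (Q @ S) i b T \<and> runs (Q @ S) j f U \<and> runs (Q @ S) k g W"
    by (rule link3[OF assms]) blast
  let ?P = "[Cond (Call i (Var 0)) (Call j (Var 0)) (Call k (Var 0))] @ S"
  have P: "runs ?P i b T" "runs ?P j f U" "runs ?P k g W" using S(4)[of "[Cond (Call i (Var 0)) (Call j (Var 0)) (Call k (Var 0))]"] by auto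
  show ?thesis
  proof (rule ptI[where P = ?P and g = "\<lambda>a. T a + U a + W a + 10" and h = "\<lambda>a. sz (f a) + sz (g a)"])
    show "\<exists>t\<le>T a + U a + W a + 10. eval ?P [encode a] (?P ! 0) (encode (if b a then f a else g a)) t" for a
    proof (cases "b a")
      case True
      then have "eval ?P [encode a] (Call i (Var 0)) (VNum 1) (1 + T a + 1)"
        using runs_Call[OF P(1) eval_Var0, of a "[]"] by (simp only: encode_simps if_True)
      from eval_Cond_true[OF this _ runs_Call[OF P(2) eval_Var0]] True show ?thesis
        by (intro exI[of _ "1 + T a + 1 + (1 + U a + 1) + 1"]) simp
    next
      case False
      then have "eval ?P [encode a] (Call i (Var 0)) (VNum 0) (1 + T a + 1)"
        using runs_Call[OF P(1) eval_Var0, of a "[]"] by (simp only: encode_simps if_False)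
      from eval_Cond_false[OF this runs_Call[OF P(3) eval_Var0]] False show ?thesis
        by (intro exI[of _ "1 + T a + 1 + (1 + W a + 1) + 1"]) simp
    qed
  qed (auto intro!: pb S pbnd_sz_pt assms)
qed

lemma pt_not [pt]: assumes "pt b" shows "pt (\<lambda>a. \<not> b a)"
proof -
  have "(\<lambda>a. \<not> b a) = (\<lambda>a. if b a then False else True)" by auto
  then show ?thesis using pt_If[OF assms pt_const pt_const, of False True] by (simp only:)
qed

lemma pt_conj [pt]: assumes "pt b" "pt c" shows "pt (\<lambda>a. b a \<and> c a)"
proof -
  have "(\<lambda>a. b a \<and> c a) = (\<lambda>a. if b a then c a else False)" by auto
  then show ?thesis using pt_If[OF assms pt_const, of False] by (simp only:)
qed

lemma pt_disj [pt]: "pt b \<Longrightarrow> pt c \<Longrightarrow> pt (\<lambda>a. b a \<or> c a)"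
  using pt_not[OF pt_conj[OF pt_not pt_not], of b c] by simp

lemma pt_eq_int [pt]: assumes "pt f" "pt g" shows "pt (\<lambda>a. f a = (g a :: int))"
proof -
  have "(\<lambda>a. f a = g a) = (\<lambda>a. \<not> f a < g a \<and> \<not> g a < f a)" by auto
  then show ?thesis using pt_conj[OF pt_not[OF pt_less] pt_not[OF pt_less], OF assms assms(2,1)] by simp
qed

lemma pt_le [pt]: "pt f \<Longrightarrow> pt g \<Longrightarrow> pt (\<lambda>a. f a \<le> (g a :: int))"
  using pt_not[OF pt_less, of g f] by (simp add: not_less)

lemma pt_neq_bool [pt]: assumes "pt f" "pt g" shows "pt (\<lambda>a. f a \<noteq> (g a :: bool))"
proof -
  have "(\<lambda>a. f a \<noteq> g a) = (\<lambda>a. if f a then \<not> g a else g a)" by auto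
  then show ?thesis using pt_If[OF assms(1) pt_not[OF assms(2)] assms(2)] by (simp only:)
qed

lemma pt_int [pt]: "pt f \<Longrightarrow> pt (\<lambda>a. int (f a))"
  by (rule pt_comp[OF pt_same_code]) (auto simp: encode_simps)

lemma pt_nat_retype: "pt (\<lambda>a. int (f a)) \<Longrightarrow> pt f"
  unfolding pt_def sz_def by (simp add: encode_simps)

lemma pt_eq_nat [pt]: "pt f \<Longrightarrow> pt g \<Longrightarrow> pt (\<lambda>a. f a = (g a :: nat))"
  using pt_eq_int[OF pt_int pt_int, of f g] by simp

lemma pt_quotient_of [pt]: "pt f \<Longrightarrow> pt (\<lambda>a. quotient_of (f a))"
  by (rule pt_comp[OF pt_same_code]) (auto simp: encode_simps encode_rat_def enc_rat_def split: prod.split)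

lemma pt_abs [pt]: "pt f \<Longrightarrow> pt (\<lambda>a. \<bar>f a :: int\<bar>)"
  unfolding abs_if by (intro pt)

lemma pt_max [pt]: "pt f \<Longrightarrow> pt g \<Longrightarrow> pt (\<lambda>a. max (f a) (g a :: int))"
  unfolding max_def by (intro pt)

lemma pt_mod [pt]: "pt f \<Longrightarrow> pt g \<Longrightarrow> pt (\<lambda>a. f a mod (g a :: int))"
  unfolding minus_div_mult_eq_mod[symmetric] by (intro pt)

section \<open>List cells, case distinction and loops\<close>

lemma pt_Cons [pt]: "pt f \<Longrightarrow> pt g \<Longrightarrow> pt (\<lambda>a. f a # g a)"
  using pt_comp[OF pt_same_code, of "\<lambda>p. fst p # snd p" "\<lambda>a. (f a, g a)"] pt_Pair[of f g]
  by (simp add: encode_simps)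

text \<open>The empty list is coded by a number and a cell by a pair, so \<open>IsPair\<close>
  decides the case. The code of a nonempty \<open>xs a\<close> is already that of the pair of head
  and tail, hence pairing it with the parameter gives the argument triple of the branch without
  taking the list apart.\<close>

lemma pt_case_list [pt]:
  assumes xs: "pt xs" and n: "pt n" and c: "pt (\<lambda>p. c (fst p) (fst (snd p)) (snd (snd p)))"
  shows "pt (\<lambda>a. case xs a of [] \<Rightarrow> n a | y # ys \<Rightarrow> c a y ys)"
proof -
  let ?c = "\<lambda>p. c (fst p) (fst (snd p)) (snd (snd p))"
  obtain S i j k T U W where S: "pbnd T" "pbnd U" "pbnd W"
    "\<And>Q. length Q = 1 \<Longrightarrow> runs (Q @ S) i xs T \<and> runs (Q @ S) j n U \<and> runs (Q @ S) k ?c W"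
    by (rule link3[OF assms]) blast
  let ?P = "[Cond (IsPair (Call i (Var 0))) (Call k (MkPair (Var 0) (Call i (Var 0)))) (Call j (Var 0))] @ S"
  have P: "runs ?P i xs T" "runs ?P j n U" "runs ?P k ?c W" using S(4)[of "[Cond (IsPair (Call i (Var 0))) (Call k (MkPair (Var 0) (Call i (Var 0)))) (Call j (Var 0))]"] by auto
  obtain m1 where m1: "\<And>p. W p \<le> (sz p + 2) ^ m1" using S(3) unfolding pbnd_def by blast
  obtain m2 where m2: "\<And>p. sz (?c p) \<le> (sz p + 2) ^ m2" using pbnd_sz_pt[OF c] unfolding pbnd_def by blast
  show ?thesis
  proof (rule ptI[where P = ?P and g = "\<lambda>a. 2 * T a + U a + (sz a + sz (xs a) + 3) ^ m1 + 20"
        and h = "\<lambda>a. sz (n a) + (sz a + sz (xs a) + 3) ^ m2"])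
    show "\<exists>t\<le>2 * T a + U a + (sz a + sz (xs a) + 3) ^ m1 + 20. eval ?P [encode a] (?P ! 0)
        (encode (case xs a of [] \<Rightarrow> n a | y # ys \<Rightarrow> c a y ys)) t" for a
    proof (cases "xs a")
      case Nil
      then have "eval ?P [encode a] (IsPair (Call i (Var 0))) (VNum 0) (1 + T a + 1 + 1)"
        using eval.IsPair[OF runs_Call[OF P(1) eval_Var0, of a "[]"]] by (simp add: encode_simps)
      from eval_Cond_false[OF this runs_Call[OF P(2) eval_Var0]] Nil show ?thesis
        by (intro exI[of _ "1 + T a + 1 + 1 + (1 + U a + 1) + 1"]) simp
    next
      case (Cons y ys)
      then have c: "eval ?P [encode a] (IsPair (Call i (Var 0))) (VNum 1) (1 + T a + 1 + 1)"
        using eval.IsPair[OF runs_Call[OF P(1) eval_Var0, of a "[]"]] by (simp add: encode_simps)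
      have "eval ?P [encode a] (MkPair (Var 0) (Call i (Var 0))) (encode (a, y, ys)) (1 + (1 + T a + 1) + 1)"
        using eval.MkPair[OF eval_Var0 runs_Call[OF P(1) eval_Var0, of a "[]"]] Cons
        by (simp add: encode_simps)
      from eval_Cond_true[OF c _ runs_Call[OF P(3) this]] Cons
      have "eval ?P [encode a] (?P ! 0) (encode (case xs a of [] \<Rightarrow> n a | y # ys \<Rightarrow> c a y ys))
         (1 + T a + 1 + 1 + (1 + (1 + T a + 1) + 1 + W (a, y, ys) + 1) + 1)" by simp
      moreover have "W (a, y, ys) \<le> (sz a + sz (xs a) + 3) ^ m1"
        using m1[of "(a, y, ys)"] Cons by (simp add: algebra_simps numeral_eq_Suc)
      ultimately show ?thesis
        by (intro exI[of _ "1 + T a + 1 + 1 + (1 + (1 + T a + 1) + 1 + W (a, y, ys) + 1) + 1"]) simp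
    qed
    show "sz (case xs a of [] \<Rightarrow> n a | y # ys \<Rightarrow> c a y ys) \<le> sz (n a) + (sz a + sz (xs a) + 3) ^ m2" for a
    proof (cases "xs a")
      case (Cons y ys)
      then show ?thesis using m2[of "(a, y, ys)"] by (simp add: algebra_simps numeral_eq_Suc)
    qed simp
  qed (auto intro!: pb S pbnd_sz_pt assms)
qed

text \<open>The source of all loops: body 1 tests \<open>b\<close>, applies \<open>f\<close> and
  calls itself. The number \<open>n a\<close> of rounds occurs only in the analysis. All
  intermediate states must be bounded by \<open>B\<close>, because polynomially many polynomial
  steps can still produce exponential sizes.\<close>

lemma pt_while:
  fixes f :: "'b::encodable \<Rightarrow> 'b"
  assumes f: "pt f" and b: "pt b" and g: "pt g" and N: "pbnd n" and B: "pbnd B"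
    and true: "\<And>a i. i < n a \<Longrightarrow> b ((f ^^ i) (g a))" and false: "\<And>a. \<not> b ((f ^^ n a) (g a))"
    and size: "\<And>a i. i \<le> n a \<Longrightarrow> sz ((f ^^ i) (g a)) \<le> B a"
  shows "pt (\<lambda>a. (f ^^ n a) (g a))"
proof -
  obtain S i j k T U W where S: "pbnd T" "pbnd U" "pbnd W"
    "\<And>Q. length Q = 2 \<Longrightarrow> runs (Q @ S) i f T \<and> runs (Q @ S) j b U \<and> runs (Q @ S) k g W"
    by (rule link3[OF f b g]) blast
  let ?L = "Cond (Call j (Var 0)) (Call 1 (Call i (Var 0))) (Var 0)"
  let ?P = "[Call 1 (Call k (Var 0)), ?L] @ S"
  have P: "runs ?P i f T" "runs ?P j b U" "runs ?P k g W" using S(4)[of "[Call 1 (Call k (Var 0)), ?L]"] by auto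
  obtain m1 where m1: "\<And>p. T p \<le> (sz p + 2) ^ m1" using S(1) unfolding pbnd_def by blast
  obtain m2 where m2: "\<And>p. U p \<le> (sz p + 2) ^ m2" using S(2) unfolding pbnd_def by blast
  define C where "C a = (B a + 2) ^ m1 + (B a + 2) ^ m2 + 20" for a
  have loop: "\<exists>t \<le> (l + 1) * C a. eval ?P [encode ((f ^^ (n a - l)) (g a))] ?L (encode ((f ^^ n a) (g a))) t"
    if "l \<le> n a" for a l
    using that
  proof (induction l)
    case 0
    let ?s = "(f ^^ n a) (g a)"
    have "U ?s \<le> (B a + 2) ^ m2"
      using m2[of ?s] power_mono[of "sz ?s + 2" "B a + 2" m2] size[of "n a" a] by auto
    moreover have "eval ?P [encode ?s] (Call j (Var 0)) (VNum 0) (1 + U ?s + 1)"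
      using runs_Call[OF P(2) eval_Var0, of ?s "[]"] false[of a] by (simp only: encode_simps if_False)
    from eval_Cond_false[OF this eval_Var0]
    have "eval ?P [encode ?s] ?L (encode ?s) (1 + U ?s + 1 + 1 + 1)" .
    ultimately show ?case by (intro exI[of _ "1 + U ?s + 1 + 1 + 1"]) (simp add: C_def)
  next
    case (Suc l)
    let ?s = "(f ^^ (n a - Suc l)) (g a)"
    have s': "f ?s = (f ^^ (n a - l)) (g a)"
      using Suc.prems by (metis Suc_diff_Suc Suc_le_lessD comp_apply funpow.simps(2))
    obtain t where t: "t \<le> (l + 1) * C a"
      "eval ?P [encode (f ?s)] ?L (encode ((f ^^ n a) (g a))) t"
      using Suc s' by auto
    have bs: "U ?s \<le> (B a + 2) ^ m2" "T ?s \<le> (B a + 2) ^ m1"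
      using m2[of ?s] m1[of ?s] power_mono[of "sz ?s + 2" "B a + 2" m2] power_mono[of "sz ?s + 2" "B a + 2" m1]
        size[of "n a - Suc l" a] by auto
    have "eval ?P [encode ?s] (Call 1 (Call i (Var 0))) (encode ((f ^^ n a) (g a))) ((1 + T ?s + 1) + t + 1)"
      by (rule eval.Call[OF runs_Call[OF P(1) eval_Var0]]) (use t in auto)
    note c = this
    have "eval ?P [encode ?s] (Call j (Var 0)) (VNum 1) (1 + U ?s + 1)"
      using runs_Call[OF P(2) eval_Var0, of ?s "[]"] true[of "n a - Suc l" a] Suc.prems
      by (simp add: encode_simps)
    from eval_Cond_true[OF this _ c]
    have "eval ?P [encode ?s] ?L (encode ((f ^^ n a) (g a))) (1 + U ?s + 1 + ((1 + T ?s + 1) + t + 1) + 1)"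
      by simp
    moreover have "1 + U ?s + 1 + ((1 + T ?s + 1) + t + 1) + 1 \<le> (Suc l + 1) * C a"
      using bs t(1) by (simp add: C_def)
    ultimately show ?case by blast
  qed
  show ?thesis
  proof (rule ptI[where P = ?P and g = "\<lambda>a. (n a + 1) * C a + W a + 10" and h = B])
    show "\<exists>t\<le>(n a + 1) * C a + W a + 10. eval ?P [encode a] (?P ! 0) (encode ((f ^^ n a) (g a))) t" for a
    proof -
      obtain t where t: "t \<le> (n a + 1) * C a" "eval ?P [encode (g a)] ?L (encode ((f ^^ n a) (g a))) t"
        using loop[of "n a" a] by auto
      have "eval ?P [encode a] (Call 1 (Call k (Var 0))) (encode ((f ^^ n a) (g a))) ((1 + W a + 1) + t + 1)"
        by (rule eval.Call[OF runs_Call[OF P(3) eval_Var0]]) (use t in auto)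
      then show ?thesis using t(1) by (intro exI[of _ "(1 + W a + 1) + t + 1"]) simp
    qed
    show "pbnd (\<lambda>a. (n a + 1) * C a + W a + 10)" unfolding C_def by (intro pb N B S)
  qed (use B size in auto)
qed

text \<open>The loop state consists of the parameter, the rest of the list and the accumulator. The
  parameter is carried along because a function body sees only its single argument.\<close>

lemma pt_foldl_bounded:
  assumes xs: "pt xs" and init: "pt init"
    and body: "pt (\<lambda>p. body (fst p) (fst (snd p)) (snd (snd p)))"
    and G: "pbnd G" "\<And>a n. n \<le> length (xs a) \<Longrightarrow> sz (foldl (body a) (init a) (take n (xs a))) \<le> G a"
  shows "pt (\<lambda>a. foldl (body a) (init a) (xs a))"
proof -
  define f where "f q = (case fst (snd q) of [] \<Rightarrow> q | y # ys \<Rightarrow> (fst q, ys, body (fst q) (snd (snd q)) y))" for q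
  define g where "g a = (a, xs a, init a)" for a
  have it: "(f ^^ i) (g a) = (a, drop i (xs a), foldl (body a) (init a) (take i (xs a)))"
    if "i \<le> length (xs a)" for a i
    using that
  proof (induction i)
    case (Suc i)
    then have "drop i (xs a) = xs a ! i # drop (Suc i) (xs a)" by (simp add: Cons_nth_drop_Suc)
    then show ?case using Suc by (simp add: f_def take_Suc_conv_app_nth)
  qed (simp add: g_def)
  have "pt (\<lambda>a. (f ^^ (length (xs a))) (g a))"
  proof (rule pt_while[where b = "\<lambda>q. case fst (snd q) of [] \<Rightarrow> False | y # ys \<Rightarrow> True"
        and B = "\<lambda>a. sz a + sz (xs a) + G a + 2"])
    show "pt f" unfolding f_def
      by (intro pt pt_app3[of body, OF body])
    show "pt g" unfolding g_def by (intro pt xs init)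
    show "pbnd (\<lambda>a. length (xs a))"
      by (rule pbnd_mono[OF pbnd_sz_pt[OF xs]]) (use sz_ge_length less_imp_le in blast)
    show "pbnd (\<lambda>a. sz a + sz (xs a) + G a + 2)" by (intro pb pbnd_sz_pt xs G)
    have dr: "sz (drop i ys) \<le> sz ys" for i and ys :: "'b list"
      using sz_append[of "take i ys" "drop i ys"] sz_ge_length[of "take i ys"] by simp
    show "sz ((f ^^ i) (g a)) \<le> sz a + sz (xs a) + G a + 2" if "i \<le> length (xs a)" for a i
      using it[OF that] dr[of i "xs a"] G(2)[OF that] by simp
    show "case fst (snd ((f ^^ i) (g a))) of [] \<Rightarrow> False | y # ys \<Rightarrow> True" if "i < length (xs a)" for a i
    proof -
      have "drop i (xs a) = xs a ! i # drop (Suc i) (xs a)" using that by (simp add: Cons_nth_drop_Suc)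
      then show ?thesis using it[of i a] that by simp
    qed
  qed (use it in \<open>auto intro!: pt\<close>)
  then have "pt (\<lambda>a. snd (snd ((f ^^ (length (xs a))) (g a))))" by (intro pt)
  then show ?thesis using it by simp
qed

text \<open>The size bound may come from an invariant that depends on the number of rounds done,
  which allows numbers that double in every round of a short loop.\<close>

lemma pt_foldl:
  assumes xs: "pt xs" and init: "pt init"
    and body: "pt (\<lambda>p. body (fst p) (fst (snd p)) (snd (snd p)))"
    and G: "pbnd G" and J0: "\<And>a. J a 0 (init a)"
    and J: "\<And>a n s x. J a n s \<Longrightarrow> n < length (xs a) \<Longrightarrow> x \<in> set (xs a) \<Longrightarrow> J a (Suc n) (body a s x)"
    and JG: "\<And>a n s. J a n s \<Longrightarrow> n \<le> length (xs a) \<Longrightarrow> sz s \<le> G a"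
  shows "pt (\<lambda>a. foldl (body a) (init a) (xs a))"
proof (rule pt_foldl_bounded[OF xs init body G])
  have "J a n (foldl (body a) (init a) (take n (xs a)))" if "n \<le> length (xs a)" for a n
    using that by (induction n) (auto simp: J0 J take_Suc_conv_app_nth)
  then show "sz (foldl (body a) (init a) (take n (xs a))) \<le> G a" if "n \<le> length (xs a)" for a n
    using JG that by blast
qed

text \<open>An element is smaller than its list, so a bound in terms of the element turns into one
  in terms of the list with the same exponent.\<close>

lemma pbnd_elem:
  assumes xs: "pbnd (\<lambda>a. sz (xs a))" and h: "pbnd (\<lambda>p. h (fst p) (snd p))"
  obtains H where "pbnd H" "\<And>a x. x \<in> set (xs a) \<Longrightarrow> h a x \<le> H a"
proof -
  obtain k where k: "\<And>p. h (fst p) (snd p) \<le> (sz p + 2) ^ k" using h unfolding pbnd_def by blast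
  show thesis
  proof (rule that[of "\<lambda>a. (sz a + sz (xs a) + 3) ^ k"])
    show "pbnd (\<lambda>a. (sz a + sz (xs a) + 3) ^ k)" by (intro pb xs)
    show "h a x \<le> (sz a + sz (xs a) + 3) ^ k" if "x \<in> set (xs a)" for a x
    proof -
      have "h a x \<le> (sz (a, x) + 2) ^ k" using k[of "(a, x)"] by simp
      also have "\<dots> \<le> (sz a + sz (xs a) + 3) ^ k"
        using sz_ge_elem[OF that] by (intro power_mono) auto
      finally show ?thesis .
    qed
  qed
qed

subsection \<open>Lists\<close>

lemma foldl_Cons: "foldl (\<lambda>s x. x # s) ys xs = rev xs @ ys"
  by (induction xs arbitrary: ys) auto

lemma pt_rev [pt]: assumes "pt xs" shows "pt (\<lambda>a. rev (xs a))"
proof -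
  have "pt (\<lambda>a. foldl (\<lambda>s x. x # s) [] (xs a))"
    by (rule pt_foldl_bounded[where G = "\<lambda>a. sz (xs a)"])
      (use assms in \<open>auto intro!: pt pbnd_sz_pt simp: foldl_Cons sz_rev sz_take\<close>)
  then show ?thesis by (simp add: foldl_Cons)
qed

lemma pt_append [pt]: assumes "pt xs" "pt ys" shows "pt (\<lambda>a. xs a @ ys a)"
proof -
  have "pt (\<lambda>a. foldl (\<lambda>s x. x # s) (ys a) (rev (xs a)))"
  proof (rule pt_foldl_bounded[where G = "\<lambda>a. sz (xs a) + sz (ys a)"])
    show "sz (foldl (\<lambda>s x. x # s) (ys a) (take n (rev (xs a)))) \<le> sz (xs a) + sz (ys a)" for a n
      using sz_append[of "rev (take n (rev (xs a)))" "ys a"] sz_rev[of "take n (rev (xs a))"]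
        sz_take[of n "rev (xs a)"] sz_rev[of "xs a"] by (simp add: foldl_Cons)
  qed (use assms in \<open>auto intro!: pt pb pbnd_sz_pt\<close>)
  then show ?thesis by (simp add: foldl_Cons)
qed

lemma foldl_Cons_map: "foldl (\<lambda>s x. f x # s) ys xs = rev (map f xs) @ ys"
  by (induction xs arbitrary: ys) auto

lemma pt_map [pt]: assumes xs: "pt xs" and f: "pt (\<lambda>p. f (fst p) (snd p))"
  shows "pt (\<lambda>a. map (f a) (xs a))"
proof -
  obtain H where H: "pbnd H" "\<And>a x. x \<in> set (xs a) \<Longrightarrow> sz (f a x) \<le> H a"
    using pbnd_elem[OF pbnd_sz_pt[OF xs], of "\<lambda>a x. sz (f a x)"] pbnd_sz_pt[OF f] by metis
  have "pt (\<lambda>a. foldl (\<lambda>s x. f a x # s) [] (xs a))"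
  proof (rule pt_foldl_bounded[where G = "\<lambda>a. 1 + sz (xs a) * (H a + 1)"])
    show "sz (foldl (\<lambda>s x. f a x # s) [] (take n (xs a))) \<le> 1 + sz (xs a) * (H a + 1)" for a n
    proof -
      have "sz (rev (map (f a) (take n (xs a)))) \<le> 1 + length (rev (map (f a) (take n (xs a)))) * (H a + 1)"
        by (rule sz_list_le) (use H(2) in \<open>auto dest: in_set_takeD\<close>)
      also have "\<dots> \<le> 1 + sz (xs a) * (H a + 1)"
        using sz_ge_length[of "xs a"] by (intro add_left_mono mult_right_mono) auto
      finally show ?thesis by (simp add: foldl_Cons_map)
    qed
    show "pt (\<lambda>p. f (fst p) (snd (snd p)) # fst (snd p))" by (intro pt pt_app2[OF f])
  qed (use assms H in \<open>auto intro!: pt pb pbnd_sz_pt\<close>)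
  then have "pt (\<lambda>a. rev (foldl (\<lambda>s x. f a x # s) [] (xs a)))" by (intro pt)
  then show ?thesis by (simp add: foldl_Cons_map)
qed

lemma concat_conv_foldl: "foldl (@) [] xss = concat xss"
proof -
  have "foldl (@) ys xss = ys @ concat xss" for ys :: "'a list"
    by (induction xss arbitrary: ys) auto
  then show ?thesis by simp
qed

lemma pt_concat [pt]: assumes xs: "pt xs" shows "pt (\<lambda>a. concat (xs a))"
proof -
  have "pt (\<lambda>a. foldl (@) [] (xs a))"
  proof (rule pt_foldl_bounded[where G = "\<lambda>a. sz (xs a)"])
    show "sz (foldl (@) [] (take n (xs a))) \<le> sz (xs a)" for a n
      using sz_concat_le[of "take n (xs a)"] sz_take[of n "xs a"] by (simp add: concat_conv_foldl)
  qed (use assms in \<open>auto intro!: pt pb pbnd_sz_pt\<close>)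
  then show ?thesis by (simp add: concat_conv_foldl)
qed

lemma pt_filter [pt]: assumes "pt xs" "pt (\<lambda>p. P (fst p) (snd p))"
  shows "pt (\<lambda>a. filter (P a) (xs a))"
proof -
  have "filter (P a) ys = concat (map (\<lambda>x. if P a x then [x] else []) ys)" for a ys
    by (induction ys) auto
  then show ?thesis by (simp only:) (intro pt assms)
qed

lemma bit_length_sum_list: "bit_length (sum_list xs) \<le> sz (xs :: int list)"
proof (induction xs)
  case (Cons x xs)
  then show ?case using bit_length_add[of x "sum_list xs"] by simp
qed simp

lemma foldl_plus: "foldl (+) s xs = s + sum_list (xs :: int list)"
  by (induction xs arbitrary: s) auto

lemma pt_sum_list [pt]: assumes xs: "pt xs" shows "pt (\<lambda>a. sum_list (xs a) :: int)"
proof -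
  have "pt (\<lambda>a. foldl (+) 0 (xs a))"
  proof (rule pt_foldl_bounded[where G = "\<lambda>a. sz (xs a) + 1"])
    show "sz (foldl (+) 0 (take n (xs a))) \<le> sz (xs a) + 1" for a n
      using bit_length_sum_list[of "take n (xs a)"] sz_take[of n "xs a"] by (simp add: foldl_plus)
  qed (use assms in \<open>auto intro!: pt pb pbnd_sz_pt\<close>)
  then show ?thesis by (simp add: foldl_plus)
qed

lemma bit_length_prod_list: "bit_length (prod_list xs) \<le> sz (xs :: int list)"
proof (induction xs)
  case (Cons x xs)
  then show ?case using bit_length_mult[of x "prod_list xs"] by simp
qed simp

lemma foldl_times: "foldl (*) s xs = s * prod_list (xs :: int list)"
  by (induction xs arbitrary: s) auto

lemma pt_prod_list [pt]: assumes xs: "pt xs" shows "pt (\<lambda>a. prod_list (xs a) :: int)"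
proof -
  have "pt (\<lambda>a. foldl (*) 1 (xs a))"
  proof (rule pt_foldl_bounded[where G = "\<lambda>a. sz (xs a) + 1"])
    show "sz (foldl (*) 1 (take n (xs a))) \<le> sz (xs a) + 1" for a n
      using bit_length_prod_list[of "take n (xs a)"] sz_take[of n "xs a"] by (simp add: foldl_times)
  qed (use assms in \<open>auto intro!: pt pb pbnd_sz_pt\<close>)
  then show ?thesis by (simp add: foldl_times)
qed

lemma pt_length [pt]: assumes "pt xs" shows "pt (\<lambda>a. length (xs a))"
proof (rule pt_nat_retype)
  have "int (length (xs a)) = sum_list (map (\<lambda>x. 1) (xs a))" for a by (simp add: sum_list_triv)
  then show "pt (\<lambda>a. int (length (xs a)))" by (simp only:) (intro pt assms)
qed

lemma pt_list_ex [pt]: assumes "pt xs" "pt (\<lambda>p. P (fst p) (snd p))"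
  shows "pt (\<lambda>a. list_ex (P a) (xs a))"
proof -
  have eq: "foldl (\<lambda>s x. s \<or> P a x) b ys = (b \<or> list_ex (P a) ys)" for a ys b
    by (induction ys arbitrary: b) auto
  have "pt (\<lambda>a. foldl (\<lambda>s x. s \<or> P a x) False (xs a))"
    by (rule pt_foldl_bounded[where G = "\<lambda>a. 2"])
      (auto intro!: pt pb assms sz_bool pt_app2[OF assms(2)])
  then show ?thesis by (simp add: eq)
qed

lemma pt_member [pt]: assumes "pt x" "pt xs" shows "pt (\<lambda>a. x a \<in> set (xs a :: nat list))"
proof -
  have "x a \<in> set (xs a) \<longleftrightarrow> list_ex (\<lambda>p. snd p = fst p) (map (\<lambda>y. (x a, y)) (xs a))" for a
    by (auto simp: list_ex_iff)
  then show ?thesis by (simp only:) (intro pt assms pt_comp[OF assms(1)])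
qed

lemma pt_zip [pt]: assumes xs: "pt xs" and ys: "pt ys" shows "pt (\<lambda>a. zip (xs a) (ys a))"
proof -
  let ?b = "\<lambda>s x. case snd s of [] \<Rightarrow> s | y # ys \<Rightarrow> ((x, y) # fst s, ys)"
  have eq: "foldl ?b (u, w) zs = (rev (zip zs w) @ u, drop (length zs) w)" for u w zs
  proof (induction zs arbitrary: u w)
    case (Cons z zs)
    then show ?case by (cases w) auto
  qed simp
  have sz_zip: "sz (zip us vs) \<le> sz us + sz vs" for us :: "'b list" and vs :: "'c list"
    by (induction us vs rule: list_induct2') auto
  have sz_drop: "sz (drop i us) \<le> sz us" for i and us :: "'c list"
    using sz_append[of "take i us" "drop i us"] sz_ge_length[of "take i us"] by simp
  have "pt (\<lambda>a. foldl ?b ([], ys a) (xs a))"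
  proof (rule pt_foldl_bounded[where G = "\<lambda>a. sz (xs a) + 2 * sz (ys a) + 1"])
    show "sz (foldl ?b ([], ys a) (take n (xs a))) \<le> sz (xs a) + 2 * sz (ys a) + 1" for a n
      using sz_zip[of "take n (xs a)" "ys a"] sz_take[of n "xs a"] sz_drop[of "length (take n (xs a))" "ys a"]
      by (simp add: eq sz_rev)
  qed (use assms in \<open>auto intro!: pt pb pbnd_sz_pt\<close>)
  then have "pt (\<lambda>a. rev (fst (foldl ?b ([], ys a) (xs a))))" by (intro pt)
  then show ?thesis by (simp add: eq)
qed

text \<open>Ranges are available only up to the length of a list: a number in binary can be
  exponentially large in its code, the length of a list cannot.\<close>

lemma pt_upt_length [pt]: fixes xs :: "'a::encodable \<Rightarrow> 'b::encodable list" assumes "pt xs" shows "pt (\<lambda>a. [0..<length (xs a)])"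
proof -
  let ?b = "\<lambda>s x. s @ [length s]"
  have eq: "foldl ?b [0..<m] zs = [0..<m + length zs]" for m and zs :: "'b list"
  proof (induction zs arbitrary: m)
    case (Cons z zs)
    then show ?case using Cons[of "Suc m"] by simp
  qed simp
  have "pt (\<lambda>a. foldl ?b [] (xs a))"
  proof (rule pt_foldl_bounded[where G = "\<lambda>a. 1 + sz (xs a) * (sz (xs a) + 2)"])
    show "sz (foldl ?b [] (take n (xs a))) \<le> 1 + sz (xs a) * (sz (xs a) + 2)" for a n
    proof -
      let ?l = "length (take n (xs a))"
      have l: "?l \<le> sz (xs a)" using sz_ge_length[of "xs a"] by simp
      have "sz [0..<?l] \<le> 1 + length [0..<?l] * (sz (xs a) + 1 + 1)"
      proof (rule sz_list_le)
        fix x assume "x \<in> set [0..<?l]"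
        then show "sz x \<le> sz (xs a) + 1" using bit_length_int_le[of x] l by (auto simp: min_def split: if_splits)
      qed
      also have "\<dots> \<le> 1 + sz (xs a) * (sz (xs a) + 2)" using l by (intro add_left_mono mult_mono) auto
      finally show ?thesis using eq[of 0 "take n (xs a)"] by simp
    qed
  qed (use assms in \<open>auto intro!: pt pb pbnd_sz_pt\<close>)
  then show ?thesis using eq[of 0] by simp
qed

text \<open>Indexing by a scan, to which the closure rules apply; out of range the value is
  0.\<close>

definition nth0 :: "int list \<Rightarrow> nat \<Rightarrow> int" where
  "nth0 xs i = sum_list (map (\<lambda>p. if fst p = i then snd p else 0) (zip [0..<length xs] xs))"

lemma nth0_eq: "i < length xs \<Longrightarrow> nth0 xs i = xs ! i"
proof -
  assume i: "i < length xs"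
  have "nth0 xs i = (\<Sum>j<length xs. if j = i then xs ! j else 0)"
    unfolding nth0_def by (subst sum_list_sum_nth) (auto intro!: sum.cong simp: atLeast0LessThan)
  then show ?thesis using i by simp
qed

lemma pt_nth0 [pt]: "pt f \<Longrightarrow> pt g \<Longrightarrow> pt (\<lambda>a. nth0 (f a) (g a))"
  by (rule pt_app2[of nth0]; assumption?) (unfold nth0_def, intro pt)

subsection \<open>Binary lengths and greatest common divisors\<close>

text \<open>For positive \<open>n\<close> the quotients run from \<open>n\<close> down to 1. They
  serve as the step sizes of the scaling, and elsewhere only as a list of logarithmic length that
  counts the rounds of a loop.\<close>

definition halves :: "int \<Rightarrow> int list" where
  "halves n = map (\<lambda>j. n div 2 ^ j) [0..<bit_length n]"

lemma pt_halves [pt]: assumes "pt x" shows "pt (\<lambda>a. halves (max 0 (x a)))"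
proof -
  define f where "f s = (fst s div 2, fst s # snd s)" for s :: "int \<times> int list"
  define g where "g a = (max 0 (x a), [] :: int list)" for a
  have it: "(f ^^ i) (g a) = (max 0 (x a) div 2 ^ i, rev (map (\<lambda>j. max 0 (x a) div 2 ^ j) [0..<i]))" for a i
    by (induction i) (auto simp: f_def g_def zdiv_zmult2_eq[symmetric] mult.commute)
  have pos: "0 < max 0 y div 2 ^ i \<longleftrightarrow> i < bit_length (max 0 y)" for i and y :: int
    using bit_length_le_iff[of "max 0 y" i] pos_imp_zdiv_pos_iff[of "2 ^ i" "max 0 y"] by auto
  have "pt (\<lambda>a. (f ^^ bit_length (max 0 (x a))) (g a))"
  proof (rule pt_while[where b = "\<lambda>s. 0 < fst s" and B = "\<lambda>a. 3 + sz (x a) + sz (x a) * (sz (x a) + 1)"])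
    have pos_le: "bit_length (max 0 y) \<le> bit_length y" for y
      by (rule bit_length_mono) auto
    show "pbnd (\<lambda>a. bit_length (max 0 (x a)))"
      by (rule pbnd_mono[OF pbnd_sz_pt[OF assms]]) (use pos_le in \<open>auto intro: le_SucI\<close>)
    show "sz ((f ^^ i) (g a)) \<le> 3 + sz (x a) + sz (x a) * (sz (x a) + 1)" if "i \<le> bit_length (max 0 (x a))" for a i
    proof -
      have e: "bit_length (max 0 (x a) div 2 ^ j) \<le> bit_length (x a)" for j
        using bit_length_div[of "max 0 (x a)" "2 ^ j"] pos_le[of "x a"] by linarith
      have "sz (map (\<lambda>j. max 0 (x a) div 2 ^ j) [0..<i]) \<le>
          1 + length (map (\<lambda>j. max 0 (x a) div 2 ^ j) [0..<i]) * (sz (x a) + 1)"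
        by (rule sz_list_le) (use e in auto)
      also have "\<dots> \<le> 1 + sz (x a) * (sz (x a) + 1)"
        using that pos_le[of "x a"] by (intro add_left_mono mult_right_mono) auto
      finally show ?thesis using e[of i] unfolding it by (simp add: sz_rev del: rev_map)
    qed
    show "pbnd (\<lambda>a. 3 + sz (x a) + sz (x a) * (sz (x a) + 1))" by (intro pb pbnd_sz_pt assms)
    show "pt f" unfolding f_def by (intro pt)
    show "pt g" unfolding g_def by (intro pt assms)
    show "pt (\<lambda>s::int \<times> int list. 0 < fst s)" by (intro pt)
  qed (use it pos in auto)
  then have "pt (\<lambda>a. rev (snd ((f ^^ bit_length (max 0 (x a))) (g a))))" by (intro pt)
  then show ?thesis unfolding it halves_def by simp
qed

definition euclid_step :: "int \<times> int \<Rightarrow> int \<times> int" where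
  "euclid_step s = (if snd s = 0 then s else (snd s, fst s mod snd s))"

text \<open>One step at least halves the product of the two numbers: the remainder \<open>r\<close>
  is less than \<open>snd s\<close>, and \<open>snd s + r \<le> fst s\<close>, so
  \<open>2 * r \<le> fst s\<close>.\<close>

lemma euclid_iter:
  assumes "0 \<le> snd s" "snd s \<le> fst s" "fst s * snd s < 2 ^ k"
  shows "(euclid_step ^^ k) s = (gcd (fst s) (snd s), 0)"
  using assms
proof (induction k arbitrary: s)
  case 0
  then have "fst s * snd s = 0" by (smt (verit) mult_nonneg_nonneg power_0)
  then have "snd s = 0" using 0 by auto
  then show ?case using 0 by (cases s) auto
next
  case (Suc k)
  have "(euclid_step ^^ k) (euclid_step s) = (gcd (fst s) (snd s), 0)"
  proof (cases "snd s = 0")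
    case True
    then have "euclid_step s = s" by (simp add: euclid_step_def)
    then show ?thesis using True Suc.IH[of s] Suc.prems by simp
  next
    case False
    let ?r = "fst s mod snd s"
    have r: "0 \<le> ?r" "?r < snd s" using False Suc.prems by auto
    have "fst s = snd s * (fst s div snd s) + ?r" by simp
    moreover have "1 \<le> fst s div snd s" using False Suc.prems
      by (smt (verit) div_pos_pos_trivial pos_imp_zdiv_pos_iff)
    ultimately have "snd s + ?r \<le> fst s"
      using False Suc.prems(1) by (smt (verit) mult_le_cancel_left1)
    then have "2 * ?r \<le> fst s" using r by linarith
    then have "snd s * (2 * ?r) \<le> snd s * fst s" using Suc.prems by (intro mult_left_mono) auto
    then have "snd s * ?r < 2 ^ k" using Suc.prems(3) by (simp add: mult.commute mult.left_commute)
    moreover have "euclid_step s = (snd s, ?r)" using False by (simp add: euclid_step_def)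
    ultimately show ?thesis using Suc.IH[of "(snd s, ?r)"] r
      by (simp add: gcd_red_int[symmetric])
  qed
  then show ?case by (simp add: funpow_swap1)
qed

lemma foldl_const_fun: "foldl (\<lambda>s x. f s) s xs = (f ^^ length xs) s"
  by (induction xs arbitrary: s) (auto simp: funpow_swap1)

text \<open>The additional list element in front pays for one preliminary step, after which the
  first number is at least the second.\<close>

lemma gcd_eq_euclid:
  "gcd a b = fst (foldl (\<lambda>s x. euclid_step s) (\<bar>a\<bar>, \<bar>b\<bar>) (0 # halves (max 0 (\<bar>a\<bar> * \<bar>b\<bar>))))"
proof -
  have len: "length (halves n) = bit_length n" for n by (simp add: halves_def)
  have "(euclid_step ^^ Suc (bit_length (\<bar>a\<bar> * \<bar>b\<bar>))) (\<bar>a\<bar>, \<bar>b\<bar>) = (gcd a b, 0)"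
  proof (cases "b = 0")
    case True
    have "(euclid_step ^^ n) (\<bar>a\<bar>, 0) = (\<bar>a\<bar>, 0)" for n
      by (induction n) (auto simp: euclid_step_def)
    then show ?thesis using True by (simp del: funpow.simps)
  next
    case False
    have "\<bar>b\<bar> * (\<bar>a\<bar> mod \<bar>b\<bar>) \<le> \<bar>b\<bar> * \<bar>a\<bar>" by (intro mult_left_mono zmod_le_nonneg_dividend) auto
    also have "\<dots> < 2 ^ bit_length (\<bar>a\<bar> * \<bar>b\<bar>)"
      using abs_less_bit_length[of "\<bar>a\<bar> * \<bar>b\<bar>"] by (simp add: abs_mult mult.commute)
    finally have "(euclid_step ^^ (bit_length (\<bar>a\<bar> * \<bar>b\<bar>))) (\<bar>b\<bar>, \<bar>a\<bar> mod \<bar>b\<bar>) = (gcd \<bar>b\<bar> (\<bar>a\<bar> mod \<bar>b\<bar>), 0)"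
      using euclid_iter[of "(\<bar>b\<bar>, \<bar>a\<bar> mod \<bar>b\<bar>)"] False by (simp add: order_less_imp_le)
    moreover have "gcd \<bar>b\<bar> (\<bar>a\<bar> mod \<bar>b\<bar>) = gcd a b" using gcd_red_int[of "\<bar>a\<bar>" "\<bar>b\<bar>"] by simp
    ultimately show ?thesis using False by (simp add: funpow_Suc_right euclid_step_def del: funpow.simps)
  qed
  then show ?thesis unfolding foldl_const_fun by (simp add: len del: funpow.simps)
qed

lemma pt_gcd [pt]: assumes "pt f" "pt g" shows "pt (\<lambda>a. gcd (f a) (g a :: int))"
proof -
  have "pt (\<lambda>p::int \<times> int. foldl (\<lambda>s x::int. euclid_step s) (\<bar>fst p\<bar>, \<bar>snd p\<bar>) (0 # halves (max 0 (\<bar>fst p\<bar> * \<bar>snd p\<bar>))))"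
  proof (rule pt_foldl[where J = "\<lambda>p n s. 0 \<le> fst s \<and> 0 \<le> snd s \<and> fst s \<le> \<bar>fst p\<bar> + \<bar>snd p\<bar> \<and> snd s \<le> \<bar>fst p\<bar> + \<bar>snd p\<bar>"
        and G = "\<lambda>p. 2 * sz p + 5"])
    show "sz s \<le> 2 * sz p + 5"
      if "0 \<le> fst s \<and> 0 \<le> snd s \<and> fst s \<le> \<bar>fst p\<bar> + \<bar>snd p\<bar> \<and> snd s \<le> \<bar>fst p\<bar> + \<bar>snd p\<bar>" for p s :: "int \<times> int"
    proof -
      have "bit_length (fst s) \<le> bit_length (\<bar>fst p\<bar> + \<bar>snd p\<bar>)" "bit_length (snd s) \<le> bit_length (\<bar>fst p\<bar> + \<bar>snd p\<bar>)"
        using that by (auto intro!: bit_length_mono)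
      moreover have "bit_length (\<bar>fst p\<bar> + \<bar>snd p\<bar>) \<le> bit_length (fst p) + bit_length (snd p) + 1"
        using bit_length_add[of "\<bar>fst p\<bar>" "\<bar>snd p\<bar>"] by (simp add: bit_length_def)
      ultimately show ?thesis by (simp add: sz_pair[of s] sz_pair[of p])
    qed
    fix p s :: "int \<times> int"
    assume J: "0 \<le> fst s \<and> 0 \<le> snd s \<and> fst s \<le> \<bar>fst p\<bar> + \<bar>snd p\<bar> \<and> snd s \<le> \<bar>fst p\<bar> + \<bar>snd p\<bar>"
    have "fst s mod snd s \<le> fst s" using J by (intro zmod_le_nonneg_dividend) auto
    then show "0 \<le> fst (euclid_step s) \<and> 0 \<le> snd (euclid_step s) \<and> fst (euclid_step s) \<le> \<bar>fst p\<bar> + \<bar>snd p\<bar> \<and>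
      snd (euclid_step s) \<le> \<bar>fst p\<bar> + \<bar>snd p\<bar>" using J by (auto simp: euclid_step_def)
  next
    show "pt (\<lambda>p::int \<times> int. 0 # halves (max 0 (\<bar>fst p\<bar> * \<bar>snd p\<bar>)))"
      "pt (\<lambda>p::int \<times> int. (\<bar>fst p\<bar>, \<bar>snd p\<bar>))" by (intro pt)+
    show "pt (\<lambda>p::(int \<times> int) \<times> (int \<times> int) \<times> int. euclid_step (fst (snd p)))"
      unfolding euclid_step_def by (intro pt)
  qed (auto intro!: pb)
  then have "pt (\<lambda>p::int \<times> int. gcd (fst p) (snd p))" unfolding gcd_eq_euclid by (intro pt)
  then show ?thesis using assms by (rule pt_app2)
qed

definition gcds :: "int list \<Rightarrow> int" where
  "gcds xs = foldl gcd 0 xs"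

lemma pt_gcds [pt]: assumes "pt f" shows "pt (\<lambda>a. gcds (f a))"
proof -
  have b: "bit_length (gcd s x) \<le> bit_length s + bit_length x" for s x
  proof (cases "x = 0")
    case False
    have "bit_length (gcd s x) \<le> bit_length x" by (intro bit_length_mono dvd_imp_le_int False gcd_dvd2)
    then show ?thesis by simp
  qed (simp add: bit_length_def)
  have B: "bit_length (foldl gcd s xs) \<le> bit_length s + sz xs" for s xs
  proof (induction xs arbitrary: s)
    case (Cons x xs)
    show ?case using b[of s x] Cons.IH[of "gcd s x"] by simp
  qed simp
  have "pt (\<lambda>a. foldl gcd 0 (f a))"
  proof (rule pt_foldl_bounded[where G = "\<lambda>a. sz (f a) + 1"])
    show "sz (foldl gcd 0 (take n (f a))) \<le> sz (f a) + 1" for a n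
      using B[of 0 "take n (f a)"] sz_take[of n "f a"] by simp
  qed (use assms in \<open>auto intro!: pt pb pbnd_sz_pt\<close>)
  then show ?thesis unfolding gcds_def .
qed

lemma gcds_dvd: "x \<in> set xs \<Longrightarrow> gcds xs dvd x"
proof -
  have a: "foldl gcd s xs dvd s" for s and xs :: "int list"
    by (induction xs arbitrary: s) (auto intro: dvd_trans)
  have "x \<in> set xs \<Longrightarrow> foldl gcd s xs dvd x" for s
  proof (induction xs arbitrary: s)
    case (Cons y xs)
    then show ?case using a[of "gcd s y" xs] by (auto intro: dvd_trans)
  qed simp
  then show "x \<in> set xs \<Longrightarrow> gcds xs dvd x" unfolding gcds_def .
qed

lemma dvd_gcds: "(\<And>x. x \<in> set xs \<Longrightarrow> d dvd x) \<Longrightarrow> d dvd gcds xs"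
proof -
  have "d dvd s \<Longrightarrow> (\<And>x. x \<in> set xs \<Longrightarrow> d dvd x) \<Longrightarrow> d dvd foldl gcd s xs" for s
    by (induction xs arbitrary: s) auto
  then show "(\<And>x. x \<in> set xs \<Longrightarrow> d dvd x) \<Longrightarrow> d dvd gcds xs" unfolding gcds_def by auto
qed

section \<open>Small integer kernel vectors\<close>

text \<open>Siegel's lemma by the pigeonhole principle: vectors with entries in
  \<open>{0..b}\<close> outnumber their possible images, and the difference of two vectors with
  equal image lies in the kernel.\<close>

lemma siegel:
  fixes a :: "'r \<Rightarrow> 'q \<Rightarrow> int"
  assumes fin: "finite R" "finite Q" and card: "card Q = Suc (card R)"
    and a: "\<And>r q. a r q \<in> {0, 1}"
  obtains d :: "'q \<Rightarrow> int" where "\<exists>q\<in>Q. d q \<noteq> 0" "\<And>q. q \<notin> Q \<Longrightarrow> d q = 0"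
    "\<And>q. \<bar>d q\<bar> \<le> int (Suc (card R) ^ card R)" "\<And>r. r \<in> R \<Longrightarrow> (\<Sum>q\<in>Q. a r q * d q) = 0"
proof -
  define k where "k = card R"
  \<comment> \<open>With this \<open>b\<close> the \<open>(Suc k * b + 1) ^ k\<close> possible
    images are at most \<open>(Suc k * (b + 1)) ^ k = b * (b + 1) ^ k\<close>, just below the number
    \<open>(b + 1) ^ Suc k\<close> of vectors.\<close>
  define b where "b = Suc k ^ k"
  define X where "X = (Q \<rightarrow>\<^sub>E {0..int b})"
  define Y where "Y = (R \<rightarrow>\<^sub>E {0..int (Suc k * b)})"
  define g where "g f = restrict (\<lambda>r. \<Sum>q\<in>Q. a r q * f q) R" for f
  have gXY: "g ` X \<subseteq> Y"
  proof
    fix y assume "y \<in> g ` X"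
    then obtain f where f: "f \<in> X" "y = g f" by auto
    have "0 \<le> (\<Sum>q\<in>Q. a r q * f q) \<and> (\<Sum>q\<in>Q. a r q * f q) \<le> int (Suc k * b)" for r
    proof -
      have fq: "0 \<le> f q" "f q \<le> int b" if "q \<in> Q" for q using f that unfolding X_def by (auto dest: PiE_mem)
      have aq: "0 \<le> a r q * f q" "a r q * f q \<le> int b" if "q \<in> Q" for q
        using a[of r q] fq[OF that] by auto
      have "(\<Sum>q\<in>Q. a r q * f q) \<le> of_nat (card Q) * int b" by (rule sum_bounded_above) (rule aq)
      then show ?thesis using aq card by (auto intro!: sum_nonneg simp: k_def algebra_simps)
    qed
    then show "y \<in> Y" unfolding f(2) g_def Y_def by auto
  qed
  have c: "card {0..int n} = Suc n" for n by simp
  have "card Y = (Suc k * b + 1) ^ k"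
    unfolding Y_def using fin by (simp add: card_PiE c k_def del: card_atLeastAtMost_int of_nat_mult of_nat_Suc mult_Suc)
  also have "\<dots> \<le> (Suc k * (b + 1)) ^ k" by (intro power_mono) auto
  also have "\<dots> = b * (b + 1) ^ k" by (simp only: power_mult_distrib b_def)
  also have "\<dots> < (b + 1) * (b + 1) ^ k" by simp
  also have "\<dots> = card X" unfolding X_def using fin card by (simp add: card_PiE k_def nat_add_distrib)
  finally have "card Y < card X" .
  moreover have "finite Y" unfolding Y_def using fin by (intro finite_PiE) auto
  ultimately have "\<not> inj_on g X" using gXY by (meson card_inj_on_le not_less)
  then obtain f1 f2 where f: "f1 \<in> X" "f2 \<in> X" "g f1 = g f2" "f1 \<noteq> f2" unfolding inj_on_def by blast
  define d where "d q = (if q \<in> Q then f1 q - f2 q else 0)" for q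
  show thesis
  proof (rule that[of d])
    obtain q where q: "f1 q \<noteq> f2 q" using f(4) by blast
    moreover have "q \<in> Q" using q f(1,2) unfolding X_def by (metis PiE_arb)
    ultimately show "\<exists>q\<in>Q. d q \<noteq> 0" unfolding d_def by auto
    show "d q = 0" if "q \<notin> Q" for q using that by (simp add: d_def)
    show "\<bar>d q\<bar> \<le> int (Suc (card R) ^ card R)" for q
    proof (cases "q \<in> Q")
      case True
      then have "f1 q \<in> {0..int b}" "f2 q \<in> {0..int b}" using f unfolding X_def by (auto dest: PiE_mem)
      then show ?thesis using True unfolding d_def b_def k_def by auto
    qed (simp add: d_def)
    show "(\<Sum>q\<in>Q. a r q * d q) = 0" if "r \<in> R" for r
    proof -
      have "(\<Sum>q\<in>Q. a r q * f1 q) = (\<Sum>q\<in>Q. a r q * f2 q)"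
        using fun_cong[OF f(3), of r] that by (simp add: g_def)
      then show ?thesis by (simp add: d_def right_diff_distrib sum_subtractf)
    qed
  qed
qed

text \<open>\<open>siegel\<close> applied to \<open>Suc (card R)\<close> of the unknowns, the others
  being 0; the size of the solution is forgotten.\<close>

lemma integer_kernel_vector:
  fixes a :: "'r \<Rightarrow> 'q \<Rightarrow> int"
  assumes "finite R" "finite Q" "card R < card Q" "\<And>r q. a r q \<in> {0, 1}"
  obtains d :: "'q \<Rightarrow> int" where "\<exists>q\<in>Q. d q \<noteq> 0" "\<And>q. q \<notin> Q \<Longrightarrow> d q = 0"
    "\<And>r. r \<in> R \<Longrightarrow> (\<Sum>q\<in>Q. a r q * d q) = 0"
proof -
  obtain Q' where Q': "Q' \<subseteq> Q" "card Q' = Suc (card R)"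
    using assms(3) by (metis Suc_leI obtain_subset_with_card_n)
  have fin: "finite Q'" using Q' assms finite_subset by blast
  obtain d where d: "\<exists>q\<in>Q'. d q \<noteq> 0" "\<And>q. q \<notin> Q' \<Longrightarrow> d q = 0" "\<And>r. r \<in> R \<Longrightarrow> (\<Sum>q\<in>Q'. a r q * d q) = 0"
    using assms(4) by (rule siegel[where a = a, OF assms(1) fin Q'(2)]) blast
  have "(\<Sum>q\<in>Q. a r q * d q) = (\<Sum>q\<in>Q'. a r q * d q)" for r
    by (rule sum.mono_neutral_right) (use Q' assms d in auto)
  then show thesis using d Q' by (intro that[of d]) auto
qed

text \<open>The double counting behind all sums over classes, levels and regions: every element is
  charged to exactly one index.\<close>

lemma sum_unique_partition:
  fixes g :: "'a \<Rightarrow> 'b::comm_monoid_add"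
  assumes "finite A" "finite N" "\<And>x. x \<in> A \<Longrightarrow> \<exists>!S. S \<in> N \<and> P S x"
  shows "(\<Sum>S\<in>N. sum g {x \<in> A. P S x}) = sum g A"
proof -
  have "(\<Sum>S\<in>N. sum g {x \<in> A. P S x}) = (\<Sum>x\<in>A. \<Sum>S\<in>{S \<in> N. P S x}. g x)"
    using assms by (intro sum.swap_restrict)
  also have "\<dots> = sum g A"
  proof (rule sum.cong[OF refl])
    fix x assume "x \<in> A"
    then obtain S where "{S \<in> N. P S x} = {S}" using assms(3)[of x] by auto
    then show "(\<Sum>S\<in>{S \<in> N. P S x}. g x) = g x" by simp
  qed
  finally show ?thesis .
qed

section \<open>Tight sets of a point of the spanning tree polytope\<close>

text \<open>Edges are indices with a map to their ends. The existence proof takes the edges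
  themselves as indices, the algorithm takes positions in its input list.\<close>

locale indexed_graph =
  fixes V :: "'v set" and I :: "'i set" and ends :: "'i \<Rightarrow> 'v set"
  assumes finite_V: "finite V" and finite_I: "finite I"
    and ends: "\<And>i. i \<in> I \<Longrightarrow> ends i \<subseteq> V \<and> card (ends i) = 2"
begin

definition EI :: "'v set \<Rightarrow> 'i set" where
  "EI U = {i \<in> I. ends i \<subseteq> U}"

definition cutI :: "'v set \<Rightarrow> 'i set" where
  "cutI S = {i \<in> I. card (ends i \<inter> S) = 1}"

definition stp :: "('i \<Rightarrow> real) \<Rightarrow> bool" where
  "stp x \<longleftrightarrow> (\<forall>i\<in>I. 0 \<le> x i) \<and> sum x I = real (card V) - 1 \<and>
    (\<forall>U. U \<subseteq> V \<and> U \<noteq> {} \<longrightarrow> sum x (EI U) \<le> real (card U) - 1)"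

definition tight :: "('i \<Rightarrow> real) \<Rightarrow> 'v set \<Rightarrow> bool" where
  "tight x U \<longleftrightarrow> U \<subseteq> V \<and> U \<noteq> {} \<and> sum x (EI U) = real (card U) - 1"

lemma finite_EI [simp]: "finite (EI U)"
  using finite_I by (simp add: EI_def)

lemma finite_cutI [simp]: "finite (cutI U)"
  using finite_I by (simp add: cutI_def)

lemma ends_ne: "i \<in> I \<Longrightarrow> ends i \<noteq> {}"
  using ends by fastforce

lemma ends_E: assumes "i \<in> I" obtains u v where "ends i = {u, v}" "u \<noteq> v" "u \<in> V" "v \<in> V"
  using ends[OF assms] by (auto simp: card_2_iff)

lemma finite_sub_V: "U \<subseteq> V \<Longrightarrow> finite U"
  using finite_V finite_subset by blast

lemma card_ends_Int: "i \<in> I \<Longrightarrow> card (ends i \<inter> S) = (if ends i \<subseteq> S then 2 else if i \<in> cutI S then 1 else 0)"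
proof -
  assume i: "i \<in> I"
  obtain u v where uv: "ends i = {u, v}" "u \<noteq> v" using ends_E[OF i] by metis
  have "{u, v} \<inter> S = (if u \<in> S then {u} else {}) \<union> (if v \<in> S then {v} else {})" by auto
  then show ?thesis using i uv by (auto simp: cutI_def)
qed

end

locale tree_point = indexed_graph V I ends
  for V :: "'v set" and I :: "'i set" and ends :: "'i \<Rightarrow> 'v set" +
  fixes x :: "'i \<Rightarrow> real"
  assumes stp: "stp x"
begin

definition "Fr = {i \<in> I. 0 < x i \<and> x i < 1}"
definition "On = {i \<in> I. x i = 1}"

lemma x_nonneg: "i \<in> I \<Longrightarrow> 0 \<le> x i"
  using stp by (simp add: stp_def)

lemma rank_le: "U \<subseteq> V \<Longrightarrow> U \<noteq> {} \<Longrightarrow> sum x (EI U) \<le> real (card U) - 1"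
  using stp by (simp add: stp_def)

lemma x_le_1: assumes "i \<in> I" shows "x i \<le> 1"
proof -
  have "x i \<le> sum x (EI (ends i))"
    by (rule member_le_sum) (use assms x_nonneg finite_I in \<open>auto simp: EI_def\<close>)
  also have "\<dots> \<le> real (card (ends i)) - 1" using rank_le[of "ends i"] ends[OF assms] ends_ne[OF assms] by simp
  finally show ?thesis using ends[OF assms] by simp
qed

lemma EI_V: "EI V = I"
  using ends by (auto simp: EI_def)

lemma finite_Fr [simp]: "finite Fr" and finite_On [simp]: "finite On"
  using finite_I by (auto simp: Fr_def On_def)

lemma Fr_I: "i \<in> Fr \<Longrightarrow> i \<in> I"
  by (simp add: Fr_def)

lemma sum_Fr_On: assumes "A \<subseteq> I" shows "sum x A = sum x (Fr \<inter> A) + real (card (On \<inter> A))"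
proof -
  have fin: "finite A" using assms finite_I finite_subset by blast
  have "sum x A = sum x (Fr \<inter> A \<union> On \<inter> A)"
  proof (rule sum.mono_neutral_right)
    show "\<forall>i\<in>A - (Fr \<inter> A \<union> On \<inter> A). x i = 0"
      using assms x_nonneg x_le_1 by (force simp: Fr_def On_def)
  qed (use fin in auto)
  also have "\<dots> = sum x (Fr \<inter> A) + sum x (On \<inter> A)"
    by (rule sum.union_disjoint) (use fin in \<open>auto simp: Fr_def On_def\<close>)
  also have "sum x (On \<inter> A) = real (card (On \<inter> A))" by (simp add: On_def)
  finally show ?thesis .
qed

section \<open>Uncrossing tight sets and the classes of fractional edges\<close>

lemma uncross:
  assumes U: "tight x U" and W: "tight x W" and ne: "U \<inter> W \<noteq> {}"
  shows "tight x (U \<inter> W)" "tight x (U \<union> W)"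
    "\<And>i. i \<in> I \<Longrightarrow> ends i \<subseteq> U \<union> W \<Longrightarrow> \<not> ends i \<subseteq> U \<Longrightarrow> \<not> ends i \<subseteq> W \<Longrightarrow> x i = 0"
proof -
  define R where "R = EI (U \<union> W) - (EI U \<union> EI W)"
  have sub: "U \<subseteq> V" "W \<subseteq> V" using U W by (auto simp: tight_def)
  have "sum x (EI U \<union> EI W) + sum x (EI U \<inter> EI W) = sum x (EI U) + sum x (EI W)"
    by (rule sum.union_inter) auto
  moreover have "EI U \<inter> EI W = EI (U \<inter> W)" by (auto simp: EI_def)
  then have "sum x (EI U \<inter> EI W) = sum x (EI (U \<inter> W))" by simp
  moreover have "sum x (EI (U \<union> W)) = sum x R + sum x (EI U \<union> EI W)"
    unfolding R_def by (rule sum.subset_diff) (auto simp: EI_def finite_I)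
  moreover have "card U + card W = card (U \<union> W) + card (U \<inter> W)"
    using sub finite_sub_V by (intro card_Un_Int) auto
  then have "real (card U) + real (card W) = real (card (U \<union> W)) + real (card (U \<inter> W))"
    by (metis of_nat_add)
  moreover have "sum x (EI (U \<union> W)) \<le> real (card (U \<union> W)) - 1" "sum x (EI (U \<inter> W)) \<le> real (card (U \<inter> W)) - 1"
    using sub ne by (auto intro!: rank_le)
  moreover have R0: "0 \<le> sum x R" by (rule sum_nonneg) (auto simp: R_def EI_def intro: x_nonneg)
  ultimately have eq: "sum x (EI (U \<union> W)) = real (card (U \<union> W)) - 1"
    "sum x (EI (U \<inter> W)) = real (card (U \<inter> W)) - 1" "sum x R = 0"
    using U W unfolding tight_def by (elim conjE; linarith)+
  show "tight x (U \<inter> W)" "tight x (U \<union> W)" using eq sub ne by (auto simp: tight_def)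
  show "x i = 0" if "i \<in> I" "ends i \<subseteq> U \<union> W" "\<not> ends i \<subseteq> U" "\<not> ends i \<subseteq> W" for i
  proof -
    have "i \<in> R" using that by (auto simp: R_def EI_def)
    moreover have "finite R" "\<And>j. j \<in> R \<Longrightarrow> 0 \<le> x j" using x_nonneg by (auto simp: R_def EI_def finite_I)
    ultimately show ?thesis using eq(3) sum_nonneg_eq_0_iff[of R x] by auto
  qed
qed

lemma V_ne: "V \<noteq> {}" 
proof
  assume "V = {}"
  then have "I = {}" using ends ends_ne by fastforce
  then have "sum x I = 0" "card V = 0" using \<open>V = {}\<close> by auto
  then show False using stp unfolding stp_def by simp
qed

lemma tight_V: "tight x V"
  using stp V_ne by (simp add: tight_def stp_def EI_V)

lemma tight_Inter:
  assumes "finite T" "T \<noteq> {}" "\<And>U. U \<in> T \<Longrightarrow> tight x U \<and> X \<subseteq> U" "X \<noteq> {}"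
  shows "tight x (\<Inter>T)"
  using assms
proof (induction T rule: finite_ne_induct)
  case (insert U T)
  then have "U \<inter> \<Inter>T \<noteq> {}" by blast
  then have "tight x (U \<inter> \<Inter>T)" using insert by (intro uncross(1)) auto
  then show ?case by simp
qed auto

text \<open>The smallest tight set around an edge; it is tight because tight sets that meet are
  closed under intersection. Two edges lie in the same tight sets iff their closures agree, so the
  sets \<open>cs U\<close> are the classes of the overview.\<close>

definition cl :: "'i \<Rightarrow> 'v set" where
  "cl i = \<Inter>{U. tight x U \<and> ends i \<subseteq> U}"

lemma tight_cl: assumes "i \<in> I" shows "tight x (cl i)"
proof -
  have "{U. tight x U \<and> ends i \<subseteq> U} \<subseteq> Pow V" by (auto simp: tight_def)
  then have "finite {U. tight x U \<and> ends i \<subseteq> U}" using finite_V by (meson finite_Pow_iff finite_subset)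
  moreover have "V \<in> {U. tight x U \<and> ends i \<subseteq> U}" using tight_V ends assms by auto
  ultimately show ?thesis unfolding cl_def
    by (intro tight_Inter[where X = "ends i"]) (use ends_ne[OF assms] in auto)
qed

lemma ends_cl: "ends i \<subseteq> cl i"
  by (auto simp: cl_def)

lemma cl_subset_iff: "tight x U \<Longrightarrow> cl i \<subseteq> U \<longleftrightarrow> ends i \<subseteq> U"
  using ends_cl by (auto simp: cl_def)

definition "cs U = {i \<in> Fr. cl i = U}"

lemma finite_cs [simp]: "finite (cs U)"
  by (simp add: cs_def)

text \<open>A tight set contains an edge iff it contains its closure, so its fractional edges form a
  union of whole classes. A vector that sums to 0 on the classes therefore respects every tight rank
  constraint, however many there are.\<close>

lemma sum_classes:
  fixes g :: "'i \<Rightarrow> real"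
  assumes "tight x U"
  shows "sum g (Fr \<inter> EI U) = (\<Sum>W\<in>{W \<in> cl ` Fr. W \<subseteq> U}. sum g (cs W))"
proof -
  have "(\<Sum>W\<in>{W \<in> cl ` Fr. W \<subseteq> U}. sum g {i \<in> Fr \<inter> EI U. cl i = W}) = sum g (Fr \<inter> EI U)"
  proof (rule sum_unique_partition)
    fix i assume i: "i \<in> Fr \<inter> EI U"
    then have "cl i \<subseteq> U" using cl_subset_iff[OF assms, of i] by (simp add: EI_def)
    then show "\<exists>!W. W \<in> {W \<in> cl ` Fr. W \<subseteq> U} \<and> cl i = W" using i by auto
  qed auto
  moreover have "{i \<in> Fr \<inter> EI U. cl i = W} = cs W" if "W \<subseteq> U" for W
    using that assms Fr_I by (auto simp: EI_def cs_def cl_subset_iff[symmetric])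
  then have "(\<Sum>W\<in>{W \<in> cl ` Fr. W \<subseteq> U}. sum g {i \<in> Fr \<inter> EI U. cl i = W}) =
      (\<Sum>W\<in>{W \<in> cl ` Fr. W \<subseteq> U}. sum g (cs W))" by (intro sum.cong) auto
  ultimately show ?thesis by simp
qed

text \<open>By induction on the size of the closure: the fractional edges inside the tight set
  \<open>W\<close> have integral total value, and all classes among them except \<open>cs W\<close>
  have smaller closures.\<close>

lemma class_sum_Ints: "W \<in> cl ` Fr \<Longrightarrow> sum x (cs W) \<in> \<int>"
proof (induction "card W" arbitrary: W rule: less_induct)
  case less
  then have W: "tight x W" using tight_cl Fr_I by auto
  have finW: "finite W" using W finite_sub_V by (auto simp: tight_def)
  have "{W' \<in> cl ` Fr. W' \<subseteq> W} = insert W {W' \<in> cl ` Fr. W' \<subset> W}" using less.prems by auto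
  then have "sum x (Fr \<inter> EI W) = sum x (cs W) + (\<Sum>W'\<in>{W' \<in> cl ` Fr. W' \<subset> W}. sum x (cs W'))"
    using sum_classes[OF W, of x] by simp
  moreover have "sum x (Fr \<inter> EI W) = real (card W) - 1 - real (card (On \<inter> EI W))"
    using sum_Fr_On[of "EI W"] W by (simp add: tight_def EI_def Collect_mono)
  moreover have I: "(\<Sum>W'\<in>{W' \<in> cl ` Fr. W' \<subset> W}. sum x (cs W')) \<in> \<int>"
    by (rule Ints_sum) (use less finW psubset_card_mono in blast)
  ultimately have "sum x (cs W) = real_of_int (int (card W) - 1 - int (card (On \<inter> EI W))) -
      (\<Sum>W'\<in>{W' \<in> cl ` Fr. W' \<subset> W}. sum x (cs W'))" by simp
  then show ?case by (simp only: Ints_diff[OF Ints_of_int I])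
qed

lemma class_sum_ge_1: assumes "W \<in> cl ` Fr" shows "1 \<le> sum x (cs W)"
proof -
  have "0 < sum x (cs W)" by (rule sum_pos[OF finite_cs]) (use assms in \<open>auto simp: cs_def Fr_def\<close>)
  moreover obtain n where "sum x (cs W) = real_of_int n" using class_sum_Ints[OF assms] by (auto elim: Ints_cases)
  ultimately show ?thesis by simp
qed

text \<open>\<open>A\<close> consists of the edges leaving \<open>Z\<close> inside a minimal tight set that is larger than \<open>Z\<close>: by
  uncrossing with \<open>Z\<close>, a tight set that contains one of these edges contains all of them.\<close>

lemma crossing_class:
  assumes Z: "tight x Z" and S: "tight x S" and ZS: "Z \<subset> S"
    and no1: "\<And>i. i \<in> cutI Z \<Longrightarrow> ends i \<subseteq> S \<Longrightarrow> x i \<noteq> 1"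
  obtains A W where "A \<subseteq> Fr \<inter> cutI Z \<inter> EI S" "A \<subseteq> cs W" "W \<in> cl ` Fr" "2 \<le> card A" "1 \<le> sum x A"
proof -
  define Ts where "Ts = {U. tight x U \<and> Z \<subset> U \<and> U \<subseteq> S}"
  have "Ts \<subseteq> Pow V" by (auto simp: Ts_def tight_def)
  have "S \<in> Ts" using S ZS by (auto simp: Ts_def)
  then obtain U where U: "U \<in> Ts" "\<And>U'. U' \<in> Ts \<Longrightarrow> card U \<le> card U'"
    using ex_has_least_nat[of "\<lambda>U. U \<in> Ts" S card] by blast
  have tU: "tight x U" "Z \<subset> U" "U \<subseteq> S" using U by (auto simp: Ts_def)
  have finU: "finite U" using tU finite_sub_V by (auto simp: tight_def)
  define A where "A = Fr \<inter> cutI Z \<inter> EI U"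
  have same: "ends j \<subseteq> cl i" if "i \<in> A" "j \<in> A" for i j
  proof -
    have ij: "i \<in> I" "j \<in> I" "ends i \<subseteq> U" "ends j \<subseteq> U" "card (ends i \<inter> Z) = 1" "card (ends j \<inter> Z) = 1" "x j \<noteq> 0"
      using that by (auto simp: A_def EI_def cutI_def Fr_def)
    have t: "tight x (cl i)" by (rule tight_cl[OF ij(1)])
    have sub: "cl i \<subseteq> U" using cl_subset_iff[OF tU(1)] ij by simp
    have "ends i \<inter> Z \<noteq> {}" "\<not> ends i \<subseteq> Z" using ij ends[OF ij(1)] by (auto simp: Int_absorb2)
    then have ne: "cl i \<inter> Z \<noteq> {}" and nsub: "\<not> cl i \<subseteq> Z" using ends_cl[of i] by auto
    have un: "tight x (cl i \<union> Z)" by (rule uncross(2)[OF t Z ne])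
    have "cl i \<union> Z \<in> Ts" using un nsub sub tU by (auto simp: Ts_def)
    then have "card U \<le> card (cl i \<union> Z)" by (rule U(2))
    \<comment> \<open>By minimality of \<open>U\<close>: the union is tight, larger than
      \<open>Z\<close> and contained in \<open>U\<close>. An edge of \<open>A\<close> outside
      \<open>cl i\<close> would be counted only in this union and would have value 0.\<close>
    then have eq: "cl i \<union> Z = U" using sub tU finU by (intro card_seteq) auto
    show "ends j \<subseteq> cl i"
    proof (rule ccontr)
      assume "\<not> ends j \<subseteq> cl i"
      moreover have "\<not> ends j \<subseteq> Z" using ij(6) ends[OF ij(2)] by (auto simp: Int_absorb2)
      ultimately show False using uncross(3)[OF t Z ne ij(2)] ij eq by auto
    qed
  qed
  have cl_eq: "cl j = cl i" if "i \<in> A" "j \<in> A" for i j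
  proof -
    have "i \<in> I" "j \<in> I" using that by (auto simp: A_def EI_def)
    then have "cl j \<subseteq> cl i" "cl i \<subseteq> cl j"
      using same[OF that] same[OF that(2,1)] cl_subset_iff[OF tight_cl] by simp_all
    then show ?thesis by simp
  qed
  have UZ: "U - Z \<noteq> {}" "U - Z \<subseteq> V" "Z \<subseteq> V" "Z \<noteq> {}" using tU Z by (auto simp: tight_def)
  have split: "EI U = EI Z \<union> EI (U - Z) \<union> (cutI Z \<inter> EI U)"
  proof
    show "EI U \<subseteq> EI Z \<union> EI (U - Z) \<union> (cutI Z \<inter> EI U)"
    proof
      fix i assume i: "i \<in> EI U"
      then have iI: "i \<in> I" by (simp add: EI_def)
      obtain u v where "ends i = {u, v}" "u \<noteq> v" using ends_E[OF iI] by metis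
      then show "i \<in> EI Z \<union> EI (U - Z) \<union> (cutI Z \<inter> EI U)"
        using i by (cases "u \<in> Z"; cases "v \<in> Z") (auto simp: EI_def cutI_def)
    qed
  qed (use tU in \<open>auto simp: EI_def\<close>)
  have "sum x (EI U) = sum x (EI Z) + sum x (EI (U - Z)) + sum x (cutI Z \<inter> EI U)"
  proof -
    have d1: "EI Z \<inter> EI (U - Z) = {}" using ends_ne by (fastforce simp: EI_def)
    have d2: "(EI Z \<union> EI (U - Z)) \<inter> (cutI Z \<inter> EI U) = {}"
    proof -
      have "card (ends i \<inter> Z) \<noteq> 1" if "i \<in> I" "ends i \<subseteq> Z \<or> ends i \<subseteq> U - Z" for i
      proof (cases "ends i \<subseteq> Z")
        case False
        then have "ends i \<inter> Z = {}" using that by auto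
        then show ?thesis by simp
      qed (use ends that in \<open>auto simp: Int_absorb2\<close>)
      then show ?thesis by (auto simp: EI_def cutI_def)
    qed
    show ?thesis by (subst split, subst sum.union_disjoint[OF _ _ d2]) (auto simp: sum.union_disjoint[OF _ _ d1])
  qed
  moreover have "sum x (EI (U - Z)) \<le> real (card (U - Z)) - 1" using rank_le UZ by blast
  moreover have "real (card (U - Z)) = real (card U) - real (card Z)"
    using tU finU by (subst card_Diff_subset) (auto simp: finite_subset card_mono of_nat_diff psubset_imp_subset)
  \<comment> \<open>Equality holds for \<open>U\<close> and \<open>Z\<close>, and
    \<open>U - Z\<close> spans at most its size minus one, so at least 1 remains for the edges
    between \<open>Z\<close> and \<open>U - Z\<close>.\<close>
  ultimately have "1 \<le> sum x (cutI Z \<inter> EI U)" using tU(1) Z by (simp add: tight_def)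
  moreover have "sum x (cutI Z \<inter> EI U) = sum x A"
  proof -
    have "On \<inter> (cutI Z \<inter> EI U) = {}" using no1 tU by (auto simp: On_def EI_def)
    then show ?thesis using sum_Fr_On[of "cutI Z \<inter> EI U"] by (auto simp: A_def cutI_def Int_assoc)
  qed
  ultimately have A1: "1 \<le> sum x A" by simp
  have finA: "finite A" by (simp add: A_def)
  have "A \<noteq> {}" using A1 by auto
  have "sum x A < real (card A) * 1"
    using finA \<open>A \<noteq> {}\<close> by (intro sum_bounded_above_strict) (auto simp: A_def Fr_def card_gt_0_iff)
  then have "2 \<le> card A" using A1 by linarith
  obtain i where i: "i \<in> A" using \<open>A \<noteq> {}\<close> by auto
  show thesis
  proof (rule that[of A "cl i"])
    show "A \<subseteq> Fr \<inter> cutI Z \<inter> EI S" using tU by (auto simp: A_def EI_def)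
    show "A \<subseteq> cs (cl i)" using cl_eq[OF i] by (auto simp: A_def cs_def)
    show "cl i \<in> cl ` Fr" using i by (auto simp: A_def)
  qed (use A1 \<open>2 \<le> card A\<close> in auto)
qed

end

section \<open>Components that stay inside a vertex set\<close>

context indexed_graph
begin

text \<open>The sets \<open>Zs\<close> are the components of \<open>B\<close> that stay inside
  \<open>O'\<close>; instead of connectedness only the number of their edges is recorded, which
  suffices for tightness. By induction on \<open>B\<close>: a new edge that changes the family
  merges two components or removes one, so each lost component is paid for by an edge meeting
  \<open>O'\<close>.\<close>

lemma closed_components:
  assumes "finite B" "B \<subseteq> I" "O' \<subseteq> V"
  shows "\<exists>Zs. (\<forall>Z\<in>Zs. Z \<noteq> {} \<and> Z \<subseteq> O' \<and> card Z \<le> Suc (card (B \<inter> EI Z)) \<and>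
       (\<forall>i\<in>B. ends i \<subseteq> Z \<or> ends i \<inter> Z = {})) \<and> (\<forall>Z\<in>Zs. \<forall>Z'\<in>Zs. Z \<noteq> Z' \<longrightarrow> Z \<inter> Z' = {}) \<and>
     card O' \<le> card Zs + card {i \<in> B. ends i \<inter> O' \<noteq> {}}"
  using assms(1,2)
proof (induction B rule: finite_induct)
  case empty
  have "card ((\<lambda>u. {u}) ` O') = card O'" by (intro card_image) auto
  then show ?case by (intro exI[of _ "(\<lambda>u. {u}) ` O'"]) auto
next
  case (insert e B)
  then have BI: "B \<subseteq> I" by simp
  from insert.IH[OF this] obtain Zs where Zs0: "(\<forall>Z\<in>Zs. Z \<noteq> {} \<and> Z \<subseteq> O' \<and> card Z \<le> Suc (card (B \<inter> EI Z)) \<and>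
       (\<forall>i\<in>B. ends i \<subseteq> Z \<or> ends i \<inter> Z = {})) \<and> (\<forall>Z\<in>Zs. \<forall>Z'\<in>Zs. Z \<noteq> Z' \<longrightarrow> Z \<inter> Z' = {}) \<and>
     card O' \<le> card Zs + card {i \<in> B. ends i \<inter> O' \<noteq> {}}" by (elim exE)
  have Zs: "\<And>Z. Z \<in> Zs \<Longrightarrow> Z \<noteq> {}" "\<And>Z. Z \<in> Zs \<Longrightarrow> Z \<subseteq> O'"
    "\<And>Z. Z \<in> Zs \<Longrightarrow> card Z \<le> Suc (card (B \<inter> EI Z))"
    "\<And>Z i. Z \<in> Zs \<Longrightarrow> i \<in> B \<Longrightarrow> ends i \<subseteq> Z \<or> ends i \<inter> Z = {}"
    "\<And>Z Z'. Z \<in> Zs \<Longrightarrow> Z' \<in> Zs \<Longrightarrow> Z \<noteq> Z' \<Longrightarrow> Z \<inter> Z' = {}"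
    "card O' \<le> card Zs + card {i \<in> B. ends i \<inter> O' \<noteq> {}}" using Zs0 by simp_all
  have "Zs \<subseteq> Pow V" using Zs(2) assms(3) by auto
  then have finZs: "finite Zs" using finite_V by (meson finite_Pow_iff finite_subset)
  have grow: "card (B \<inter> EI Z) \<le> card (insert e B \<inter> EI Z)" for Z
    by (rule card_mono) (use insert finite_EI in auto)
  have cnt: "card {i \<in> insert e B. ends i \<inter> O' \<noteq> {}} =
      (if ends e \<inter> O' \<noteq> {} then 1 else 0) + card {i \<in> B. ends i \<inter> O' \<noteq> {}}"
  proof -
    have "{i \<in> insert e B. ends i \<inter> O' \<noteq> {}} =
      (if ends e \<inter> O' \<noteq> {} then insert e {i \<in> B. ends i \<inter> O' \<noteq> {}} else {i \<in> B. ends i \<inter> O' \<noteq> {}})" by auto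
    then show ?thesis using insert by simp
  qed
  have eI: "e \<in> I" using insert by simp
  obtain u v where uv: "ends e = {u, v}" "u \<noteq> v" using ends_E[OF eI] by metis
  define Zk where "Zk = {Z \<in> Zs. ends e \<subseteq> Z \<or> ends e \<inter> Z = {}}"
  have Zk: "\<And>Z. Z \<in> Zk \<Longrightarrow> Z \<in> Zs" "\<And>Z i. Z \<in> Zk \<Longrightarrow> i \<in> insert e B \<Longrightarrow> ends i \<subseteq> Z \<or> ends i \<inter> Z = {}"
    using Zs(4) by (auto simp: Zk_def)
  consider (keep) "Zk = Zs" | (drop) Z where "Z \<in> Zs" "Zs - Zk = {Z}" "ends e \<inter> Z \<noteq> {}"
    | (merge) Z1 Z2 where "Z1 \<in> Zs" "Z2 \<in> Zs" "Z1 \<noteq> Z2" "u \<in> Z1" "v \<in> Z2" "Zs - Zk = {Z1, Z2}"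
  proof -
    have bad: "Z \<in> Zs - Zk \<longleftrightarrow> Z \<in> Zs \<and> (u \<in> Z \<longleftrightarrow> v \<notin> Z)" for Z using uv by (auto simp: Zk_def)
    have uniq: "Z = Z'" if "Z \<in> Zs" "Z' \<in> Zs" "w \<in> Z" "w \<in> Z'" for Z Z' w using Zs(5) that by blast
    show thesis
    proof (cases "\<exists>Z\<in>Zs. u \<in> Z \<and> v \<notin> Z")
      case True
      then obtain Z1 where Z1: "Z1 \<in> Zs" "u \<in> Z1" "v \<notin> Z1" by auto
      show thesis
      proof (cases "\<exists>Z\<in>Zs. v \<in> Z")
        case True
        then obtain Z2 where Z2: "Z2 \<in> Zs" "v \<in> Z2" by auto
        have "u \<notin> Z2" using uniq[OF Z1(1) Z2(1) Z1(2)] Z1 Z2 by auto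
        have "Z \<in> {Z1, Z2}" if "Z \<in> Zs - Zk" for Z
          using bad[of Z] that uniq[of Z Z1 u] uniq[of Z Z2 v] Z1 Z2 by auto
        moreover have "Z1 \<in> Zs - Zk" "Z2 \<in> Zs - Zk" using bad[of Z1] bad[of Z2] Z1 Z2 \<open>u \<notin> Z2\<close> by simp_all
        ultimately have "Zs - Zk = {Z1, Z2}" by blast
        then show thesis using Z1 Z2 by (intro merge[of Z1 Z2]) auto
      next
        case False
        have "Z = Z1" if "Z \<in> Zs - Zk" for Z
          using bad[of Z] that uniq[of Z Z1 u] Z1 False by auto
        moreover have "Z1 \<in> Zs - Zk" using bad[of Z1] Z1 by simp
        ultimately have "Zs - Zk = {Z1}" by blast
        then show thesis using Z1 uv by (intro drop[of Z1]) auto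
      qed
    next
      case F1: False
      show thesis
      proof (cases "\<exists>Z\<in>Zs. v \<in> Z \<and> u \<notin> Z")
        case True
        then obtain Z1 where Z1: "Z1 \<in> Zs" "v \<in> Z1" "u \<notin> Z1" by auto
        have "Z = Z1" if "Z \<in> Zs - Zk" for Z
          using bad[of Z] that uniq[of Z Z1 v] Z1 F1 by auto
        moreover have "Z1 \<in> Zs - Zk" using bad[of Z1] Z1 by simp
        ultimately have "Zs - Zk = {Z1}" by blast
        then show thesis using Z1 uv by (intro drop[of Z1]) auto
      next
        case False
        have "Z \<notin> Zs - Zk" for Z using bad[of Z] F1 False by auto
        then have "Zs - Zk = {}" by blast
        then show thesis using Zk(1) by (intro keep) auto
      qed
    qed
  qed
  then show ?case
  proof cases
    case keep
    show ?thesis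
    proof (rule exI[of _ Zs], intro conjI ballI impI)
      fix Z assume Z: "Z \<in> Zs"
      show "card Z \<le> Suc (card (insert e B \<inter> EI Z))" using Zs(3)[OF Z] grow[of Z] by simp
      show "ends i \<subseteq> Z \<or> ends i \<inter> Z = {}" if "i \<in> insert e B" for i
        using Zk(2)[of Z i] keep Z that by simp
    qed (use Zs(1,2,5,6) cnt in auto)
  next
    case drop
    have "card Zs = card Zk + 1"
      using card_Diff_subset[of Zk Zs] drop(2) finZs card_mono[of Zs Zk] Zk(1)
      by (auto simp: finite_subset[OF _ finZs] subset_iff)
    moreover have "ends e \<inter> O' \<noteq> {}" using drop Zs(2) by blast
    ultimately have c: "card O' \<le> card Zk + card {i \<in> insert e B. ends i \<inter> O' \<noteq> {}}" using Zs(6) cnt by simp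
    show ?thesis
    proof (rule exI[of _ Zk], intro conjI ballI impI)
      fix Z assume Z: "Z \<in> Zk"
      show "card Z \<le> Suc (card (insert e B \<inter> EI Z))" using Zs(3)[OF Zk(1)[OF Z]] grow[of Z] by simp
    qed (use Zs(1,2,5) Zk c in auto)
  next
    case merge
    let ?Z = "Z1 \<union> Z2" let ?Zs = "insert ?Z Zk"
    have dis: "Z1 \<inter> Z2 = {}" using Zs(5) merge by blast
    have fin: "finite Z1" "finite Z2" using merge Zs(2) assms(3) finite_sub_V by (meson order_trans)+
    have nz: "Z1 \<notin> Zk" "Z2 \<notin> Zk" using merge by auto
    have disZ: "Z \<inter> ?Z = {}" if "Z \<in> Zk" for Z using Zs(5)[OF Zk(1)[OF that]] merge nz that by blast
    have "?Z \<notin> Zk" using disZ Zs(1) merge(1) by blast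
    have "card Zs = card Zk + 2"
      using card_Diff_subset[of Zk Zs] merge(3,6) finZs card_mono[of Zs Zk] Zk(1)
      by (auto simp: finite_subset[OF _ finZs] subset_iff)
    moreover have "card ?Zs = card Zk + 1" using \<open>?Z \<notin> Zk\<close> finZs Zk(1) by (simp add: finite_subset[of Zk Zs] subset_iff)
    moreover have "ends e \<inter> O' \<noteq> {}" using merge Zs(2)[of Z1] uv by blast
    ultimately have c: "card O' \<le> card ?Zs + card {i \<in> insert e B. ends i \<inter> O' \<noteq> {}}" using Zs(6) cnt by simp
    have EIs: "B \<inter> EI Z1 \<union> B \<inter> EI Z2 \<union> {e} \<subseteq> insert e B \<inter> EI ?Z" using merge uv eI by (auto simp: EI_def)
    have "card (B \<inter> EI Z1 \<union> B \<inter> EI Z2 \<union> {e}) = card (B \<inter> EI Z1) + card (B \<inter> EI Z2) + 1"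
    proof -
      have "B \<inter> EI Z1 \<inter> (B \<inter> EI Z2) = {}" using dis ends_ne by (fastforce simp: EI_def)
      moreover have "e \<notin> B" using insert by simp
      ultimately show ?thesis using insert by (simp add: card_Un_disjoint)
    qed
    then have "card (B \<inter> EI Z1) + card (B \<inter> EI Z2) + 1 \<le> card (insert e B \<inter> EI ?Z)"
      using card_mono[OF _ EIs] insert by simp
    then have cZ: "card ?Z \<le> Suc (card (insert e B \<inter> EI ?Z))"
      using Zs(3)[OF merge(1)] Zs(3)[OF merge(2)] card_Un_disjoint[OF fin dis] by linarith
    have clZ: "ends i \<subseteq> ?Z \<or> ends i \<inter> ?Z = {}" if "i \<in> insert e B" for i
    proof (cases "i = e")
      case True
      then show ?thesis using uv merge by auto
    next
      case False
      then have "i \<in> B" using that by simp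
      then show ?thesis using Zs(4)[OF merge(1), of i] Zs(4)[OF merge(2), of i] by auto
    qed
    show ?thesis
    proof (rule exI[of _ ?Zs], intro conjI ballI impI)
      fix Z assume Z: "Z \<in> ?Zs"
      show "card Z \<le> Suc (card (insert e B \<inter> EI Z))"
        using Z cZ Zs(3)[OF Zk(1)] grow by (metis insertE le_trans Suc_le_mono)
      show "Z \<noteq> {}" "Z \<subseteq> O'" using Z Zs(1,2) Zk(1) merge by blast+
      show "ends i \<subseteq> Z \<or> ends i \<inter> Z = {}" if "i \<in> insert e B" for i using Z clZ[OF that] Zk(2)[OF _ that] by blast
      fix Z' assume "Z' \<in> ?Zs" "Z \<noteq> Z'"
      then show "Z \<inter> Z' = {}" using Z disZ Zs(5) Zk(1) by blast
    qed (rule c)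
  qed
qed

end

section \<open>The counting argument\<close>

context tree_point
begin

text \<open>Weighted half-edges: ends of fractional edges in \<open>X\<close>. Weight 1 gives the
  count, \<open>x\<close> carries integrality of cuts over to regions, and a kernel vector carries
  linear dependence over.\<close>

definition hs :: "('i \<Rightarrow> real) \<Rightarrow> 'v set \<Rightarrow> real" where
  "hs g X = (\<Sum>i\<in>Fr. real (card (ends i \<inter> X)) * g i)"

lemma hs_cut: "hs g S = sum g (Fr \<inter> cutI S) + 2 * sum g (Fr \<inter> EI S)"
proof -
  have "hs g S = (\<Sum>i\<in>Fr. (if i \<in> cutI S then g i else 0) + 2 * (if i \<in> EI S then g i else 0))"
    unfolding hs_def
  proof (rule sum.cong[OF refl])
    fix i assume "i \<in> Fr"
    then have iI: "i \<in> I" by (rule Fr_I)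
    then have "i \<in> EI S \<longleftrightarrow> ends i \<subseteq> S" "ends i \<subseteq> S \<Longrightarrow> i \<notin> cutI S"
      using ends[of i] by (auto simp: EI_def cutI_def Int_absorb2)
    then show "real (card (ends i \<inter> S)) * g i = (if i \<in> cutI S then g i else 0) + 2 * (if i \<in> EI S then g i else 0)"
      using card_ends_Int[OF iI, of S] by simp
  qed
  also have "\<dots> = sum g (Fr \<inter> cutI S) + 2 * sum g (Fr \<inter> EI S)"
    by (simp add: sum.distrib sum_distrib_left[symmetric] sum.inter_restrict[symmetric])
  finally show ?thesis .
qed

end

section \<open>Levels and regions of a laminar family of tight sets\<close>

locale laminar_point = tree_point V I ends x
  for V :: "'v set" and I :: "'i set" and ends :: "'i \<Rightarrow> 'v set" and x :: "'i \<Rightarrow> real" +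
  fixes M :: "'v set set"
  assumes M_tight: "\<And>S. S \<in> M \<Longrightarrow> tight x S" and V_notin: "V \<notin> M"
    and lam: "\<And>S T. S \<in> M \<Longrightarrow> T \<in> M \<Longrightarrow> S \<inter> T \<in> {{}, S, T}"
begin

text \<open>The whole vertex set is added as the root of the forest, so that every vertex, edge and
  class has a level. \<open>V\<close> is no member of \<open>M\<close>, as it contributes a region
  but no cut row.\<close>

definition "N = insert V M"
definition "ch S = {D \<in> M. D \<subset> S \<and> \<not> (\<exists>T\<in>M. D \<subset> T \<and> T \<subset> S)}"
definition "reg S = S - \<Union>(ch S)"
definition "lvl S = {i \<in> EI S. \<forall>D\<in>ch S. \<not> ends i \<subseteq> D}"
definition "C S = {U \<in> cl ` Fr. U \<subseteq> S \<and> (\<forall>D\<in>ch S. \<not> U \<subseteq> D)}"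

lemma M_sub: "S \<in> M \<Longrightarrow> S \<subseteq> V" and M_ne: "S \<in> M \<Longrightarrow> S \<noteq> {}"
  using M_tight by (auto simp: tight_def)

lemma finite_M [simp]: "finite M"
  using M_sub finite_V by (meson PowI finite_Pow_iff finite_subset subsetI)

lemma finite_N [simp]: "finite N"
  by (simp add: N_def)

lemma N_tight: "S \<in> N \<Longrightarrow> tight x S"
  using M_tight tight_V by (auto simp: N_def)

lemma N_sub: "S \<in> N \<Longrightarrow> S \<subseteq> V" and N_fin: "S \<in> N \<Longrightarrow> finite S"
  using N_tight finite_sub_V by (auto simp: tight_def)

lemma ch_M: "D \<in> ch S \<Longrightarrow> D \<in> M" and ch_sub: "D \<in> ch S \<Longrightarrow> D \<subset> S"
  by (auto simp: ch_def)

lemma ch_N: "D \<in> ch S \<Longrightarrow> D \<in> N"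
  by (auto simp: ch_def N_def)

lemma finite_ch [simp]: "finite (ch S)"
  by (simp add: ch_def)

lemma N_comparable: assumes "S \<in> N" "T \<in> N" "S \<inter> T \<noteq> {}" shows "S \<subseteq> T \<or> T \<subseteq> S"
proof (cases "S \<in> M \<and> T \<in> M")
  case True
  then show ?thesis using lam[of S T] assms(3) by blast
qed (use assms N_sub in \<open>auto simp: N_def\<close>)

lemma ch_cover: assumes "S \<in> M" "T \<in> N" "S \<subset> T" shows "\<exists>D\<in>ch T. S \<subseteq> D"
proof -
  let ?P = "\<lambda>D. D \<in> M \<and> S \<subseteq> D \<and> D \<subset> T"
  have "?P S" using assms by simp
  moreover have "\<forall>D. ?P D \<longrightarrow> card D < Suc (card V)"
    using card_mono[OF finite_V M_sub] by (auto simp: less_Suc_eq_le)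
  ultimately obtain D where D: "?P D" "\<And>D'. ?P D' \<Longrightarrow> card D' \<le> card D"
    using ex_has_greatest_nat[of ?P S card "Suc (card V)"] by blast
  have "\<not> (\<exists>U\<in>M. D \<subset> U \<and> U \<subset> T)"
  proof
    assume "\<exists>U\<in>M. D \<subset> U \<and> U \<subset> T"
    then obtain U where U: "U \<in> M" "D \<subset> U" "U \<subset> T" by auto
    then have "card U \<le> card D" using D by auto
    moreover have "card D < card U" using U M_sub finite_sub_V by (intro psubset_card_mono) auto
    ultimately show False by simp
  qed
  then show ?thesis using D by (intro bexI[of _ D]) (auto simp: ch_def)
qed

text \<open>The level is the smallest member of \<open>N\<close> including \<open>X\<close>. It is
  applied to single vertices, giving their regions, and to closures, giving the levels of
  classes.\<close>

lemma unique_level: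
  assumes "X \<noteq> {}" "X \<subseteq> V"
  shows "\<exists>!S. S \<in> N \<and> X \<subseteq> S \<and> (\<forall>D\<in>ch S. \<not> X \<subseteq> D)"
proof -
  let ?P = "\<lambda>S. S \<in> N \<and> X \<subseteq> S"
  have "?P V" using assms by (simp add: N_def)
  then obtain S where S: "?P S" "\<And>T. ?P T \<Longrightarrow> card S \<le> card T"
    using ex_has_least_nat[of ?P V card] by blast
  have "\<not> X \<subseteq> D" if D: "D \<in> ch S" for D
  proof
    assume "X \<subseteq> D"
    then have "card S \<le> card D" using S(2) ch_N[OF D] by blast
    moreover have "card D < card S" using ch_sub[OF D] S N_fin by (intro psubset_card_mono) auto
    ultimately show False by simp
  qed
  moreover have "T = S" if T: "T \<in> N" "X \<subseteq> T" "\<forall>D\<in>ch T. \<not> X \<subseteq> D" and S: "S \<in> N" "X \<subseteq> S" "\<forall>D\<in>ch S. \<not> X \<subseteq> D" for S T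
  proof (rule ccontr)
    assume ne: "T \<noteq> S"
    have "S \<inter> T \<noteq> {}" using assms T S by auto
    then consider "S \<subset> T" | "T \<subset> S" using N_comparable[OF S(1) T(1)] ne by auto
    then show False
    proof cases
      case 1
      then have "S \<in> M" using S(1) N_sub[OF T(1)] by (auto simp: N_def)
      then show False using ch_cover[OF _ T(1) 1] T S by blast
    next
      case 2
      then have "T \<in> M" using T(1) N_sub[OF S(1)] by (auto simp: N_def)
      then show False using ch_cover[OF _ S(1) 2] T S by blast
    qed
  qed
  ultimately show ?thesis using S(1) by (intro ex1I[of _ S]) auto
qed

lemma unique_parent: assumes D: "D \<in> M" shows "\<exists>!S. S \<in> N \<and> D \<in> ch S"
proof -
  let ?P = "\<lambda>S. S \<in> N \<and> D \<subset> S"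
  have "?P V" using M_sub[OF D] V_notin D by (auto simp: N_def)
  then obtain S where S: "?P S" "\<And>T. ?P T \<Longrightarrow> card S \<le> card T"
    using ex_has_least_nat[of ?P V card] by blast
  have "\<not> (\<exists>T\<in>M. D \<subset> T \<and> T \<subset> S)"
  proof
    assume "\<exists>T\<in>M. D \<subset> T \<and> T \<subset> S"
    then obtain T where T: "T \<in> M" "D \<subset> T" "T \<subset> S" by auto
    then have "card S \<le> card T" using S by (auto simp: N_def)
    moreover have "card T < card S" using T S N_fin by (intro psubset_card_mono) auto
    ultimately show False by simp
  qed
  then have "D \<in> ch S" using S D by (auto simp: ch_def)
  moreover have False if "D \<in> ch S" "D \<in> ch T" "S \<in> N" "T \<in> N" "S \<subset> T" for S T
  proof -
    have "S \<in> M" using that N_sub[of T] by (auto simp: N_def)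
    then show False using that by (auto simp: ch_def)
  qed
  then have "T = S" if "D \<in> ch S" "D \<in> ch T" "S \<in> N" "T \<in> N" for S T
    using that N_comparable[of S T] M_ne[OF D] ch_sub[of D] by blast
  ultimately show ?thesis using S(1) by (intro ex1I[of _ S]) auto
qed

lemma ch_disj: assumes "D \<in> ch S" "D' \<in> ch S" "D \<noteq> D'" shows "D \<inter> D' = {}"
proof (rule ccontr)
  assume "D \<inter> D' \<noteq> {}"
  then consider "D \<subset> D'" | "D' \<subset> D" using N_comparable[OF ch_N[OF assms(1)] ch_N[OF assms(2)]] assms by auto
  then show False by cases (use assms in \<open>auto simp: ch_def\<close>)
qed

lemma sum_lvl:
  fixes g :: "'i \<Rightarrow> real"
  shows "sum g (EI S) = sum g (lvl S) + (\<Sum>D\<in>ch S. sum g (EI D))"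
proof -
  have "EI S = lvl S \<union> (\<Union>D\<in>ch S. EI D)" using ch_sub by (fastforce simp: lvl_def EI_def)
  moreover have "lvl S \<inter> (\<Union>D\<in>ch S. EI D) = {}" by (auto simp: lvl_def EI_def)
  moreover have "finite (lvl S)" by (simp add: lvl_def)
  moreover have "sum g (\<Union>D\<in>ch S. EI D) = (\<Sum>D\<in>ch S. sum g (EI D))"
  proof (rule sum.UNION_disjoint)
    show "\<forall>D\<in>ch S. \<forall>D'\<in>ch S. D \<noteq> D' \<longrightarrow> EI D \<inter> EI D' = {}"
    proof (intro ballI impI)
      fix D D' assume "D \<in> ch S" "D' \<in> ch S" "D \<noteq> D'"
      then have "D \<inter> D' = {}" by (rule ch_disj)
      then show "EI D \<inter> EI D' = {}" using ends_ne by (fastforce simp: EI_def)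
    qed
  qed auto
  ultimately show ?thesis by (simp add: sum.union_disjoint)
qed

lemma card_reg_Int:
  assumes "S \<in> N" shows "card (X \<inter> S) = card (X \<inter> reg S) + (\<Sum>D\<in>ch S. card (X \<inter> D))"
proof -
  have "X \<inter> S = (X \<inter> reg S) \<union> (\<Union>D\<in>ch S. X \<inter> D)" using ch_sub by (fastforce simp: reg_def)
  moreover have "(X \<inter> reg S) \<inter> (\<Union>D\<in>ch S. X \<inter> D) = {}" by (auto simp: reg_def)
  moreover have fin: "finite S" "\<And>D. D \<in> ch S \<Longrightarrow> finite D" using assms N_fin ch_N by auto
  moreover have "card (\<Union>D\<in>ch S. X \<inter> D) = (\<Sum>D\<in>ch S. card (X \<inter> D))"
    by (rule card_UN_disjoint) (use fin ch_disj in \<open>auto simp: disjoint_iff\<close>)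
  ultimately show ?thesis by (simp add: card_Un_disjoint reg_def)
qed

lemma hs_reg: assumes "S \<in> N" shows "hs g S = hs g (reg S) + (\<Sum>D\<in>ch S. hs g D)"
proof -
  have "(\<Sum>D\<in>ch S. hs g D) = (\<Sum>i\<in>Fr. \<Sum>D\<in>ch S. real (card (ends i \<inter> D)) * g i)"
    unfolding hs_def by (rule sum.swap)
  then show ?thesis unfolding hs_def card_reg_Int[OF assms]
    by (simp add: sum.distrib[symmetric] sum_distrib_right[symmetric] distrib_right[symmetric])
qed

text \<open>The value left at the level is that of a spanning tree after contraction of the
  children, because \<open>S\<close> and its children are all tight.\<close>

lemma sum_x_lvl: assumes "S \<in> N" shows "sum x (lvl S) = real (card (reg S)) + real (card (ch S)) - 1"
proof -
  have "sum x (EI S) = real (card S) - 1" using N_tight[OF assms] by (simp add: tight_def)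
  moreover have "(\<Sum>D\<in>ch S. sum x (EI D)) = (\<Sum>D\<in>ch S. real (card D) - 1)"
    by (rule sum.cong) (use M_tight ch_M in \<open>auto simp: tight_def\<close>)
  moreover have "card S = card (reg S) + (\<Sum>D\<in>ch S. card D)"
    using card_reg_Int[OF assms, of V] N_sub[OF assms] N_sub ch_N
    by (simp add: Int_absorb1 reg_def cong: sum.cong) (metis Diff_subset Int_absorb1 order_trans)
  ultimately show ?thesis using sum_lvl[of x S] by (simp add: sum_subtractf)
qed

text \<open>Tightness of \<open>S\<close> and its children is used here: no class is split between
  levels.\<close>

lemma mem_lvl_iff: assumes "S \<in> N" "i \<in> Fr" shows "i \<in> lvl S \<longleftrightarrow> cl i \<in> C S"
proof -
  have "ends i \<subseteq> S \<longleftrightarrow> cl i \<subseteq> S" using cl_subset_iff[OF N_tight[OF assms(1)]] by simp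
  moreover have "ends i \<subseteq> D \<longleftrightarrow> cl i \<subseteq> D" if "D \<in> ch S" for D
    using cl_subset_iff[OF M_tight[OF ch_M[OF that]]] by simp
  ultimately show ?thesis using assms(2) Fr_I[OF assms(2)] by (auto simp: lvl_def C_def EI_def)
qed

lemma sum_class_lvl:
  fixes g :: "'i \<Rightarrow> real"
  assumes "S \<in> N" shows "sum g (Fr \<inter> lvl S) = (\<Sum>U\<in>C S. sum g (cs U))"
proof -
  have "(\<Sum>U\<in>C S. sum g {i \<in> Fr \<inter> lvl S. cl i = U}) = sum g (Fr \<inter> lvl S)"
  proof (rule sum_unique_partition)
    fix i assume "i \<in> Fr \<inter> lvl S"
    then have "cl i \<in> C S" using mem_lvl_iff[OF assms, of i] by simp
    then show "\<exists>!U. U \<in> C S \<and> cl i = U" by auto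
  qed (auto simp: C_def)
  moreover have "(\<Sum>U\<in>C S. sum g {i \<in> Fr \<inter> lvl S. cl i = U}) = (\<Sum>U\<in>C S. sum g (cs U))"
    by (intro sum.cong refl arg_cong[of _ _ "sum g"]) (use mem_lvl_iff[OF assms] in \<open>auto simp: cs_def\<close>)
  ultimately show ?thesis by simp
qed

lemma finite_C [simp]: "finite (C S)"
  by (simp add: C_def)

section \<open>Local inequalities in the regions\<close>

lemma card_C_le: assumes "S \<in> N" shows "real (card (C S)) \<le> sum x (Fr \<inter> lvl S)"
proof -
  have "(\<Sum>U\<in>C S. 1) \<le> (\<Sum>U\<in>C S. sum x (cs U))"
    by (rule sum_mono) (auto simp: C_def intro: class_sum_ge_1)
  then show ?thesis using sum_class_lvl[OF assms] by simp
qed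

text \<open>\<open>Zs\<close> are the components of the edges of value 1 inside \<open>S\<close>
  that stay in the region; their edges already exhaust the rank bound, so they are tight. Either
  \<open>S\<close> itself is one of them, or each has a bundle \<open>A Z\<close> of fractional
  edges from a single class leaving it. The last inequality: each value-1 edge meeting the region
  reduces both the value left for fractional edges and, at most, the number of components by
  one.\<close>

lemma local_structure:
  assumes S: "S \<in> N"
  obtains (solid) "ch S = {}" "C S = {}"
  | (split) Zs A W where "finite Zs" "\<And>Z Z'. Z \<in> Zs \<Longrightarrow> Z' \<in> Zs \<Longrightarrow> Z \<noteq> Z' \<Longrightarrow> Z \<inter> Z' = {}"
      "\<And>Z. Z \<in> Zs \<Longrightarrow> Z \<subseteq> reg S"
      "\<And>Z. Z \<in> Zs \<Longrightarrow> A Z \<subseteq> Fr \<inter> cutI Z \<inter> EI S" "\<And>Z. Z \<in> Zs \<Longrightarrow> A Z \<subseteq> cs (W Z)"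
      "\<And>Z. Z \<in> Zs \<Longrightarrow> W Z \<in> C S" "\<And>Z. Z \<in> Zs \<Longrightarrow> 2 \<le> card (A Z)" "\<And>Z. Z \<in> Zs \<Longrightarrow> 1 \<le> sum x (A Z)"
      "sum x (Fr \<inter> lvl S) \<le> real (card Zs) + real (card (ch S)) - 1"
proof -
  let ?B = "On \<inter> EI S"
  have regV: "reg S \<subseteq> V" using N_sub[OF S] by (auto simp: reg_def)
  obtain Zs where "(\<forall>Z\<in>Zs. Z \<noteq> {} \<and> Z \<subseteq> reg S \<and> card Z \<le> Suc (card (?B \<inter> EI Z)) \<and>
       (\<forall>i\<in>?B. ends i \<subseteq> Z \<or> ends i \<inter> Z = {})) \<and> (\<forall>Z\<in>Zs. \<forall>Z'\<in>Zs. Z \<noteq> Z' \<longrightarrow> Z \<inter> Z' = {}) \<and>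
     card (reg S) \<le> card Zs + card {i \<in> ?B. ends i \<inter> reg S \<noteq> {}}"
  proof -
    have "finite ?B" "?B \<subseteq> I" by (auto simp: EI_def finite_I)
    from closed_components[OF this regV] show thesis using that by (elim exE)
  qed
  then have Zs: "\<And>Z. Z \<in> Zs \<Longrightarrow> Z \<noteq> {}" "\<And>Z. Z \<in> Zs \<Longrightarrow> Z \<subseteq> reg S" "\<And>Z. Z \<in> Zs \<Longrightarrow> card Z \<le> Suc (card (?B \<inter> EI Z))"
    "\<And>Z i. Z \<in> Zs \<Longrightarrow> i \<in> ?B \<Longrightarrow> ends i \<subseteq> Z \<or> ends i \<inter> Z = {}"
    "\<And>Z Z'. Z \<in> Zs \<Longrightarrow> Z' \<in> Zs \<Longrightarrow> Z \<noteq> Z' \<Longrightarrow> Z \<inter> Z' = {}"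
    "card (reg S) \<le> card Zs + card {i \<in> ?B. ends i \<inter> reg S \<noteq> {}}" by simp_all
  have lvlI: "lvl S \<subseteq> I" by (auto simp: lvl_def EI_def)
  have sumF: "sum x (Fr \<inter> lvl S) = real (card (reg S)) + real (card (ch S)) - 1 - real (card (On \<inter> lvl S))"
    using sum_x_lvl[OF S] sum_Fr_On[OF lvlI] by simp
  have tZ: "tight x Z" if "Z \<in> Zs" for Z
  proof -
    have ZV: "Z \<subseteq> V" using Zs(2)[OF that] regV by auto
    have "real (card (?B \<inter> EI Z)) \<le> real (card (On \<inter> EI Z))" by (intro of_nat_mono card_mono) auto
    also have "\<dots> \<le> sum x (EI Z)"
      using sum_Fr_On[of "EI Z"] sum_nonneg[of "Fr \<inter> EI Z" x] x_nonneg by (auto simp: EI_def Fr_def)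
    finally have "real (card Z) - 1 \<le> sum x (EI Z)" using Zs(3)[OF that] by linarith
    then show ?thesis using rank_le[OF ZV Zs(1)[OF that]] ZV Zs(1)[OF that] by (simp add: tight_def)
  qed
  show thesis
  proof (cases "S \<in> Zs")
    case True
    have "ch S = {}"
    proof (rule ccontr)
      assume "ch S \<noteq> {}"
      then obtain D where D: "D \<in> ch S" by auto
      then have "D \<noteq> {}" "D \<subseteq> S" using M_ne ch_M ch_sub by blast+
      then show False using Zs(2)[OF True] D by (auto simp: reg_def)
    qed
    moreover have "C S = {}"
    proof -
      \<comment> \<open>Without children the level is all of \<open>EI S\<close>, and its value is
        used up by the edges of value 1, so no class of value at least 1 fits.\<close>
      have "reg S = S" "lvl S = EI S" using \<open>ch S = {}\<close> by (auto simp: reg_def lvl_def)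
      then have "sum x (Fr \<inter> lvl S) \<le> 0"
        using sumF Zs(3)[OF True] \<open>ch S = {}\<close> by (simp add: Int_assoc)
      then have "card (C S) = 0" using card_C_le[OF S] by linarith
      then show ?thesis by simp
    qed
    ultimately show thesis by (rule solid)
  next
    case False
    have "\<exists>A W. A \<subseteq> Fr \<inter> cutI Z \<inter> EI S \<and> A \<subseteq> cs W \<and> W \<in> C S \<and> 2 \<le> card A \<and> 1 \<le> sum x A" if Z: "Z \<in> Zs" for Z
    proof -
      have "Z \<subset> S" using Zs(2)[OF Z] False Z by (auto simp: reg_def)
      moreover have "x i \<noteq> 1" if i: "i \<in> cutI Z" "ends i \<subseteq> S" for i
      proof
        assume "x i = 1"
        then have "i \<in> ?B" using i by (auto simp: On_def EI_def cutI_def)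
        then consider "ends i \<subseteq> Z" | "ends i \<inter> Z = {}" using Zs(4)[OF Z] by blast
        then show False using i(1) ends[of i] by cases (auto simp: cutI_def Int_absorb2)
      qed
      ultimately obtain A W where A: "A \<subseteq> Fr \<inter> cutI Z \<inter> EI S" "A \<subseteq> cs W" "W \<in> cl ` Fr" "2 \<le> card A" "1 \<le> sum x A"
        by (rule crossing_class[OF tZ[OF Z] N_tight[OF S]]) blast+
      obtain i where i: "i \<in> A" using A(4) by fastforce
      have "ends i \<inter> Z \<noteq> {}" using A(1) i by (auto simp: cutI_def)
      then have "ends i \<inter> reg S \<noteq> {}" using Zs(2)[OF Z] by auto
      then have "i \<in> lvl S" using A(1) i by (auto simp: lvl_def reg_def)
      moreover have "cl i = W" "i \<in> Fr" using A i by (auto simp: cs_def)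
      ultimately have "W \<in> C S" using mem_lvl_iff[OF S] by auto
      then show ?thesis using A by blast
    qed
    then obtain A W where AW: "\<And>Z. Z \<in> Zs \<Longrightarrow> A Z \<subseteq> Fr \<inter> cutI Z \<inter> EI S \<and> A Z \<subseteq> cs (W Z) \<and> W Z \<in> C S \<and> 2 \<le> card (A Z) \<and> 1 \<le> sum x (A Z)"
      by metis
    have "Zs \<subseteq> Pow V" using Zs(2) regV by blast
    then have fin: "finite Zs" using finite_V by (meson finite_Pow_iff finite_subset)
    have "{i \<in> ?B. ends i \<inter> reg S \<noteq> {}} \<subseteq> On \<inter> lvl S" by (auto simp: lvl_def reg_def)
    then have "card {i \<in> ?B. ends i \<inter> reg S \<noteq> {}} \<le> card (On \<inter> lvl S)" by (intro card_mono) auto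
    then have "sum x (Fr \<inter> lvl S) \<le> real (card Zs) + real (card (ch S)) - 1" using Zs(6) sumF by linarith
    then show thesis using AW by (intro split[OF fin Zs(5) Zs(2), of A W]) auto
  qed
qed

text \<open>An edge of \<open>A Z\<close> has exactly one end in \<open>Z\<close>, and the sets
  \<open>Z\<close> are disjoint, so the bundles occupy distinct half-edges of the region;
  \<open>r\<close> counts the remaining ones. It does not depend on \<open>g\<close>, so the same
  decomposition can be read with all three weights.\<close>

lemma hs_components:
  assumes S: "S \<in> N" and fin: "finite Zs"
    and dis: "\<And>Z Z'. Z \<in> Zs \<Longrightarrow> Z' \<in> Zs \<Longrightarrow> Z \<noteq> Z' \<Longrightarrow> Z \<inter> Z' = {}" and sub: "\<And>Z. Z \<in> Zs \<Longrightarrow> Z \<subseteq> reg S"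
    and A: "\<And>Z. Z \<in> Zs \<Longrightarrow> A Z \<subseteq> Fr \<inter> cutI Z \<inter> EI S"
  obtains r :: "'i \<Rightarrow> nat" where
    "\<And>g. hs g (reg S) = (\<Sum>Z\<in>Zs. sum g (A Z)) + (\<Sum>i\<in>Fr. real (r i) * g i)"
proof
  define k where "k i = card {Z \<in> Zs. i \<in> A Z}" for i
  define r where "r i = card (ends i \<inter> reg S) - k i" for i
  fix g :: "'i \<Rightarrow> real"
  have k: "k i \<le> card (ends i \<inter> reg S)" if "i \<in> Fr" for i
  proof -
    let ?Z = "{Z \<in> Zs. i \<in> A Z}"
    have fe: "finite (ends i)" using ends[OF Fr_I[OF that]] card_ge_0_finite[of "ends i"] by simp
    have "k i = (\<Sum>Z\<in>?Z. 1)" by (simp add: k_def)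
    also have "\<dots> = (\<Sum>Z\<in>?Z. card (ends i \<inter> Z))"
    proof (rule sum.cong[OF refl])
      fix Z assume "Z \<in> ?Z"
      then have "i \<in> cutI Z" using A by blast
      then show "1 = card (ends i \<inter> Z)" by (simp add: cutI_def)
    qed
    also have "\<dots> = card (\<Union>Z\<in>?Z. ends i \<inter> Z)"
      by (rule card_UN_disjoint[symmetric]) (use fin fe dis in \<open>auto simp: disjoint_iff\<close>)
    also have "\<dots> \<le> card (ends i \<inter> reg S)" by (rule card_mono) (use fe sub in auto)
    finally show ?thesis .
  qed
  have "(\<Sum>Z\<in>Zs. sum g (A Z)) = (\<Sum>Z\<in>Zs. sum g {i \<in> Fr. i \<in> A Z})"
    by (intro sum.cong refl arg_cong[of _ _ "sum g"]) (use A in auto)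
  also have "\<dots> = (\<Sum>i\<in>Fr. \<Sum>Z\<in>{Z \<in> Zs. i \<in> A Z}. g i)" by (rule sum.swap_restrict) (use fin in auto)
  also have "\<dots> = (\<Sum>i\<in>Fr. real (k i) * g i)" by (simp add: k_def)
  finally have "(\<Sum>Z\<in>Zs. sum g (A Z)) + (\<Sum>i\<in>Fr. real (r i) * g i) = (\<Sum>i\<in>Fr. real (k i) * g i + real (r i) * g i)"
    by (simp add: sum.distrib)
  also have "\<dots> = hs g (reg S)" unfolding hs_def
    by (rule sum.cong) (use k in \<open>auto simp: r_def of_nat_diff algebra_simps\<close>)
  finally show "hs g (reg S) = (\<Sum>Z\<in>Zs. sum g (A Z)) + (\<Sum>i\<in>Fr. real (r i) * g i)" by simp
qed

text \<open>Each bundle has at least two half-edges, and each class at the level uses up at least 1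
  of the value left there. The gain of 2 at the root is what makes the final count strict.\<close>

lemma local_count_V:
  assumes "Fr \<noteq> {}"
  shows "2 * real (card (C V)) + 2 \<le> hs (\<lambda>_. 1) (reg V) + 2 * real (card (ch V))"
proof -
  have VN: "V \<in> N" by (simp add: N_def)
  from VN show ?thesis
  proof (cases rule: local_structure)
    case solid
    obtain i where i: "i \<in> Fr" using assms by auto
    then have "i \<in> lvl V" using solid Fr_I[OF i] EI_V by (simp add: lvl_def)
    then show ?thesis using mem_lvl_iff[OF VN i] solid by simp
  next
    case (split Zs A W)
    obtain r where r: "\<And>g. hs g (reg V) = (\<Sum>Z\<in>Zs. sum g (A Z)) + (\<Sum>i\<in>Fr. real (r i) * g i)"
      using hs_components[OF VN split(1-4)] by metis
    have "(\<Sum>Z\<in>Zs. 2) \<le> (\<Sum>Z\<in>Zs. sum (\<lambda>_. 1) (A Z) :: real)" by (rule sum_mono) (use split(7) in simp)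
    then have "2 * real (card Zs) \<le> hs (\<lambda>_. 1) (reg V)"
      using r[of "\<lambda>_. 1"] sum_nonneg[of Fr "\<lambda>i. real (r i)"] by simp
    then show ?thesis using card_C_le[OF VN] split(9) by linarith
  qed
qed

lemma sum_Fr_EI_zero:
  fixes d :: "'i \<Rightarrow> real"
  assumes "\<And>U. U \<in> cl ` Fr \<Longrightarrow> sum d (cs U) = 0" "tight x T"
  shows "sum d (Fr \<inter> EI T) = 0"
  unfolding sum_classes[OF assms(2)] by (rule sum.neutral) (use assms(1) in auto)

text \<open>The vector \<open>d\<close> witnesses that the cut row of \<open>S\<close> does not
  follow from the other rows. With children or several components the general estimate gives 2 in
  place of 4. If 4 fails, at most one half-edge lies outside the bundles, all classes at the level
  have value 1, and every bundle is a whole class. A single half-edge outside contradicts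
  integrality, none contradicts \<open>d\<close>.\<close>

lemma local_count_M:
  fixes d :: "'i \<Rightarrow> real"
  assumes S: "S \<in> M" and int: "\<And>T. T \<in> M \<Longrightarrow> sum x (cutI T) \<in> \<int>" and four: "4 \<le> card (Fr \<inter> cutI S)"
    and d0: "\<And>i. i \<notin> Fr \<Longrightarrow> d i = 0" and d1: "\<And>U. U \<in> cl ` Fr \<Longrightarrow> sum d (cs U) = 0"
    and d2: "\<And>T. T \<in> M \<Longrightarrow> T \<noteq> S \<Longrightarrow> sum d (cutI T) = 0" and d3: "sum d (cutI S) \<noteq> 0"
  shows "2 * real (card (C S)) + 4 \<le> hs (\<lambda>_. 1) (reg S) + 2 * real (card (ch S))"
proof -
  have SN: "S \<in> N" using S by (simp add: N_def)
  from SN show ?thesis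
  proof (cases rule: local_structure)
    case solid
    then have "reg S = S" by (simp add: reg_def)
    moreover have "4 \<le> hs (\<lambda>_. 1) S" using four unfolding hs_cut by simp
    ultimately show ?thesis using solid by simp
  next
    case (split Zs A W)
    obtain r where r: "\<And>g. hs g (reg S) = (\<Sum>Z\<in>Zs. sum g (A Z)) + (\<Sum>i\<in>Fr. real (r i) * g i)"
      using hs_components[OF SN split(1-4)] by metis
    let ?z = "real (card Zs)" let ?q = "real (card (ch S))"
    have finA: "finite (A Z)" if "Z \<in> Zs" for Z using split(4)[OF that] finite_Fr finite_subset by blast
    have A2: "2 * ?z \<le> (\<Sum>Z\<in>Zs. sum (\<lambda>_. 1) (A Z) :: real)"
      using sum_mono[of Zs "\<lambda>_. 2 :: real" "\<lambda>Z. sum (\<lambda>_. 1) (A Z)"] split(7) by simp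
    have h1: "hs (\<lambda>_. 1) (reg S) = (\<Sum>Z\<in>Zs. sum (\<lambda>_. 1) (A Z)) + real (\<Sum>i\<in>Fr. r i)"
      using r[of "\<lambda>_. 1"] by simp
    show ?thesis
    proof (rule ccontr)
      assume "\<not> ?thesis"
      then have lt: "hs (\<lambda>_. 1) (reg S) + 2 * ?q < 2 * real (card (C S)) + 4" by simp
      have h_int: "hs (\<lambda>_. 1) (reg S) = real (\<Sum>i\<in>Fr. card (ends i \<inter> reg S))" by (simp add: hs_def)
      have Cle: "real (card (C S)) \<le> ?z + ?q - 1" using card_C_le[OF SN] split(9) by linarith
      have le1: "(\<Sum>i\<in>Fr. r i) \<le> 1"
      proof -
        have "hs (\<lambda>_. 1) (reg S) < 2 * ?z + 2" using lt Cle by linarith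
        then show ?thesis using A2 h1 by linarith
      qed
      have "2 * card Zs + 2 * card (ch S) < 2 * card (C S) + 4"
        using lt A2 h1 by linarith
      then have "card Zs + card (ch S) \<le> card (C S) + 1" by linarith
      then have Ceq: "sum x (Fr \<inter> lvl S) = real (card (C S))"
        using card_C_le[OF SN] split(9) by linarith
      have one: "sum x (cs U) = 1" if U: "U \<in> C S" for U
      proof -
        have "(\<Sum>U\<in>C S. sum x (cs U) - 1) = 0" using Ceq sum_class_lvl[OF SN, of x] by (simp add: sum_subtractf)
        moreover have "\<And>U. U \<in> C S \<Longrightarrow> 0 \<le> sum x (cs U) - 1" using class_sum_ge_1 by (auto simp: C_def)
        ultimately show ?thesis using sum_nonneg_eq_0_iff[of "C S" "\<lambda>U. sum x (cs U) - 1"] U by auto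
      qed
      have Aeq: "A Z = cs (W Z)" if Z: "Z \<in> Zs" for Z
      proof (rule ccontr)
        assume "A Z \<noteq> cs (W Z)"
        then obtain j where j: "j \<in> cs (W Z) - A Z" using split(5)[OF Z] by blast
        have "sum x (A Z) < sum x (cs (W Z))"
          by (rule sum_strict_mono2[OF finite_cs split(5)[OF Z] j]) (use j in \<open>auto simp: cs_def Fr_def\<close>)
        then show False using one[OF split(6)[OF Z]] split(8)[OF Z] by simp
      qed
      \<comment> \<open>Cuts of members are integral by hypothesis, inner values by tightness.
        Subtracting the children from \<open>S\<close> makes the half-edge value of the region
        integral.\<close>
      have "hs x T \<in> \<int>" if T: "T \<in> M" for T
      proof -
        have "sum x (Fr \<inter> cutI T) = sum x (cutI T) - real (card (On \<inter> cutI T))"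
          using sum_Fr_On[of "cutI T"] by (simp add: cutI_def Collect_mono)
        moreover have "sum x (Fr \<inter> EI T) = real (card T) - 1 - real (card (On \<inter> EI T))"
          using sum_Fr_On[of "EI T"] M_tight[OF T] by (simp add: EI_def Collect_mono tight_def)
        ultimately show ?thesis unfolding hs_cut using int[OF T] by auto
      qed
      then have "hs x S - (\<Sum>D\<in>ch S. hs x D) \<in> \<int>" using S ch_M by (intro Ints_diff Ints_sum) auto
      then have "hs x (reg S) \<in> \<int>" using hs_reg[OF SN, of x] by simp
      moreover have "(\<Sum>Z\<in>Zs. sum x (A Z)) = ?z" using Aeq one split(6) by simp
      ultimately have "hs x (reg S) - ?z \<in> \<int>" "hs x (reg S) - ?z = (\<Sum>i\<in>Fr. real (r i) * x i)"
        using r[of x] by auto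
      then have rint: "(\<Sum>i\<in>Fr. real (r i) * x i) \<in> \<int>" by simp
      \<comment> \<open>The bundles contribute integers, so a lone remaining half-edge would force
        its edge to have an integral value.\<close>
      have r0: "r i = 0" if i: "i \<in> Fr" for i
      proof (rule ccontr)
        assume "r i \<noteq> 0"
        moreover have sp: "(\<Sum>j\<in>Fr. r j) = r i + (\<Sum>j\<in>Fr - {i}. r j)" using i by (simp add: sum.remove)
        ultimately have "r i = 1" "(\<Sum>j\<in>Fr - {i}. r j) = 0" using le1 by linarith+
        then have "(\<Sum>j\<in>Fr. real (r j) * x j) = x i"
          using i by (simp add: sum.remove)
        then have "x i \<in> \<int>" using rint by simp
        then obtain n where "x i = real_of_int n" by (auto elim: Ints_cases)
        moreover have "0 < x i" "x i < 1" using i by (auto simp: Fr_def)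
        ultimately show False by simp
      qed
      \<comment> \<open>The region now consists of whole classes, on which \<open>d\<close> sums to
        0; the children vanish by their own cut rows, and so would the cut of
        \<open>S\<close>.\<close>
      have "hs d (reg S) = 0" using r[of d] r0 Aeq d1 split(6) by (simp add: C_def)
      moreover have "sum d (cutI T) = sum d (Fr \<inter> cutI T)" for T
        by (rule sum.mono_neutral_right) (use d0 in auto)
      moreover have "hs d D = 0" if "D \<in> ch S" for D
      proof -
        have "D \<in> M" "D \<noteq> S" using that ch_M ch_sub by auto
        then show ?thesis unfolding hs_cut using d2 sum_Fr_EI_zero[OF d1 M_tight] calculation(2)[of D] by simp
      qed
      ultimately have "sum d (cutI S) = hs d S" "hs d S = 0"
        using hs_reg[OF SN, of d] hs_cut[of d S] sum_Fr_EI_zero[OF d1 M_tight[OF S]] by auto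
      then show False using d3 by simp
    qed
  qed
qed

lemma card_count:
  assumes "Fr \<noteq> {}"
    and loc: "\<And>S. S \<in> M \<Longrightarrow> 2 * real (card (C S)) + 4 \<le> hs (\<lambda>_. 1) (reg S) + 2 * real (card (ch S))"
  shows "card (cl ` Fr) + card M < card Fr"
proof -
  have sumN: "sum f N = f V + sum f M" for f :: "'v set \<Rightarrow> real" using V_notin by (simp add: N_def)
  have cN: "(\<Sum>S\<in>N. real (card (C S))) = real (card (cl ` Fr))"
  proof -
    have "(\<Sum>S\<in>N. sum (\<lambda>_. 1::real) {U \<in> cl ` Fr. U \<subseteq> S \<and> (\<forall>D\<in>ch S. \<not> U \<subseteq> D)}) = sum (\<lambda>_. 1) (cl ` Fr)"
    proof (rule sum_unique_partition)
      fix U assume "U \<in> cl ` Fr"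
      then have "tight x U" using tight_cl Fr_I by auto
      then show "\<exists>!S. S \<in> N \<and> U \<subseteq> S \<and> (\<forall>D\<in>ch S. \<not> U \<subseteq> D)"
        by (intro unique_level) (auto simp: tight_def)
    qed auto
    then show ?thesis by (simp add: C_def)
  qed
  have chN: "(\<Sum>S\<in>N. real (card (ch S))) = real (card M)"
  proof -
    have "(\<Sum>S\<in>N. sum (\<lambda>_. 1::real) {D \<in> M. D \<in> ch S}) = sum (\<lambda>_. 1) M"
      by (rule sum_unique_partition) (use unique_parent in auto)
    moreover have "{D \<in> M. D \<in> ch S} = ch S" for S using ch_M by auto
    ultimately show ?thesis by simp
  qed
  have hN: "(\<Sum>S\<in>N. hs (\<lambda>_. 1) (reg S)) = 2 * real (card Fr)"
  proof -
    have "(\<Sum>S\<in>N. hs (\<lambda>_. 1) (reg S)) = (\<Sum>i\<in>Fr. \<Sum>S\<in>N. real (card (ends i \<inter> reg S)))"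
      unfolding hs_def by (subst sum.swap) simp
    also have "\<dots> = (\<Sum>i\<in>Fr. 2)"
    proof (rule sum.cong[OF refl])
      fix i assume "i \<in> Fr"
      then have e: "ends i \<subseteq> V" "card (ends i) = 2" using ends Fr_I by auto
      have "(\<Sum>S\<in>N. sum (\<lambda>_. 1::real) {u \<in> ends i. {u} \<subseteq> S \<and> (\<forall>D\<in>ch S. \<not> {u} \<subseteq> D)}) = sum (\<lambda>_. 1) (ends i)"
      proof (rule sum_unique_partition)
        fix u assume "u \<in> ends i"
        then show "\<exists>!S. S \<in> N \<and> {u} \<subseteq> S \<and> (\<forall>D\<in>ch S. \<not> {u} \<subseteq> D)"
          using e by (intro unique_level) auto
      qed (use e card_ge_0_finite[of "ends i"] in auto)
      moreover have "{u \<in> ends i. {u} \<subseteq> S \<and> (\<forall>D\<in>ch S. \<not> {u} \<subseteq> D)} = ends i \<inter> reg S" for S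
        by (auto simp: reg_def)
      ultimately show "(\<Sum>S\<in>N. real (card (ends i \<inter> reg S))) = 2" using e by simp
    qed
    finally show ?thesis by simp
  qed
  have "(\<Sum>S\<in>M. 2 * real (card (C S)) + 4) \<le> (\<Sum>S\<in>M. hs (\<lambda>_. 1) (reg S) + 2 * real (card (ch S)))"
    by (rule sum_mono) (rule loc)
  then have "2 * (\<Sum>S\<in>M. real (card (C S))) + 4 * real (card M) \<le>
      (\<Sum>S\<in>M. hs (\<lambda>_. 1) (reg S)) + 2 * (\<Sum>S\<in>M. real (card (ch S)))"
    by (simp add: sum.distrib sum_distrib_left)
  then have "2 * real (card (cl ` Fr)) + 2 * real (card M) + 2 \<le> 2 * real (card Fr)"
    using local_count_V[OF assms(1)] cN chN hN
      sumN[of "\<lambda>S. real (card (C S))"] sumN[of "\<lambda>S. real (card (ch S))"] sumN[of "\<lambda>S. hs (\<lambda>_. 1) (reg S)"]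
    by linarith
  then show ?thesis by linarith
qed

end

section \<open>A direction for the fractional edges\<close>

context tree_point
begin

text \<open>After \<open>M\<close> is shrunk to a minimal family with the same kernel, the number of rows is less than
  the number of fractional edges: sum the local inequalities over the regions of the family.\<close>

theorem fractional_direction:
  assumes M: "\<And>S. S \<in> M \<Longrightarrow> tight x S \<and> sum x (cutI S) \<in> \<int> \<and> 4 \<le> card (Fr \<inter> cutI S)"
    and lam: "\<And>S T. S \<in> M \<Longrightarrow> T \<in> M \<Longrightarrow> S \<inter> T \<in> {{}, S, T}" and ne: "Fr \<noteq> {}"
  obtains d :: "'i \<Rightarrow> int" where "\<exists>i\<in>I. d i \<noteq> 0" "\<And>i. i \<notin> Fr \<Longrightarrow> d i = 0"
    "\<And>U. tight x U \<Longrightarrow> sum d (EI U) = 0" "\<And>S. S \<in> M \<Longrightarrow> sum d (cutI S) = 0"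
proof -
  define K where "K N d \<longleftrightarrow> (\<forall>i. i \<notin> Fr \<longrightarrow> d i = 0) \<and> (\<forall>U\<in>cl ` Fr. sum d (cs U) = 0) \<and> (\<forall>S\<in>N. sum d (cutI S) = 0)"
    for N and d :: "'i \<Rightarrow> real"
  let ?P = "\<lambda>M'. M' \<subseteq> M \<and> (\<forall>d. K M' d \<longrightarrow> K M d)"
  have "M \<subseteq> Pow V" using M by (auto simp: tight_def)
  then have finM: "finite M" using finite_V by (meson finite_Pow_iff finite_subset)
  have "?P M" by simp
  then obtain M' where M': "?P M'" "\<And>M''. ?P M'' \<Longrightarrow> card M' \<le> card M''"
    using ex_has_least_nat[of ?P M card] by blast
  have M's: "M' \<subseteq> M" "finite M'" using M' finM finite_subset by auto
  have VM: "V \<notin> M'"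
  proof
    assume "V \<in> M'"
    then have "4 \<le> card (Fr \<inter> cutI V)" using M M's by blast
    then obtain i where "i \<in> cutI V" by fastforce
    then show False using ends[of i] by (auto simp: cutI_def Int_absorb2)
  qed
  interpret laminar_point V I ends x M'
    by unfold_locales (use M lam M's VM in blast)+
  have "card (cl ` Fr) + card M' < card Fr"
  proof (rule card_count[OF ne])
    fix S assume S: "S \<in> M'"
    \<comment> \<open>If removing \<open>S\<close> did not enlarge the kernel, \<open>M'\<close>
      would not be smallest. A vector of the larger kernel is the witness that the local count asks
      for.\<close>
    have "\<exists>d. K (M' - {S}) d \<and> sum d (cutI S) \<noteq> 0"
    proof (rule ccontr)
      assume "\<not> ?thesis"
      then have "\<forall>d. K (M' - {S}) d \<longrightarrow> K M' d" by (auto simp: K_def)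
      then have "?P (M' - {S})" using M' by blast
      then show False using M'(2)[of "M' - {S}"] card_Diff1_less[OF M's(2) S] by simp
    qed
    then obtain d where d: "K (M' - {S}) d" "sum d (cutI S) \<noteq> 0" by blast
    show "2 * real (card (C S)) + 4 \<le> hs (\<lambda>_. 1) (reg S) + 2 * real (card (ch S))"
      by (rule local_count_M[of S d]) (use d S M M's in \<open>auto simp: K_def\<close>)
  qed
  define a :: "'v set + 'v set \<Rightarrow> 'i \<Rightarrow> int" where
    "a r i = (case r of Inl U \<Rightarrow> if cl i = U then 1 else 0 | Inr S \<Rightarrow> if i \<in> cutI S then 1 else 0)" for r i
  have fins: "finite (cl ` Fr <+> M')" using M's by auto
  have cards: "card (cl ` Fr <+> M') < card Fr"
    using \<open>card (cl ` Fr) + card M' < card Fr\<close> M's by (simp add: card_Plus)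
  have a01: "a r i \<in> {0, 1}" for r i by (auto simp: a_def split: sum.splits)
  obtain d :: "'i \<Rightarrow> int" where d: "\<exists>i\<in>Fr. d i \<noteq> 0" "\<And>i. i \<notin> Fr \<Longrightarrow> d i = 0"
    "\<And>r. r \<in> cl ` Fr <+> M' \<Longrightarrow> (\<Sum>i\<in>Fr. a r i * d i) = 0"
    using a01 by (rule integer_kernel_vector[where a = a, OF fins finite_Fr cards]) blast
  let ?d = "\<lambda>i. real_of_int (d i)"
  have K': "K M' ?d"
  proof -
    have "sum d (cs U) = 0" if "U \<in> cl ` Fr" for U
    proof -
      have "(\<Sum>i\<in>Fr. a (Inl U) i * d i) = (\<Sum>i\<in>Fr. if cl i = U then d i else 0)"
        by (rule sum.cong) (auto simp: a_def)
      also have "\<dots> = sum d (cs U)" unfolding cs_def by (simp add: sum.inter_filter)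
      finally show ?thesis using d(3)[of "Inl U"] that by auto
    qed
    moreover have "sum d (cutI S) = 0" if "S \<in> M'" for S
    proof -
      have "(\<Sum>i\<in>Fr. a (Inr S) i * d i) = (\<Sum>i\<in>Fr. if i \<in> cutI S then d i else 0)"
        by (rule sum.cong) (auto simp: a_def)
      also have "\<dots> = sum d (Fr \<inter> cutI S)" by (simp add: sum.inter_restrict)
      also have "\<dots> = sum d (cutI S)" by (rule sum.mono_neutral_left) (use d(2) in auto)
      finally show ?thesis using d(3)[of "Inr S"] that by auto
    qed
    ultimately show ?thesis using d(2) unfolding K_def of_int_sum[symmetric] by simp
  qed
  then have KM: "K M ?d" using M' by blast
  have cast: "sum d A = 0 \<longleftrightarrow> sum ?d A = 0" for A by (metis of_int_eq_0_iff of_int_sum)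
  show thesis
  proof (rule that[of d])
    show "\<exists>i\<in>I. d i \<noteq> 0" using d(1) Fr_I by blast
    show "sum d (cutI S) = 0" if "S \<in> M" for S
      using KM that unfolding K_def cast by simp
    show "sum d (EI U) = 0" if "tight x U" for U
    proof -
      have "sum ?d (Fr \<inter> EI U) = 0" by (rule sum_Fr_EI_zero) (use KM that in \<open>auto simp: K_def\<close>)
      moreover have "sum ?d (EI U) = sum ?d (Fr \<inter> EI U)"
        by (rule sum.mono_neutral_right) (use d(2) in auto)
      ultimately show ?thesis unfolding cast by simp
    qed
  qed (use d in auto)
qed

end

section \<open>Iterative relaxation\<close>

text \<open>The ratio test of the simplex method: a pair holds the slack of a constraint and its
  rate of change, and the step ends where the first decreasing slack reaches 0.\<close>

lemma ratio_test:
  fixes J :: "(real \<times> real) set"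
  assumes "finite J" "\<And>p. p \<in> J \<Longrightarrow> 0 \<le> fst p" "\<exists>p\<in>J. snd p < 0"
  obtains t where "0 \<le> t" "\<And>p. p \<in> J \<Longrightarrow> 0 \<le> fst p + t * snd p"
    "\<exists>p\<in>J. snd p < 0 \<and> fst p + t * snd p = 0"
proof -
  let ?N = "{p \<in> J. snd p < 0}" let ?r = "\<lambda>p. fst p / - snd p"
  have N: "finite ?N" "?N \<noteq> {}" using assms(1,3) by force+
  define t where "t = Min (?r ` ?N)"
  have "t \<in> ?r ` ?N" unfolding t_def using N by (intro Min_in) auto
  then obtain p where p: "p \<in> J" "snd p < 0" "t = fst p / - snd p" by auto
  show thesis
  proof (rule that[of t])
    show "0 \<le> t" using p assms(2)[OF p(1)] by (simp add: divide_nonneg_neg)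
    show "\<exists>p\<in>J. snd p < 0 \<and> fst p + t * snd p = 0" using p by (intro bexI[of _ p]) auto
    show "0 \<le> fst q + t * snd q" if "q \<in> J" for q
    proof (cases "snd q < 0")
      case True
      then have "t \<le> fst q / - snd q" unfolding t_def using N that by (intro Min_le) auto
      then show ?thesis using True by (simp add: field_simps)
    next
      case False
      then show ?thesis using assms(2)[OF that] \<open>0 \<le> t\<close> by simp
    qed
  qed
qed

locale relaxation = indexed_graph V I ends
  for V :: "'v set" and I :: "'i set" and ends :: "'i \<Rightarrow> 'v set" +
  fixes L :: "'v set set" and k :: "'v set \<Rightarrow> int" and c :: "'i \<Rightarrow> real" and c0 :: real
  assumes lamL: "\<And>S T. S \<in> L \<Longrightarrow> T \<in> L \<Longrightarrow> S \<inter> T \<in> {{}, S, T}" and VL: "V \<in> L"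
begin

text \<open>The support is counted, not the value. It only shrinks under moves, so a dropped set
  stays dropped, and its final number of tree edges is within the bound.\<close>

definition "act x S \<longleftrightarrow> 2 * k S + 1 < int (card {i \<in> cutI S. (0::real) < x i})"

definition "feas x \<longleftrightarrow> stp x \<and> (\<forall>S\<in>L. tight x S) \<and> (\<Sum>i\<in>I. c i * x i) \<le> c0 \<and>
  (\<forall>S\<in>L. act x S \<longrightarrow> sum x (cutI S) \<le> of_int (k S))"

definition "tcut x = {S \<in> L. act x S \<and> sum x (cutI S) = of_int (k S)}"

text \<open>A set once settled remains so, since inactive sets never return and moves preserve tight
  active cuts; thus the number of settled sets can measure progress.\<close>

definition "settled x = {S \<in> L. \<not> act x S \<or> sum x (cutI S) = of_int (k S)}"

definition "integral x = {i \<in> I. x i = 0 \<or> x i = (1::real)}"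

lemma feas_tree_point: "feas x \<Longrightarrow> tree_point V I ends x"
  by unfold_locales (simp add: feas_def)

lemma finite_L: "feas x \<Longrightarrow> finite L"
  using finite_V by (auto simp: feas_def tight_def intro!: finite_subset[of L "Pow V"])

lemma integral_Fr:
  assumes "feas x" shows "i \<in> I \<Longrightarrow> i \<notin> integral x \<longleftrightarrow> 0 < x i \<and> x i < 1"
proof -
  interpret tree_point V I ends x using feas_tree_point[OF assms] .
  show "i \<in> I \<Longrightarrow> ?thesis" using x_nonneg[of i] x_le_1[of i] by (auto simp: integral_def)
qed

lemma direction_exists:
  assumes feas: "feas x" and ne: "integral x \<noteq> I"
  obtains d :: "'i \<Rightarrow> int" where "\<exists>i\<in>I. d i \<noteq> 0" "\<And>i. i \<in> integral x \<Longrightarrow> d i = 0"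
    "\<And>U. tight x U \<Longrightarrow> sum d (EI U) = 0" "\<And>S. S \<in> tcut x \<Longrightarrow> sum d (cutI S) = 0"
proof -
  interpret tree_point V I ends x using feas_tree_point[OF feas] .
  have Fr: "Fr = I - integral x" using integral_Fr[OF feas] by (auto simp: Fr_def)
  then have Fne: "Fr \<noteq> {}" using ne by (auto simp: integral_def)
  have tc: "tight x S \<and> sum x (cutI S) \<in> \<int> \<and> 4 \<le> card (Fr \<inter> cutI S)" if S: "S \<in> tcut x" for S
  proof (intro conjI)
    show "tight x S" using S feas by (auto simp: tcut_def feas_def)
    have k: "sum x (cutI S) = of_int (k S)" "act x S" using S by (auto simp: tcut_def)
    then show "sum x (cutI S) \<in> \<int>" by simp
    let ?f = "card (Fr \<inter> cutI S)" let ?a = "card (On \<inter> cutI S)"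
    have "{i \<in> cutI S. 0 < x i} = (Fr \<inter> cutI S) \<union> (On \<inter> cutI S)"
      using x_le_1 by (force simp: Fr_def On_def cutI_def)
    moreover have "(Fr \<inter> cutI S) \<inter> (On \<inter> cutI S) = {}" by (auto simp: Fr_def On_def)
    ultimately have "card {i \<in> cutI S. 0 < x i} = ?f + ?a" by (simp add: card_Un_disjoint)
    then have af: "2 * k S + 1 < int ?f + int ?a" using k(2) by (simp add: act_def)
    have s: "sum x (Fr \<inter> cutI S) = of_int (k S - int ?a)"
      using sum_Fr_On[of "cutI S"] k(1) by (simp add: cutI_def Collect_mono)
    have "Fr \<inter> cutI S \<noteq> {}"
    proof
      assume e: "Fr \<inter> cutI S = {}"
      then have "k S = int ?a" using s by simp
      then show False using af e by simp
    qed
    then have "0 < sum x (Fr \<inter> cutI S)" by (intro sum_pos) (auto simp: Fr_def)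
    then have "1 \<le> k S - int ?a" using s by simp
    \<comment> \<open>The fractional part has positive integral value, so
      \<open>?a \<le> k S - 1\<close>; with more than \<open>2 * k S + 1\<close> edges in the
      support at least \<open>k S + 3\<close> are fractional, and
      \<open>k S \<ge> 1\<close>.\<close>
    then show "4 \<le> ?f" using af by linarith
  qed
  have lam: "S \<inter> T \<in> {{}, S, T}" if "S \<in> tcut x" "T \<in> tcut x" for S T
    using that lamL[of S T] by (simp add: tcut_def)
  obtain d :: "'i \<Rightarrow> int" where d: "\<exists>i\<in>I. d i \<noteq> 0" "\<And>i. i \<notin> Fr \<Longrightarrow> d i = 0"
    "\<And>U. tight x U \<Longrightarrow> sum d (EI U) = 0" "\<And>S. S \<in> tcut x \<Longrightarrow> sum d (cutI S) = 0"
    using fractional_direction[of "tcut x", OF tc lam Fne] by metis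
  show thesis using d Fr by (intro that[of d]) auto
qed

text \<open>Integral coordinates are fixed, so an edge of value 0 never returns to the support.
  Family rank constraints and tight cuts are kept by the kernel equations, the remaining constraints
  by the choice of the step length.\<close>

lemma feas_move:
  fixes d :: "'i \<Rightarrow> real"
  assumes feas: "feas x" and t: "0 \<le> t" and x': "\<And>i. x' i = x i + t * d i"
    and d0: "\<And>i. i \<in> integral x \<Longrightarrow> d i = 0" and dL: "\<And>S. S \<in> L \<Longrightarrow> sum d (EI S) = 0"
    and dc: "\<And>S. S \<in> tcut x \<Longrightarrow> sum d (cutI S) = 0" and cost: "(\<Sum>i\<in>I. c i * d i) \<le> 0"
    and pos: "\<And>i. i \<in> I \<Longrightarrow> 0 \<le> x' i"
    and rank: "\<And>U. U \<subseteq> V \<Longrightarrow> U \<noteq> {} \<Longrightarrow> sum x' (EI U) \<le> real (card U) - 1"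
    and deg: "\<And>S. S \<in> L \<Longrightarrow> act x S \<Longrightarrow> sum x' (cutI S) \<le> of_int (k S)"
  shows "feas x'" "integral x \<subseteq> integral x'" "settled x \<subseteq> settled x'"
proof -
  interpret tree_point V I ends x using feas_tree_point[OF feas] .
  have sum_x': "sum x' A = sum x A + t * sum d A" for A
    by (simp add: x' sum.distrib sum_distrib_left)
  have supp: "{i \<in> cutI S. 0 < x' i} \<subseteq> {i \<in> cutI S. 0 < x i}" for S
  proof
    fix i assume i: "i \<in> {i \<in> cutI S. 0 < x' i}"
    then have "i \<in> I" by (simp add: cutI_def)
    then show "i \<in> {i \<in> cutI S. 0 < x i}"
      using i d0[of i] x_nonneg[of i] by (auto simp: x' integral_def less_le)
  qed
  have act: "act x S" if "act x' S" for S
    using that card_mono[OF _ supp[of S]] by (simp add: act_def)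
  have "sum x' I = sum x I" using sum_x'[of I] dL[OF VL] EI_V by simp
  then have "stp x'" using stp pos rank by (simp add: stp_def)
  moreover have "tight x' S" if "S \<in> L" for S
    using feas that sum_x'[of "EI S"] dL[OF that] by (auto simp: feas_def tight_def)
  moreover have "(\<Sum>i\<in>I. c i * x' i) = (\<Sum>i\<in>I. c i * x i) + t * (\<Sum>i\<in>I. c i * d i)"
    by (simp add: x' algebra_simps sum.distrib sum_distrib_left)
  then have "(\<Sum>i\<in>I. c i * x' i) \<le> c0"
    using feas mult_nonneg_nonpos[OF t cost] by (simp add: feas_def)
  ultimately show "feas x'" using deg act by (simp add: feas_def)
  show "integral x \<subseteq> integral x'" using d0 by (auto simp: integral_def x')
  show "settled x \<subseteq> settled x'"
  proof
    fix S assume S: "S \<in> settled x"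
    show "S \<in> settled x'"
    proof (cases "act x S")
      case True
      then have "S \<in> tcut x" using S by (auto simp: settled_def tcut_def)
      then show ?thesis using dc[of S] sum_x'[of "cutI S"] by (auto simp: settled_def tcut_def)
    next
      case False
      then show ?thesis using S act by (auto simp: settled_def)
    qed
  qed
qed

text \<open>A feasible point maximising the number of integral coordinates, tight sets and settled
  sets must be integral, as a further move would raise this number. All tight sets may be counted
  here, because nothing has to be computed; real data are covered as well.\<close>

lemma exists_integral:
  assumes "feas x0" shows "\<exists>x. feas x \<and> integral x = I"
proof -
  define m where "m x = card (integral x) + card {U. tight x U} + card (settled x)" for x
  have finT: "finite {U. tight x U}" for x
    by (rule finite_subset[of _ "Pow V"]) (auto simp: tight_def finite_V)
  have finI': "finite (integral x)" for x using finite_I by (simp add: integral_def)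
  have finS: "finite (settled x)" for x using finite_L[OF assms] by (simp add: settled_def)
  have "m x < Suc (card I + card (Pow V) + card L)" if "feas x" for x
  proof -
    have "card (integral x) \<le> card I" by (rule card_mono) (auto simp: integral_def finite_I)
    moreover have "card {U. tight x U} \<le> card (Pow V)" by (rule card_mono) (auto simp: tight_def finite_V)
    moreover have "card (settled x) \<le> card L" by (rule card_mono) (auto simp: settled_def finite_L[OF assms])
    ultimately show ?thesis by (simp add: m_def)
  qed
  then obtain x where x: "feas x" "\<And>y. feas y \<Longrightarrow> m y \<le> m x"
    using ex_has_greatest_nat[of feas x0 m] assms by blast
  have "integral x = I"
  proof (rule ccontr)
    assume "integral x \<noteq> I"
    then obtain d :: "'i \<Rightarrow> int" where d: "\<exists>i\<in>I. d i \<noteq> 0" "\<And>i. i \<in> integral x \<Longrightarrow> d i = 0"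
      "\<And>U. tight x U \<Longrightarrow> sum d (EI U) = 0" "\<And>S. S \<in> tcut x \<Longrightarrow> sum d (cutI S) = 0"
      using direction_exists[OF x(1)] by metis
    define s :: real where "s = (if (\<Sum>i\<in>I. c i * d i) \<le> 0 then 1 else -1)"
    define e where "e i = s * d i" for i
    interpret tree_point V I ends x using feas_tree_point[OF x(1)] .
    have sum_e: "sum e A = s * of_int (sum d A)" for A by (simp add: e_def sum_distrib_left)
    have e: "\<exists>i\<in>I. e i \<noteq> 0" "\<And>i. i \<in> integral x \<Longrightarrow> e i = 0"
      "\<And>U. tight x U \<Longrightarrow> sum e (EI U) = 0" "\<And>S. S \<in> tcut x \<Longrightarrow> sum e (cutI S) = 0"
      using d unfolding sum_e by (auto simp: e_def s_def)
    have cost: "(\<Sum>i\<in>I. c i * e i) \<le> 0"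
    proof -
      have "(\<Sum>i\<in>I. c i * e i) = s * (\<Sum>i\<in>I. c i * d i)" by (simp add: e_def sum_distrib_left mult.left_commute)
      then show ?thesis by (simp add: s_def)
    qed
    \<comment> \<open>\<open>V\<close> is tight, so the entries of \<open>e\<close> sum to 0 and a
      nonzero \<open>e\<close> has a negative one. This bounds the step length.\<close>
    have neg: "\<exists>i\<in>I. e i < 0"
    proof (rule ccontr)
      assume "\<not> ?thesis"
      then have "\<And>i. i \<in> I \<Longrightarrow> 0 \<le> e i" by (auto simp: not_less)
      moreover have "sum e I = 0" using e(3)[OF tight_V] EI_V by simp
      ultimately show False using e(1) sum_nonneg_eq_0_iff[OF finite_I, of e] by auto
    qed
    define Us where "Us = {U. U \<subseteq> V \<and> U \<noteq> {}}"
    define Ls where "Ls = {S \<in> L. act x S}"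
    have fins: "finite Us" "finite Ls" using finite_V finite_L[OF assms] by (auto simp: Us_def Ls_def)
    define J where "J = (\<lambda>i. (x i, e i)) ` I \<union>
      (\<lambda>U. (real (card U) - 1 - sum x (EI U), - sum e (EI U))) ` Us \<union>
      (\<lambda>S. (of_int (k S) - sum x (cutI S), - sum e (cutI S))) ` Ls"
    have "0 \<le> fst p" if "p \<in> J" for p
    proof -
      have "0 \<le> real (card U) - 1 - sum x (EI U)" if "U \<in> Us" for U
        using that rank_le[of U] by (simp add: Us_def)
      moreover have "sum x (cutI S) \<le> of_int (k S)" if "S \<in> Ls" for S
        using that x(1) by (simp add: Ls_def feas_def)
      ultimately show ?thesis using that x_nonneg unfolding J_def by (elim UnE imageE) auto
    qed
    moreover have "\<exists>p\<in>J. snd p < 0" using neg by (force simp: J_def)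
    moreover have "finite J" using fins finite_I by (simp add: J_def)
    ultimately obtain t where t: "0 \<le> t" "\<And>p. p \<in> J \<Longrightarrow> 0 \<le> fst p + t * snd p"
      "\<exists>p\<in>J. snd p < 0 \<and> fst p + t * snd p = 0" using ratio_test[of J] by metis
    define x' where "x' i = x i + t * e i" for i
    have sum_x': "sum x' A = sum x A + t * sum e A" for A
      by (simp add: x'_def sum.distrib sum_distrib_left)
    have step: "feas x'" "integral x \<subseteq> integral x'" "settled x \<subseteq> settled x'"
    proof -
      have pos: "0 \<le> x' i" if "i \<in> I" for i using t(2)[of "(x i, e i)"] that by (auto simp: J_def x'_def)
      have rank: "sum x' (EI U) \<le> real (card U) - 1" if "U \<subseteq> V" "U \<noteq> {}" for U
        using t(2)[of "(real (card U) - 1 - sum x (EI U), - sum e (EI U))"] that sum_x'[of "EI U"]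
        by (auto simp: J_def Us_def)
      have deg: "sum x' (cutI S) \<le> of_int (k S)" if "S \<in> L" "act x S" for S
        using t(2)[of "(of_int (k S) - sum x (cutI S), - sum e (cutI S))"] that sum_x'[of "cutI S"]
        by (auto simp: J_def Ls_def)
      have eL: "sum e (EI S) = 0" if "S \<in> L" for S using e(3) x(1) that by (auto simp: feas_def)
      note m = feas_move[OF x(1) t(1) x'_def e(2) eL e(4) cost pos rank deg]
      show "feas x'" by (rule m(1))
      show "integral x \<subseteq> integral x'" by (rule m(2))
      show "settled x \<subseteq> settled x'" by (rule m(3))
    qed
    have tmono: "{U. tight x U} \<subseteq> {U. tight x' U}"
    proof
      fix U assume "U \<in> {U. tight x U}"
      then show "U \<in> {U. tight x' U}" using e(3)[of U] sum_x'[of "EI U"] by (simp add: tight_def)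
    qed
    obtain p where p: "p \<in> J" "snd p < 0" "fst p + t * snd p = 0" using t(3) by blast
    have "m x < m x'"
    proof -
      have le: "card (integral x) \<le> card (integral x')" "card {U. tight x U} \<le> card {U. tight x' U}"
        "card (settled x) \<le> card (settled x')"
        using step tmono by (auto intro!: card_mono finI' finT finS)
      from p(1) consider i where "i \<in> I" "p = (x i, e i)"
        | U where "U \<in> Us" "p = (real (card U) - 1 - sum x (EI U), - sum e (EI U))"
        | S where "S \<in> Ls" "p = (of_int (k S) - sum x (cutI S), - sum e (cutI S))"
        unfolding J_def by blast
      then show ?thesis
      proof cases
        case 1
        then have "i \<in> integral x'" "i \<notin> integral x" using p e(2)[of i] by (auto simp: integral_def x'_def)
        then have "card (integral x) < card (integral x')"
          using step(2) by (intro psubset_card_mono finI') auto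
        then show ?thesis using le by (simp add: m_def)
      next
        case 2
        then have "tight x' U" "\<not> tight x U" using p e(3)[of U] sum_x'[of "EI U"] by (auto simp: tight_def Us_def)
        then have "card {U. tight x U} < card {U. tight x' U}"
          using tmono by (intro psubset_card_mono finT) auto
        then show ?thesis using le by (simp add: m_def)
      next
        case 3
        then have "S \<in> settled x'" "S \<notin> settled x" using p e(4)[of S] sum_x'[of "cutI S"]
          by (auto simp: settled_def Ls_def tcut_def)
        then have "card (settled x) < card (settled x')"
          using step(3) by (intro psubset_card_mono finS) auto
        then show ?thesis using le by (simp add: m_def)
      qed
    qed
    then show False using x(2)[OF step(1)] by simp
  qed
  then show ?thesis using x(1) by blast
qed

end

section \<open>Integral points are spanning trees\<close>

context tree_point
begin

text \<open>Connected: if a vertex reached only a proper subset \<open>U\<close>, all edges would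
  lie inside \<open>U\<close> or its complement, at most \<open>card V - 2\<close> in number.
  Acyclic: the vertices of a cycle would span as many edges as vertices, against the rank
  bound.\<close>

lemma integral_spanning_tree:
  assumes int: "\<And>i. i \<in> I \<Longrightarrow> x i = 0 \<or> x i = 1" and inj: "inj_on ends I"
  shows "spanning_tree V (ends ` I) (ends ` On)"
proof -
  have cnt: "sum x (EI U) = real (card (On \<inter> EI U))" for U
  proof -
    have "Fr = {}" using int by (force simp: Fr_def)
    then show ?thesis using sum_Fr_On[of "EI U"] by (simp add: EI_def Collect_mono)
  qed
  have sub: "ends ` On \<subseteq> ends ` I" by (auto simp: On_def)
  have conn: "connected_on V (ends ` On)"
    unfolding connected_on_def
  proof (intro conjI ballI V_ne)
    fix u v assume uv: "u \<in> V" "v \<in> V"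
    let ?R = "{(a, b). {a, b} \<in> ends ` On}"
    define U where "U = {w \<in> V. (u, w) \<in> ?R\<^sup>*}"
    have uU: "u \<in> U" using uv by (simp add: U_def)
    have "U = V"
    proof (rule ccontr)
      assume ne: "U \<noteq> V"
      have UV: "U \<subseteq> V" "U \<noteq> {}" "V - U \<noteq> {}" using ne uU by (auto simp: U_def)
      have "On \<subseteq> EI U \<union> EI (V - U)"
      proof
        fix i assume i: "i \<in> On"
        then have iI: "i \<in> I" by (simp add: On_def)
        obtain a b where ab: "ends i = {a, b}" "a \<in> V" "b \<in> V" using ends_E[OF iI] by metis
        have R: "(a, b) \<in> ?R" "(b, a) \<in> ?R" using i ab by (auto simp: image_iff insert_commute intro!: bexI[of _ i])
        have "a \<in> U \<longleftrightarrow> b \<in> U" using R ab unfolding U_def by (auto intro: rtrancl_into_rtrancl)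
        then show "i \<in> EI U \<union> EI (V - U)" using iI ab by (auto simp: EI_def)
      qed
      then have "On = (On \<inter> EI U) \<union> (On \<inter> EI (V - U))" by auto
      then have "card On \<le> card (On \<inter> EI U) + card (On \<inter> EI (V - U))" by (metis card_Un_le)
      moreover have "real (card On) = real (card V) - 1"
        using cnt[of V] tight_V EI_V by (simp add: tight_def Int_absorb2 On_def Collect_mono)
      moreover have "real (card (On \<inter> EI U)) \<le> real (card U) - 1" "real (card (On \<inter> EI (V - U))) \<le> real (card (V - U)) - 1"
        using rank_le[of U] rank_le[of "V - U"] UV cnt by auto
      moreover have "card V = card U + card (V - U)"
        using UV finite_V by (metis card_Diff_subset card_mono finite_subset le_add_diff_inverse)
      ultimately show False by linarith
    qed
    then show "(u, v) \<in> ?R\<^sup>*" using uv by (auto simp: U_def)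
  qed
  have "\<not> has_cycle (ends ` On)"
  proof
    assume "has_cycle (ends ` On)"
    then obtain p where p: "3 \<le> length p" "distinct p"
      "\<And>j. j < length p \<Longrightarrow> {p ! j, p ! (Suc j mod length p)} \<in> ends ` On" unfolding has_cycle_def by blast
    let ?n = "length p"
    define f where "f j = {p ! j, p ! (Suc j mod ?n)}" for j
    have n0: "0 < ?n" using p(1) by linarith
    have inj: "inj_on f {..<?n}"
    proof (rule inj_onI)
      fix i j assume ij: "i \<in> {..<?n}" "j \<in> {..<?n}" "f i = f j"
      have si: "Suc i mod ?n < ?n" "Suc j mod ?n < ?n" using n0 by auto
      have eq: "p ! a = p ! b \<longleftrightarrow> a = b" if "a < ?n" "b < ?n" for a b using that p(2) by (simp add: nth_eq_iff_index_eq)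
      show "i = j"
      proof (rule ccontr)
        assume "i \<noteq> j"
        \<comment> \<open>Two positions with the same edge would be successors of each other, which
          is impossible on a cycle of length at least 3. So the cycle has as many edges as
          vertices.\<close>
        then have "i = Suc j mod ?n" "j = Suc i mod ?n"
          using ij si eq unfolding f_def doubleton_eq_iff by auto
        moreover have "Suc a mod ?n = (if Suc a = ?n then 0 else Suc a)" if "a < ?n" for a using that by auto
        ultimately show False using ij p(1) by (auto split: if_splits)
      qed
    qed
    have pV: "set p \<subseteq> V"
    proof
      fix w assume "w \<in> set p"
      then obtain j where j: "j < ?n" "w = p ! j" by (auto simp: in_set_conv_nth)
      then obtain i where "i \<in> On" "ends i = f j" using p(3)[of j] by (auto simp: f_def)
      then show "w \<in> V" using ends[of i] j by (auto simp: f_def On_def)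
    qed
    have "f ` {..<?n} \<subseteq> ends ` (On \<inter> EI (set p))"
    proof
      fix e assume "e \<in> f ` {..<?n}"
      then obtain j where j: "j < ?n" "e = f j" by auto
      then obtain i where i: "i \<in> On" "ends i = f j" using p(3)[of j] by (auto simp: f_def)
      have "f j \<subseteq> set p" using j n0 by (auto simp: f_def)
      then show "e \<in> ends ` (On \<inter> EI (set p))" using i j by (auto simp: EI_def On_def)
    qed
    then have "card (f ` {..<?n}) \<le> card (On \<inter> EI (set p))"
      by (meson card_image_le card_mono finite_Int finite_On finite_imageI le_trans)
    then have "?n \<le> card (On \<inter> EI (set p))" using card_image[OF inj] by simp
    moreover have "real (card (On \<inter> EI (set p))) \<le> real (card (set p)) - 1"
    proof -
      have "set p \<noteq> {}" using p(1) by auto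
      then show ?thesis using rank_le[OF pV] cnt by simp
    qed
    ultimately show False using distinct_card[OF p(2)] by linarith
  qed
  then show ?thesis using sub conn by (simp add: spanning_tree_def)
qed

end

section \<open>From edge indices to edge sets\<close>

lemma sum_cut_edges_image:
  assumes "indexed_graph V I ends" "inj_on ends I"
  shows "sum f (cut_edges (ends ` I) S) = (\<Sum>i\<in>indexed_graph.cutI I ends S. f (ends i))"
    "sum f (induced_edges (ends ` I) S) = (\<Sum>i\<in>indexed_graph.EI I ends S. f (ends i))"
proof -
  interpret indexed_graph V I ends by fact
  have "cut_edges (ends ` I) S = ends ` cutI S" by (auto simp: cut_edges_def cutI_def)
  moreover have "inj_on ends (cutI S)" by (rule inj_on_subset[OF assms(2)]) (auto simp: cutI_def)
  ultimately show "sum f (cut_edges (ends ` I) S) = (\<Sum>i\<in>cutI S. f (ends i))" by (simp add: sum.reindex)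
  have "induced_edges (ends ` I) S = ends ` EI S" by (auto simp: induced_edges_def EI_def)
  moreover have "inj_on ends (EI S)" by (rule inj_on_subset[OF assms(2)]) (auto simp: EI_def)
  ultimately show "sum f (induced_edges (ends ` I) S) = (\<Sum>i\<in>EI S. f (ends i))" by (simp add: sum.reindex)
qed

locale instance_relaxation =
  fixes V :: "'v set" and I :: "'i set" and ends :: "'i \<Rightarrow> 'v set" and L :: "'v set set"
    and b :: "'v set \<Rightarrow> nat" and x0 ce :: "'v set \<Rightarrow> real"
  assumes inst: "laminar_instance V (ends ` I) L b x0" and algn: "aligned (ends ` I) L x0"
    and fin: "finite I" and inj: "inj_on ends I"
begin

sublocale relaxation V I ends L "\<lambda>S. \<lceil>sum x0 (cut_edges (ends ` I) S)\<rceil>" "\<lambda>i. ce (ends i)"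
  "\<Sum>e\<in>ends ` I. ce e * x0 e"
  by unfold_locales
    (use inst fin in \<open>auto simp: laminar_instance_def ugraph_def laminar_on_def\<close>)

text \<open>Alignment enters here: it makes every set of the family tight at the start, and the
  moves keep these constraints.\<close>

lemma feas_initial: "feas (\<lambda>i. x0 (ends i))"
proof -
  note graph = indexed_graph_axioms
  have stp: "stp (\<lambda>i. x0 (ends i))"
    using inst sum_cut_edges_image(2)[OF graph inj, of x0]
    by (auto simp: laminar_instance_def spanning_tree_polytope_def stp_def sum.reindex[OF inj])
  have "tight (\<lambda>i. x0 (ends i)) S" if S: "S \<in> L" for S
  proof -
    have "x0 \<in> spanning_tree_polytope S (induced_edges (ends ` I) S)"
      using algn S by (simp add: aligned_def)
    then have s: "sum x0 (induced_edges (ends ` I) S) = real (card S) - 1"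
      by (simp add: spanning_tree_polytope_def)
    \<comment> \<open>An empty set in the family would need total value -1 on no edges, so alignment
      excludes it.\<close>
    have "induced_edges (ends ` I) {} = {}" using ends_ne by (auto simp: induced_edges_def)
    then have "S \<noteq> {}" using s by auto
    moreover have "S \<subseteq> V" using inst S by (auto simp: laminar_instance_def laminar_on_def)
    ultimately show ?thesis using s sum_cut_edges_image(2)[OF graph inj, of x0] by (simp add: tight_def)
  qed
  moreover have "(\<Sum>i\<in>cutI S. x0 (ends i)) \<le> of_int \<lceil>sum x0 (cut_edges (ends ` I) S)\<rceil>" for S
    using sum_cut_edges_image(1)[OF graph inj, of x0] by simp
  moreover have "(\<Sum>i\<in>I. ce (ends i) * x0 (ends i)) = (\<Sum>e\<in>ends ` I. ce e * x0 e)"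
    by (simp add: sum.reindex[OF inj])
  ultimately show ?thesis using stp by (simp add: feas_def)
qed

text \<open>At an integral point support and tree coincide. An inactive set has at most
  \<open>2 * k S + 1\<close> support edges by definition; an active set even has at most
  \<open>k S\<close>.\<close>

lemma thin_tree_final:
  assumes "feas x" "integral x = I"
  shows "thin_tree V (ends ` I) L x0 ce (ends ` {i \<in> I. x i = 1})"
proof -
  interpret tree_point V I ends x using feas_tree_point[OF assms(1)] .
  note graph = indexed_graph_axioms
  have int: "x i = 0 \<or> x i = 1" if "i \<in> I" for i using assms(2) that by (auto simp: integral_def)
  have On: "{i \<in> I. x i = 1} = On" by (simp add: On_def)
  have "sum ce (ends ` On) = (\<Sum>i\<in>On. ce (ends i))"
    by (rule sum.reindex[unfolded o_def]) (rule inj_on_subset[OF inj], auto simp: On_def)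
  also have "\<dots> = (\<Sum>i\<in>I. ce (ends i) * x i)"
    by (rule sum.mono_neutral_cong_left) (use int finite_I in \<open>auto simp: On_def\<close>)
  also have "\<dots> \<le> (\<Sum>e\<in>ends ` I. ce e * x0 e)" using assms(1) by (simp add: feas_def)
  finally have cost: "sum ce (ends ` On) \<le> (\<Sum>e\<in>ends ` I. ce e * x0 e)" .
  have deg: "int (card (ends ` On \<inter> cut_edges (ends ` I) S)) \<le> 2 * \<lceil>sum x0 (cut_edges (ends ` I) S)\<rceil> + 1" if S: "S \<in> L" for S
  proof -
    have "ends ` On \<inter> cut_edges (ends ` I) S = ends ` (On \<inter> cutI S)"
      using inj by (auto simp: cut_edges_def cutI_def On_def inj_on_def image_iff)
    then have "card (ends ` On \<inter> cut_edges (ends ` I) S) = card (On \<inter> cutI S)"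
      by (simp add: card_image inj_on_subset[OF inj] On_def Collect_mono subset_iff)
    moreover have supp: "{i \<in> cutI S. 0 < x i} = On \<inter> cutI S"
      using int by (force simp: On_def cutI_def)
    moreover have "int (card (On \<inter> cutI S)) \<le> 2 * \<lceil>sum x0 (cut_edges (ends ` I) S)\<rceil> + 1"
    proof (cases "act x S")
      case True
      then have "sum x (cutI S) \<le> of_int \<lceil>sum x0 (cut_edges (ends ` I) S)\<rceil>" using assms(1) S by (auto simp: feas_def)
      moreover have "sum x (cutI S) = real (card (On \<inter> cutI S))"
      proof -
        have "Fr = {}" using int by (force simp: Fr_def)
        then show ?thesis using sum_Fr_On[of "cutI S"] by (simp add: cutI_def Collect_mono)
      qed
      ultimately have "int (card (On \<inter> cutI S)) \<le> \<lceil>sum x0 (cut_edges (ends ` I) S)\<rceil>" by linarith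
      then show ?thesis by linarith
    next
      case False
      then show ?thesis using supp by (simp add: act_def)
    qed
    ultimately show ?thesis by simp
  qed
  show ?thesis unfolding thin_tree_def On
    using integral_spanning_tree[OF int inj] cost deg by (auto intro: order_trans)
      (smt (verit) of_int_ceiling_le_add_one)+
qed

end

lemma thin_tree_exists:
  assumes "laminar_instance V E L b x" "aligned E L x"
  shows "\<exists>T. thin_tree V E L x c T"
proof -
  have "finite E" using assms(1) by (auto simp: laminar_instance_def ugraph_def intro: finite_subset[of E "Pow V"])
  then interpret instance_relaxation V E "\<lambda>e. e" L b x c
    by unfold_locales (use assms in auto)
  obtain y where y: "feas y" "integral y = E" using exists_integral[OF feas_initial] by blast
  have "thin_tree V E L x c {i \<in> E. y i = 1}" using thin_tree_final[OF y] by simp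
  then show ?thesis by blast
qed

section \<open>Kernel vectors of 0/1 matrices\<close>

definition dot :: "int list \<Rightarrow> int list \<Rightarrow> int" where
  "dot u v = sum_list (map (\<lambda>p. fst p * snd p) (zip u v))"

definition comb :: "int \<Rightarrow> int list \<Rightarrow> int \<Rightarrow> int list \<Rightarrow> int list" where
  "comb a u b v = map (\<lambda>p. a * fst p + b * snd p) (zip u v)"

lemma dot_sum: "length u = m \<Longrightarrow> length v = m \<Longrightarrow> dot u v = (\<Sum>i<m. u ! i * v ! i)"
  by (simp add: dot_def sum_list_sum_nth atLeast0LessThan)

lemma length_comb [simp]: "length (comb a u b v) = min (length u) (length v)"
  by (simp add: comb_def)

lemma comb_nth: "i < length u \<Longrightarrow> i < length v \<Longrightarrow> comb a u b v ! i = a * u ! i + b * v ! i"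
  by (simp add: comb_def)

lemma dot_comb:
  assumes "length r = m" "length u = m" "length v = m"
  shows "dot r (comb a u b v) = a * dot r u + b * dot r v"
  using assms by (simp add: dot_sum[of _ m] comb_nth algebra_simps sum.distrib sum_distrib_left)

text \<open>Removing the common divisor after every combination prevents the growth of entries in
  the elimination: a primitive vector can be compared with a small solution.\<close>

definition prim :: "int list \<Rightarrow> int list" where
  "prim v = map (\<lambda>a. a div gcds v) v"

text \<open>Turns any list into a 0/1 row of the right length, so that the running time is
  polynomial on every input; proper rows are unchanged.\<close>

definition clean :: "(nat \<times> nat) list \<Rightarrow> int list \<Rightarrow> int list" where
  "clean ps r = map (\<lambda>i. if nth0 r i = 0 then 0 else 1) [0..<length ps]"

definition unit :: "(nat \<times> nat) list \<Rightarrow> nat \<Rightarrow> int list" where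
  "unit ps j = map (\<lambda>i. if i = j then 1 else 0) [0..<length ps]"

text \<open>Restricts the spanned space to the vectors orthogonal to \<open>r\<close>: one
  nonorthogonal vector \<open>q\<close> is the pivot and disappears, the others are corrected by
  it.\<close>

definition elim_row :: "(nat \<times> int list) list \<Rightarrow> int list \<Rightarrow> (nat \<times> int list) list" where
  "elim_row B r = (case filter (\<lambda>p. dot r (snd p) \<noteq> 0) B of [] \<Rightarrow> B
     | q # qs \<Rightarrow> filter (\<lambda>p. dot r (snd p) = 0) B @
         map (\<lambda>p. (fst p, prim (comb (dot r (snd q)) (snd p) (- dot r (snd p)) (snd q)))) qs)"

definition kernel_basis :: "(nat \<times> nat) list \<Rightarrow> int list list \<Rightarrow> (nat \<times> int list) list" where
  "kernel_basis ps rs = foldl (\<lambda>B r. elim_row B (clean ps r)) (map (\<lambda>j. (j, unit ps j)) [0..<length ps]) rs"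

section \<open>Primitive vectors and the invariant of the elimination\<close>

definition row01 :: "nat \<Rightarrow> int list \<Rightarrow> bool" where
  "row01 m r \<longleftrightarrow> length r = m \<and> set r \<subseteq> {0, 1}"

lemma row01_nth: "row01 m r \<Longrightarrow> i < m \<Longrightarrow> r ! i \<in> {0, 1}"
  unfolding row01_def using nth_mem by blast

lemma row01_clean: "row01 (length ps) (clean ps r)"
  by (auto simp: row01_def clean_def)

lemma clean_row01: "row01 (length ps) r \<Longrightarrow> clean ps r = r"
proof (rule nth_equalityI)
  fix i assume r: "row01 (length ps) r" and "i < length (clean ps r)"
  then have i: "i < length ps" by (simp add: clean_def)
  then show "clean ps r ! i = r ! i"
    using r row01_nth[OF r i] by (auto simp: clean_def nth0_eq row01_def)
qed (auto simp: clean_def row01_def)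

lemma row01_unit: "row01 (length ps) (unit ps j)"
  by (auto simp: row01_def unit_def)

lemma dot_unit: "length v = length ps \<Longrightarrow> j < length ps \<Longrightarrow> dot (unit ps j) v = v ! j"
  by (simp add: dot_sum[of _ "length ps"] unit_def if_distrib[of "\<lambda>a. a * _"] cong: if_cong)

lemma gcds_nonneg: "0 \<le> gcds v"
proof -
  have "0 \<le> s \<Longrightarrow> 0 \<le> foldl gcd s v" for s :: int by (induction v arbitrary: s) auto
  then show ?thesis by (simp add: gcds_def)
qed

lemma gcds_pos: "x \<in> set v \<Longrightarrow> x \<noteq> 0 \<Longrightarrow> 0 < gcds v"
  using gcds_dvd[of x v] gcds_nonneg[of v] by (cases "gcds v = 0") auto

lemma prim_nth: "i < length v \<Longrightarrow> prim v ! i * gcds v = v ! i"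
  using gcds_dvd[of "v ! i" v] by (simp add: prim_def)

lemma length_prim [simp]: "length (prim v) = length v"
  by (simp add: prim_def)

lemma gcds_prim: assumes "x \<in> set v" "x \<noteq> 0" shows "gcds (prim v) = 1"
proof -
  let ?g = "gcds v" let ?c = "gcds (prim v)"
  have g: "0 < ?g" using gcds_pos[OF assms] .
  have "?g * ?c dvd ?g"
  proof (rule dvd_gcds)
    fix y assume y: "y \<in> set v"
    then have "y div ?g \<in> set (prim v)" by (auto simp: prim_def)
    then have "?c dvd y div ?g" by (rule gcds_dvd)
    then have "?g * ?c dvd ?g * (y div ?g)" by (intro mult_dvd_mono) auto
    then show "?g * ?c dvd y" using gcds_dvd[OF y] by simp
  qed
  then have "?c dvd 1" using g by (simp add: dvd_mult_cancel_left)
  then show ?thesis using gcds_nonneg[of "prim v"] by simp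
qed

text \<open>The greatest common divisor is an integral combination of the entries, by
  Bezout.\<close>

lemma dvd_mult_gcds:
  assumes "\<And>x. x \<in> set v \<Longrightarrow> c dvd k * x" shows "c dvd k * gcds v"
proof -
  have "c dvd k * s \<Longrightarrow> (\<And>x. x \<in> set v \<Longrightarrow> c dvd k * x) \<Longrightarrow> c dvd k * foldl gcd s v" for s :: int
  proof (induction v arbitrary: s)
    case (Cons a v)
    obtain p q where "p * s + q * a = gcd s a" using bezout_int by blast
    then have "k * gcd s a = p * (k * s) + q * (k * a)" by (metis distrib_left mult.left_commute)
    then have "c dvd k * gcd s a" using Cons.prems by auto
    then show ?case using Cons by simp
  qed simp
  from this[of 0] assms show ?thesis by (simp add: gcds_def)
qed

text \<open>The vector \<open>snd p\<close> has its own coordinate \<open>fst p\<close>, at which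
  the other basis vectors vanish. The list \<open>us\<close> collects one row for each pivot
  removed. Orthogonality to \<open>us\<close> together with zeros at all own coordinates forces the
  zero vector, so a vector in the kernel of \<open>us\<close> is determined by its own coordinates,
  and an empty basis means a trivial kernel.\<close>

definition kinv :: "nat \<Rightarrow> int list list \<Rightarrow> (nat \<times> int list) list \<Rightarrow> bool" where
  "kinv m rs B \<longleftrightarrow> distinct (map fst B) \<and>
    (\<forall>p\<in>set B. fst p < m \<and> length (snd p) = m \<and> snd p ! fst p \<noteq> 0 \<and> gcds (snd p) = 1 \<and>
       (\<forall>q\<in>set B. q \<noteq> p \<longrightarrow> snd q ! fst p = 0)) \<and>
    (\<forall>r\<in>set rs. row01 m r \<and> (\<forall>p\<in>set B. dot r (snd p) = 0)) \<and>
    (\<exists>us. length us + length B = m \<and> set us \<subseteq> set rs \<and> (\<forall>u\<in>set us. row01 m u) \<and>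
      (\<forall>d. length d = m \<longrightarrow> (\<forall>u\<in>set us. dot u d = 0) \<longrightarrow> (\<forall>p\<in>set B. d ! fst p = 0) \<longrightarrow> (\<forall>i<m. d ! i = 0)))"

lemma kinv_units: "kinv (length ps) [] (map (\<lambda>j. (j, unit ps j)) [0..<length ps])"
proof -
  have g: "gcds (unit ps j) = 1" if "j < length ps" for j
  proof -
    have "gcds (unit ps j) dvd 1" using that by (intro gcds_dvd) (auto simp: unit_def)
    then show ?thesis using gcds_nonneg[of "unit ps j"] by simp
  qed
  show ?thesis unfolding kinv_def
    by (intro conjI exI[of _ "[]"]) (auto simp: unit_def comp_def g[unfolded unit_def])
qed

text \<open>The pivot vanishes at the own coordinates of the other vectors, so subtracting multiples
  of it keeps these coordinates private. The row \<open>r\<close> joins \<open>us\<close> exactly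
  when a pivot is removed.\<close>

lemma kinv_elim:
  assumes K: "kinv m rs B" and r: "row01 m r"
  shows "kinv m (r # rs) (elim_row B r)"
proof -
  let ?nz = "filter (\<lambda>p. dot r (snd p) \<noteq> 0) B" let ?z = "filter (\<lambda>p. dot r (snd p) = 0) B"
  from K have dist: "distinct (map fst B)"
    and B: "\<And>p. p \<in> set B \<Longrightarrow> fst p < m" "\<And>p. p \<in> set B \<Longrightarrow> length (snd p) = m"
      "\<And>p. p \<in> set B \<Longrightarrow> snd p ! fst p \<noteq> 0" "\<And>p. p \<in> set B \<Longrightarrow> gcds (snd p) = 1"
      "\<And>p q. p \<in> set B \<Longrightarrow> q \<in> set B \<Longrightarrow> q \<noteq> p \<Longrightarrow> snd q ! fst p = 0"
    and rs: "\<And>s p. s \<in> set rs \<Longrightarrow> p \<in> set B \<Longrightarrow> dot s (snd p) = 0"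
    and rs01: "\<And>s. s \<in> set rs \<Longrightarrow> row01 m s" by (auto simp: kinv_def)
  from K obtain us where us: "length us + length B = m" "set us \<subseteq> set rs" "\<And>u. u \<in> set us \<Longrightarrow> row01 m u"
      "\<And>d. length d = m \<Longrightarrow> (\<And>u. u \<in> set us \<Longrightarrow> dot u d = 0) \<Longrightarrow> (\<And>p. p \<in> set B \<Longrightarrow> d ! fst p = 0) \<Longrightarrow> (\<forall>i<m. d ! i = 0)"
    unfolding kinv_def by metis
  have lr: "length r = m" using r by (simp add: row01_def)
  show ?thesis
  proof (cases ?nz)
    case Nil
    then have "\<forall>p\<in>set B. dot r (snd p) = 0" by (simp add: filter_empty_conv)
    moreover have "elim_row B r = B" using Nil by (simp add: elim_row_def)
    moreover have "\<exists>us'. length us' + length B = m \<and> set us' \<subseteq> set (r # rs) \<and> (\<forall>u\<in>set us'. row01 m u) \<and>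
        (\<forall>d. length d = m \<longrightarrow> (\<forall>u\<in>set us'. dot u d = 0) \<longrightarrow> (\<forall>p\<in>set B. d ! fst p = 0) \<longrightarrow> (\<forall>i<m. d ! i = 0))"
      using us(1,2,3) us(4) by (intro exI[of _ us]) (simp add: subset_insertI2)
    ultimately show ?thesis using dist B rs rs01 r unfolding kinv_def by simp
  next
    case (Cons q qs)
    define \<alpha> where "\<alpha> = dot r (snd q)"
    define raw where "raw p = comb \<alpha> (snd p) (- dot r (snd p)) (snd q)" for p :: "nat \<times> int list"
    define new where "new p = (fst p, prim (raw p))" for p
    have B': "elim_row B r = ?z @ map new qs"
      using Cons by (simp add: elim_row_def new_def raw_def \<alpha>_def)
    have q: "q \<in> set B" "\<alpha> \<noteq> 0" using Cons by (auto simp: \<alpha>_def filter_eq_Cons_iff)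
    have qs: "\<And>p. p \<in> set qs \<Longrightarrow> p \<in> set B" "\<And>p. p \<in> set qs \<Longrightarrow> dot r (snd p) \<noteq> 0"
    proof -
      have "set (q # qs) = {p \<in> set B. dot r (snd p) \<noteq> 0}" using Cons by (metis set_filter)
      then show "\<And>p. p \<in> set qs \<Longrightarrow> p \<in> set B" "\<And>p. p \<in> set qs \<Longrightarrow> dot r (snd p) \<noteq> 0" by auto
    qed
    have dnz: "distinct (map fst ?nz)" "distinct (map fst ?z)"
      using dist by (auto intro: distinct_map_filter)
    have fst_inj: "\<And>p p'. p \<in> set B \<Longrightarrow> p' \<in> set B \<Longrightarrow> fst p = fst p' \<Longrightarrow> p = p'"
      using dist by (metis distinct_map inj_onD)
    have qne: "p \<noteq> q" if "p \<in> set qs" for p using dnz(1) Cons that by auto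
    have rawl: "length (raw p) = m" if "p \<in> set B" for p using B(2)[OF that] B(2)[OF q(1)] by (simp add: raw_def)
    have rawn: "raw p ! i = \<alpha> * snd p ! i - dot r (snd p) * snd q ! i" if "p \<in> set B" "i < m" for p i
      using B(2)[OF that(1)] B(2)[OF q(1)] that by (simp add: raw_def comb_nth)
    have own: "raw p ! fst p \<noteq> 0" if "p \<in> set qs" for p
      using rawn[OF qs(1)[OF that] B(1)[OF qs(1)[OF that]]] B(3)[OF qs(1)[OF that]] q(2)
        B(5)[OF qs(1)[OF that] q(1)] qne[OF that] by auto
    have g: "gcds (raw p) \<noteq> 0" "gcds (prim (raw p)) = 1" if "p \<in> set qs" for p
    proof -
      have "raw p ! fst p \<in> set (raw p)" using rawl[OF qs(1)[OF that]] B(1)[OF qs(1)[OF that]] by simp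
      from gcds_pos[OF this own[OF that]] gcds_prim[OF this own[OF that]]
      show "gcds (raw p) \<noteq> 0" "gcds (prim (raw p)) = 1" by simp_all
    qed
    have newn: "snd (new p) ! i * gcds (raw p) = raw p ! i" if "p \<in> set qs" "i < m" for p i
      using prim_nth[of i "raw p"] rawl[OF qs(1)[OF that(1)]] that by (simp add: new_def)
    have new0: "snd (new p) ! i = 0 \<longleftrightarrow> raw p ! i = 0" if "p \<in> set qs" "i < m" for p i
      using newn[OF that] g(1)[OF that(1)] by auto
    have dnew: "dot s (snd (new p)) = 0 \<longleftrightarrow> dot s (raw p) = 0" if "p \<in> set qs" "length s = m" for p s
    proof -
      have "dot s (raw p) = dot s (snd (new p)) * gcds (raw p)"
        using newn[OF that(1)] rawl[OF qs(1)[OF that(1)]] that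
        by (simp add: dot_sum[of _ m] new_def sum_distrib_right mult.assoc)
      then show ?thesis using g(1)[OF that(1)] by auto
    qed
    have draw: "dot s (raw p) = \<alpha> * dot s (snd p) - dot r (snd p) * dot s (snd q)" if "p \<in> set B" "length s = m" for p s
      using dot_comb[OF that(2) B(2)[OF that(1)] B(2)[OF q(1)]] by (simp add: raw_def)
    have mem: "p \<in> set (elim_row B r) \<longleftrightarrow> (p \<in> set B \<and> dot r (snd p) = 0) \<or> (\<exists>p'\<in>set qs. p = new p')" for p
      unfolding B' by auto
    have off: "raw p ! fst p' = 0" if "p \<in> set qs" "p' \<in> set B" "p' \<noteq> p" "p' \<noteq> q" for p p'
      using rawn[OF qs(1)[OF that(1)] B(1)[OF that(2)]] B(5)[OF that(2) qs(1)[OF that(1)]] B(5)[OF that(2) q(1)] that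
      by simp
    have dist': "distinct (map fst (elim_row B r))"
    proof -
      have "map fst (map new qs) = map fst qs" by (simp add: new_def)
      moreover have "distinct (map fst qs)" using dnz(1) Cons by simp
      moreover have "set (map fst ?z) \<inter> set (map fst qs) = {}"
      proof -
        have False if "p \<in> set ?z" "p' \<in> set qs" "fst p = fst p'" for p p'
          using fst_inj[of p p'] qs[of p'] that by auto
        then show ?thesis by force
      qed
      ultimately show ?thesis unfolding B' using dnz(2) by (simp only: map_append distinct_append)
    qed
    have each: "fst p < m \<and> length (snd p) = m \<and> snd p ! fst p \<noteq> 0 \<and> gcds (snd p) = 1 \<and>
       (\<forall>p'\<in>set (elim_row B r). p' \<noteq> p \<longrightarrow> snd p' ! fst p = 0)" if p: "p \<in> set (elim_row B r)" for p
    proof -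
      obtain b where b: "b \<in> set B" "fst b = fst p" "b \<noteq> q" "p = b \<and> dot r (snd b) = 0 \<or> b \<in> set qs \<and> p = new b"
      proof -
        from p consider "p \<in> set B" "dot r (snd p) = 0" | b where "b \<in> set qs" "p = new b" unfolding mem by blast
        then show thesis
        proof cases
          case 1
          then show thesis using q by (intro that[of p]) (auto simp: \<alpha>_def)
        next
          case (2 b)
          then show thesis using qs(1)[of b] qne[of b] by (intro that[of b]) (auto simp: new_def)
        qed
      qed
      have oth: "snd p' ! fst p = 0" if p': "p' \<in> set (elim_row B r)" "p' \<noteq> p" for p'
      proof -
        from p'(1) consider "p' \<in> set B" "dot r (snd p') = 0" | b' where "b' \<in> set qs" "p' = new b'" unfolding mem by auto
        then show ?thesis
        proof cases
          case 1
          have "p' \<noteq> b" using b(4) p'(2) 1 qs(2)[of b] by auto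
          then show ?thesis using B(5)[OF b(1) 1(1)] b(2) by simp
        next
          case 2
          have "b' \<noteq> b" using b(4) p'(2) 2 qs(2)[of b'] by auto
          then have "raw b' ! fst b = 0" using off[OF 2(1) b(1)] b(3) by auto
          then show ?thesis using new0[OF 2(1) B(1)[OF b(1)]] 2 b(2) by simp
        qed
      qed
      have "fst p < m \<and> length (snd p) = m \<and> snd p ! fst p \<noteq> 0 \<and> gcds (snd p) = 1"
        using b(4)
      proof
        assume "b \<in> set qs \<and> p = new b"
        then show ?thesis using B(1)[OF b(1)] rawl[OF b(1)] own g new0 by (auto simp: new_def)
      qed (use B b in auto)
      then show ?thesis using oth by blast
    qed
    have rows: "dot s (snd p) = 0" if "s \<in> set (r # rs)" "p \<in> set (elim_row B r)" for s p
    proof -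
      have ls: "length s = m" using that(1) lr rs01 by (auto simp: row01_def)
      have ss: "s = r \<or> (\<forall>p\<in>set B. dot s (snd p) = 0)" using that(1) rs by auto
      from that(2) consider "p \<in> set B" "dot r (snd p) = 0" | b where "b \<in> set qs" "p = new b" unfolding mem by auto
      then show ?thesis
      proof cases
        case 2
        then show ?thesis using dnew[OF 2(1) ls] draw[OF qs(1)[OF 2(1)] ls] ss qs(1)[OF 2(1)] q(1) by (auto simp: \<alpha>_def)
      qed (use ss in auto)
    qed
    have len: "length (r # us) + length (elim_row B r) = m"
    proof -
      have "length ?z + length ?nz = length B" using sum_length_filter_compl[of "\<lambda>p. dot r (snd p) = 0" B] by simp
      then show ?thesis using Cons us(1) by (simp add: B')
    qed
    have comp: "\<forall>i<m. d ! i = 0" if d: "length d = m" "\<And>u. u \<in> set (r # us) \<Longrightarrow> dot u d = 0"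
      "\<And>p. p \<in> set (elim_row B r) \<Longrightarrow> d ! fst p = 0" for d
    proof -
      \<comment> \<open>The coordinate of the pivot is cleared, so the old invariant makes
        \<open>?e\<close> zero and \<open>d\<close> proportional to \<open>snd q\<close>. As
        \<open>r\<close> is orthogonal to \<open>d\<close> but not to \<open>snd q\<close>, the
        factor is 0.\<close>
      let ?e = "comb (snd q ! fst q) d (- d ! fst q) (snd q)"
      have lq: "length (snd q) = m" using B(2)[OF q(1)] .
      have "\<forall>i<m. ?e ! i = 0"
      proof (rule us(4))
        show "length ?e = m" using d(1) lq by simp
        show "dot u ?e = 0" if "u \<in> set us" for u
          using dot_comb[of u m d "snd q"] us(3)[OF that] d lq that rs[of u q] us(2) q(1) by (auto simp: row01_def)
        show "?e ! fst p = 0" if p: "p \<in> set B" for p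
        proof (cases "p = q")
          case True
          then show ?thesis using B(1)[OF p] d(1) lq by (simp add: comb_nth)
        next
          case False
          have "\<exists>p'\<in>set (elim_row B r). fst p' = fst p"
          proof (cases "dot r (snd p) = 0")
            case True
            then show ?thesis using p by (intro bexI[of _ p]) (auto simp: mem)
          next
            case nz: False
            then have "p \<in> set ?nz" using p by simp
            then have "p \<in> set qs" using Cons False by simp
            then show ?thesis by (intro bexI[of _ "new p"]) (auto simp: mem, simp add: new_def)
          qed
          then have "d ! fst p = 0" using d(3) by force
          moreover have "snd q ! fst p = 0" using B(5)[OF p q(1)] False by auto
          ultimately show ?thesis using B(1)[OF p] d(1) lq by (simp add: comb_nth)
        qed
      qed
      then have e: "snd q ! fst q * d ! i = d ! fst q * snd q ! i" if "i < m" for i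
        using that d(1) lq by (simp add: comb_nth)
      have "snd q ! fst q * dot r d = d ! fst q * dot r (snd q)"
        using e lr d(1) lq by (simp add: dot_sum[of _ m] sum_distrib_left mult.left_commute)
      then have "d ! fst q = 0" using d(2)[of r] q(2) by (simp add: \<alpha>_def)
      then show ?thesis using e B(3)[OF q(1)] by auto
    qed
    show ?thesis unfolding kinv_def
    proof (intro conjI)
      show "\<exists>us'. length us' + length (elim_row B r) = m \<and> set us' \<subseteq> set (r # rs) \<and> (\<forall>u\<in>set us'. row01 m u) \<and>
        (\<forall>d. length d = m \<longrightarrow> (\<forall>u\<in>set us'. dot u d = 0) \<longrightarrow> (\<forall>p\<in>set (elim_row B r). d ! fst p = 0) \<longrightarrow> (\<forall>i<m. d ! i = 0))"
      proof (intro exI[of _ "r # us"] conjI allI impI)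
        fix d i assume "length d = m" "\<forall>u\<in>set (r # us). dot u d = 0" "\<forall>p\<in>set (elim_row B r). d ! fst p = 0" "i < m"
        then show "d ! i = 0" using comp[of d] by auto
      qed (use len us(2,3) r in auto)
      show "\<forall>s\<in>set (r # rs). row01 m s \<and> (\<forall>p\<in>set (elim_row B r). dot s (snd p) = 0)"
        using rows r rs01 by auto
    qed (use dist' each in auto)
  qed
qed

lemma kinv_kernel: "kinv (length ps) (rev (map (clean ps) rs)) (kernel_basis ps rs)"
proof (induction rs rule: rev_induct)
  case Nil
  then show ?case using kinv_units by (simp add: kernel_basis_def)
next
  case (snoc r rs)
  then show ?case using kinv_elim[OF snoc row01_clean] by (simp add: kernel_basis_def)
qed

text \<open>The vector is supported on \<open>Q\<close>, its own coordinate and the coordinates that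
  belong to no basis vector, one more than there are rows in \<open>us\<close>. Siegel's lemma gives
  a small kernel vector on \<open>Q\<close>. The kernel there is a line, and since
  \<open>snd p\<close> is primitive, the small vector is a nonzero integral multiple of it.\<close>

lemma kinv_bound:
  assumes K: "kinv m rs B" and p: "p \<in> set B" and i: "i < m"
  shows "\<bar>snd p ! i\<bar> \<le> int (Suc m ^ m)"
proof -
  from K obtain us where us: "length us + length B = m" "set us \<subseteq> set rs" "\<And>u. u \<in> set us \<Longrightarrow> row01 m u"
      "\<And>d. length d = m \<Longrightarrow> (\<And>u. u \<in> set us \<Longrightarrow> dot u d = 0) \<Longrightarrow> (\<And>p. p \<in> set B \<Longrightarrow> d ! fst p = 0) \<Longrightarrow> (\<forall>i<m. d ! i = 0)"
    unfolding kinv_def by metis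
  have B: "distinct (map fst B)" "\<And>p. p \<in> set B \<Longrightarrow> fst p < m" "length (snd p) = m" "snd p ! fst p \<noteq> 0"
    "gcds (snd p) = 1" "\<And>q. q \<in> set B \<Longrightarrow> q \<noteq> p \<Longrightarrow> snd p ! fst q = 0" "\<And>u. u \<in> set us \<Longrightarrow> dot u (snd p) = 0"
    using K p us(2) unfolding kinv_def by (auto 4 3)
  let ?v = "snd p" let ?j = "fst p"
  define Q where "Q = insert ?j ({..<m} - fst ` set B)"
  have cQ: "card Q = Suc (length us)"
  proof -
    have "card (fst ` set B) = length B" using B(1) by (metis distinct_card length_map list.set_map)
    moreover have "fst ` set B \<subseteq> {..<m}" using B(2) by auto
    ultimately have "card ({..<m} - fst ` set B) = m - length B" by (simp add: card_Diff_subset)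
    then show ?thesis using us(1) p by (simp add: Q_def)
  qed
  have Qm: "Q \<subseteq> {..<m}" using B(2)[OF p] by (auto simp: Q_def)
  define a :: "nat \<Rightarrow> nat \<Rightarrow> int" where "a r q = (if r < length us \<and> q < m then us ! r ! q else 0)" for r q
  have "a r q \<in> {0, 1}" for r q using row01_nth[OF us(3)[OF nth_mem]] by (auto simp: a_def)
  note a01 = this
  have cQ': "card Q = Suc (card {..<length us})" using cQ by simp
  have finQ: "finite Q" using Qm finite_subset by blast
  obtain d :: "nat \<Rightarrow> int" where d': "\<exists>q\<in>Q. d q \<noteq> 0" "\<And>q. q \<notin> Q \<Longrightarrow> d q = 0"
    "\<And>q. \<bar>d q\<bar> \<le> int (Suc (card {..<length us}) ^ card {..<length us})"
    "\<And>r. r \<in> {..<length us} \<Longrightarrow> (\<Sum>q\<in>Q. a r q * d q) = 0"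
    using a01 by (rule siegel[where a = a, OF finite_lessThan finQ cQ']) blast
  have d: "\<exists>q\<in>Q. d q \<noteq> 0" "\<And>q. q \<notin> Q \<Longrightarrow> d q = 0"
    "\<And>q. \<bar>d q\<bar> \<le> int (Suc (length us) ^ length us)" "\<And>r. r < length us \<Longrightarrow> (\<Sum>q\<in>Q. a r q * d q) = 0"
    using d' by simp_all
  define D where "D = map d [0..<m]"
  have Dl: "length D = m" "\<And>i. i < m \<Longrightarrow> D ! i = d i" by (auto simp: D_def)
  have dotD: "dot u D = 0" if u: "u \<in> set us" for u
  proof -
    obtain r where r: "r < length us" "u = us ! r" using u by (metis in_set_conv_nth)
    have "dot u D = (\<Sum>q<m. a r q * d q)" using r Dl us(3)[OF u] by (simp add: dot_sum[of _ m] row01_def a_def)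
    also have "\<dots> = (\<Sum>q\<in>Q. a r q * d q)" by (rule sum.mono_neutral_right) (use Qm d(2) in auto)
    finally show ?thesis using d(4)[OF r(1)] by simp
  qed
  let ?e = "comb (?v ! ?j) D (- d ?j) ?v"
  have "\<forall>i<m. ?e ! i = 0"
  proof (rule us(4))
    show "length ?e = m" using Dl B(3) by simp
    show "dot u ?e = 0" if "u \<in> set us" for u
      using dot_comb[of u m D ?v] us(3)[OF that] Dl B(3) B(7)[OF that] dotD[OF that] by (simp add: row01_def)
    show "?e ! fst q = 0" if q: "q \<in> set B" for q
    proof (cases "q = p")
      case True
      then show ?thesis using B(2)[OF p] Dl B(3) by (simp add: comb_nth)
    next
      case False
      then have "fst q \<noteq> ?j" using B(1) p q by (metis distinct_map inj_onD)
      then have "d (fst q) = 0" using q by (intro d(2)) (auto simp: Q_def)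
      then show ?thesis using B(2)[OF q] Dl B(3) B(6)[OF q False] by (simp add: comb_nth)
    qed
  qed
  then have e: "?v ! ?j * d i = d ?j * ?v ! i" if "i < m" for i using that Dl B(3) by (simp add: comb_nth)
  have "?v ! ?j dvd d ?j * gcds ?v"
  proof (rule dvd_mult_gcds)
    fix y assume "y \<in> set ?v"
    then obtain i where "i < m" "y = ?v ! i" using B(3) by (auto simp: in_set_conv_nth)
    then show "?v ! ?j dvd d ?j * y" using e[of i] by (metis dvd_triv_left)
  qed
  then obtain s where s: "d ?j = ?v ! ?j * s" using B(5) by (auto elim: dvdE)
  have ds: "d i = s * ?v ! i" if "i < m" for i using e[OF that] s B(4) by auto
  then have "s \<noteq> 0" using d(1) Qm by auto
  then have "1 \<le> \<bar>s\<bar>" by linarith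
  then have "\<bar>?v ! i\<bar> \<le> \<bar>s\<bar> * \<bar>?v ! i\<bar>" using mult_right_mono[of 1 "\<bar>s\<bar>" "\<bar>?v ! i\<bar>"] by simp
  also have "\<dots> = \<bar>d i\<bar>" using ds[OF i] by (simp add: abs_mult)
  also have "\<dots> \<le> int (Suc (length us) ^ length us)" by (rule d(3))
  also have "\<dots> \<le> int (Suc m ^ m)"
  proof -
    have "Suc (length us) ^ length us \<le> Suc m ^ length us" using us(1) by (intro power_mono) auto
    also have "\<dots> \<le> Suc m ^ m" using us(1) by (intro power_increasing) auto
    finally show ?thesis by linarith
  qed
  finally show ?thesis .
qed

lemma kernel_rows:
  assumes "p \<in> set (kernel_basis ps rs)" "\<And>r. r \<in> set rs \<Longrightarrow> row01 (length ps) r"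
  shows "length (snd p) = length ps" "\<exists>i<length ps. snd p ! i \<noteq> 0" "\<And>r. r \<in> set rs \<Longrightarrow> dot r (snd p) = 0"
    "\<And>i. i < length ps \<Longrightarrow> \<bar>snd p ! i\<bar> \<le> int (Suc (length ps) ^ length ps)"
proof -
  have c: "map (clean ps) rs = rs" using assms(2) by (intro map_idI clean_row01) auto
  have K: "kinv (length ps) (rev rs) (kernel_basis ps rs)" using kinv_kernel[of ps rs] c by simp
  show "length (snd p) = length ps" "\<exists>i<length ps. snd p ! i \<noteq> 0" "\<And>r. r \<in> set rs \<Longrightarrow> dot r (snd p) = 0"
    using K assms(1) by (auto simp: kinv_def)
  show "\<And>i. i < length ps \<Longrightarrow> \<bar>snd p ! i\<bar> \<le> int (Suc (length ps) ^ length ps)"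
    by (rule kinv_bound[OF K assms(1)])
qed

lemma kernel_Nil:
  assumes "kernel_basis ps rs = []" "\<And>r. r \<in> set rs \<Longrightarrow> row01 (length ps) r"
    "length d = length ps" "\<And>r. r \<in> set rs \<Longrightarrow> dot r d = 0"
  shows "\<forall>i<length ps. d ! i = 0"
proof -
  have c: "map (clean ps) rs = rs" using assms(2) by (intro map_idI clean_row01) auto
  have K: "kinv (length ps) (rev rs) (kernel_basis ps rs)" using kinv_kernel[of ps rs] c by simp
  then obtain us where us: "set us \<subseteq> set rs" "\<And>d. length d = length ps \<Longrightarrow> (\<forall>u\<in>set us. dot u d = 0) \<Longrightarrow> \<forall>i<length ps. d ! i = 0"
    using assms(1) unfolding kinv_def by auto
  show ?thesis using us assms(3,4) by blast
qed

section \<open>Running time of the elimination\<close>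

lemma pt_dot [pt]: "pt f \<Longrightarrow> pt g \<Longrightarrow> pt (\<lambda>a. dot (f a) (g a))"
  by (rule pt_app2[of dot]; assumption?) (unfold dot_def, intro pt)

lemma pt_comb [pt]: "pt f \<Longrightarrow> pt g \<Longrightarrow> pt h \<Longrightarrow> pt k \<Longrightarrow> pt (\<lambda>a. comb (f a) (g a) (h a) (k a))"
  by (rule pt_app4[of comb]; assumption?) (unfold comb_def, intro pt)

lemma pt_prim [pt]: "pt f \<Longrightarrow> pt (\<lambda>a. prim (f a))"
  by (rule pt_comp[of prim]; assumption?) (unfold prim_def, intro pt)

lemma pt_clean [pt]: "pt f \<Longrightarrow> pt g \<Longrightarrow> pt (\<lambda>a. clean (f a) (g a))"
  by (rule pt_app2[of clean]; assumption?) (unfold clean_def, intro pt)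

lemma pt_unit [pt]: "pt f \<Longrightarrow> pt g \<Longrightarrow> pt (\<lambda>a. unit (f a) (g a))"
  by (rule pt_app2[of unit]; assumption?) (unfold unit_def, intro pt)

lemma pt_elim_row [pt]: "pt f \<Longrightarrow> pt g \<Longrightarrow> pt (\<lambda>a. elim_row (f a) (g a))"
  by (rule pt_app2[of elim_row]; assumption?) (unfold elim_row_def, intro pt)

lemma bit_length_power_le: "bit_length (int (Suc m ^ m)) \<le> m * Suc m + 1"
proof -
  have "Suc m < 2 ^ Suc m" by (rule less_exp)
  then have "Suc m ^ m \<le> (2 ^ Suc m) ^ m" by (intro power_mono) auto
  also have "\<dots> = 2 ^ (m * Suc m)" by (simp only: power_mult[symmetric] mult.commute)
  also have "\<dots> < 2 ^ (m * Suc m + 1)" by simp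
  finally have "int (Suc m ^ m) < int (2 ^ (m * Suc m + 1))" by (simp only: of_nat_less_iff)
  then show ?thesis unfolding bit_length_le_iff by simp
qed

text \<open>The bound on the entries depends only on the number of columns, so it holds after every
  row and not merely at the end.\<close>

lemma pt_kernel_basis [pt]: assumes "pt f" "pt g" shows "pt (\<lambda>a. kernel_basis (f a) (g a))"
proof -
  let ?m = "\<lambda>p::(nat \<times> nat) list \<times> int list list. length (fst p)"
  have "pt (\<lambda>p::(nat \<times> nat) list \<times> int list list. foldl (\<lambda>B r. elim_row B (clean (fst p) r))
      (map (\<lambda>j. (j, unit (fst p) j)) [0..<length (fst p)]) (snd p))"
  proof (rule pt_foldl[where J = "\<lambda>p n B. \<exists>rs. kinv (?m p) rs B"
        and G = "\<lambda>p. 1 + sz p * (sz p + 3 + (1 + sz p * (sz p * Suc (sz p) + 3)) + 1)"])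
    show "pbnd (\<lambda>p::(nat \<times> nat) list \<times> int list list. 1 + sz p * (sz p + 3 + (1 + sz p * (sz p * Suc (sz p) + 3)) + 1))"
      by (intro pb)
    show "\<exists>rs. kinv (?m p) rs (map (\<lambda>j. (j, unit (fst p) j)) [0..<length (fst p)])" for p
      using kinv_units by blast
    show "\<exists>rs. kinv (?m p) rs (elim_row B (clean (fst p) r))" if "\<exists>rs. kinv (?m p) rs B" for p B r
      using that kinv_elim[OF _ row01_clean] by blast
    show "sz B \<le> 1 + sz p * (sz p + 3 + (1 + sz p * (sz p * Suc (sz p) + 3)) + 1)" if ex: "\<exists>rs. kinv (?m p) rs B" for p B
    proof -
      let ?s = "sz p"
      obtain rs where K: "kinv (?m p) rs B" using ex by blast
      have m: "?m p \<le> ?s" using sz_ge_length[of "fst p"] sz_pair[of p] by linarith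
      have "length B \<le> ?m p" using K unfolding kinv_def by auto
      have el: "sz q \<le> ?s + 3 + (1 + ?s * (?s * Suc ?s + 3))" if q: "q \<in> set B" for q
      proof -
        have l: "fst q < ?m p" "length (snd q) = ?m p" using K q by (auto simp: kinv_def)
        have "sz (snd q) \<le> 1 + length (snd q) * (?s * Suc ?s + 2 + 1)"
        proof (rule sz_list_le)
          fix y assume "y \<in> set (snd q)"
          then obtain i where i: "i < ?m p" "y = snd q ! i" using l(2) by (auto simp: in_set_conv_nth)
          have "bit_length y \<le> bit_length (int (Suc (?m p) ^ ?m p))"
            using kinv_bound[OF K q i(1)] i(2) by (intro bit_length_mono) simp
          also have "\<dots> \<le> ?m p * Suc (?m p) + 1" by (rule bit_length_power_le)
          also have "\<dots> \<le> ?s * Suc ?s + 1" using m by (intro add_right_mono mult_mono) auto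
          finally show "sz y \<le> ?s * Suc ?s + 2" by simp
        qed
        also have "\<dots> \<le> 1 + ?s * (?s * Suc ?s + 2 + 1)" using l(2) m by (intro add_left_mono mult_right_mono) auto
        finally have "sz (snd q) \<le> 1 + ?s * (?s * Suc ?s + 3)" by (simp add: numeral_eq_Suc)
        moreover have "sz (fst q) \<le> ?s + 1" using bit_length_int_le[of "fst q"] l(1) m by simp
        ultimately show ?thesis using sz_pair[of q] by linarith
      qed
      have "sz B \<le> 1 + length B * (?s + 3 + (1 + ?s * (?s * Suc ?s + 3)) + 1)" by (rule sz_list_le[OF el])
      also have "\<dots> \<le> 1 + ?s * (?s + 3 + (1 + ?s * (?s * Suc ?s + 3)) + 1)"
        using \<open>length B \<le> ?m p\<close> m by (intro add_left_mono mult_right_mono) auto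
      finally show ?thesis .
    qed
  qed (intro pt)+
  then have "pt (\<lambda>p. kernel_basis (fst p) (snd p))" unfolding kernel_basis_def .
  then show ?thesis using assms by (rule pt_app2)
qed

section \<open>Separation of rank constraints\<close>

text \<open>An entry \<open>((u, v), w, y)\<close> stands for an edge of weight \<open>w\<close> that assigns \<open>y\<close> to \<open>u\<close> and \<open>w - y\<close> to \<open>v\<close>.
  In a triple \<open>(D, r, vs)\<close>, the root \<open>r\<close> has capacity \<open>0\<close> and the other vertices have capacity \<open>D\<close>.\<close>

type_synonym oriented = "((nat \<times> nat) \<times> int \<times> int) list"

definition cap :: "int \<times> nat \<times> nat list \<Rightarrow> nat \<Rightarrow> int" where
  "cap c v = (if v = fst (snd c) then 0 else fst c)"

definition load :: "oriented \<Rightarrow> nat \<Rightarrow> int" where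
  "load q v = sum_list (map (\<lambda>e. (if fst (fst e) = v then snd (snd e) else 0) +
     (if snd (fst e) = v then fst (snd e) - snd (snd e) else 0)) q)"

definition shift_at :: "nat \<Rightarrow> int \<Rightarrow> oriented \<Rightarrow> oriented" where
  "shift_at i \<delta> q = map (\<lambda>z. (fst (snd z), fst (snd (snd z)),
     if fst z = i then snd (snd (snd z)) - \<delta> else snd (snd (snd z)))) (zip [0..<length q] q)"

text \<open>One search step. An entry of \<open>R\<close> is a reached vertex together with the
  whole orientation after \<open>\<delta>\<close> has been moved to it, so no path needs to be
  reconstructed. An edge giving at least \<open>\<delta>\<close> to a reached vertex can pass this
  amount on to its other end.\<close>

definition cands :: "int \<Rightarrow> (nat \<times> oriented) list \<Rightarrow> (nat \<times> oriented) list" where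
  "cands \<delta> R = concat (map (\<lambda>p. concat (map (\<lambda>z.
     (if fst (fst (snd z)) = fst p \<and> \<not> snd (fst (snd z)) \<in> set (map fst R) \<and> 0 < \<delta> \<and> \<delta> \<le> snd (snd (snd z))
      then [(snd (fst (snd z)), shift_at (fst z) \<delta> (snd p))] else []) @
     (if snd (fst (snd z)) = fst p \<and> \<not> fst (fst (snd z)) \<in> set (map fst R) \<and> 0 < \<delta> \<and>
         \<delta> \<le> fst (snd (snd z)) - snd (snd (snd z))
      then [(fst (fst (snd z)), shift_at (fst z) (- \<delta>) (snd p))] else []))
     (zip [0..<length (snd p)] (snd p)))) R)"

definition grow :: "int \<Rightarrow> (nat \<times> oriented) list \<Rightarrow> (nat \<times> oriented) list" where
  "grow \<delta> R = (case cands \<delta> R of [] \<Rightarrow> R | p # ps \<Rightarrow> p # R)"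

text \<open>The search starts at the vertices whose load exceeds the capacity by at least
  \<open>\<delta>\<close>. A round adds at most one vertex, so there are as many rounds as
  vertices.\<close>

definition reach :: "int \<times> nat \<times> nat list \<Rightarrow> int \<Rightarrow> oriented \<Rightarrow> (nat \<times> oriented) list" where
  "reach c \<delta> q = foldl (\<lambda>R x. grow \<delta> R)
     (map (\<lambda>v. (v, q)) (filter (\<lambda>v. \<delta> \<le> load q v - cap c v) (snd (snd c)))) (snd (snd c))"

definition augment :: "int \<times> nat \<times> nat list \<Rightarrow> int \<Rightarrow> oriented \<Rightarrow> oriented" where
  "augment c \<delta> q = (case filter (\<lambda>p. load q (fst p) + \<delta> \<le> cap c (fst p)) (reach c \<delta> q) of
     [] \<Rightarrow> q | p # ps \<Rightarrow> snd p)"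

text \<open>Only the length of this list matters: it bounds the number of augmentations in a phase.\<close>

definition attempts :: "int \<times> nat \<times> nat list \<Rightarrow> oriented \<Rightarrow> int list" where
  "attempts c q = (let a = map (\<lambda>v. 0) (snd (snd c)); b = map (\<lambda>e. 0) q in
     a @ a @ a @ a @ a @ a @ b @ b @ b @ [0])"

definition phase :: "int \<times> nat \<times> nat list \<Rightarrow> oriented \<Rightarrow> int \<Rightarrow> oriented" where
  "phase c q \<delta> = foldl (\<lambda>s x. augment c \<delta> s) q (attempts c q)"

definition orient :: "int \<times> nat \<times> nat list \<Rightarrow> oriented \<Rightarrow> oriented" where
  "orient c q = foldl (phase c) q (halves (max 0 (sum_list (map (\<lambda>e. fst (snd e)) q))))"

definition violated :: "int \<times> nat \<times> nat list \<Rightarrow> oriented \<Rightarrow> nat list" where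
  "violated c q = map fst (reach c 1 (orient c q))"

text \<open>Every nonempty vertex set contains a possible root, so one orientation problem per
  vertex tests all rank constraints. Initially each edge gives its full weight to its first
  end.\<close>

definition separating_set :: "int \<Rightarrow> nat list \<Rightarrow> (nat \<times> nat) list \<Rightarrow> int list \<Rightarrow> nat list" where
  "separating_set D vs ps w =
    (case filter (\<lambda>U. length U \<noteq> 0) (map (\<lambda>r. violated (D, r, vs) (zip ps (zip w w))) vs) of
       [] \<Rightarrow> [] | U # Us \<Rightarrow> U)"

subsection \<open>Correctness\<close>

lemma length_shift_at [simp]: "length (shift_at i \<delta> q) = length q"
  by (simp add: shift_at_def)

lemma shift_at_nth: "j < length q \<Longrightarrow> shift_at i \<delta> q ! j =
    (fst (q ! j), fst (snd (q ! j)), if j = i then snd (snd (q ! j)) - \<delta> else snd (snd (q ! j)))"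
  by (simp add: shift_at_def)

lemma mem_cands:
  "x \<in> set (cands \<delta> R) \<longleftrightarrow> (\<exists>p\<in>set R. \<exists>i<length (snd p). let e = snd p ! i in
    (fst (fst e) = fst p \<and> snd (fst e) \<notin> fst ` set R \<and> 0 < \<delta> \<and> \<delta> \<le> snd (snd e) \<and>
       x = (snd (fst e), shift_at i \<delta> (snd p))) \<or>
    (snd (fst e) = fst p \<and> fst (fst e) \<notin> fst ` set R \<and> 0 < \<delta> \<and> \<delta> \<le> fst (snd e) - snd (snd e) \<and>
       x = (fst (fst e), shift_at i (- \<delta>) (snd p))))"
proof -
  have z: "(\<exists>z\<in>set (zip [0..<length q] q). P z) \<longleftrightarrow> (\<exists>i<length q. P (i, q ! i))" for q :: oriented and P
  proof -
    have "zip [0..<length q] q = map (\<lambda>i. (i, q ! i)) [0..<length q]" by (rule nth_equalityI) auto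
    then show ?thesis by auto
  qed
  show ?thesis unfolding cands_def set_concat set_map
    by (simp only: UN_iff set_concat set_map image_image z set_append Un_iff Let_def fst_conv snd_conv) (auto split: if_splits)
qed

section \<open>Orientations, excess and scaling\<close>

locale orientation =
  fixes vs :: "nat list" and ps :: "(nat \<times> nat) list" and w :: "int list" and D :: int and r :: nat
  assumes vs: "distinct vs" and ps: "\<And>i. i < length ps \<Longrightarrow> fst (ps ! i) \<in> set vs \<and> snd (ps ! i) \<in> set vs \<and> fst (ps ! i) \<noteq> snd (ps ! i)"
    and w: "length w = length ps" "\<And>i. i < length ps \<Longrightarrow> 0 \<le> w ! i" and D: "0 \<le> D"
begin

abbreviation "m \<equiv> length ps"
abbreviation "n \<equiv> length vs"
abbreviation "c \<equiv> (D, r, vs)"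
abbreviation "capv \<equiv> cap c"

definition "inside U i \<longleftrightarrow> fst (ps ! i) \<in> U \<and> snd (ps ! i) \<in> U"
definition "wE U = (\<Sum>i\<in>{i \<in> {..<m}. inside U i}. w ! i)"

definition "ori q \<longleftrightarrow> length q = m \<and> (\<forall>i<m. fst (q ! i) = ps ! i \<and> fst (snd (q ! i)) = w ! i \<and>
   0 \<le> snd (snd (q ! i)) \<and> snd (snd (q ! i)) \<le> w ! i)"

lemma load_sum: assumes "ori q" shows "load q v =
  (\<Sum>i<m. (if fst (ps ! i) = v then snd (snd (q ! i)) else 0) + (if snd (ps ! i) = v then w ! i - snd (snd (q ! i)) else 0))"
  using assms by (auto simp: load_def ori_def sum_list_sum_nth atLeast0LessThan intro!: sum.cong)

lemma load_U: assumes "ori q" "finite U" shows "(\<Sum>v\<in>U. load q v) =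
  (\<Sum>i<m. (if fst (ps ! i) \<in> U then snd (snd (q ! i)) else 0) + (if snd (ps ! i) \<in> U then w ! i - snd (snd (q ! i)) else 0))"
proof -
  have "(\<Sum>v\<in>U. load q v) = (\<Sum>i<m. \<Sum>v\<in>U. (if fst (ps ! i) = v then snd (snd (q ! i)) else 0) +
      (if snd (ps ! i) = v then w ! i - snd (snd (q ! i)) else 0))"
    unfolding load_sum[OF assms(1)] by (rule sum.swap)
  then show ?thesis using assms(2) by (simp add: sum.distrib)
qed

lemma load_nonneg: "ori q \<Longrightarrow> 0 \<le> load q v"
  unfolding load_sum by (intro sum_nonneg) (auto simp: ori_def)

lemma wE_filter: "wE U = (\<Sum>i<m. if inside U i then w ! i else 0)"
  unfolding wE_def by (simp add: sum.inter_filter[symmetric])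

lemma load_ge: assumes "ori q" "finite U" shows "wE U \<le> (\<Sum>v\<in>U. load q v)"
  unfolding load_U[OF assms] wE_filter
  by (rule sum_mono) (use assms(1) in \<open>auto simp: ori_def inside_def\<close>)

lemma load_shift:
  assumes q: "ori q" and i: "i < m"
  shows "load (shift_at i \<delta> q) v = load q v - (if fst (ps ! i) = v then \<delta> else 0) + (if snd (ps ! i) = v then \<delta> else 0)"
proof -
  have len: "length q = m" using q by (simp add: ori_def)
  let ?f = "\<lambda>y j. (if fst (ps ! j) = v then y else 0) + (if snd (ps ! j) = v then w ! j - y else 0)"
  have "load (shift_at i \<delta> q) v = (\<Sum>j<m. ?f (snd (snd (shift_at i \<delta> q ! j))) j)"
    using q by (auto simp: load_def sum_list_sum_nth atLeast0LessThan len shift_at_nth ori_def intro!: sum.cong)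
  also have "\<dots> = (\<Sum>j<m. ?f (snd (snd (q ! j))) j + (if j = i then - (if fst (ps ! i) = v then \<delta> else 0) + (if snd (ps ! i) = v then \<delta> else 0) else 0))"
    by (rule sum.cong) (auto simp: shift_at_nth len)
  also have "\<dots> = load q v + (- (if fst (ps ! i) = v then \<delta> else 0) + (if snd (ps ! i) = v then \<delta> else 0))"
    using i by (simp only: sum.distrib load_sum[OF q]) simp
  finally show ?thesis by simp
qed

lemma ori_shift:
  assumes "ori q" "i < m" "0 \<le> snd (snd (q ! i)) - \<delta>" "snd (snd (q ! i)) - \<delta> \<le> w ! i"
  shows "ori (shift_at i \<delta> q)"
  using assms by (auto simp: ori_def shift_at_nth)

text \<open>Each copy differs from \<open>q\<close> by moving \<open>\<delta>\<close> from some
  overloaded vertex to the reached one. The last clause says that edges not inside the reached set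
  are unmodified in every copy, so the end of the search can be interpreted in \<open>q\<close>
  itself.\<close>

definition "reached \<delta> q R \<longleftrightarrow> distinct (map fst R) \<and> fst ` set R \<subseteq> set vs \<and>
  {v \<in> set vs. \<delta> \<le> load q v - capv v} \<subseteq> fst ` set R \<and>
  (\<forall>p\<in>set R. ori (snd p) \<and> (\<exists>s\<in>set vs. \<delta> \<le> load q s - capv s \<and>
      (\<forall>u. load (snd p) u = load q u - (if u = s then \<delta> else 0) + (if u = fst p then \<delta> else 0))) \<and>
    (\<forall>i<m. \<not> inside (fst ` set R) i \<longrightarrow> snd p ! i = q ! i))"

lemma reached_cand:
  assumes R: "reached \<delta> q R" and x: "x \<in> set (cands \<delta> R)"
  shows "reached \<delta> q (x # R)"
proof -
  obtain p i where p: "p \<in> set R" "i < length (snd p)"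
    and x': "(fst (fst (snd p ! i)) = fst p \<and> snd (fst (snd p ! i)) \<notin> fst ` set R \<and> 0 < \<delta> \<and> \<delta> \<le> snd (snd (snd p ! i)) \<and>
       x = (snd (fst (snd p ! i)), shift_at i \<delta> (snd p))) \<or>
      (snd (fst (snd p ! i)) = fst p \<and> fst (fst (snd p ! i)) \<notin> fst ` set R \<and> 0 < \<delta> \<and>
       \<delta> \<le> fst (snd (snd p ! i)) - snd (snd (snd p ! i)) \<and> x = (fst (fst (snd p ! i)), shift_at i (- \<delta>) (snd p)))"
    using x unfolding mem_cands Let_def by blast
  have op: "ori (snd p)" using R p by (auto simp: reached_def)
  have i: "i < m" using op p by (simp add: ori_def)
  have e: "fst (snd p ! i) = ps ! i" "fst (snd (snd p ! i)) = w ! i" "0 \<le> snd (snd (snd p ! i))" "snd (snd (snd p ! i)) \<le> w ! i"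
    using op i by (auto simp: ori_def)
  obtain \<epsilon> where \<epsilon>: "snd x = shift_at i \<epsilon> (snd p)" "fst x \<notin> fst ` set R" "fst x \<in> set vs" "0 < \<delta>"
      "{fst (ps ! i), snd (ps ! i)} = {fst p, fst x}"
      "0 \<le> snd (snd (snd p ! i)) - \<epsilon>" "snd (snd (snd p ! i)) - \<epsilon> \<le> w ! i"
      "\<And>u. load (snd x) u = load (snd p) u - (if u = fst p then \<delta> else 0) + (if u = fst x then \<delta> else 0)"
    using x'
  proof
    assume a: "fst (fst (snd p ! i)) = fst p \<and> snd (fst (snd p ! i)) \<notin> fst ` set R \<and> 0 < \<delta> \<and> \<delta> \<le> snd (snd (snd p ! i)) \<and>
       x = (snd (fst (snd p ! i)), shift_at i \<delta> (snd p))"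
    show thesis by (rule that[of \<delta>]) (use a e ps[OF i] load_shift[OF op i] in auto)
  next
    assume a: "snd (fst (snd p ! i)) = fst p \<and> fst (fst (snd p ! i)) \<notin> fst ` set R \<and> 0 < \<delta> \<and>
       \<delta> \<le> fst (snd (snd p ! i)) - snd (snd (snd p ! i)) \<and> x = (fst (fst (snd p ! i)), shift_at i (- \<delta>) (snd p))"
    show thesis by (rule that[of "- \<delta>"]) (use a e ps[OF i] load_shift[OF op i] in auto)
  qed
  have pR: "fst p \<in> fst ` set R" using p by simp
  then have pne: "fst p \<noteq> fst x" using \<epsilon>(2) by metis
  obtain s where s: "s \<in> set vs" "\<delta> \<le> load q s - capv s"
    "\<And>u. load (snd p) u = load q u - (if u = s then \<delta> else 0) + (if u = fst p then \<delta> else 0)"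
    using R p unfolding reached_def by blast
  have lx: "load (snd x) u = load q u - (if u = s then \<delta> else 0) + (if u = fst x then \<delta> else 0)" for u
    using \<epsilon>(8)[of u] s(3)[of u] by simp
  have ox: "ori (snd x)" unfolding \<epsilon>(1) by (rule ori_shift[OF op i \<epsilon>(6,7)])
  have same: "snd p' ! j = q ! j" if "p' \<in> set R" "j < m" "\<not> inside (fst ` set R) j" for p' j
    using R that by (auto simp: reached_def)
  have ins: "inside (fst ` set (x # R)) i" "\<not> inside (fst ` set R) i"
  proof -
    consider "fst (ps ! i) = fst p" "snd (ps ! i) = fst x" | "fst (ps ! i) = fst x" "snd (ps ! i) = fst p"
      using \<epsilon>(5) by (auto simp: doubleton_eq_iff)
    then show "inside (fst ` set (x # R)) i" "\<not> inside (fst ` set R) i"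
      by (cases; use pR \<epsilon>(2) in \<open>simp add: inside_def\<close>)+
  qed
  have mono: "inside (fst ` set (x # R)) j" if "inside (fst ` set R) j" for j using that by (auto simp: inside_def)
  have samex: "snd x ! j = q ! j" if "j < m" "\<not> inside (fst ` set (x # R)) j" for j
  proof -
    have "j \<noteq> i" "\<not> inside (fst ` set R) j" using that ins mono by auto
    then show ?thesis using same[OF p(1) that(1)] op that(1) by (auto simp: \<epsilon>(1) shift_at_nth ori_def prod_eq_iff)
  qed
  have all: "ori (snd p') \<and> (\<exists>s\<in>set vs. \<delta> \<le> load q s - capv s \<and>
      (\<forall>u. load (snd p') u = load q u - (if u = s then \<delta> else 0) + (if u = fst p' then \<delta> else 0))) \<and>
    (\<forall>j<m. \<not> inside (fst ` set (x # R)) j \<longrightarrow> snd p' ! j = q ! j)" if "p' \<in> set (x # R)" for p'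
  proof (cases "p' = x")
    case True
    then show ?thesis using ox s(1,2) lx samex by blast
  next
    case False
    then have p': "p' \<in> set R" using that by simp
    then have "ori (snd p')" "\<exists>s\<in>set vs. \<delta> \<le> load q s - capv s \<and>
      (\<forall>u. load (snd p') u = load q u - (if u = s then \<delta> else 0) + (if u = fst p' then \<delta> else 0))"
      using R by (auto simp: reached_def)
    then show ?thesis using same[OF p'] mono by blast
  qed
  have "distinct (map fst (x # R))" "fst ` set (x # R) \<subseteq> set vs" "{v \<in> set vs. \<delta> \<le> load q v - capv v} \<subseteq> fst ` set (x # R)"
    using R \<epsilon>(2,3) by (auto simp: reached_def)
  then show ?thesis unfolding reached_def using all by blast
qed

lemma reached_reach:
  assumes q: "ori q" and \<delta>: "0 < \<delta>"
  shows "reached \<delta> q (reach c \<delta> q)" "cands \<delta> (reach c \<delta> q) = []"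
proof -
  let ?Init = "map (\<lambda>v. (v, q)) (filter (\<lambda>v. \<delta> \<le> load q v - capv v) vs)"
  let ?R = "\<lambda>k. (grow \<delta> ^^ k) ?Init"
  have R0: "reached \<delta> q ?Init" using vs q by (auto simp: reached_def comp_def image_image)
  have R: "reached \<delta> q (?R k)" for k
  proof (induction k)
    case (Suc k)
    then show ?case using reached_cand by (auto simp: grow_def split: list.split)
  qed (use R0 in simp)
  have reach: "reach c \<delta> q = ?R n" by (simp add: reach_def foldl_const_fun)
  show "reached \<delta> q (reach c \<delta> q)" unfolding reach by (rule R)
  have stay: "?R (k + j) = ?R k" if "cands \<delta> (?R k) = []" for k j
    using that by (induction j) (auto simp: grow_def)
  have len: "length ?Init + k \<le> length (?R k)" if "cands \<delta> (?R n) \<noteq> []" "k \<le> n" for k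
    using that(2)
  proof (induction k)
    case (Suc k)
    have "cands \<delta> (?R k) \<noteq> []"
    proof
      assume "cands \<delta> (?R k) = []"
      then have "?R n = ?R k" using stay[of k "n - k"] Suc.prems by simp
      then show False using that(1) \<open>cands \<delta> (?R k) = []\<close> by simp
    qed
    moreover have "length (grow \<delta> R') = Suc (length R')" if "cands \<delta> R' \<noteq> []" for R'
      using that by (auto simp: grow_def split: list.split)
    ultimately show ?case using Suc by simp
  qed simp
  show "cands \<delta> (reach c \<delta> q) = []"
  proof (rule ccontr)
    assume ne: "cands \<delta> (reach c \<delta> q) \<noteq> []"
    have "length (?R n) \<le> n"
    proof -
      have "distinct (map fst (?R n))" using R[of n] unfolding reached_def by blast
      from distinct_card[OF this] have "length (?R n) = card (fst ` set (?R n))" by simp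
      also have "\<dots> \<le> card (set vs)" using R[of n] by (intro card_mono) (auto simp: reached_def)
      also have "\<dots> = n" using vs by (rule distinct_card)
      finally show ?thesis .
    qed
    moreover have "length ?Init + n \<le> length (?R n)" using len[of n] ne reach by simp
    \<comment> \<open>If all \<open>n\<close> rounds were successful although only \<open>n\<close>
      vertices exist, the search began with no vertex; but then there is no candidate at
      all.\<close>
    ultimately have "length ?Init = 0" by linarith
    then have "?Init = []" by simp
    moreover have "cands \<delta> [] = []" by (simp add: cands_def)
    ultimately have "cands \<delta> ?Init = []" by simp
    then show False using stay[of 0 n] ne reach by simp
  qed
qed

definition "X q = (\<Sum>v\<in>set vs. max 0 (load q v - capv v))"

text \<open>Weak duality: edges inside \<open>U\<close> deliver their weight to \<open>U\<close> in
  every orientation, so the violation of any set bounds the total excess from below.\<close>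

lemma X_ge: assumes "ori q" "U \<subseteq> set vs" shows "wE U - (\<Sum>v\<in>U. capv v) \<le> X q"
proof -
  have fin: "finite U" using assms finite_subset by blast
  have "wE U - (\<Sum>v\<in>U. capv v) \<le> (\<Sum>v\<in>U. load q v - capv v)" using load_ge[OF assms(1) fin] by (simp add: sum_subtractf)
  also have "\<dots> \<le> (\<Sum>v\<in>U. max 0 (load q v - capv v))" by (rule sum_mono) auto
  also have "\<dots> \<le> X q" unfolding X_def by (rule sum_mono2) (use assms in auto)
  finally show ?thesis .
qed

definition "stuck \<delta> q \<longleftrightarrow> (\<forall>p\<in>set (reach c \<delta> q). capv (fst p) < load q (fst p) + \<delta>)"

lemma stuck_augment: "stuck \<delta> q \<Longrightarrow> augment c \<delta> q = q"
  by (auto simp: stuck_def augment_def filter_empty_conv not_le split: list.split dest: filter_eq_ConsD)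

text \<open>The source has excess at least \<open>\<delta>\<close> and the target has room for
  \<open>\<delta>\<close>, so the total excess drops by exactly \<open>\<delta>\<close>.\<close>

lemma augment_progress:
  assumes q: "ori q" and \<delta>: "0 < \<delta>" and ns: "\<not> stuck \<delta> q"
  shows "ori (augment c \<delta> q)" "X (augment c \<delta> q) = X q - \<delta>"
proof -
  obtain p ps' where f: "filter (\<lambda>p. load q (fst p) + \<delta> \<le> capv (fst p)) (reach c \<delta> q) = p # ps'"
    using ns by (cases "filter (\<lambda>p. load q (fst p) + \<delta> \<le> capv (fst p)) (reach c \<delta> q)")
      (auto simp: stuck_def filter_empty_conv not_le)
  then have p: "p \<in> set (reach c \<delta> q)" "load q (fst p) + \<delta> \<le> capv (fst p)"
    by (auto dest!: filter_eq_ConsD)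
  have a: "augment c \<delta> q = snd p" using f by (simp add: augment_def)
  from reached_reach(1)[OF q \<delta>] p(1) obtain s where s: "s \<in> set vs" "\<delta> \<le> load q s - capv s"
    "\<And>u. load (snd p) u = load q u - (if u = s then \<delta> else 0) + (if u = fst p then \<delta> else 0)"
    and o: "ori (snd p)" "fst p \<in> set vs" unfolding reached_def by blast
  show "ori (augment c \<delta> q)" using a o by simp
  have sp: "s \<noteq> fst p" using s(2) p(2) \<delta> by auto
  have "max 0 (load (snd p) u - capv u) = max 0 (load q u - capv u) - (if u = s then \<delta> else 0)" for u
    using s(2,3) p(2) \<delta> sp by auto
  then have "X (snd p) = X q - (\<Sum>u\<in>set vs. if u = s then \<delta> else 0)" unfolding X_def by (simp add: sum_subtractf)
  then show "X (augment c \<delta> q) = X q - \<delta>" using a s(1) by simp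
qed

text \<open>The reached set \<open>U\<close> is nearly closed: an edge leaving it contributes less
  than \<open>\<delta>\<close> to \<open>U\<close>, as otherwise its other end would have been
  reached.\<close>

lemma stuck_closed:
  assumes q: "ori q" and \<delta>: "0 < \<delta>" and st: "stuck \<delta> q"
  defines "U \<equiv> fst ` set (reach c \<delta> q)"
  shows "U \<subseteq> set vs" "\<And>v. v \<in> set vs \<Longrightarrow> \<delta> \<le> load q v - capv v \<Longrightarrow> v \<in> U"
    "\<And>v. v \<in> U \<Longrightarrow> capv v < load q v + \<delta>"
    "(\<Sum>v\<in>U. load q v) \<le> wE U + int m * (\<delta> - 1)"
proof -
  note R = reached_reach[OF q \<delta>]
  show US: "U \<subseteq> set vs" "\<And>v. v \<in> set vs \<Longrightarrow> \<delta> \<le> load q v - capv v \<Longrightarrow> v \<in> U"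
    using R(1) by (auto simp: reached_def U_def)
  show "\<And>v. v \<in> U \<Longrightarrow> capv v < load q v + \<delta>" using st by (auto simp: stuck_def U_def)
  have fin: "finite U" by (simp add: U_def)
  have a: "snd (snd (q ! i)) < \<delta>" if i: "i < m" "fst (ps ! i) \<in> U" "snd (ps ! i) \<notin> U" for i
  proof (rule ccontr)
    assume ge: "\<not> ?thesis"
    obtain p where p: "p \<in> set (reach c \<delta> q)" "fst p = fst (ps ! i)" using i by (auto simp: U_def)
    have "ori (snd p)" "snd p ! i = q ! i" using R(1) p(1) i unfolding reached_def U_def inside_def by blast+
    then have "(snd (ps ! i), shift_at i \<delta> (snd p)) \<in> set (cands \<delta> (reach c \<delta> q))"
      unfolding mem_cands Let_def using p i ge \<delta> q
      by (intro bexI[OF _ p(1)] exI[of _ i]) (auto simp: ori_def U_def)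
    then show False using R(2) by simp
  qed
  have b: "w ! i - snd (snd (q ! i)) < \<delta>" if i: "i < m" "snd (ps ! i) \<in> U" "fst (ps ! i) \<notin> U" for i
  proof (rule ccontr)
    assume ge: "\<not> ?thesis"
    obtain p where p: "p \<in> set (reach c \<delta> q)" "fst p = snd (ps ! i)" using i by (auto simp: U_def)
    have "ori (snd p)" "snd p ! i = q ! i" using R(1) p(1) i unfolding reached_def U_def inside_def by blast+
    then have "(fst (ps ! i), shift_at i (- \<delta>) (snd p)) \<in> set (cands \<delta> (reach c \<delta> q))"
      unfolding mem_cands Let_def using p i ge \<delta> q
      by (intro bexI[OF _ p(1)] exI[of _ i]) (auto simp: ori_def U_def)
    then show False using R(2) by simp
  qed
  have "(\<Sum>v\<in>U. load q v) \<le> (\<Sum>i<m. (if inside U i then w ! i else 0) + (\<delta> - 1))"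
    unfolding load_U[OF q fin]
  proof (rule sum_mono)
    fix i assume "i \<in> {..<m}"
    then have i: "i < m" by simp
    show "(if fst (ps ! i) \<in> U then snd (snd (q ! i)) else 0) + (if snd (ps ! i) \<in> U then w ! i - snd (snd (q ! i)) else 0)
      \<le> (if inside U i then w ! i else 0) + (\<delta> - 1)"
      using a[OF i] b[OF i] \<delta> by (auto simp: inside_def)
  qed
  then show "(\<Sum>v\<in>U. load q v) \<le> wE U + int m * (\<delta> - 1)" unfolding wE_filter by (simp add: sum.distrib)
qed

lemma stuck_X:
  assumes q: "ori q" and \<delta>: "0 < \<delta>" and st: "stuck \<delta> q"
  shows "\<exists>U\<subseteq>set vs. X q \<le> wE U - (\<Sum>v\<in>U. capv v) + int (2 * n + m) * \<delta>"
proof -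
  define U where "U = fst ` set (reach c \<delta> q)"
  note S = stuck_closed[OF q \<delta> st, folded U_def]
  have cU: "card U \<le> n" "card (set vs - U) \<le> n"
    using card_mono[OF _ S(1)] card_mono[of "set vs" "set vs - U"] distinct_card[OF vs] by auto
  have "X q = (\<Sum>v\<in>U. max 0 (load q v - capv v)) + (\<Sum>v\<in>set vs - U. max 0 (load q v - capv v))"
    unfolding X_def by (subst sum.subset_diff[OF S(1)]) auto
  also have "(\<Sum>v\<in>U. max 0 (load q v - capv v)) \<le> (\<Sum>v\<in>U. load q v - capv v + \<delta>)"
    by (rule sum_mono) (use S(3) \<delta> in fastforce)
  also have "\<dots> = (\<Sum>v\<in>U. load q v) - (\<Sum>v\<in>U. capv v) + int (card U) * \<delta>" by (simp add: sum.distrib sum_subtractf)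
  also have "(\<Sum>v\<in>set vs - U. max 0 (load q v - capv v)) \<le> (\<Sum>v\<in>set vs - U. \<delta>)"
    by (rule sum_mono) (use S(2) \<delta> in fastforce)
  also have "(\<Sum>v\<in>set vs - U. \<delta>) = int (card (set vs - U)) * \<delta>" by simp
  also have "int (card (set vs - U)) * \<delta> \<le> int n * \<delta>" using cU \<delta> by (intro mult_right_mono) auto
  also have "int (card U) * \<delta> \<le> int n * \<delta>" using cU \<delta> by (intro mult_right_mono) auto
  also have "(\<Sum>v\<in>U. load q v) \<le> wE U + int m * \<delta>" using S(4) mult_left_mono[of "\<delta> - 1" \<delta> "int m"] by linarith
  finally have "X q \<le> wE U - (\<Sum>v\<in>U. capv v) + int (2 * n + m) * \<delta>" by (simp add: algebra_simps)
  then show ?thesis using S(1) by blast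
qed

text \<open>Every augmentation lowers the excess by \<open>\<delta>\<close>, and the excess cannot
  fall below the bound given by \<open>U\<close>. Since \<open>attempts\<close> has length
  \<open>3 * (2 * n + m) + 1\<close>, the phase gets stuck.\<close>

lemma phase_stuck:
  assumes q: "ori q" and \<delta>: "0 < \<delta>"
    and X: "U \<subseteq> set vs" "X q \<le> wE U - (\<Sum>v\<in>U. capv v) + int (3 * (2 * n + m)) * \<delta>"
  shows "ori (phase c q \<delta>)" "stuck \<delta> (phase c q \<delta>)"
proof -
  let ?N = "Suc (3 * (2 * n + m))"
  have len: "length (attempts c q) = ?N" using q by (simp add: attempts_def Let_def ori_def)
  have ph: "phase c q \<delta> = (augment c \<delta> ^^ ?N) q" unfolding phase_def foldl_const_fun len by simp
  have o: "ori ((augment c \<delta> ^^ k) q)" for k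
  proof (induction k)
    case (Suc k)
    then show ?case using augment_progress(1)[OF Suc \<delta>] stuck_augment by (cases "stuck \<delta> ((augment c \<delta> ^^ k) q)") auto
  qed (use q in simp)
  have st: "stuck \<delta> ((augment c \<delta> ^^ (k + j)) q)" if "stuck \<delta> ((augment c \<delta> ^^ k) q)" for k j
    using that by (induction j) (auto simp: stuck_augment)
  have XX: "X ((augment c \<delta> ^^ k) q) = X q - int k * \<delta>" if "\<not> stuck \<delta> ((augment c \<delta> ^^ ?N) q)" "k \<le> ?N" for k
    using that(2)
  proof (induction k)
    case (Suc k)
    have "\<not> stuck \<delta> ((augment c \<delta> ^^ k) q)" using st[of k "?N - k"] that(1) Suc.prems by auto
    from augment_progress(2)[OF o \<delta> this] Suc show ?case by (simp add: algebra_simps)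
  qed simp
  show "ori (phase c q \<delta>)" unfolding ph by (rule o)
  show "stuck \<delta> (phase c q \<delta>)"
  proof (rule ccontr)
    assume "\<not> ?thesis"
    then have "X ((augment c \<delta> ^^ ?N) q) = X q - int ?N * \<delta>" using XX[of ?N] unfolding ph by simp
    moreover have "wE U - (\<Sum>v\<in>U. capv v) \<le> X ((augment c \<delta> ^^ ?N) q)" by (rule X_ge[OF o X(1)])
    ultimately have "int ?N * \<delta> \<le> int (3 * (2 * n + m)) * \<delta>" using X(2) by linarith
    then show False using \<delta> by (simp add: mult_le_cancel_right)
  qed
qed

lemma orient_stuck:
  assumes q: "ori q" and n: "0 < n"
  shows "ori (orient c q)" "stuck 1 (orient c q)"
proof -
  define W where "W = (\<Sum>i<m. w ! i)"
  have W0: "0 \<le> W" unfolding W_def using w(2) by (intro sum_nonneg) auto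
  have Wq: "sum_list (map (\<lambda>e. fst (snd e)) q) = W"
    using q by (simp add: W_def ori_def sum_list_sum_nth atLeast0LessThan)
  let ?b = "bit_length W"
  have foldl_map: "orient c q = foldl (phase c) q (map (\<lambda>j. W div 2 ^ j) [0..<?b])"
    using W0 by (simp add: orient_def Wq halves_def)
  have X0: "X q \<le> W"
  proof -
    have "capv v \<ge> 0" for v using D by (simp add: cap_def)
    then have "X q \<le> (\<Sum>v\<in>set vs. load q v)" unfolding X_def
      by (intro sum_mono) (use load_nonneg[OF q] in \<open>auto simp: le_max_iff_disj\<close>)
    also have "\<dots> = W" unfolding load_U[OF q finite_set] W_def by (rule sum.cong) (use ps in auto)
    finally show ?thesis .
  qed
  have dpos: "0 < W div 2 ^ j" if "j < ?b" for j
    using that bit_length_le_iff[of W j] pos_imp_zdiv_pos_iff[of "2 ^ j" W] W0 by auto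
  let ?q = "\<lambda>k. foldl (phase c) q (map (\<lambda>j. W div 2 ^ j) [0..<k])"
  have main: "ori (?q k) \<and> (if k = 0 then ?q k = q else stuck (W div 2 ^ (k - 1)) (?q k))" if "k \<le> ?b" for k
    using that
  proof (induction k)
    case (Suc k)
    then have IH: "ori (?q k)" "k \<noteq> 0 \<Longrightarrow> stuck (W div 2 ^ (k - 1)) (?q k)" "k = 0 \<Longrightarrow> ?q k = q" by auto
    let ?\<delta> = "W div 2 ^ k"
    have \<delta>: "0 < ?\<delta>" using dpos Suc.prems by simp
    have "\<exists>U\<subseteq>set vs. X (?q k) \<le> wE U - (\<Sum>v\<in>U. capv v) + int (3 * (2 * n + m)) * ?\<delta>"
    proof (cases "k = 0")
      case True
      have "X q \<le> 1 * W" using X0 by simp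
      also have "\<dots> \<le> int (3 * (2 * n + m)) * W" 
      proof (rule mult_right_mono[OF _ W0])
        have "1 \<le> 3 * (2 * n + m)" using n by (cases vs) auto
        then have "int 1 \<le> int (3 * (2 * n + m))" by (rule of_nat_mono)
        then show "1 \<le> int (3 * (2 * n + m))" by (simp only: of_nat_1)
      qed
      finally show ?thesis using True IH(3) by (intro exI[of _ "{}"]) (auto simp: wE_def inside_def)
    next
      case False
      let ?\<epsilon> = "W div 2 ^ (k - 1)"
      have \<epsilon>: "0 < ?\<epsilon>" using dpos[of "k - 1"] Suc.prems by simp
      obtain U where U: "U \<subseteq> set vs" "X (?q k) \<le> wE U - (\<Sum>v\<in>U. capv v) + int (2 * n + m) * ?\<epsilon>"
        using stuck_X[OF IH(1) \<epsilon> IH(2)[OF False]] by blast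
      have "?\<delta> = ?\<epsilon> div 2"
        using False by (metis power_minus_mult mult.commute zdiv_zmult2_eq zero_le_numeral zero_le_power neq0_conv)
      \<comment> \<open>Halving with rounding down gives
        \<open>?\<epsilon> \<le> 2 * ?\<delta> + 1\<close>. This is the origin of the factor 3 in
        the number of attempts.\<close>
      then have "?\<epsilon> \<le> 3 * ?\<delta>" using \<delta> by linarith
      then have "int (2 * n + m) * ?\<epsilon> \<le> int (2 * n + m) * (3 * ?\<delta>)" by (intro mult_left_mono) auto
      then have "X (?q k) \<le> wE U - (\<Sum>v\<in>U. capv v) + int (3 * (2 * n + m)) * ?\<delta>" using U(2) by (simp add: algebra_simps)
      then show ?thesis using U(1) by blast
    qed
    then obtain U where U: "U \<subseteq> set vs" "X (?q k) \<le> wE U - (\<Sum>v\<in>U. capv v) + int (3 * (2 * n + m)) * ?\<delta>" by blast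
    show ?case using phase_stuck[OF IH(1) \<delta> U] by simp
  qed (use q in simp)
  show "ori (orient c q)" using main[of ?b] foldl_map by simp
  show "stuck 1 (orient c q)"
  proof (cases "?b = 0")
    case True
    then have "W = 0" using abs_less_bit_length[of W] by simp
    then have "X q \<le> 0" using X0 by simp
    have "load q v - capv v \<le> 0" if "v \<in> set vs" for v
    proof -
      have "max 0 (load q v - capv v) \<le> X q" unfolding X_def by (rule member_le_sum) (use that in auto)
      then show ?thesis using \<open>X q \<le> 0\<close> by simp
    qed
    then have "filter (\<lambda>v. 1 \<le> load q v - capv v) vs = []" by (force simp: filter_empty_conv)
    then have "reach c 1 q = (grow 1 ^^ n) []" by (simp add: reach_def foldl_const_fun)
    moreover have "(grow 1 ^^ k) [] = []" for k by (induction k) (auto simp: grow_def cands_def)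
    ultimately have "reach c 1 q = []" by simp
    then show ?thesis using foldl_map True by (simp add: stuck_def)
  next
    case False
    \<comment> \<open>The last quotient is the leading binary digit, so the final phase uses step
      1.\<close>
    have "W div 2 ^ (?b - 1) = 1"
    proof -
      have "W < 2 ^ ?b" using abs_less_bit_length[of W] by simp
      also have "(2::int) ^ ?b = 2 * 2 ^ (?b - 1)" using False by (metis power_eq_if mult.commute)
      finally have P: "(0::int) < 2 ^ (?b - 1)" and lt: "W < 2 * 2 ^ (?b - 1)" by simp_all
      have "2 ^ (?b - 1) * (W div 2 ^ (?b - 1)) \<le> W"
        using mult_div_mod_eq[of "2 ^ (?b - 1)" W] pos_mod_sign[OF P, of W] by linarith
      then have "2 ^ (?b - 1) * (W div 2 ^ (?b - 1)) < 2 ^ (?b - 1) * 2" using lt by linarith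
      then have "W div 2 ^ (?b - 1) < 2" by (simp only: mult_less_cancel_left_pos[OF P])
      then show ?thesis using dpos[of "?b - 1"] False by simp
    qed
    then show ?thesis using main[of ?b] foldl_map False by simp
  qed
qed

text \<open>At step 1 the error from the edges leaving \<open>U\<close> disappears. All load of
  \<open>U\<close> then comes from edges inside it, and a nonempty \<open>U\<close> is violated; if
  \<open>U\<close> is empty, no vertex is overloaded and the orientation certifies all
  constraints.\<close>

lemma violated_correct:
  assumes n: "0 < n" and q0: "ori q0"
  defines "U \<equiv> violated c q0"
  shows "distinct U" "set U \<subseteq> set vs" "U \<noteq> [] \<Longrightarrow> (\<Sum>v\<in>set U. capv v) < wE (set U)"
    "U = [] \<Longrightarrow> T \<subseteq> set vs \<Longrightarrow> wE T \<le> (\<Sum>v\<in>T. capv v)"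
proof -
  let ?q = "orient c q0"
  note o = orient_stuck[OF q0 n]
  have U: "set U = fst ` set (reach c 1 ?q)" "distinct U"
    using reached_reach(1)[OF o(1), of 1] by (auto simp: U_def violated_def reached_def)
  note S = stuck_closed[OF o(1) zero_less_one o(2), folded U(1)]
  show "distinct U" "set U \<subseteq> set vs" using U S(1) by auto
  show "(\<Sum>v\<in>set U. capv v) < wE (set U)" if "U \<noteq> []"
  proof -
    let ?Init = "map (\<lambda>v. (v, ?q)) (filter (\<lambda>v. 1 \<le> load ?q v - capv v) vs)"
    have "?Init \<noteq> []"
    proof
      assume e: "?Init = []"
      have "reach c 1 ?q = (grow 1 ^^ n) ?Init" by (simp add: reach_def foldl_const_fun)
      moreover have "(grow 1 ^^ k) [] = []" for k by (induction k) (auto simp: grow_def cands_def)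
      ultimately have "reach c 1 ?q = []" using e by simp
      then show False using that by (simp add: U_def violated_def)
    qed
    then obtain s where s: "s \<in> set vs" "1 \<le> load ?q s - capv s" by (auto simp: filter_empty_conv)
    have "(\<Sum>v\<in>set U. capv v) < (\<Sum>v\<in>set U. load ?q v)"
    proof (rule sum_strict_mono_ex1)
      show "\<forall>v\<in>set U. capv v \<le> load ?q v" using S(3) by fastforce
      show "\<exists>v\<in>set U. capv v < load ?q v" using S(2)[OF s] s(2) by (intro bexI[of _ s]) auto
    qed simp
    then show ?thesis using S(4) by simp
  qed
  show "wE T \<le> (\<Sum>v\<in>T. capv v)" if "U = []" "T \<subseteq> set vs"
  proof -
    have "load ?q v \<le> capv v" if "v \<in> T" for v using S(2)[of v] \<open>U = []\<close> \<open>T \<subseteq> set vs\<close> that by force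
    then have "(\<Sum>v\<in>T. load ?q v) \<le> (\<Sum>v\<in>T. capv v)" by (rule sum_mono)
    then show ?thesis using load_ge[OF o(1), of T] that(2) finite_subset[of T "set vs"] by simp
  qed
qed

end

text \<open>The capacities of \<open>T\<close> add up to \<open>D * (card T - 1)\<close> if the root
  is in \<open>T\<close>, and to more otherwise. So a set found for any root violates its rank
  constraint, and a violated \<open>T\<close> is noticed at each root inside it.\<close>

lemma separating_set_correct:
  assumes vs: "distinct vs" "vs \<noteq> []"
    and ps: "\<And>i. i < length ps \<Longrightarrow> fst (ps ! i) \<in> set vs \<and> snd (ps ! i) \<in> set vs \<and> fst (ps ! i) \<noteq> snd (ps ! i)"
    and w: "length w = length ps" "\<And>i. i < length ps \<Longrightarrow> 0 \<le> w ! i" and D: "0 \<le> D"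
  defines "U \<equiv> separating_set D vs ps w"
  defines "wE \<equiv> \<lambda>T. \<Sum>i\<in>{i \<in> {..<length ps}. edge_of (ps ! i) \<subseteq> T}. w ! i"
  shows "U \<noteq> [] \<Longrightarrow> distinct U \<and> set U \<subseteq> set vs \<and> D * (int (length U) - 1) < wE (set U)"
    "U = [] \<Longrightarrow> T \<subseteq> set vs \<Longrightarrow> T \<noteq> {} \<Longrightarrow> wE T \<le> D * (int (card T) - 1)"
proof -
  let ?q = "zip ps (zip w w)"
  have O: "orientation vs ps w D" by unfold_locales (use vs ps w D in auto)
  have ori: "orientation.ori ps w ?q" unfolding orientation.ori_def[OF O] using w by auto
  have wE: "orientation.wE ps w T = wE T" for T
    unfolding orientation.wE_def[OF O] orientation.inside_def[OF O] wE_def by (simp add: edge_of_def)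
  have n: "0 < length vs" using vs by simp
  have capT: "(\<Sum>v\<in>T. cap (D, r, vs) v) = D * int (card (T - {r}))" if "finite T" for T r
  proof -
    have "(\<Sum>v\<in>T. cap (D, r, vs) v) = (\<Sum>v\<in>T - {r}. D)"
      by (rule sum.mono_neutral_cong_right) (use that in \<open>auto simp: cap_def\<close>)
    then show ?thesis by simp
  qed
  let ?f = "filter (\<lambda>U. length U \<noteq> 0) (map (\<lambda>r. violated (D, r, vs) ?q) vs)"
  show "distinct U \<and> set U \<subseteq> set vs \<and> D * (int (length U) - 1) < wE (set U)" if "U \<noteq> []"
  proof -
    have "U = (case ?f of [] \<Rightarrow> [] | U # Us \<Rightarrow> U)" by (simp only: U_def separating_set_def)
    then have "U \<in> set ?f" using that by (cases ?f) (auto simp del: filter.simps)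
    then obtain r where r: "U = violated (D, r, vs) ?q" by auto
    note V = orientation.violated_correct[OF O n ori, of r, folded r]
    have "card (set U) = length U" using V(1) by (rule distinct_card)
    have "D * (int (length U) - 1) \<le> D * int (card (set U - {r}))"
      using \<open>card (set U) = length U\<close> D card_Diff_singleton_if[of "set U" r] by (intro mult_left_mono) auto
    also have "\<dots> < wE (set U)" using V(3)[OF that] capT wE by simp
    finally show ?thesis using V(1,2) by blast
  qed
  show "wE T \<le> D * (int (card T) - 1)" if "U = []" "T \<subseteq> set vs" and ne: "T \<noteq> {}"
  proof -
    obtain r where r: "r \<in> T" using ne by auto
    have "U = (case ?f of [] \<Rightarrow> [] | U # Us \<Rightarrow> U)" by (simp only: U_def separating_set_def)
    then have "?f = []" using that(1) by (cases ?f) (auto dest: filter_eq_ConsD)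
    then have "violated (D, r, vs) ?q = []" using r that(2) by (auto simp: filter_empty_conv)
    from orientation.violated_correct(4)[OF O n ori this that(2)]
    have "wE T \<le> D * int (card (T - {r}))" using capT[of T r] wE finite_subset[OF that(2)] by simp
    moreover have "int (card (T - {r})) = int (card T) - 1"
      using r finite_subset[OF that(2)] card_gt_0_iff[of T] by (subst card_Diff_singleton) (auto simp: of_nat_diff Suc_leI)
    ultimately show ?thesis by simp
  qed
qed

subsection \<open>Running time\<close>

text \<open>A size invariant for arbitrary data, including negative weights and shares out of range:
  running times are claimed for all inputs, not only for orientations.\<close>

definition rel1 :: "(nat \<times> nat) \<times> int \<times> int \<Rightarrow> (nat \<times> nat) \<times> int \<times> int \<Rightarrow> bool" where
  "rel1 e f \<longleftrightarrow> fst f = fst e \<and> fst (snd f) = fst (snd e) \<and> min 0 (snd (snd e)) \<le> snd (snd f) \<and>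
     snd (snd f) \<le> max (max 0 (snd (snd e))) (fst (snd e))"

definition rel :: "oriented \<Rightarrow> oriented \<Rightarrow> bool" where
  "rel q q' \<longleftrightarrow> list_all2 rel1 q q'"

lemma rel_refl: "rel q q"
  by (auto simp: rel_def rel1_def list_all2_conv_all_nth)

lemma rel_trans: "rel q q' \<Longrightarrow> rel q' q'' \<Longrightarrow> rel q q''"
  unfolding rel_def by (erule (1) list_all2_trans[rotated]) (auto simp: rel1_def)

lemma rel_shift:
  assumes "rel q q'" "i < length q'"
    "(0 < \<delta> \<and> \<delta> \<le> snd (snd (q' ! i))) \<or> (\<delta> < 0 \<and> - \<delta> \<le> fst (snd (q' ! i)) - snd (snd (q' ! i)))"
  shows "rel q (shift_at i \<delta> q')"
proof (rule rel_trans[OF assms(1)])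
  show "rel q' (shift_at i \<delta> q')"
    unfolding rel_def list_all2_conv_all_nth using assms(2,3) by (auto simp: shift_at_nth rel1_def)
qed

lemma sz_rel: assumes "rel q q'" shows "sz q' \<le> 2 * sz q"
  using assms unfolding rel_def
proof (induction rule: list_all2_induct)
  case (Cons e q f q')
  have "\<bar>snd (snd f)\<bar> \<le> \<bar>\<bar>fst (snd e)\<bar> + \<bar>snd (snd e)\<bar>\<bar>" using Cons(1) by (auto simp: rel1_def)
  then have "bit_length (snd (snd f)) \<le> bit_length (\<bar>fst (snd e)\<bar> + \<bar>snd (snd e)\<bar>)" by (rule bit_length_mono)
  also have "\<dots> \<le> bit_length \<bar>fst (snd e)\<bar> + bit_length \<bar>snd (snd e)\<bar> + 1" by (rule bit_length_add)
  also have "\<dots> = bit_length (fst (snd e)) + bit_length (snd (snd e)) + 1" by (simp add: bit_length_def)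
  finally have "sz f \<le> 2 * sz e" using Cons(1) by (simp add: rel1_def sz_pair[of e] sz_pair[of f] sz_pair[of "snd e"] sz_pair[of "snd f"])
  then show ?case using Cons by simp
qed simp

definition okR :: "nat list \<Rightarrow> oriented \<Rightarrow> (nat \<times> oriented) list \<Rightarrow> bool" where
  "okR vs q R \<longleftrightarrow> (\<forall>p\<in>set R. rel q (snd p) \<and> sz (fst p) \<le> sz vs + sz q)"

lemma okR_grow: assumes R: "okR vs q R" shows "okR vs q (grow \<delta> R)" "length (grow \<delta> R) \<le> Suc (length R)"
proof -
  have "rel q (snd x) \<and> sz (fst x) \<le> sz vs + sz q" if x: "x \<in> set (cands \<delta> R)" for x
  proof -
    obtain p i where p: "p \<in> set R" "i < length (snd p)"
      and x': "(fst (fst (snd p ! i)) = fst p \<and> snd (fst (snd p ! i)) \<notin> fst ` set R \<and> 0 < \<delta> \<and> \<delta> \<le> snd (snd (snd p ! i)) \<and>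
         x = (snd (fst (snd p ! i)), shift_at i \<delta> (snd p))) \<or>
        (snd (fst (snd p ! i)) = fst p \<and> fst (fst (snd p ! i)) \<notin> fst ` set R \<and> 0 < \<delta> \<and>
         \<delta> \<le> fst (snd (snd p ! i)) - snd (snd (snd p ! i)) \<and> x = (fst (fst (snd p ! i)), shift_at i (- \<delta>) (snd p)))"
      using x unfolding mem_cands Let_def by blast
    have rp: "rel q (snd p)" using R p by (auto simp: okR_def)
    then have "length (snd p) = length q" "fst (snd p ! i) = fst (q ! i)"
      using p(2) by (auto simp: rel_def list_all2_conv_all_nth rel1_def)
    moreover have "sz (q ! i) < sz q" using p(2) calculation by (intro sz_ge_elem) simp
    ultimately have "sz (fst (fst (snd p ! i))) \<le> sz q" "sz (snd (fst (snd p ! i))) \<le> sz q"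
      using sz_pair[of "q ! i"] sz_pair[of "fst (q ! i)"] by simp_all
    then show ?thesis using x' rel_shift[OF rp p(2), of \<delta>] rel_shift[OF rp p(2), of "- \<delta>"] by auto
  qed
  then show "okR vs q (grow \<delta> R)" using R by (auto simp: okR_def grow_def split: list.split)
  show "length (grow \<delta> R) \<le> Suc (length R)" by (auto simp: grow_def split: list.split)
qed

lemma okR_reach: "okR (snd (snd c)) q (reach c \<delta> q)"
proof -
  have "okR (snd (snd c)) q (foldl (\<lambda>R x. grow \<delta> R) R xs)" if "okR (snd (snd c)) q R" for R and xs :: "nat list"
    using that by (induction xs arbitrary: R) (auto intro: okR_grow)
  moreover have "okR (snd (snd c)) q (map (\<lambda>v. (v, q)) (filter (\<lambda>v. \<delta> \<le> load q v - cap c v) (snd (snd c))))"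
    using sz_ge_elem[of _ "snd (snd c)"] rel_refl by (force simp: okR_def)
  ultimately show ?thesis unfolding reach_def by blast
qed

lemma rel_augment: "rel q (augment c \<delta> q)"
proof -
  have "rel q (snd p)" if "p \<in> set (reach c \<delta> q)" for p using okR_reach[of c q \<delta>] that by (auto simp: okR_def)
  note R = this
  show ?thesis
  proof (cases "filter (\<lambda>p. load q (fst p) + \<delta> \<le> cap c (fst p)) (reach c \<delta> q)")
    case Nil
    then show ?thesis by (simp add: augment_def rel_refl)
  next
    case (Cons p ps)
    have "p \<in> set (filter (\<lambda>p. load q (fst p) + \<delta> \<le> cap c (fst p)) (reach c \<delta> q))" unfolding Cons by simp
    then have "p \<in> set (reach c \<delta> q)" by simp
    then show ?thesis using R[of p] Cons by (simp add: augment_def)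
  qed
qed

lemma rel_phase: "rel q (phase c q \<delta>)"
proof -
  have "rel q (foldl (\<lambda>s x. augment c \<delta> s) s xs)" if "rel q s" for s and xs :: "int list"
    using that by (induction xs arbitrary: s) (auto dest: rel_trans[OF _ rel_augment])
  then show ?thesis unfolding phase_def using rel_refl by blast
qed

lemma pt_cap [pt]: "pt f \<Longrightarrow> pt g \<Longrightarrow> pt (\<lambda>a. cap (f a) (g a))"
  by (rule pt_app2[of cap]; assumption?) (unfold cap_def, intro pt)

lemma pt_load [pt]: "pt f \<Longrightarrow> pt g \<Longrightarrow> pt (\<lambda>a. load (f a) (g a))"
  by (rule pt_app2[of load]; assumption?) (unfold load_def, intro pt)

lemma pt_shift_at [pt]: "pt f \<Longrightarrow> pt g \<Longrightarrow> pt h \<Longrightarrow> pt (\<lambda>a. shift_at (f a) (g a) (h a))"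
  by (rule pt_app3[of shift_at]; assumption?) (unfold shift_at_def, intro pt)

lemma pt_cands [pt]: "pt f \<Longrightarrow> pt g \<Longrightarrow> pt (\<lambda>a. cands (f a) (g a))"
  by (rule pt_app2[of cands]; assumption?) (unfold cands_def, intro pt)

lemma pt_grow [pt]: "pt f \<Longrightarrow> pt g \<Longrightarrow> pt (\<lambda>a. grow (f a) (g a))"
  by (rule pt_app2[of grow]; assumption?) (unfold grow_def, intro pt)

text \<open>Every search entry carries a complete orientation, which makes the list quadratic in the
  input size.\<close>

lemma pt_reach [pt]: assumes "pt f" "pt g" "pt h" shows "pt (\<lambda>a. reach (f a) (g a) (h a))"
proof (rule pt_app3[of reach, OF _ assms])
  let ?vs = "\<lambda>p::(int \<times> nat \<times> nat list) \<times> int \<times> oriented. snd (snd (fst p))"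
  let ?q = "\<lambda>p::(int \<times> nat \<times> nat list) \<times> int \<times> oriented. snd (snd p)"
  let ?d = "\<lambda>p::(int \<times> nat \<times> nat list) \<times> int \<times> oriented. fst (snd p)"
  show "pt (\<lambda>p. reach (fst p) (?d p) (?q p))" unfolding reach_def
  proof (rule pt_foldl[where J = "\<lambda>p k R. length R \<le> length (?vs p) + k \<and> okR (?vs p) (?q p) R"
        and G = "\<lambda>p. 1 + (2 * sz p) * (4 * sz p + 1)"])
    show "pbnd (\<lambda>p::(int \<times> nat \<times> nat list) \<times> int \<times> oriented. 1 + (2 * sz p) * (4 * sz p + 1))" by (intro pb)
    show "length (map (\<lambda>v. (v, ?q p)) (filter (\<lambda>v. ?d p \<le> load (?q p) v - cap (fst p) v) (?vs p))) \<le> length (?vs p) + 0 \<and>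
      okR (?vs p) (?q p) (map (\<lambda>v. (v, ?q p)) (filter (\<lambda>v. ?d p \<le> load (?q p) v - cap (fst p) v) (?vs p)))" for p
      using sz_ge_elem[of _ "?vs p"] rel_refl by (force simp: okR_def)
    show "length (grow (?d p) R) \<le> length (?vs p) + Suc k \<and> okR (?vs p) (?q p) (grow (?d p) R)"
      if "length R \<le> length (?vs p) + k \<and> okR (?vs p) (?q p) R" for p k R
      using that okR_grow[of "?vs p" "?q p" R "?d p"] by auto
    show "sz R \<le> 1 + (2 * sz p) * (4 * sz p + 1)"
      if a: "length R \<le> length (?vs p) + k \<and> okR (?vs p) (?q p) R" "k \<le> length (?vs p)" for p k R
    proof -
      have s: "sz (?vs p) + sz (?q p) + 1 \<le> sz p"
        using sz_pair[of p] sz_pair[of "fst p"] sz_pair[of "snd (fst p)"] sz_pair[of "snd p"] by linarith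
      have "sz R \<le> 1 + length R * (4 * sz p + 1)"
      proof (rule sz_list_le)
        fix x assume "x \<in> set R"
        then have "rel (?q p) (snd x)" "sz (fst x) \<le> sz (?vs p) + sz (?q p)" using a(1) by (auto simp: okR_def)
        then show "sz x \<le> 4 * sz p" using sz_rel[of "?q p" "snd x"] s sz_pair[of x] by linarith
      qed
      also have "\<dots> \<le> 1 + (2 * sz p) * (4 * sz p + 1)"
        using a s sz_ge_length[of "?vs p"] by (intro add_left_mono mult_right_mono) linarith+
      finally show ?thesis .
    qed
  qed (intro pt)+
qed

lemma pt_augment [pt]: "pt f \<Longrightarrow> pt g \<Longrightarrow> pt h \<Longrightarrow> pt (\<lambda>a. augment (f a) (g a) (h a))"
  by (rule pt_app3[of augment]; assumption?) (unfold augment_def, intro pt)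

lemma pt_attempts [pt]: "pt f \<Longrightarrow> pt g \<Longrightarrow> pt (\<lambda>a. attempts (f a) (g a))"
  by (rule pt_app2[of attempts]; assumption?) (unfold attempts_def, intro pt)

lemma pt_phase [pt]: assumes "pt f" "pt g" "pt h" shows "pt (\<lambda>a. phase (f a) (g a) (h a))"
proof (rule pt_app3[of phase, OF _ assms])
  let ?q = "\<lambda>p::(int \<times> nat \<times> nat list) \<times> oriented \<times> int. fst (snd p)"
  show "pt (\<lambda>p. phase (fst p) (?q p) (snd (snd p)))" unfolding phase_def
  proof (rule pt_foldl[where J = "\<lambda>p k s. rel (?q p) s" and G = "\<lambda>p. 2 * sz p"])
    show "sz s \<le> 2 * sz p" if "rel (?q p) s" for p s
      using sz_rel[OF that] sz_pair[of p] sz_pair[of "snd p"] by linarith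
  qed (auto intro: rel_refl rel_trans rel_augment intro!: pb | intro pt)+
qed

lemma pt_orient [pt]: assumes "pt f" "pt g" shows "pt (\<lambda>a. orient (f a) (g a))"
proof (rule pt_app2[of orient, OF _ assms])
  show "pt (\<lambda>p. orient (fst p) (snd p))" unfolding orient_def
  proof (rule pt_foldl[where J = "\<lambda>p k s. rel (snd p) s" and G = "\<lambda>p. 2 * sz p"])
    show "sz s \<le> 2 * sz p" if "rel (snd p) s" for p :: "(int \<times> nat \<times> nat list) \<times> oriented" and s
      using sz_rel[OF that] sz_pair[of p] by linarith
  qed (auto intro: rel_refl rel_trans rel_phase intro!: pb | intro pt)+
qed

lemma pt_violated [pt]: "pt f \<Longrightarrow> pt g \<Longrightarrow> pt (\<lambda>a. violated (f a) (g a))"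
  by (rule pt_app2[of violated]; assumption?) (unfold violated_def, intro pt)

lemma pt_separating_set [pt]: "pt f \<Longrightarrow> pt g \<Longrightarrow> pt h \<Longrightarrow> pt k \<Longrightarrow> pt (\<lambda>a. separating_set (f a) (g a) (h a) (k a))"
  by (rule pt_app4[of separating_set]; assumption?) (unfold separating_set_def, intro pt)

section \<open>The rounding algorithm\<close>

definition rowE :: "(nat \<times> nat) list \<Rightarrow> nat list \<Rightarrow> int list" where
  "rowE ps U = map (\<lambda>p. if fst p \<in> set U \<and> snd p \<in> set U then 1 else 0) ps"

definition rowC :: "(nat \<times> nat) list \<Rightarrow> nat list \<Rightarrow> int list" where
  "rowC ps U = map (\<lambda>p. if (fst p \<in> set U) \<noteq> (snd p \<in> set U) then 1 else 0) ps"

text \<open>A state \<open>(D, w, K)\<close> of the algorithm stands for the point \<open>w / D\<close>; the list \<open>K\<close> holds the rank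
  rows found to be tight. Each entry of \<open>LS\<close> consists of the rank row, the cut row and the bound \<open>k S\<close> of
  a set of the laminar family.\<close>

definition supp_count :: "int list \<Rightarrow> int list \<Rightarrow> int" where
  "supp_count r w = sum_list (map (\<lambda>p. if fst p = 1 \<and> 0 < snd p then 1 else 0) (zip r w))"

definition active :: "(int list \<times> int list \<times> int) list \<Rightarrow> int list \<Rightarrow> (int list \<times> int list \<times> int) list" where
  "active LS w = filter (\<lambda>l. 2 * snd (snd l) + 1 < supp_count (fst (snd l)) w) LS"

text \<open>The equations imposed on a direction: rank rows of the family, recorded rank rows, tight
  active cuts, and coordinates that are already integral.\<close>

definition tight_rows :: "(nat \<times> nat) list \<Rightarrow> (int list \<times> int list \<times> int) list \<Rightarrow> int \<times> int list \<times> int list list \<Rightarrow> int list list" where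
  "tight_rows ps LS s = map fst LS @ snd (snd s) @
     map (\<lambda>l. fst (snd l)) (filter (\<lambda>l. dot (fst (snd l)) (fst (snd s)) = snd (snd l) * fst s) (active LS (fst (snd s)))) @
     map (\<lambda>i. unit ps i) (filter (\<lambda>i. nth0 (fst (snd s)) i = 0 \<or> nth0 (fst (snd s)) i = fst s) [0..<length ps])"

text \<open>Fractions of slack and rate for nonnegativity and for active cuts. The upper bound 1 of
  a coordinate is the rank constraint of its two ends and is left to the separation.\<close>

definition bounds :: "(int list \<times> int list \<times> int) list \<Rightarrow> int \<times> int list \<times> int list list \<Rightarrow> int list \<Rightarrow> (int \<times> int) list" where
  "bounds LS s d = concat (map (\<lambda>p. if snd p < 0 then [(fst p, - snd p)] else []) (zip (fst (snd s)) d)) @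
     concat (map (\<lambda>l. if 0 < dot (fst (snd l)) d
       then [(snd (snd l) * fst s - dot (fst (snd l)) (fst (snd s)), dot (fst (snd l)) d)] else []) (active LS (fst (snd s))))"

definition min_frac :: "(int \<times> int) list \<Rightarrow> int \<times> int" where
  "min_frac fs = (case fs of [] \<Rightarrow> (0, 1) | f # gs \<Rightarrow>
     foldl (\<lambda>m g. if fst g * snd m < fst m * snd g then g else m) f gs)"

definition sum_abs :: "int list \<Rightarrow> int" where
  "sum_abs d = sum_list (map (\<lambda>a. \<bar>a\<bar>) d)"

text \<open>The fraction \<open>f\<close> is a step length that violates a rank constraint. The rank constraints become
  tight at step lengths whose denominators are at most \<open>sum_abs d\<close>; an interval of length less than
  \<open>1 / (sum_abs d)\<^sup>2\<close> contains only one of them. So every set violated at the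
  upper end, but not at the lower end, becomes tight at the largest feasible step length.\<close>

definition bisect :: "nat list \<Rightarrow> (nat \<times> nat) list \<Rightarrow> int \<times> int list \<times> int list \<Rightarrow> int \<times> int \<Rightarrow> int \<times> int" where
  "bisect vs ps s f = foldl (\<lambda>t x.
      if length (separating_set (2 * snd t * fst s) vs ps
           (comb (2 * snd t) (fst (snd s)) (2 * fst t + fst f) (snd (snd s)))) = 0
      then (2 * fst t + fst f, 2 * snd t) else (2 * fst t, 2 * snd t))
    (0, snd f) (halves (max 0 (fst f * sum_abs (snd (snd s)) * sum_abs (snd (snd s)))))"

text \<open>When a rank constraint blocks, the step length is computed exactly from the blocking
  set, as its slack over its rate. The bisection serves only to select this set.\<close>

definition advance :: "nat list \<Rightarrow> (nat \<times> nat) list \<Rightarrow> int \<times> int list \<times> int list \<Rightarrow> int \<times> int \<Rightarrow> (int \<times> int) \<times> int list list" where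
  "advance vs ps s f =
    (if length (separating_set (snd f * fst s) vs ps (comb (snd f) (fst (snd s)) (fst f) (snd (snd s)))) = 0 then (f, [])
     else (let t = bisect vs ps s f;
               U = separating_set (snd t * fst s) vs ps (comb (snd t) (fst (snd s)) (fst t + fst f) (snd (snd s)));
               r = rowE ps U
           in ((fst s * (int (length U) - 1) - dot r (fst (snd s)), dot r (snd (snd s))), [r])))"

definition step_dir :: "nat list \<Rightarrow> (nat \<times> nat) list \<Rightarrow> (int list \<times> int list \<times> int) list \<Rightarrow> int \<times> int list \<times> int list list \<Rightarrow>
    int list \<Rightarrow> int \<times> int list \<times> int list list" where
  "step_dir vs ps LS s d = (let h = advance vs ps (fst s, fst (snd s), d) (min_frac (bounds LS s d)) in
     (snd (fst h) * fst s, comb (snd (fst h)) (fst (snd s)) (fst (fst h)) d, snd h @ snd (snd s)))"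

definition step :: "nat list \<times> (nat \<times> nat) list \<times> (int list \<times> int list \<times> int) list \<times> int list \<Rightarrow>
    int \<times> int list \<times> int list list \<Rightarrow> int \<times> int list \<times> int list list" where
  "step c s = (case kernel_basis (fst (snd c)) (tight_rows (fst (snd c)) (fst (snd (snd c))) s) of [] \<Rightarrow> s
     | b # bs \<Rightarrow> step_dir (fst c) (fst (snd c)) (fst (snd (snd c))) s
        (if 0 < dot (snd (snd (snd c))) (snd b) then map (\<lambda>a. - a) (snd b) else snd b))"

section \<open>Smallest fractions and independent rows\<close>

lemma min_frac_correct:
  assumes "fs \<noteq> []" "\<And>f. f \<in> set fs \<Longrightarrow> 0 < snd f"
  shows "min_frac fs \<in> set fs" "f \<in> set fs \<Longrightarrow> fst (min_frac fs) * snd f \<le> fst f * snd (min_frac fs)"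
proof -
  let ?g = "\<lambda>m g. if fst g * snd m < fst m * snd g then g else (m :: int \<times> int)"
  have *: "foldl ?g f gs \<in> insert f (set gs) \<and> (\<forall>h\<in>insert f (set gs). fst (foldl ?g f gs) * snd h \<le> fst h * snd (foldl ?g f gs))"
    if "\<And>h. h \<in> insert f (set gs) \<Longrightarrow> 0 < snd h" for f gs
    using that
  proof (induction gs rule: rev_induct)
    case (snoc g gs)
    let ?m = "foldl ?g f gs"
    have IH: "?m \<in> insert f (set gs)" "\<And>h. h \<in> insert f (set gs) \<Longrightarrow> fst ?m * snd h \<le> fst h * snd ?m"
      using snoc by auto
    have pall: "\<And>h. h \<in> insert f (set (gs @ [g])) \<Longrightarrow> 0 < snd h" using snoc.prems by blast
    have "0 < snd ?m" by (rule pall) (use IH(1) in auto)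
    moreover have "0 < snd g" by (rule pall) simp
    moreover have "0 < snd h" if "h \<in> insert f (set gs)" for h by (rule pall) (use that in auto)
    ultimately have pos: "0 < snd ?m" "0 < snd g" "\<And>h. h \<in> insert f (set gs) \<Longrightarrow> 0 < snd h" by blast+
    show ?case
    proof (cases "fst g * snd ?m < fst ?m * snd g")
      case True
      have "fst g * snd h \<le> fst h * snd g" if h: "h \<in> insert f (set gs)" for h
      proof -
        have "(fst g * snd h) * snd ?m \<le> (fst ?m * snd h) * snd g"
          using True pos(3)[OF h] mult_right_mono[of "fst g * snd ?m" "fst ?m * snd g" "snd h"] by (simp add: algebra_simps)
        also have "\<dots> \<le> (fst h * snd ?m) * snd g" using IH(2)[OF h] pos by (intro mult_right_mono) auto
        finally have "(fst g * snd h) * snd ?m \<le> (fst h * snd g) * snd ?m" by (simp add: algebra_simps)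
        then show ?thesis using pos(1) by simp
      qed
      then show ?thesis using True by auto
    next
      case False
      then show ?thesis using IH by auto
    qed
  qed simp
  obtain f0 gs where fs: "fs = f0 # gs" using assms(1) by (cases fs) auto
  have "min_frac fs \<in> insert f0 (set gs) \<and> (\<forall>h\<in>insert f0 (set gs). fst (min_frac fs) * snd h \<le> fst h * snd (min_frac fs))"
    using *[of f0 gs] assms(2) fs by (simp add: min_frac_def)
  then show "min_frac fs \<in> set fs" "f \<in> set fs \<Longrightarrow> fst (min_frac fs) * snd f \<le> fst f * snd (min_frac fs)"
    using fs by auto
qed

lemma abs_dot_le: "row01 (length d) r \<Longrightarrow> \<bar>dot r d\<bar> \<le> sum_abs d"
proof -
  assume r: "row01 (length d) r"
  have "\<bar>dot r d\<bar> \<le> (\<Sum>i<length d. \<bar>r ! i * d ! i\<bar>)"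
    using r by (simp add: dot_sum[of _ "length d"] row01_def sum_abs)
  also have "\<dots> \<le> (\<Sum>i<length d. \<bar>d ! i\<bar>)"
    by (rule sum_mono) (use row01_nth[OF r] in fastforce)
  also have "\<dots> = sum_abs d" by (simp add: sum_abs_def sum_list_sum_nth atLeast0LessThan)
  finally show ?thesis .
qed

text \<open>Linear independence with witnesses: each row is nonzero on a vector that annihilates all
  earlier ones. The direction of a blocked step is such a vector.\<close>

fun indep :: "nat \<Rightarrow> int list list \<Rightarrow> bool" where
  "indep m [] = True"
| "indep m (r # K) \<longleftrightarrow> indep m K \<and> row01 m r \<and> (\<exists>d. length d = m \<and> dot r d \<noteq> 0 \<and> (\<forall>s\<in>set K. dot s d = 0))"

lemma indep_row01: "indep m K \<Longrightarrow> r \<in> set K \<Longrightarrow> row01 m r"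
  by (induction K) auto

text \<open>Multiplying a vanishing combination with the witness of the first row leaves only its
  coefficient.\<close>

lemma indep_sum_zero:
  assumes "indep m K" "\<And>i. i < m \<Longrightarrow> (\<Sum>j<length K. K ! j ! i * a j) = 0" "j < length K"
  shows "a j = (0::int)"
  using assms
proof (induction K arbitrary: a j)
  case (Cons r K)
  obtain d where d: "length d = m" "dot r d \<noteq> 0" "\<And>s. s \<in> set K \<Longrightarrow> dot s d = 0" using Cons.prems(1) by auto
  have row: "length s = m" if "s \<in> set (r # K)" for s using indep_row01[OF Cons.prems(1) that] by (simp add: row01_def)
  have sp: "(\<Sum>j<length (r # K). (r # K) ! j ! i * a j) = r ! i * a 0 + (\<Sum>j<length K. K ! j ! i * a (Suc j))" for i
    by (simp add: sum.lessThan_Suc_shift del: sum.lessThan_Suc)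
  have "0 = (\<Sum>i<m. d ! i * (r ! i * a 0 + (\<Sum>j<length K. K ! j ! i * a (Suc j))))"
    using Cons.prems(2) unfolding sp by simp
  also have "\<dots> = a 0 * dot r d + (\<Sum>i<m. \<Sum>j<length K. a (Suc j) * (K ! j ! i * d ! i))"
    using row[of r] d(1) by (simp add: dot_sum[of _ m] distrib_left sum.distrib sum_distrib_left mult_ac)
  also have "(\<Sum>i<m. \<Sum>j<length K. a (Suc j) * (K ! j ! i * d ! i)) = (\<Sum>j<length K. a (Suc j) * dot (K ! j) d)"
    using row d(1) by (subst sum.swap) (simp add: dot_sum[of _ m] sum_distrib_left)
  also have "\<dots> = 0" using d(3) by simp
  finally have a0: "a 0 = 0" using d(2) by simp
  have "a (Suc j') = 0" if "j' < length K" for j'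
    by (rule Cons.IH[of "\<lambda>j. a (Suc j)"]) (use Cons.prems a0 that sp in auto)
  then show ?case using a0 Cons.prems(3) by (cases j) auto
qed simp

lemma indep_length: assumes "indep m K" shows "length K \<le> m"
proof (rule ccontr)
  assume "\<not> ?thesis"
  then have c: "card {..<m} < card {..<length K}" by simp
  define a where "a i j = (if i < m \<and> j < length K then K ! j ! i else 0)" for i j
  have a: "a i j \<in> {0, 1}" for i j
    using row01_nth[OF indep_row01[OF assms nth_mem]] by (auto simp: a_def)
  obtain d :: "nat \<Rightarrow> int" where d: "\<exists>j\<in>{..<length K}. d j \<noteq> 0" "\<And>j. j \<notin> {..<length K} \<Longrightarrow> d j = 0"
    "\<And>i. i \<in> {..<m} \<Longrightarrow> (\<Sum>j<length K. a i j * d j) = 0"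
    using a by (rule integer_kernel_vector[where a = a, OF finite_lessThan finite_lessThan c]) blast
  have "(\<Sum>j<length K. K ! j ! i * d j) = 0" if "i < m" for i
    using d(3)[of i] that by (simp add: a_def)
  then show False using d(1) indep_sum_zero[OF assms, of d] by auto
qed

text \<open>Only the sign of the cost of a direction matters, so the costs enter as an integer
  vector \<open>cv\<close>, which is \<open>c\<close> times the positive number
  \<open>\<gamma>\<close>.\<close>

locale algorithm = relaxation "set vs" "{..<length ps}" "\<lambda>i. edge_of (ps ! i)" "(\<lambda>l. set (fst l)) ` set ls" k c c0
  for vs :: "nat list" and ps :: "(nat \<times> nat) list" and ls :: "(nat list \<times> int) list" and k c c0 +
  fixes cv :: "int list" and \<gamma> :: real
  assumes dvs: "distinct vs" and kl: "\<And>l. l \<in> set ls \<Longrightarrow> k (set (fst l)) = snd l"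
    and cv: "length cv = length ps" "0 < \<gamma>" "\<And>i. i < length ps \<Longrightarrow> c i = of_int (cv ! i) / \<gamma>"
begin

abbreviation "m \<equiv> length ps"

definition "LS = map (\<lambda>l. (rowE ps (fst l), rowC ps (fst l), snd l)) ls"

abbreviation "x_of D w \<equiv> (\<lambda>i. real_of_int (w ! i) / real_of_int D)"

lemma ps_ends: "i < m \<Longrightarrow> fst (ps ! i) \<in> set vs \<and> snd (ps ! i) \<in> set vs \<and> fst (ps ! i) \<noteq> snd (ps ! i)"
  using ends[of i] by (auto simp: edge_of_def card_2_iff)

lemma row01_rowE: "row01 m (rowE ps U)" and row01_rowC: "row01 m (rowC ps U)"
  by (auto simp: row01_def rowE_def rowC_def)

lemma dot_rowE: "length v = m \<Longrightarrow> dot (rowE ps U) v = (\<Sum>i\<in>EI (set U). v ! i)"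
proof -
  assume v: "length v = m"
  have "dot (rowE ps U) v = (\<Sum>i<m. if edge_of (ps ! i) \<subseteq> set U then v ! i else 0)"
    using v by (simp add: dot_sum[of _ m] rowE_def edge_of_def) (rule sum.cong, auto)
  also have "\<dots> = (\<Sum>i\<in>EI (set U). v ! i)" by (simp add: EI_def sum.inter_filter[symmetric])
  finally show ?thesis .
qed

lemma mem_cutI: "i < m \<Longrightarrow> i \<in> cutI S \<longleftrightarrow> (fst (ps ! i) \<in> S) \<noteq> (snd (ps ! i) \<in> S)"
  unfolding cutI_def using ps_ends[of i]
  by (cases "fst (ps ! i) \<in> S"; cases "snd (ps ! i) \<in> S") (auto simp: edge_of_def)

lemma dot_rowC: "length v = m \<Longrightarrow> dot (rowC ps U) v = (\<Sum>i\<in>cutI (set U). v ! i)"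
proof -
  assume v: "length v = m"
  have "dot (rowC ps U) v = (\<Sum>i<m. if i \<in> cutI (set U) then v ! i else 0)"
    using v mem_cutI by (simp add: dot_sum[of _ m] rowC_def) (rule sum.cong, auto)
  also have "\<dots> = sum (\<lambda>i. v ! i) ({..<m} \<inter> cutI (set U))" by (simp add: sum.inter_restrict)
  also have "{..<m} \<inter> cutI (set U) = cutI (set U)" by (auto simp: cutI_def)
  finally show ?thesis .
qed

lemma supp_count_rowC: "length w = m \<Longrightarrow> 0 < D \<Longrightarrow> supp_count (rowC ps S) w = int (card {i \<in> cutI (set S). 0 < x_of D w i})"
proof -
  assume w: "length w = m" and D: "0 < D"
  have "supp_count (rowC ps S) w = (\<Sum>i<m. if i \<in> cutI (set S) \<and> 0 < w ! i then 1 else 0)"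
    using w mem_cutI by (simp add: supp_count_def rowC_def sum_list_sum_nth atLeast0LessThan) (rule sum.cong, auto)
  also have "\<dots> = int (card {i \<in> {..<m}. i \<in> cutI (set S) \<and> 0 < w ! i})" by (simp add: sum.inter_filter[symmetric])
  also have "{i \<in> {..<m}. i \<in> cutI (set S) \<and> 0 < w ! i} = {i \<in> cutI (set S). 0 < x_of D w i}"
    using D by (auto simp: cutI_def zero_less_divide_iff)
  finally show ?thesis .
qed

lemma set_active:
  assumes "length w = m" "0 < D"
  shows "set (active LS w) = (\<lambda>l. (rowE ps (fst l), rowC ps (fst l), snd l)) ` {l \<in> set ls. act (x_of D w) (set (fst l))}"
proof -
  have "set (active LS w) = (\<lambda>l. (rowE ps (fst l), rowC ps (fst l), snd l)) `
      {l \<in> set ls. 2 * snd l + 1 < supp_count (rowC ps (fst l)) w}"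
    by (simp add: active_def LS_def filter_map comp_def)
  also have "{l \<in> set ls. 2 * snd l + 1 < supp_count (rowC ps (fst l)) w} = {l \<in> set ls. act (x_of D w) (set (fst l))}"
    by (intro Collect_cong conj_cong refl) (simp add: act_def supp_count_rowC[OF assms] kl)
  finally show ?thesis .
qed

lemma sum_x_of: "sum (x_of D w) A = real_of_int (\<Sum>i\<in>A. w ! i) / real_of_int D"
  by (simp add: sum_divide_distrib)

definition "good s \<longleftrightarrow> 0 < fst s \<and> length (fst (snd s)) = m \<and> feas (x_of (fst s) (fst (snd s))) \<and> indep m (snd (snd s)) \<and>
   (\<forall>r\<in>set (snd (snd s)). \<exists>U. r = rowE ps U \<and> tight (x_of (fst s) (fst (snd s))) (set U))"

definition "potential s = card (integral (x_of (fst s) (fst (snd s)))) + card (settled (x_of (fst s) (fst (snd s)))) + length (snd (snd s))"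

text \<open>Recorded rows stand in for the tight sets counted in the existence proof. Being
  independent, there are at most \<open>m\<close> of them, which makes the bound polynomial.\<close>

lemma potential_le: assumes "good s" shows "potential s \<le> 2 * m + length ls"
proof -
  let ?x = "x_of (fst s) (fst (snd s))"
  have "card (integral ?x) \<le> card {..<m}" by (rule card_mono) (auto simp: integral_def)
  moreover have "card (settled ?x) \<le> card ((\<lambda>l. set (fst l)) ` set ls)" by (rule card_mono) (auto simp: settled_def)
  moreover have "card ((\<lambda>l. set (fst l)) ` set ls) \<le> length ls" by (meson card_image_le card_length finite_set le_trans)
  moreover have "length (snd (snd s)) \<le> m" using assms indep_length by (auto simp: good_def)
  ultimately show ?thesis by (simp add: potential_def)
qed

lemma row01_tight_rows: assumes "good s" "r \<in> set (tight_rows ps LS s)" shows "row01 m r"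
  using assms row01_rowE row01_rowC row01_unit indep_row01
  by (fastforce simp: tight_rows_def LS_def active_def good_def)

lemma tight_rows_kill:
  assumes g: "good s" and d: "length d = m"
  defines "x \<equiv> x_of (fst s) (fst (snd s))"
  shows "(\<forall>r\<in>set (tight_rows ps LS s). dot r d = 0) \<longleftrightarrow>
    (\<forall>S\<in>(\<lambda>l. set (fst l)) ` set ls. (\<Sum>i\<in>EI S. d ! i) = 0) \<and> (\<forall>r\<in>set (snd (snd s)). dot r d = 0) \<and>
    (\<forall>S\<in>tcut x. (\<Sum>i\<in>cutI S. d ! i) = 0) \<and> (\<forall>i\<in>integral x. d ! i = 0)"
proof -
  let ?D = "fst s" let ?w = "fst (snd s)"
  have D: "0 < ?D" "length ?w = m" using g by (auto simp: good_def)
  have a: "(\<forall>r\<in>set (map fst LS). dot r d = 0) \<longleftrightarrow> (\<forall>S\<in>(\<lambda>l. set (fst l)) ` set ls. (\<Sum>i\<in>EI S. d ! i) = 0)"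
    using dot_rowE[OF d] by (auto simp: LS_def)
  have t: "dot (rowC ps (fst l)) ?w = snd l * ?D \<longleftrightarrow> sum x (cutI (set (fst l))) = of_int (k (set (fst l)))" if "l \<in> set ls" for l
  proof -
    have "sum x (cutI (set (fst l))) = real_of_int (dot (rowC ps (fst l)) ?w) / real_of_int ?D"
      unfolding x_def sum_x_of dot_rowC[OF D(2)] by simp
    moreover have "dot (rowC ps (fst l)) ?w = snd l * ?D \<longleftrightarrow> real_of_int (dot (rowC ps (fst l)) ?w) = real_of_int (snd l) * real_of_int ?D"
      by (metis of_int_eq_iff of_int_mult)
    ultimately show ?thesis using D(1) kl[OF that] by (simp add: nonzero_divide_eq_eq)
  qed
  have b: "(\<forall>r\<in>set (map (\<lambda>l. fst (snd l)) (filter (\<lambda>l. dot (fst (snd l)) ?w = snd (snd l) * ?D) (active LS ?w))). dot r d = 0) \<longleftrightarrow>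
      (\<forall>S\<in>tcut x. (\<Sum>i\<in>cutI S. d ! i) = 0)"
  proof -
    have "set (map (\<lambda>l. fst (snd l)) (filter (\<lambda>l. dot (fst (snd l)) ?w = snd (snd l) * ?D) (active LS ?w))) =
      (\<lambda>l. rowC ps (fst l)) ` {l \<in> set ls. set (fst l) \<in> tcut x}"
    proof -
      have "set (map (\<lambda>l. fst (snd l)) (filter (\<lambda>l. dot (fst (snd l)) ?w = snd (snd l) * ?D) (active LS ?w))) =
        (\<lambda>l. rowC ps (fst l)) ` {l \<in> set ls. act x (set (fst l)) \<and> dot (rowC ps (fst l)) ?w = snd l * ?D}"
        unfolding set_map set_filter set_active[OF D(2,1)] x_def[symmetric] by force
      also have "{l \<in> set ls. act x (set (fst l)) \<and> dot (rowC ps (fst l)) ?w = snd l * ?D} = {l \<in> set ls. set (fst l) \<in> tcut x}"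
        by (rule Collect_cong) (use t in \<open>auto simp: tcut_def\<close>)
      finally show ?thesis .
    qed
    then have "?thesis \<longleftrightarrow> ((\<forall>l\<in>set ls. set (fst l) \<in> tcut x \<longrightarrow> (\<Sum>i\<in>cutI (set (fst l)). d ! i) = 0) \<longleftrightarrow>
        (\<forall>S\<in>tcut x. (\<Sum>i\<in>cutI S. d ! i) = 0))" using dot_rowC[OF d] by (simp only:) auto
    moreover have "tcut x \<subseteq> (\<lambda>l. set (fst l)) ` set ls" by (auto simp: tcut_def)
    ultimately show ?thesis by blast
  qed
  have u: "(\<forall>r\<in>set (map (\<lambda>i. unit ps i) (filter (\<lambda>i. nth0 ?w i = 0 \<or> nth0 ?w i = ?D) [0..<m])). dot r d = 0) \<longleftrightarrow>
      (\<forall>i\<in>integral x. d ! i = 0)"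
    using D dot_unit[OF d] by (auto simp: integral_def x_def nth0_eq)
  show ?thesis unfolding tight_rows_def set_append ball_Un a b u by blast
qed

lemma integral_all_kernel: assumes g: "good s" and "integral (x_of (fst s) (fst (snd s))) = {..<m}"
  shows "kernel_basis ps (tight_rows ps LS s) = []"
proof (rule ccontr)
  assume "\<not> ?thesis"
  then obtain p where p: "p \<in> set (kernel_basis ps (tight_rows ps LS s))" by (meson hd_in_set)
  note k = kernel_rows[OF p row01_tight_rows[OF g]]
  have "\<forall>i\<in>{..<m}. snd p ! i = 0" using tight_rows_kill[OF g k(1)] k(3) assms(2) by auto
  then show False using k(2) by auto
qed

text \<open>The direction respecting all tight sets, recorded or not, lies in the kernel of the rows
  imposed. So the basis can be empty only at an integral point.\<close>

lemma kernel_Nil_integral: assumes g: "good s" and "kernel_basis ps (tight_rows ps LS s) = []"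
  shows "integral (x_of (fst s) (fst (snd s))) = {..<m}"
proof (rule ccontr)
  define x where "x = x_of (fst s) (fst (snd s))"
  assume "\<not> ?thesis"
  then have ne: "integral x \<noteq> {..<m}" by (simp add: x_def)
  have fx: "feas x" using g by (simp add: good_def x_def)
  obtain d :: "nat \<Rightarrow> int" where d: "\<exists>i\<in>{..<m}. d i \<noteq> 0" "\<And>i. i \<in> integral x \<Longrightarrow> d i = 0"
    "\<And>U. tight x U \<Longrightarrow> sum d (EI U) = 0" "\<And>S. S \<in> tcut x \<Longrightarrow> sum d (cutI S) = 0"
    using direction_exists[OF fx ne] by metis
  define e where "e = map d [0..<m]"
  have e: "length e = m" "\<And>i. i < m \<Longrightarrow> e ! i = d i" by (auto simp: e_def)
  have se: "(\<Sum>i\<in>A. e ! i) = sum d A" if "A \<subseteq> {..<m}" for A by (rule sum.cong) (use that e in auto)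
  have sub: "EI U \<subseteq> {..<m}" "cutI U \<subseteq> {..<m}" for U by (auto simp: EI_def cutI_def)
  have "\<forall>r\<in>set (tight_rows ps LS s). dot r e = 0"
    unfolding tight_rows_kill[OF g e(1)] x_def[symmetric]
  proof (intro conjI ballI)
    fix S assume "S \<in> (\<lambda>l. set (fst l)) ` set ls"
    then have "tight x S" using fx unfolding feas_def by blast
    then show "(\<Sum>i\<in>EI S. e ! i) = 0" using d(3) se sub by simp
  next
    fix r assume "r \<in> set (snd (snd s))"
    then obtain U where "r = rowE ps U" "tight x (set U)" using g by (auto simp: good_def x_def)
    then show "dot r e = 0" using d(3) dot_rowE[OF e(1)] se sub by simp
  next
    fix i assume "i \<in> integral x"
    then show "e ! i = 0" using d(2) e(2) by (auto simp: integral_def)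
  qed (use d(4) se sub in simp)
  then have "\<forall>i<m. e ! i = 0" using kernel_Nil[OF assms(2) row01_tight_rows[OF g] e(1)] by blast
  then show False using d(1) e(2) by auto
qed

end

section \<open>One round of the algorithm\<close>

context algorithm
begin

text \<open>The rank constraints after a step of length \<open>p / q\<close>, with denominators
  cleared.\<close>

definition "viol s d p q \<longleftrightarrow> (\<exists>T\<subseteq>set vs. T \<noteq> {} \<and>
   q * fst s * (int (card T) - 1) < q * (\<Sum>i\<in>EI T. fst (snd s) ! i) + p * (\<Sum>i\<in>EI T. d ! i))"

lemma sum_comb:
  assumes "length w = m" "length d = m" "A \<subseteq> {..<m}"
  shows "(\<Sum>i\<in>A. comb q w p d ! i) = q * (\<Sum>i\<in>A. w ! i) + p * (\<Sum>i\<in>A. d ! i)"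
proof -
  have "(\<Sum>i\<in>A. comb q w p d ! i) = (\<Sum>i\<in>A. q * w ! i + p * d ! i)"
    by (rule sum.cong) (use assms in \<open>auto simp: comb_nth\<close>)
  then show ?thesis by (simp add: sum.distrib sum_distrib_left)
qed

lemma EI_sub: "EI U \<subseteq> {..<m}" and cutI_sub: "cutI U \<subseteq> {..<m}"
  by (auto simp: EI_def cutI_def)

lemma EI_filter: "{i \<in> {..<m}. edge_of (ps ! i) \<subseteq> T} = EI T"
  by (simp add: EI_def)

lemma vs_ne: assumes "good s" shows "vs \<noteq> []"
proof -
  have "feas (x_of (fst s) (fst (snd s)))" using assms by (simp add: good_def)
  from tree_point.V_ne[OF feas_tree_point[OF this]] show ?thesis by auto
qed

lemma separating_viol:
  assumes g: "good s" and d: "length d = m" and q: "0 < q"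
    and pos: "\<And>i. i < m \<Longrightarrow> 0 \<le> q * fst (snd s) ! i + p * d ! i"
  defines "U \<equiv> separating_set (q * fst s) vs ps (comb q (fst (snd s)) p d)"
  shows "U = [] \<longleftrightarrow> \<not> viol s d p q"
    "U \<noteq> [] \<Longrightarrow> distinct U \<and> set U \<subseteq> set vs \<and> q * fst s * (int (length U) - 1) <
       q * (\<Sum>i\<in>EI (set U). fst (snd s) ! i) + p * (\<Sum>i\<in>EI (set U). d ! i)"
proof -
  let ?w = "comb q (fst (snd s)) p d"
  have l: "length (fst (snd s)) = m" "0 < fst s" using g by (auto simp: good_def)
  have lw: "length ?w = m" using l d by simp
  have wp: "0 \<le> ?w ! i" if "i < m" for i using pos[OF that] that l d by (simp add: comb_nth)
  have D: "0 \<le> q * fst s" using q l by simp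
  note O = separating_set_correct[OF dvs vs_ne[OF g] ps_ends lw wp D, folded U_def, unfolded EI_filter]
  have sE: "(\<Sum>i\<in>EI T. ?w ! i) = q * (\<Sum>i\<in>EI T. fst (snd s) ! i) + p * (\<Sum>i\<in>EI T. d ! i)" for T
    by (rule sum_comb[OF l(1) d EI_sub])
  show 2: "U \<noteq> [] \<Longrightarrow> distinct U \<and> set U \<subseteq> set vs \<and> q * fst s * (int (length U) - 1) <
       q * (\<Sum>i\<in>EI (set U). fst (snd s) ! i) + p * (\<Sum>i\<in>EI (set U). d ! i)" using O(1) unfolding sE .
  show "U = [] \<longleftrightarrow> \<not> viol s d p q"
  proof
    assume "U = []"
    then show "\<not> viol s d p q" using O(2) unfolding viol_def sE by (meson not_less)
  next
    assume nv: "\<not> viol s d p q"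
    show "U = []"
    proof (rule ccontr)
      assume ne: "U \<noteq> []"
      from 2[OF this] have "viol s d p q" unfolding viol_def
        using ne by (intro exI[of _ "set U"]) (auto simp: distinct_card)
      then show False using nv by simp
    qed
  qed
qed

section \<open>Moving along a fixed direction\<close>

context
  fixes s d
  assumes g: "good s" and d: "length d = m" and kill: "\<And>r. r \<in> set (tight_rows ps LS s) \<Longrightarrow> dot r d = 0"
    and dne: "\<exists>i<m. d ! i \<noteq> 0" and cost: "dot cv d \<le> 0"
begin

abbreviation "D \<equiv> fst s"
abbreviation "w \<equiv> fst (snd s)"
abbreviation "K \<equiv> snd (snd s)"
abbreviation "x \<equiv> x_of D w"

lemma Dw: "0 < D" "length w = m"
  using g by (auto simp: good_def)

lemma feas_x: "feas x"
  using g by (simp add: good_def)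

lemma kills:
  shows "\<And>l. l \<in> set ls \<Longrightarrow> (\<Sum>i\<in>EI (set (fst l)). d ! i) = 0" "\<And>r. r \<in> set K \<Longrightarrow> dot r d = 0"
    "\<And>S. S \<in> tcut x \<Longrightarrow> (\<Sum>i\<in>cutI S. d ! i) = 0" "\<And>i. i \<in> integral x \<Longrightarrow> d ! i = 0"
  using kill tight_rows_kill[OF g d] by auto

lemma w_nonneg: "i < m \<Longrightarrow> 0 \<le> w ! i"
proof -
  interpret tree_point "set vs" "{..<m}" "\<lambda>i. edge_of (ps ! i)" x using feas_tree_point[OF feas_x] .
  show "i < m \<Longrightarrow> 0 \<le> w ! i" using x_nonneg[of i] Dw(1) by (simp add: zero_le_divide_iff)
qed

lemma w_rank: "T \<subseteq> set vs \<Longrightarrow> T \<noteq> {} \<Longrightarrow> (\<Sum>i\<in>EI T. w ! i) \<le> D * (int (card T) - 1)"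
proof -
  interpret tree_point "set vs" "{..<m}" "\<lambda>i. edge_of (ps ! i)" x using feas_tree_point[OF feas_x] .
  assume T: "T \<subseteq> set vs" "T \<noteq> {}"
  have "real_of_int (\<Sum>i\<in>EI T. w ! i) / real_of_int D \<le> real (card T) - 1" using rank_le[OF T] unfolding sum_x_of .
  then have "real_of_int (\<Sum>i\<in>EI T. w ! i) \<le> real_of_int (D * (int (card T) - 1))"
    using Dw(1) by (simp add: field_simps)
  then show ?thesis by (simp only: of_int_le_iff)
qed

lemma w_cut: "l \<in> set ls \<Longrightarrow> act x (set (fst l)) \<Longrightarrow> dot (rowC ps (fst l)) w \<le> snd l * D"
proof -
  assume l: "l \<in> set ls" "act x (set (fst l))"
  then have "sum x (cutI (set (fst l))) \<le> of_int (snd l)" using feas_x kl[OF l(1)] unfolding feas_def by force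
  then have "real_of_int (dot (rowC ps (fst l)) w) \<le> real_of_int (snd l * D)"
    unfolding sum_x_of dot_rowC[OF Dw(2)] using Dw(1) by (simp add: field_simps)
  then show ?thesis by (simp only: of_int_le_iff)
qed

lemma sum_d_zero: "(\<Sum>i<m. d ! i) = 0"
proof -
  interpret tree_point "set vs" "{..<m}" "\<lambda>i. edge_of (ps ! i)" x using feas_tree_point[OF feas_x] .
  obtain l where "l \<in> set ls" "set (fst l) = set vs" using VL by auto
  then show ?thesis using kills(1)[of l] EI_V by simp
qed

abbreviation "fs \<equiv> bounds LS s d"
abbreviation "f \<equiv> min_frac fs"

lemma mem_bounds: "b \<in> set fs \<longleftrightarrow> (\<exists>i<m. d ! i < 0 \<and> b = (w ! i, - d ! i)) \<or>
   (\<exists>l\<in>set ls. act x (set (fst l)) \<and> 0 < dot (rowC ps (fst l)) d \<and>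
      b = (snd l * D - dot (rowC ps (fst l)) w, dot (rowC ps (fst l)) d))"
proof -
  have z: "set (zip w d) = (\<lambda>i. (w ! i, d ! i)) ` {..<m}" using Dw(2) d by (auto simp: set_zip)
  have "b \<in> set fs \<longleftrightarrow> (\<exists>p\<in>set (zip w d). snd p < 0 \<and> b = (fst p, - snd p)) \<or>
    (\<exists>l\<in>set (active LS w). 0 < dot (fst (snd l)) d \<and> b = (snd (snd l) * D - dot (fst (snd l)) w, dot (fst (snd l)) d))"
    by (auto simp: bounds_def split: if_splits)
  moreover have "(\<exists>p\<in>set (zip w d). snd p < 0 \<and> b = (fst p, - snd p)) \<longleftrightarrow> (\<exists>i<m. d ! i < 0 \<and> b = (w ! i, - d ! i))"
    unfolding z by auto
  moreover have "(\<exists>y\<in>set (active LS w). P y) \<longleftrightarrow>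
      (\<exists>l\<in>set ls. act x (set (fst l)) \<and> P (rowE ps (fst l), rowC ps (fst l), snd l))" for P
    unfolding set_active[OF Dw(2,1)] by blast
  ultimately show ?thesis by simp
qed

lemma bounds_ne: "fs \<noteq> []"
proof -
  have "\<exists>i<m. d ! i < 0"
  proof (rule ccontr)
    assume "\<not> ?thesis"
    then have "\<And>i. i \<in> {..<m} \<Longrightarrow> 0 \<le> d ! i" by (meson lessThan_iff not_less)
    then show False using sum_d_zero dne sum_nonneg_eq_0_iff[of "{..<m}" "\<lambda>i. d ! i"] by auto
  qed
  then show ?thesis using mem_bounds by force
qed

lemma bounds_pos: "b \<in> set fs \<Longrightarrow> 0 < snd b" "b \<in> set fs \<Longrightarrow> 0 \<le> fst b"
  unfolding mem_bounds using w_nonneg w_cut by auto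

lemma f_mem: "f \<in> set fs" and f_min: "b \<in> set fs \<Longrightarrow> fst f * snd b \<le> fst b * snd f"
  using min_frac_correct[OF bounds_ne bounds_pos(1)] by auto

lemma f_pos: "0 < snd f" "0 \<le> fst f"
  using bounds_pos[OF f_mem] by auto

lemma ratio_le:
  assumes "0 < q" "0 \<le> p" "p * snd f \<le> fst f * q" "b \<in> set fs" shows "p * snd b \<le> fst b * q"
proof -
  have "(p * snd b) * snd f = (p * snd f) * snd b" by simp
  also have "\<dots> \<le> (fst f * q) * snd b" using assms(3) bounds_pos(1)[OF assms(4)] by (intro mult_right_mono) auto
  also have "\<dots> = (fst f * snd b) * q" by simp
  also have "\<dots> \<le> (fst b * snd f) * q" using f_min[OF assms(4)] assms(1) by (intro mult_right_mono) auto
  finally have "(p * snd b) * snd f \<le> (fst b * q) * snd f" by (simp add: mult_ac)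
  then show ?thesis using f_pos(1) by simp
qed

lemma move_nonneg:
  assumes "0 < q" "0 \<le> p" "p * snd f \<le> fst f * q" "i < m" shows "0 \<le> q * w ! i + p * d ! i"
proof (cases "d ! i < 0")
  case True
  then have "(w ! i, - d ! i) \<in> set fs" using assms(4) mem_bounds by blast
  from ratio_le[OF assms(1-3) this] show ?thesis by (simp add: algebra_simps)
next
  case False
  then show ?thesis using assms w_nonneg[OF assms(4)] by simp
qed

lemma move_feas:
  assumes q: "0 < q" and p: "0 \<le> p" and le: "p * snd f \<le> fst f * q" and nv: "\<not> viol s d p q"
  shows "feas (x_of (q * D) (comb q w p d))" "integral x \<subseteq> integral (x_of (q * D) (comb q w p d))"
    "settled x \<subseteq> settled (x_of (q * D) (comb q w p d))"
proof -
  let ?x = "x_of (q * D) (comb q w p d)"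
  define e where "e i = (if i < m then real_of_int (d ! i) else 0)" for i
  define x' where "x' i = x i + real_of_int p / (real_of_int q * real_of_int D) * e i" for i
  have xx: "x' i = ?x i" if "i < m" for i
    using that q Dw d by (simp add: x'_def e_def comb_nth field_simps)
  have se: "sum e A = real_of_int (\<Sum>i\<in>A. d ! i)" if "A \<subseteq> {..<m}" for A
    unfolding of_int_sum by (rule sum.cong) (use that in \<open>auto simp: e_def\<close>)
  have sx: "sum x' A = real_of_int (q * (\<Sum>i\<in>A. w ! i) + p * (\<Sum>i\<in>A. d ! i)) / (real_of_int q * real_of_int D)"
    if "A \<subseteq> {..<m}" for A
  proof -
    have "sum x' A = sum ?x A" by (rule sum.cong) (use that xx in auto)
    then show ?thesis unfolding sum_x_of sum_comb[OF Dw(2) d that] by simp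
  qed
  have qD: "0 < real_of_int q * real_of_int D" using q Dw(1) by simp
  have t: "0 \<le> real_of_int p / (real_of_int q * real_of_int D)" using p qD by simp
  have d0: "e i = 0" if "i \<in> integral x" for i using kills(4)[OF that] by (simp add: e_def)
  have dL: "sum e (EI S) = 0" if S: "S \<in> (\<lambda>l. set (fst l)) ` set ls" for S
  proof -
    obtain l where "l \<in> set ls" "S = set (fst l)" using S by blast
    then show ?thesis unfolding se[OF EI_sub] using kills(1)[of l] by (simp only: of_int_0)
  qed
  have dc: "sum e (cutI S) = 0" if "S \<in> tcut x" for S
    unfolding se[OF cutI_sub] kills(3)[OF that] by (simp only: of_int_0)
  have co: "(\<Sum>i<m. c i * e i) \<le> 0"
  proof -
    have "(\<Sum>i<m. c i * e i) = real_of_int (dot cv d) / \<gamma>"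
      using cv d by (simp add: dot_sum[of _ m] e_def sum_divide_distrib)
    then show ?thesis using cost cv(2) by (simp add: divide_nonpos_pos)
  qed
  have pos: "0 \<le> x' i" if "i \<in> {..<m}" for i
  proof -
    have "0 \<le> real_of_int (q * w ! i + p * d ! i)" using move_nonneg[OF q p le, of i] that by (simp only: of_int_0_le_iff lessThan_iff)
    then show ?thesis using that qD xx[of i] Dw d by (simp add: comb_nth)
  qed
  have rank: "sum x' (EI U) \<le> real (card U) - 1" if U: "U \<subseteq> set vs" "U \<noteq> {}" for U
  proof -
    have "q * (\<Sum>i\<in>EI U. w ! i) + p * (\<Sum>i\<in>EI U. d ! i) \<le> q * D * (int (card U) - 1)"
      using nv U unfolding viol_def by (meson not_less)
    then have "real_of_int (q * (\<Sum>i\<in>EI U. w ! i) + p * (\<Sum>i\<in>EI U. d ! i)) \<le> real_of_int (q * D * (int (card U) - 1))"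
      by (simp only: of_int_le_iff)
    also have "\<dots> = (real (card U) - 1) * (real_of_int q * real_of_int D)" by simp
    finally show ?thesis unfolding sx[OF EI_sub] pos_divide_le_eq[OF qD] .
  qed
  have deg: "sum x' (cutI S) \<le> of_int (k S)" if S: "S \<in> (\<lambda>l. set (fst l)) ` set ls" "act x S" for S
  proof -
    obtain l where l: "l \<in> set ls" "S = set (fst l)" using S by auto
    let ?r = "rowC ps (fst l)"
    have "q * dot ?r w + p * dot ?r d \<le> q * (snd l * D)"
    proof (cases "0 < dot ?r d")
      case True
      then have "(snd l * D - dot ?r w, dot ?r d) \<in> set fs" using l S mem_bounds by blast
      from ratio_le[OF q p le this] show ?thesis by (simp add: algebra_simps)
    next
      case False
      have "q * dot ?r w \<le> q * (snd l * D)" using w_cut[OF l(1)] l S q by simp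
      moreover have "p * dot ?r d \<le> 0" using False p by (simp add: mult_nonneg_nonpos)
      ultimately show ?thesis by linarith
    qed
    then have "real_of_int (q * dot ?r w + p * dot ?r d) \<le> real_of_int (q * (snd l * D))" by (simp only: of_int_le_iff)
    also have "\<dots> = of_int (k S) * (real_of_int q * real_of_int D)" using kl[OF l(1)] l by simp
    finally show ?thesis unfolding sx[OF cutI_sub] pos_divide_le_eq[OF qD] l(2) dot_rowC[OF Dw(2)] dot_rowC[OF d] .
  qed
  note M = feas_move[OF feas_x t x'_def d0 dL dc co pos rank deg]
  \<comment> \<open>Beyond the list the two functions may differ; all notions involved depend only
    on the values at edges.\<close>
  have cong: "act ?x = act x'" "integral ?x = integral x'" "sum ?x (cutI S) = sum x' (cutI S)" "sum ?x (EI S) = sum x' (EI S)"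
    "sum ?x {..<m} = sum x' {..<m}" "(\<Sum>i<m. c i * ?x i) = (\<Sum>i<m. c i * x' i)" for S
  proof -
    have "{i \<in> cutI S. 0 < ?x i} = {i \<in> cutI S. 0 < x' i}" for S using xx cutI_sub by (auto simp: subset_iff)
    then show "act ?x = act x'" by (intro ext) (simp only: act_def)
    show "integral ?x = integral x'" unfolding integral_def
      by (intro Collect_cong conj_cong refl) (simp only: xx[symmetric] lessThan_iff)
    show "sum ?x (cutI S) = sum x' (cutI S)" "sum ?x (EI S) = sum x' (EI S)"
      using xx cutI_sub[of S] EI_sub[of S] by (auto intro!: sum.cong simp: subset_iff)
    show "sum ?x {..<m} = sum x' {..<m}" "(\<Sum>i<m. c i * ?x i) = (\<Sum>i<m. c i * x' i)"
      using xx by (auto intro!: sum.cong)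
  qed
  have "stp ?x \<longleftrightarrow> stp x'" unfolding stp_def cong using xx by (auto simp: Ball_def)
  then show "feas ?x" using M(1) unfolding feas_def tight_def cong by blast
  show "integral x \<subseteq> integral ?x" using M(2) unfolding cong .
  show "settled x \<subseteq> settled ?x" using M(3) unfolding settled_def cong .
qed

lemma viol_scale: "0 < a \<Longrightarrow> viol s d (a * p) (a * q) \<longleftrightarrow> viol s d p q"
proof -
  assume a: "0 < a"
  have "(a * q) * fst s * N < (a * q) * X + (a * p) * Y \<longleftrightarrow> q * fst s * N < q * X + p * Y" for N X Y
  proof -
    have "(a * q) * fst s * N < (a * q) * X + (a * p) * Y \<longleftrightarrow> a * (q * fst s * N) < a * (q * X + p * Y)"
      by (simp add: algebra_simps)
    then show ?thesis using a by (simp only: mult_less_cancel_left_pos)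
  qed
  then show ?thesis unfolding viol_def by simp
qed

lemma not_viol_0: "0 < q \<Longrightarrow> \<not> viol s d 0 q"
proof
  assume q: "0 < q" and "viol s d 0 q"
  then obtain T where T: "T \<subseteq> set vs" "T \<noteq> {}" "q * D * (int (card T) - 1) < q * (\<Sum>i\<in>EI T. w ! i)"
    by (auto simp: viol_def)
  have "q * (\<Sum>i\<in>EI T. w ! i) \<le> q * (D * (int (card T) - 1))" using w_rank[OF T(1,2)] q by (intro mult_left_mono) auto
  then show False using T(3) by (simp add: mult.assoc)
qed

text \<open>The interval from \<open>fst t / snd t\<close> to \<open>(fst t + fst f) / snd t\<close>
  has a feasible lower and an infeasible upper end. Each round doubles the denominator; after as
  many rounds as the binary length of \<open>fst f * sum_abs d * sum_abs d\<close> the interval is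
  shorter than \<open>1 / (sum_abs d)\<close> squared.\<close>

lemma bisect_correct:
  assumes v: "viol s d (fst f) (snd f)"
  defines "t \<equiv> bisect vs ps (D, w, d) f"
  shows "0 \<le> fst t" "\<not> viol s d (fst t) (snd t)" "viol s d (fst t + fst f) (snd t)"
    "(fst t + fst f) * snd f \<le> fst f * snd t" "fst f * sum_abs d * sum_abs d < snd t"
proof -
  define B where "B t = (if length (separating_set (2 * snd t * D) vs ps
           (comb (2 * snd t) w (2 * fst t + fst f) d)) = 0
      then (2 * fst t + fst f, 2 * snd t) else (2 * fst t, 2 * snd t))" for t
  define J where "J n t \<longleftrightarrow> 0 \<le> fst t \<and> \<not> viol s d (fst t) (snd t) \<and> viol s d (fst t + fst f) (snd t) \<and>
    (fst t + fst f) * snd f \<le> fst f * snd t \<and> snd t = snd f * 2 ^ n" for n t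
  have J: "J n ((B ^^ n) (0, snd f))" for n
  proof (induction n)
    case 0
    then show ?case using v f_pos not_viol_0 by (simp add: J_def)
  next
    case (Suc n)
    obtain a Q where aQ: "(B ^^ n) (0, snd f) = (a, Q)" by fastforce
    from Suc have h: "0 \<le> a" "\<not> viol s d a Q" "viol s d (a + fst f) Q" "(a + fst f) * snd f \<le> fst f * Q" "Q = snd f * 2 ^ n"
      by (auto simp: J_def aQ)
    have Q: "0 < 2 * Q" using h(5) f_pos by simp
    have le: "(2 * a + fst f) * snd f \<le> fst f * (2 * Q)"
      using h(4) mult_nonneg_nonneg[OF f_pos(2) less_imp_le[OF f_pos(1)]] by (simp add: algebra_simps)
    have "0 \<le> 2 * a + fst f" using h(1) f_pos by simp
    note O = separating_viol(1)[OF g d Q move_nonneg[OF Q this le]]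
    have sc: "viol s d (2 * a) (2 * Q) \<longleftrightarrow> viol s d a Q" "viol s d (2 * a + fst f + fst f) (2 * Q) \<longleftrightarrow> viol s d (a + fst f) Q"
      using viol_scale[of 2 a Q] viol_scale[of 2 "a + fst f" Q] by (simp_all add: algebra_simps)
    show ?case
    proof (cases "viol s d (2 * a + fst f) (2 * Q)")
      case True
      then have "B (a, Q) = (2 * a, 2 * Q)" using O by (simp add: B_def)
      then show ?thesis using True h sc le by (simp add: J_def aQ)
    next
      case False
      then have "B (a, Q) = (2 * a + fst f, 2 * Q)" using O by (simp add: B_def)
      then show ?thesis using False h sc f_pos by (simp add: J_def aQ algebra_simps)
    qed
  qed
  let ?N = "max 0 (fst f * sum_abs d * sum_abs d)"
  have "t = foldl (\<lambda>t x. B t) (0, snd f) (halves ?N)" unfolding t_def bisect_def B_def by simp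
  then have t: "t = (B ^^ bit_length ?N) (0, snd f)" unfolding foldl_const_fun by (simp add: halves_def)
  from J[of "bit_length ?N"] show "0 \<le> fst t" "\<not> viol s d (fst t) (snd t)" "viol s d (fst t + fst f) (snd t)"
    "(fst t + fst f) * snd f \<le> fst f * snd t" by (auto simp: J_def t)
  have "snd t = snd f * 2 ^ bit_length ?N" using J[of "bit_length ?N"] by (simp add: J_def t)
  moreover have "1 * 2 ^ bit_length ?N \<le> snd f * 2 ^ bit_length ?N" using f_pos by (intro mult_right_mono) auto
  ultimately show "fst f * sum_abs d * sum_abs d < snd t" using abs_less_bit_length[of ?N] by linarith
qed

lemma sum_le_sum_abs: "A \<subseteq> {..<m} \<Longrightarrow> (\<Sum>i\<in>A. d ! i) \<le> sum_abs d"
proof -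
  assume A: "A \<subseteq> {..<m}"
  have "(\<Sum>i\<in>A. d ! i) \<le> (\<Sum>i\<in>A. \<bar>d ! i\<bar>)" by (rule sum_mono) auto
  also have "\<dots> \<le> (\<Sum>i<m. \<bar>d ! i\<bar>)" by (rule sum_mono2) (use A in auto)
  also have "\<dots> = sum_abs d" using d by (simp add: sum_abs_def sum_list_sum_nth atLeast0LessThan)
  finally show ?thesis .
qed

text \<open>The set \<open>U\<close> found at the upper end becomes tight at \<open>p / q\<close>. A
  set \<open>T\<close> violated there would become tight strictly earlier, but not before the lower
  end, and both lengths would lie in the short interval.\<close>

lemma advance_violated:
  assumes v: "viol s d (fst f) (snd f)"
  obtains U p q where "advance vs ps (D, w, d) f = ((p, q), [rowE ps U])" "set U \<subseteq> set vs" "U \<noteq> []" "distinct U"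
    "p = D * (int (length U) - 1) - (\<Sum>i\<in>EI (set U). w ! i)" "q = (\<Sum>i\<in>EI (set U). d ! i)"
    "0 < q" "0 \<le> p" "p * snd f \<le> fst f * q" "\<not> viol s d p q"
proof -
  define t where "t = bisect vs ps (D, w, d) f"
  define a where "a = fst t" define Q where "Q = snd t"
  note b = bisect_correct[OF v, folded t_def, folded a_def Q_def]
  have S: "0 \<le> sum_abs d" unfolding sum_abs_def by (rule sum_list_nonneg) auto
  have "0 \<le> fst f * sum_abs d * sum_abs d" using f_pos(2) S by (intro mult_nonneg_nonneg)
  then have Q: "0 < Q" using b(5) by linarith
  define U where "U = separating_set (Q * D) vs ps (comb Q w (a + fst f) d)"
  have ap: "0 \<le> a + fst f" using b(1) f_pos by simp
  have "0 \<le> Q * w ! i + (a + fst f) * d ! i" if "i < m" for i by (rule move_nonneg[OF Q ap b(4) that])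
  note O = separating_viol[OF g d Q this, folded U_def]
  have ne: "U \<noteq> []" using O(1) b(3) by simp
  have U: "distinct U" "set U \<subseteq> set vs" "Q * D * (int (length U) - 1) <
       Q * (\<Sum>i\<in>EI (set U). w ! i) + (a + fst f) * (\<Sum>i\<in>EI (set U). d ! i)" using O(2)[OF _ ne] by auto
  define p where "p = D * (int (length U) - 1) - (\<Sum>i\<in>EI (set U). w ! i)"
  define q where "q = (\<Sum>i\<in>EI (set U). d ! i)"
  have adv: "advance vs ps (D, w, d) f = ((p, q), [rowE ps U])"
  proof -
    have "separating_set (snd f * D) vs ps (comb (snd f) w (fst f) d) \<noteq> []"
      using separating_viol(1)[OF g d f_pos(1) move_nonneg[OF f_pos(1,2)]] v by simp
    then show ?thesis unfolding advance_def p_def q_def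
      by (simp add: Let_def t_def[symmetric] a_def[symmetric] Q_def[symmetric] U_def[symmetric] dot_rowE[OF Dw(2)] dot_rowE[OF d])
  qed
  have p0: "0 \<le> p" using w_rank[OF U(2)] ne distinct_card[OF U(1)] by (simp add: p_def)
  have hi: "Q * p < (a + fst f) * q" using U(3) by (simp add: p_def q_def algebra_simps)
  have q0: "0 < q"
  proof (rule ccontr)
    assume "\<not> 0 < q"
    then have "(a + fst f) * q \<le> 0" using ap by (simp add: mult_nonneg_nonpos)
    moreover have "0 \<le> Q * p" using Q p0 by simp
    ultimately show False using hi by simp
  qed
  have le: "p * snd f \<le> fst f * q"
  proof -
    have "Q * (p * snd f) \<le> ((a + fst f) * snd f) * q" using hi f_pos(1) mult_right_mono[of "Q * p" "(a + fst f) * q" "snd f"]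
      by (simp add: algebra_simps)
    also have "\<dots> \<le> (fst f * Q) * q" using b(4) q0 by (intro mult_right_mono) auto
    finally have "Q * (p * snd f) \<le> Q * (fst f * q)" by (simp add: mult_ac)
    then show ?thesis using Q by simp
  qed
  have nv: "\<not> viol s d p q"
  proof
    assume "viol s d p q"
    then obtain T where T: "T \<subseteq> set vs" "T \<noteq> {}" "q * D * (int (card T) - 1) < q * (\<Sum>i\<in>EI T. w ! i) + p * (\<Sum>i\<in>EI T. d ! i)"
      unfolding viol_def by blast
    define pT where "pT = D * (int (card T) - 1) - (\<Sum>i\<in>EI T. w ! i)"
    define dT where "dT = (\<Sum>i\<in>EI T. d ! i)"
    have pT: "0 \<le> pT" using w_rank[OF T(1,2)] by (simp add: pT_def)
    have lt: "q * pT < p * dT" using T(3) by (simp add: pT_def dT_def algebra_simps)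
    have dT: "0 < dT"
    proof (rule ccontr)
      assume "\<not> 0 < dT"
      then have "p * dT \<le> 0" using p0 by (simp add: mult_nonneg_nonpos)
      moreover have "0 \<le> q * pT" using q0 pT by simp
      ultimately show False using lt by simp
    qed
    have "Q * (\<Sum>i\<in>EI T. w ! i) + a * dT \<le> Q * D * (int (card T) - 1)"
      using b(2) T(1,2) unfolding viol_def dT_def by (meson not_less)
    then have lo: "a * dT \<le> Q * pT" by (simp add: pT_def algebra_simps)
    \<comment> \<open>\<open>p * dT - q * pT\<close> is a positive integer, so the two lengths
      differ by at least \<open>1 / (q * dT)\<close>, more than the interval allows.\<close>
    have "Q * 1 \<le> Q * (p * dT - q * pT)" using lt Q by (intro mult_left_mono) auto
    also have "\<dots> = (Q * p) * dT - q * (Q * pT)" by (simp add: algebra_simps)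
    also have "\<dots> < ((a + fst f) * q) * dT - q * (a * dT)"
    proof -
      have "(Q * p) * dT < ((a + fst f) * q) * dT" using hi dT by simp
      moreover have "q * (a * dT) \<le> q * (Q * pT)" using lo q0 by (intro mult_left_mono) auto
      ultimately show ?thesis by linarith
    qed
    also have "\<dots> = fst f * q * dT" by (simp add: algebra_simps)
    also have "\<dots> \<le> fst f * sum_abs d * sum_abs d"
    proof -
      have "q \<le> sum_abs d" unfolding q_def by (rule sum_le_sum_abs[OF EI_sub])
      moreover have "dT \<le> sum_abs d" unfolding dT_def by (rule sum_le_sum_abs[OF EI_sub])
      ultimately show ?thesis using f_pos(2) S dT q0 by (intro mult_mono) auto
    qed
    finally show False using b(5) by simp
  qed
  show thesis by (rule that[OF adv U(2) ne U(1) p_def q_def q0 p0 le nv])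
qed

lemma tight_keep:
  assumes q: "0 < q" and "tight x (set U)" "dot (rowE ps U) d = 0"
  shows "tight (x_of (q * D) (comb q w p d)) (set U)"
proof -
  have "(\<Sum>i\<in>EI (set U). d ! i) = 0" using assms(3) dot_rowE[OF d] by simp
  then have "(\<Sum>i\<in>EI (set U). comb q w p d ! i) = q * (\<Sum>i\<in>EI (set U). w ! i)"
    using sum_comb[OF Dw(2) d EI_sub] by simp
  then have "sum (x_of (q * D) (comb q w p d)) (EI (set U)) = sum x (EI (set U))"
    unfolding sum_x_of using q Dw(1) by simp
  then show ?thesis using assms(2) unfolding tight_def by simp
qed

text \<open>If no rank constraint blocks, the ratio test makes a coordinate integral or settles a
  cut. Otherwise the new row is positive on \<open>d\<close>, on which all recorded rows vanish, so
  \<open>d\<close> itself witnesses independence; this holds even for a step of length 0.\<close>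

lemma step_dir_progress:
  shows "good (step_dir vs ps LS s d)" "potential s < potential (step_dir vs ps LS s d)"
proof -
  let ?s = "step_dir vs ps LS s d"
  have finI: "finite (integral y)" for y :: "nat \<Rightarrow> real" by (simp add: integral_def)
  have finS: "finite (settled y)" for y by (simp add: settled_def)
  have indepK: "indep m K" "\<And>r. r \<in> set K \<Longrightarrow> \<exists>U. r = rowE ps U \<and> tight x (set U)" using g by (auto simp: good_def)
  have "good ?s \<and> potential s < potential ?s"
  proof (cases "viol s d (fst f) (snd f)")
    case False
    let ?p = "fst f" let ?q = "snd f"
    let ?x = "x_of (?q * D) (comb ?q w ?p d)"
    have adv: "advance vs ps (D, w, d) f = (f, [])"
      using separating_viol(1)[OF g d f_pos(1) move_nonneg[OF f_pos(1,2)]] False by (simp add: advance_def)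
    have st: "?s = (?q * D, comb ?q w ?p d, K)" by (simp add: step_dir_def adv Let_def)
    note M = move_feas[OF f_pos order_refl False]
    have "good ?s" unfolding good_def st fst_conv snd_conv
    proof (intro conjI ballI)
      show "0 < ?q * D" using f_pos Dw by simp
      show "length (comb ?q w ?p d) = m" using Dw d by simp
      show "\<exists>U. r = rowE ps U \<and> tight ?x (set U)" if "r \<in> set K" for r
        using indepK(2)[OF that] tight_keep[OF f_pos(1)] kills(2)[OF that] by blast
    qed (use M indepK in auto)
    moreover have "card (integral x) + card (settled x) < card (integral ?x) + card (settled ?x)"
    proof -
      have le: "card (integral x) \<le> card (integral ?x)" "card (settled x) \<le> card (settled ?x)"
        using M by (auto intro!: card_mono finI finS)
      from f_mem consider i where "i < m" "d ! i < 0" "f = (w ! i, - d ! i)"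
        | l where "l \<in> set ls" "act x (set (fst l))" "0 < dot (rowC ps (fst l)) d"
          "f = (snd l * D - dot (rowC ps (fst l)) w, dot (rowC ps (fst l)) d)" unfolding mem_bounds by blast
      then show ?thesis
      proof cases
        case 1
        have "comb ?q w ?p d ! i = 0" using 1 Dw d by (simp add: comb_nth)
        then have "i \<in> integral ?x" using 1(1) by (simp add: integral_def)
        moreover have "i \<notin> integral x" using kills(4)[of i] 1 by auto
        ultimately have "card (integral x) < card (integral ?x)" using M(2) by (intro psubset_card_mono finI) auto
        then show ?thesis using le by linarith
      next
        case 2
        let ?S = "set (fst l)" let ?r = "rowC ps (fst l)"
        have "(\<Sum>i\<in>cutI ?S. comb ?q w ?p d ! i) = ?q * dot ?r w + ?p * dot ?r d"
          unfolding sum_comb[OF Dw(2) d cutI_sub] dot_rowC[OF Dw(2)] dot_rowC[OF d] by simp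
        also have "\<dots> = snd l * (?q * D)" using 2(4) by (simp add: algebra_simps)
        finally have "sum ?x (cutI ?S) = real_of_int (snd l * (?q * D)) / real_of_int (?q * D)" unfolding sum_x_of by simp
        also have "\<dots> = of_int (k ?S)" using f_pos(1) Dw(1) kl[OF 2(1)] by simp
        finally have "?S \<in> settled ?x" using 2(1) unfolding settled_def by blast
        moreover have "?S \<notin> settled x"
        proof
          assume "?S \<in> settled x"
          then have "?S \<in> tcut x" using 2(2) by (auto simp: settled_def tcut_def)
          then have "dot ?r d = 0" using kills(3) dot_rowC[OF d] by simp
          then show False using 2(3) by simp
        qed
        ultimately have "card (settled x) < card (settled ?x)" using M(3) by (intro psubset_card_mono finS) auto
        then show ?thesis using le by linarith
      qed
    qed
    ultimately show ?thesis unfolding potential_def st fst_conv snd_conv by linarith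
  next
    case True
    then obtain U p q where A: "advance vs ps (D, w, d) f = ((p, q), [rowE ps U])" "set U \<subseteq> set vs" "U \<noteq> []" "distinct U"
      "p = D * (int (length U) - 1) - (\<Sum>i\<in>EI (set U). w ! i)" "q = (\<Sum>i\<in>EI (set U). d ! i)"
      "0 < q" "0 \<le> p" "p * snd f \<le> fst f * q" "\<not> viol s d p q" by (rule advance_violated)
    let ?x = "x_of (q * D) (comb q w p d)" let ?r = "rowE ps U"
    have st: "?s = (q * D, comb q w p d, ?r # K)" by (simp add: step_dir_def A(1) Let_def)
    note M = move_feas[OF A(7-10)]
    have "tight ?x (set U)"
    proof -
      have "(\<Sum>i\<in>EI (set U). comb q w p d ! i) = q * D * (int (length U) - 1)"
        unfolding sum_comb[OF Dw(2) d EI_sub] A(6)[symmetric] A(5) by (simp add: algebra_simps)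
      then have "sum ?x (EI (set U)) = real_of_int (q * D * (int (length U) - 1)) / real_of_int (q * D)"
        unfolding sum_x_of by simp
      also have "\<dots> = real (card (set U)) - 1" using A(7) Dw(1) distinct_card[OF A(4)] by simp
      finally show ?thesis using A(2,3) unfolding tight_def by simp
    qed
    moreover have "indep m (?r # K)"
      using indepK(1) row01_rowE d kills(2) dot_rowE[OF d] A(6,7) by (auto intro!: exI[of _ d])
    ultimately have "good ?s" unfolding good_def st fst_conv snd_conv
    proof (intro conjI ballI)
      show "0 < q * D" using A(7) Dw by simp
      show "length (comb q w p d) = m" using Dw d by simp
      fix r assume "r \<in> set (?r # K)"
      then consider "r = ?r" | "r \<in> set K" by auto
      then show "\<exists>U. r = rowE ps U \<and> tight ?x (set U)"
        by cases (use \<open>tight ?x (set U)\<close> in blast, use indepK(2)[of r] tight_keep[OF A(7)] kills(2)[of r] in blast)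
    qed (use M in auto)
    moreover have "card (integral x) \<le> card (integral ?x)" "card (settled x) \<le> card (settled ?x)"
      using M by (auto intro!: card_mono finI finS)
    ultimately show ?thesis unfolding potential_def st fst_conv snd_conv by simp
  qed
  then show "good ?s" "potential s < potential ?s" by auto
qed

end

lemma step_progress:
  assumes g: "good s"
  defines "s' \<equiv> step (vs, ps, LS, cv) s"
  shows "good s'" "integral (x_of (fst s) (fst (snd s))) = {..<m} \<Longrightarrow> s' = s"
    "integral (x_of (fst s) (fst (snd s))) \<noteq> {..<m} \<Longrightarrow> potential s < potential s'"
proof -
  show "integral (x_of (fst s) (fst (snd s))) = {..<m} \<Longrightarrow> s' = s"
    using integral_all_kernel[OF g] by (simp add: s'_def step_def)
  have "good s' \<and> (integral (x_of (fst s) (fst (snd s))) \<noteq> {..<m} \<longrightarrow> potential s < potential s')"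
  proof (cases "kernel_basis ps (tight_rows ps LS s)")
    case Nil
    then show ?thesis using g kernel_Nil_integral[OF g Nil] by (simp add: s'_def step_def)
  next
    case (Cons b bs)
    then have b: "b \<in> set (kernel_basis ps (tight_rows ps LS s))" by simp
    note k = kernel_rows[OF b row01_tight_rows[OF g]]
    define d where "d = (if 0 < dot cv (snd b) then map (\<lambda>a. - a) (snd b) else snd b)"
    have s': "s' = step_dir vs ps LS s d" using Cons by (simp add: s'_def step_def d_def)
    have d: "length d = m" "\<And>i. i < m \<Longrightarrow> d ! i = (if 0 < dot cv (snd b) then - snd b ! i else snd b ! i)"
      using k(1) by (auto simp: d_def)
    have dd: "dot r d = (if 0 < dot cv (snd b) then - dot r (snd b) else dot r (snd b))" if "length r = m" for r
      using that d k(1) by (simp add: dot_sum[of _ m] sum_negf)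
    have kill: "dot r d = 0" if "r \<in> set (tight_rows ps LS s)" for r
      using dd[of r] k(3)[OF _ that] row01_tight_rows[OF g that] by (simp add: row01_def)
    have ne: "\<exists>i<m. d ! i \<noteq> 0"
    proof -
      obtain i where i: "i < m" "snd b ! i \<noteq> 0" using k(2) by auto
      then show ?thesis using d(2)[OF i(1)] by (intro exI[of _ i]) auto
    qed
    have co: "dot cv d \<le> 0" using dd[OF cv(1)] by simp
    show ?thesis unfolding s' using step_dir_progress[OF g d(1) kill ne co] by simp
  qed
  then show "good s'" "integral (x_of (fst s) (fst (snd s))) \<noteq> {..<m} \<Longrightarrow> potential s < potential s'" by auto
qed

text \<open>At an integral point a round changes nothing, so a fixed number of rounds above the
  largest potential can be run without a test.\<close>

lemma iterate_integral:
  assumes g: "good s" and N: "2 * m + length ls < N"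
  defines "t \<equiv> (step (vs, ps, LS, cv) ^^ N) s"
  shows "good t" "integral (x_of (fst t) (fst (snd t))) = {..<m}"
proof -
  let ?t = "\<lambda>n. (step (vs, ps, LS, cv) ^^ n) s" let ?I = "\<lambda>t. integral (x_of (fst t) (fst (snd t)))"
  have gt: "good (?t n)" for n by (induction n) (auto intro: g step_progress(1))
  have "?I (?t n) = {..<m} \<or> n \<le> potential (?t n)" for n
  proof (induction n)
    case (Suc n)
    show ?case
    proof (cases "?I (?t n) = {..<m}")
      case True
      then show ?thesis using step_progress(2)[OF gt True] by simp
    next
      case False
      then have "n < potential (?t (Suc n))" using Suc step_progress(3)[OF gt False] by simp
      then show ?thesis by simp
    qed
  qed simp
  then show "?I t = {..<m}" using potential_le[OF gt, of N] N unfolding t_def by fastforce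
  show "good t" unfolding t_def by (rule gt)
qed

end

section \<open>Running time of the rounding algorithm\<close>

lemma length_separating_set: "length (separating_set D vs ps w) \<le> 2 * length vs"
proof -
  have "length (foldl (\<lambda>R x. grow \<delta> R) R xs) \<le> length R + length xs" for \<delta> R and xs :: "nat list"
  proof (induction xs arbitrary: R)
    case (Cons x xs)
    have "length (grow \<delta> R) \<le> Suc (length R)" by (auto simp: grow_def split: list.split)
    then show ?case using Cons[of "grow \<delta> R"] by simp
  qed simp
  note len = this
  have r: "length (reach c \<delta> q) \<le> 2 * length (snd (snd c))" for c \<delta> q
  proof -
    let ?i = "map (\<lambda>v. (v, q)) (filter (\<lambda>v. \<delta> \<le> load q v - cap c v) (snd (snd c)))"
    have "length (reach c \<delta> q) \<le> length ?i + length (snd (snd c))" unfolding reach_def by (rule len)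
    moreover have "length ?i \<le> length (snd (snd c))" by simp
    ultimately show ?thesis by linarith
  qed
  let ?f = "filter (\<lambda>U. length U \<noteq> 0) (map (\<lambda>r. violated (D, r, vs) (zip ps (zip w w))) vs)"
  have f: "length U \<le> 2 * length vs" if U: "U \<in> set ?f" for U
  proof -
    obtain r' where "U = violated (D, r', vs) (zip ps (zip w w))" using U by auto
    then show ?thesis using r[of "(D, r', vs)"] by (simp add: violated_def)
  qed
  show ?thesis
  proof (cases ?f)
    case Nil
    then show ?thesis by (simp only: separating_set_def list.case) simp
  next
    case (Cons U Us)
    then have "separating_set D vs ps w = U" by (simp only: separating_set_def list.case)
    moreover have "U \<in> set ?f" unfolding Cons by simp
    ultimately show ?thesis using f by simp
  qed
qed

lemma sum_abs_bound: "(\<And>y. y \<in> set d \<Longrightarrow> \<bar>y\<bar> \<le> B) \<Longrightarrow> sum_abs d \<le> int (length d) * B"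
proof (induction d)
  case (Cons y d)
  then have "sum_abs d \<le> int (length d) * B" "\<bar>y\<bar> \<le> B" by auto
  then show ?case by (simp add: sum_abs_def algebra_simps)
qed (simp add: sum_abs_def)

lemma row01_rows: "row01 (length ps) (rowE ps U)" "row01 (length ps) (rowC ps U)"
  by (auto simp: row01_def rowE_def rowC_def)

text \<open>Bounds the absolute sum, and hence each entry, of a kernel vector with \<open>m\<close>
  entries. The summand 1 keeps it positive, which also covers the default denominator in
  \<open>min_frac\<close>.\<close>

definition dir_bound :: "nat \<Rightarrow> int" where
  "dir_bound m = int m * int (Suc m ^ m) + 1"

lemma min_frac_mem: "min_frac fs \<in> insert (0, 1) (set fs)"
proof -
  have "foldl (\<lambda>m g. if fst g * snd m < fst m * snd g then g else m) f gs \<in> insert f (set gs)" for f :: "int \<times> int" and gs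
  proof (induction gs arbitrary: f)
    case (Cons a gs)
    show ?case using Cons.IH[of "if fst a * snd f < fst f * snd a then a else f"] by auto
  qed simp
  then show ?thesis by (cases fs) (auto simp: min_frac_def)
qed

text \<open>A round multiplies all numbers by at most a factor \<open>G\<close> that does not depend
  on the state: step lengths have denominators at most \<open>dir_bound\<close> and numerators
  proportional to \<open>A\<close>. The much longer endpoints of the bisection never enter the
  state. Hence binary lengths grow linearly in the number of rounds.\<close>

lemma step_size:
  fixes vs :: "nat list" and cv :: "int list"
  assumes w: "length (fst (snd s)) = length ps" "\<And>y. y \<in> set (fst (snd s)) \<Longrightarrow> \<bar>y\<bar> \<le> A" and D: "\<bar>fst s\<bar> \<le> A"
    and LS: "\<And>l. l \<in> set LS \<Longrightarrow> row01 (length ps) (fst (snd l)) \<and> \<bar>snd (snd l)\<bar> \<le> \<kappa>" and \<kappa>: "0 \<le> \<kappa>"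
  defines "s' \<equiv> step (vs, ps, LS, cv) s"
  defines "G \<equiv> dir_bound (length ps) * (\<kappa> + int (length ps) + 2 * int (length vs) + 3)"
  shows "length (fst (snd s')) = length ps" "\<And>y. y \<in> set (fst (snd s')) \<Longrightarrow> \<bar>y\<bar> \<le> G * A" "\<bar>fst s'\<bar> \<le> G * A"
    "\<exists>R. snd (snd s') = R @ snd (snd s) \<and> length R \<le> 1 \<and> (\<forall>r\<in>set R. row01 (length ps) r)"
proof -
  let ?m = "length ps" let ?D = "fst s" let ?w = "fst (snd s)"
  define S where "S = dir_bound ?m"
  define P where "P = \<kappa> + int ?m + 2 * int (length vs) + 2"
  have A0: "0 \<le> A" using D by linarith
  have S1: "1 \<le> S" by (simp add: S_def dir_bound_def)
  have P1: "1 \<le> P" using \<kappa> by (simp add: P_def)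
  have G: "G = S * (P + 1)" by (simp add: G_def S_def P_def)
  have G1: "1 \<le> G" unfolding G using S1 P1 mult_mono[of 1 S 1 "P + 1"] by simp
  have GA: "A \<le> G * A" using mult_right_mono[OF G1 A0] by simp
  have "length (fst (snd s')) = ?m \<and> (\<forall>y\<in>set (fst (snd s')). \<bar>y\<bar> \<le> G * A) \<and> \<bar>fst s'\<bar> \<le> G * A \<and>
    (\<exists>R. snd (snd s') = R @ snd (snd s) \<and> length R \<le> 1 \<and> (\<forall>r\<in>set R. row01 ?m r))"
  proof (cases "kernel_basis ps (tight_rows ps LS s)")
    case Nil
    then have "s' = s" by (simp add: s'_def step_def)
    then show ?thesis using w D GA by (auto intro: order_trans)
  next
    case (Cons b bs)
    then have b: "b \<in> set (kernel_basis ps (tight_rows ps LS s))" by simp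
    define d where "d = (if 0 < dot cv (snd b) then map (\<lambda>a. - a) (snd b) else snd b)"
    have s': "s' = step_dir vs ps LS s d" using Cons by (simp add: s'_def step_def d_def)
    have lb: "length (snd b) = ?m" using kinv_kernel[of ps "tight_rows ps LS s"] b by (auto simp: kinv_def)
    have d: "length d = ?m" using lb by (simp add: d_def)
    have dy: "\<bar>y\<bar> \<le> int (Suc ?m ^ ?m)" if y: "y \<in> set d" for y
    proof -
      obtain i where i: "i < ?m" "\<bar>y\<bar> = \<bar>snd b ! i\<bar>"
      proof -
        have "\<exists>z\<in>set (snd b). \<bar>y\<bar> = \<bar>z\<bar>" using y by (auto simp: d_def split: if_splits)
        then obtain z where "z \<in> set (snd b)" "\<bar>y\<bar> = \<bar>z\<bar>" by blast
        then show thesis using lb by (metis in_set_conv_nth that)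
      qed
      then show ?thesis using kinv_bound[OF kinv_kernel b i(1)] by simp
    qed
    have dS: "sum_abs d \<le> S" using sum_abs_bound[of d, OF dy] d by (simp add: S_def dir_bound_def)
    have yS: "\<bar>y\<bar> \<le> S" if "y \<in> set d" for y
    proof -
      have "1 \<le> int ?m" using that d by (cases ps) auto
      then have "int (Suc ?m ^ ?m) \<le> int ?m * int (Suc ?m ^ ?m)" using mult_right_mono[of 1 "int ?m" "int (Suc ?m ^ ?m)"] by simp
      then show ?thesis using dy[OF that] unfolding S_def dir_bound_def by linarith
    qed
    have rd: "\<bar>dot r d\<bar> \<le> S" if "row01 ?m r" for r using abs_dot_le[of d r] that d dS by simp
    have rw: "\<bar>dot r ?w\<bar> \<le> int ?m * A" if "row01 ?m r" for r
      using abs_dot_le[of ?w r] that w(1) sum_abs_bound[of ?w, OF w(2)] by simp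
    have bnd: "\<bar>fst h\<bar> \<le> P * A \<and> \<bar>snd h\<bar> \<le> S" if "h \<in> insert (0, 1) (set (bounds LS s d))" for h
    proof -
      have PA: "A \<le> P * A" using mult_right_mono[OF P1 A0] by simp
      from that consider "h = (0, 1)" | p where "p \<in> set (zip ?w d)" "h = (fst p, - snd p)"
        | l where "l \<in> set LS" "h = (snd (snd l) * ?D - dot (fst (snd l)) ?w, dot (fst (snd l)) d)"
        by (auto simp: bounds_def active_def split: if_splits)
      then show ?thesis
      proof cases
        case 1
        then show ?thesis using S1 P1 A0 by simp
      next
        case 2
        obtain y z where "p = (y, z)" by fastforce
        then have "y \<in> set ?w" "z \<in> set d" "h = (y, - z)" using 2 by (auto dest: set_zip_leftD set_zip_rightD)
        then show ?thesis using w(2)[of y] PA yS[of z] by simp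
      next
        case 3
        have "\<bar>snd (snd l) * ?D\<bar> \<le> \<kappa> * A" using LS[OF 3(1)] D \<kappa> by (simp add: abs_mult mult_mono)
        moreover have "\<bar>dot (fst (snd l)) ?w\<bar> \<le> int ?m * A" using rw LS[OF 3(1)] by blast
        ultimately have "\<bar>fst h\<bar> \<le> (\<kappa> + int ?m) * A" using 3(2) by (simp add: algebra_simps)
        also have "\<dots> \<le> P * A" using A0 by (intro mult_right_mono) (auto simp: P_def)
        finally show ?thesis using 3 rd LS[OF 3(1)] by simp
      qed
    qed
    define h where "h = advance vs ps (?D, ?w, d) (min_frac (bounds LS s d))"
    have H: "\<bar>fst (fst h)\<bar> \<le> P * A \<and> \<bar>snd (fst h)\<bar> \<le> S \<and> length (snd h) \<le> 1 \<and> (\<forall>r\<in>set (snd h). row01 ?m r)"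
    proof -
      let ?f = "min_frac (bounds LS s d)"
      have f: "\<bar>fst ?f\<bar> \<le> P * A \<and> \<bar>snd ?f\<bar> \<le> S" by (rule bnd[OF min_frac_mem])
      define t where "t = bisect vs ps (?D, ?w, d) ?f"
      define U where "U = separating_set (snd t * ?D) vs ps (comb (snd t) ?w (fst t + fst ?f) d)"
      have hh: "h = (?f, []) \<or> h = ((?D * (int (length U) - 1) - dot (rowE ps U) ?w, dot (rowE ps U) d), [rowE ps U])"
        by (simp add: h_def advance_def Let_def U_def t_def)
      have "\<bar>?D * (int (length U) - 1) - dot (rowE ps U) ?w\<bar> \<le> P * A"
      proof -
        have "\<bar>int (length U) - 1\<bar> \<le> 2 * int (length vs) + 1"
          using length_separating_set[of "snd t * ?D" vs ps "comb (snd t) ?w (fst t + fst ?f) d"] by (simp add: U_def)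
        then have "\<bar>?D * (int (length U) - 1)\<bar> \<le> A * (2 * int (length vs) + 1)"
          unfolding abs_mult using D A0 by (intro mult_mono) auto
        moreover have "\<bar>dot (rowE ps U) ?w\<bar> \<le> int ?m * A" by (rule rw[OF row01_rows(1)])
        ultimately have "\<bar>?D * (int (length U) - 1) - dot (rowE ps U) ?w\<bar> \<le> (2 * int (length vs) + 1 + int ?m) * A"
          by (simp add: algebra_simps)
        also have "\<dots> \<le> P * A" using A0 \<kappa> by (intro mult_right_mono) (auto simp: P_def)
        finally show ?thesis .
      qed
      then show ?thesis using hh f rd[OF row01_rows(1)] row01_rows(1) by auto
    qed
    have st: "s' = (snd (fst h) * ?D, comb (snd (fst h)) ?w (fst (fst h)) d, snd h @ snd (snd s))"
      unfolding s' step_dir_def h_def by (simp add: Let_def)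
    have "\<bar>snd (fst h) * ?D\<bar> \<le> S * A" unfolding abs_mult using H D S1 by (intro mult_mono) auto
    also have "\<dots> \<le> G * A" unfolding G using A0 S1 P1 by (intro mult_right_mono) auto
    finally have "\<bar>fst s'\<bar> \<le> G * A" by (simp add: st)
    moreover have "\<bar>y\<bar> \<le> G * A" if y: "y \<in> set (fst (snd s'))" for y
    proof -
      obtain i where i: "i < ?m" "y = snd (fst h) * ?w ! i + fst (fst h) * d ! i"
        using y w(1) d unfolding st by (auto simp: in_set_conv_nth comb_nth)
      have "\<bar>snd (fst h) * ?w ! i\<bar> \<le> S * A" unfolding abs_mult using H w i S1 by (intro mult_mono) auto
      moreover have "\<bar>fst (fst h) * d ! i\<bar> \<le> (P * A) * S" unfolding abs_mult
        using H yS[of "d ! i"] i d P1 A0 by (intro mult_mono) auto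
      ultimately show ?thesis using i(2) unfolding G by (simp add: algebra_simps)
    qed
    ultimately show ?thesis using H w(1) d by (auto simp: st)
  qed
  then show "length (fst (snd s')) = length ps" "\<And>y. y \<in> set (fst (snd s')) \<Longrightarrow> \<bar>y\<bar> \<le> G * A" "\<bar>fst s'\<bar> \<le> G * A"
    "\<exists>R. snd (snd s') = R @ snd (snd s) \<and> length R \<le> 1 \<and> (\<forall>r\<in>set R. row01 (length ps) r)" by auto
qed

section \<open>Polynomial time of a single round\<close>

lemma pt_rowE [pt]: "pt f \<Longrightarrow> pt g \<Longrightarrow> pt (\<lambda>a. rowE (f a) (g a))"
  by (rule pt_app2[of rowE]; assumption?) (unfold rowE_def, intro pt)

lemma pt_rowC [pt]: "pt f \<Longrightarrow> pt g \<Longrightarrow> pt (\<lambda>a. rowC (f a) (g a))"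
  by (rule pt_app2[of rowC]; assumption?) (unfold rowC_def, intro pt)

lemma pt_supp_count [pt]: "pt f \<Longrightarrow> pt g \<Longrightarrow> pt (\<lambda>a. supp_count (f a) (g a))"
  by (rule pt_app2[of supp_count]; assumption?) (unfold supp_count_def, intro pt)

lemma pt_active [pt]: "pt f \<Longrightarrow> pt g \<Longrightarrow> pt (\<lambda>a. active (f a) (g a))"
  by (rule pt_app2[of active]; assumption?) (unfold active_def, intro pt)

lemma pt_tight_rows [pt]: "pt f \<Longrightarrow> pt g \<Longrightarrow> pt h \<Longrightarrow> pt (\<lambda>a. tight_rows (f a) (g a) (h a))"
  by (rule pt_app3[of tight_rows]; assumption?) (unfold tight_rows_def, intro pt)

lemma pt_bounds [pt]: "pt f \<Longrightarrow> pt g \<Longrightarrow> pt h \<Longrightarrow> pt (\<lambda>a. bounds (f a) (g a) (h a))"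
  by (rule pt_app3[of bounds]; assumption?) (unfold bounds_def, intro pt)

lemma pt_sum_abs [pt]: "pt f \<Longrightarrow> pt (\<lambda>a. sum_abs (f a))"
  by (rule pt_comp[of sum_abs]; assumption?) (unfold sum_abs_def, intro pt)

lemma pt_foldl_min:
  assumes "pt f" "pt g"
  shows "pt (\<lambda>a. foldl (\<lambda>m g. if fst g * snd m < fst m * snd g then g else (m :: int \<times> int)) (f a) (g a))"
proof (rule pt_app2[OF _ assms])
  show "pt (\<lambda>p::(int \<times> int) \<times> (int \<times> int) list. foldl (\<lambda>m g. if fst g * snd m < fst m * snd g then g else m) (fst p) (snd p))"
  proof (rule pt_foldl[where J = "\<lambda>p n s. s = fst p \<or> s \<in> set (snd p)" and G = sz])
    show "sz s \<le> sz p" if "s = fst p \<or> s \<in> set (snd p)" for s and p :: "(int \<times> int) \<times> (int \<times> int) list"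
      using that sz_ge_elem[of s "snd p"] sz_pair[of p] by auto
  qed (auto intro!: pb | intro pt)+
qed

lemma pt_min_frac [pt]: assumes "pt f" shows "pt (\<lambda>a. min_frac (f a))"
  unfolding min_frac_def by (rule pt_case_list[OF assms pt_const]) (intro pt_foldl_min pt)

lemma bit_length_pow2_mult: "bit_length (2 ^ n * a) \<le> n + bit_length a"
proof -
  have "\<bar>2 ^ n * a\<bar> < 2 ^ n * 2 ^ bit_length a" using abs_less_bit_length[of a] by (simp add: abs_mult)
  then show ?thesis by (simp add: bit_length_le_iff power_add)
qed

text \<open>The fraction doubles in every round, but the number of rounds is only a binary length,
  so its own length stays polynomial.\<close>

lemma pt_bisect [pt]: assumes "pt f" "pt g" "pt h" "pt k" shows "pt (\<lambda>a. bisect (f a) (g a) (h a) (k a))"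
proof (rule pt_app4[of bisect, OF _ assms])
  let ?f = "\<lambda>p::nat list \<times> (nat \<times> nat) list \<times> (int \<times> int list \<times> int list) \<times> int \<times> int. snd (snd (snd p))"
  let ?d = "\<lambda>p::nat list \<times> (nat \<times> nat) list \<times> (int \<times> int list \<times> int list) \<times> int \<times> int. snd (snd (fst (snd (snd p))))"
  let ?xs = "\<lambda>p::nat list \<times> (nat \<times> nat) list \<times> (int \<times> int list \<times> int list) \<times> int \<times> int.
     halves (max 0 (fst (?f p) * sum_abs (?d p) * sum_abs (?d p)))"
  have xs: "pt ?xs" by (intro pt)
  show "pt (\<lambda>p. bisect (fst p) (fst (snd p)) (fst (snd (snd p))) (?f p))" unfolding bisect_def
  \<comment> \<open>The added \<open>\<bar>fst (?f p)\<bar>\<close> absorbs the summand of a round,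
    so that the left side at most doubles.\<close>
  proof (rule pt_foldl[where J = "\<lambda>p n t. \<bar>fst t\<bar> + \<bar>fst (?f p)\<bar> \<le> 2 ^ n * \<bar>fst (?f p)\<bar> \<and> \<bar>snd t\<bar> \<le> 2 ^ n * \<bar>snd (?f p)\<bar>"
        and G = "\<lambda>p. 2 * sz (?xs p) + 2 * sz p + 10"])
    show "pbnd (\<lambda>p. 2 * sz (?xs p) + 2 * sz p + 10)" by (intro pb pbnd_sz_pt[OF xs])
    show "sz t \<le> 2 * sz (?xs p) + 2 * sz p + 10"
      if J: "\<bar>fst t\<bar> + \<bar>fst (?f p)\<bar> \<le> 2 ^ n * \<bar>fst (?f p)\<bar> \<and> \<bar>snd t\<bar> \<le> 2 ^ n * \<bar>snd (?f p)\<bar>" and n: "n \<le> length (?xs p)" for p n t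
    proof -
      have "bit_length (fst t) \<le> bit_length (2 ^ n * fst (?f p))" "bit_length (snd t) \<le> bit_length (2 ^ n * snd (?f p))"
        using J by (auto intro!: bit_length_mono simp: abs_mult)
      then have "bit_length (fst t) \<le> n + bit_length (fst (?f p))" "bit_length (snd t) \<le> n + bit_length (snd (?f p))"
        using bit_length_pow2_mult le_trans by blast+
      moreover have "sz (?f p) \<le> sz p" using sz_pair[of p] sz_pair[of "snd p"] sz_pair[of "snd (snd p)"] by linarith
      ultimately show ?thesis using n sz_ge_length[of "?xs p"] sz_pair[of t] sz_pair[of "?f p"] by simp
    qed
  qed ((intro pt xs; fail) | auto simp: algebra_simps)+
qed

lemma pt_advance [pt]: "pt f \<Longrightarrow> pt g \<Longrightarrow> pt h \<Longrightarrow> pt k \<Longrightarrow> pt (\<lambda>a. advance (f a) (g a) (h a) (k a))"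
  by (rule pt_app4[of advance]; assumption?) (unfold advance_def, intro pt)

lemma pt_step_dir: "pt (\<lambda>p. step_dir (fst (fst p)) (fst (snd (fst p))) (fst (snd (snd (fst p)))) (fst (snd p)) (snd (snd p)))"
  unfolding step_dir_def by (intro pt)

lemma pt_step [pt]: "pt f \<Longrightarrow> pt g \<Longrightarrow> pt (\<lambda>a. step (f a) (g a))"
proof (rule pt_app2[of step]; assumption?)
  have sd: "pt (\<lambda>a. step_dir (fst (c a)) (fst (snd (c a))) (fst (snd (snd (c a)))) (s a) (d a))"
    if "pt c" "pt s" "pt d" for c :: "'b::encodable \<Rightarrow> nat list \<times> (nat \<times> nat) list \<times> (int list \<times> int list \<times> int) list \<times> int list" and s d
    using pt_comp[OF pt_step_dir, of "\<lambda>a. (c a, s a, d a)"] that by (simp add: pt_Pair)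
  show "pt (\<lambda>p. step (fst p) (snd p))" unfolding step_def by (intro pt sd)
qed

section \<open>Input data and the complete program\<close>

definition denom :: "rat \<Rightarrow> int" where
  "denom r = snd (quotient_of r)"

definition numer :: "rat \<Rightarrow> int" where
  "numer r = fst (quotient_of r)"

text \<open>The product of the denominators suffices as a common multiple, since its binary length
  is at most the sum of theirs.\<close>

definition common_denom :: "rat list \<Rightarrow> int" where
  "common_denom rs = prod_list (map denom rs)"

definition scaled :: "rat list \<Rightarrow> int list" where
  "scaled rs = map (\<lambda>r. numer r * (common_denom rs div denom r)) rs"

type_synonym code = "nat list \<times> ((nat \<times> nat) \<times> (rat \<times> rat)) list \<times> (nat list \<times> nat) list"

definition in_ps :: "code \<Rightarrow> (nat \<times> nat) list" where
  "in_ps a = map fst (fst (snd a))"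

definition in_x :: "code \<Rightarrow> rat list" where
  "in_x a = map (\<lambda>e. fst (snd e)) (fst (snd a))"

definition in_c :: "code \<Rightarrow> rat list" where
  "in_c a = map (\<lambda>e. snd (snd e)) (fst (snd a))"

text \<open>Each set is paired with the rounded-up value of its cut; the ceiling is obtained from
  integer division by negating twice.\<close>

definition in_ls :: "code \<Rightarrow> (nat list \<times> int) list" where
  "in_ls a = map (\<lambda>l. (fst l, - ((- dot (rowC (in_ps a) (fst l)) (scaled (in_x a))) div common_denom (in_x a)))) (snd (snd a))"

definition in_LS :: "code \<Rightarrow> (int list \<times> int list \<times> int) list" where
  "in_LS a = map (\<lambda>l. (rowE (in_ps a) (fst l), rowC (in_ps a) (fst l), snd l)) (in_ls a)"

text \<open>Only the length matters: one more than the largest possible potential.\<close>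

definition rounds :: "code \<Rightarrow> int list" where
  "rounds a = map (\<lambda>e. 0) (fst (snd a)) @ map (\<lambda>e. 0) (fst (snd a)) @ map (\<lambda>l. 0) (snd (snd a)) @ [0]"

definition run :: "code \<Rightarrow> int \<times> int list \<times> int list list" where
  "run a = foldl (\<lambda>s x. step (fst a, in_ps a, in_LS a, scaled (in_c a)) s)
     (common_denom (in_x a), scaled (in_x a), []) (rounds a)"

text \<open>At the end every numerator is 0 or the denominator, so the tree edges are those with a
  nonzero numerator.\<close>

definition main :: "code \<Rightarrow> (nat \<times> nat) list" where
  "main a = map fst (filter (\<lambda>z. snd z \<noteq> 0) (zip (in_ps a) (fst (snd (run a)))))"

lemma pt_common_denom [pt]: "pt f \<Longrightarrow> pt (\<lambda>a. common_denom (f a))"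
  by (rule pt_comp[of common_denom]; assumption?) (unfold common_denom_def denom_def, intro pt)

lemma pt_scaled [pt]: "pt f \<Longrightarrow> pt (\<lambda>a. scaled (f a))"
  by (rule pt_comp[of scaled]; assumption?) (unfold scaled_def numer_def denom_def, intro pt)

lemma pt_in [pt]: "pt in_ps" "pt in_x" "pt in_c"
  by (unfold in_ps_def in_x_def in_c_def) (intro pt)+

lemmas pt_in' [pt] = pt_comp[OF pt_in(1)] pt_comp[OF pt_in(2)] pt_comp[OF pt_in(3)]

lemma pt_in_LS [pt]: "pt in_LS"
  unfolding in_LS_def in_ls_def by (intro pt)

lemma pt_rounds: "pt rounds"
  unfolding rounds_def by (intro pt)

lemma length_in [simp]: "length (scaled rs) = length rs" "length (in_x a) = length (in_ps a)" "length (in_c a) = length (in_ps a)"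
  by (auto simp: scaled_def in_x_def in_c_def in_ps_def)

definition growth :: "code \<Rightarrow> int" where
  "growth a = dir_bound (length (in_ps a)) * (sum_abs (scaled (in_x a)) + int (length (in_ps a)) + 2 * int (length (fst a)) + 3)"

definition start_size :: "code \<Rightarrow> int" where
  "start_size a = \<bar>common_denom (in_x a)\<bar> + sum_abs (scaled (in_x a))"

lemma mem_le_sum_abs: "y \<in> set d \<Longrightarrow> \<bar>y\<bar> \<le> sum_abs d" and sum_abs_nonneg: "0 \<le> sum_abs d"
proof -
  show 0: "0 \<le> sum_abs d" for d unfolding sum_abs_def by (rule sum_list_nonneg) auto
  show "y \<in> set d \<Longrightarrow> \<bar>y\<bar> \<le> sum_abs d"
  proof (induction d)
    case (Cons a d)
    then show ?case using 0[of d] by (auto simp: sum_abs_def)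
  qed simp
qed

lemma pbnd_length: "pt f \<Longrightarrow> pbnd (\<lambda>a. length (f a))"
  by (rule pbnd_mono[OF pbnd_sz_pt]) (auto simp: less_imp_le[OF sz_ge_length])

lemma pbnd_bit_length: "pt f \<Longrightarrow> pbnd (\<lambda>a. bit_length (f a))"
  by (rule pbnd_mono[OF pbnd_sz_pt[of f]]) auto

lemma pbnd_growth: "pbnd (\<lambda>a. bit_length (growth a))"
proof -
  let ?m = "\<lambda>a. length (in_ps a)"
  let ?r = "\<lambda>a. sum_abs (scaled (in_x a)) + int (?m a) + 2 * int (length (fst a)) + 3"
  have "bit_length (dir_bound n) \<le> n + (n * Suc n + 1) + 2" for n
  proof -
    have "bit_length (dir_bound n) \<le> bit_length (int n * int (Suc n ^ n)) + bit_length 1 + 1"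
      unfolding dir_bound_def by (rule bit_length_add)
    also have "bit_length (int n * int (Suc n ^ n)) \<le> bit_length (int n) + bit_length (int (Suc n ^ n))" by (rule bit_length_mult)
    also have "bit_length (int n) \<le> n" by (rule bit_length_int_le)
    also have "bit_length (int (Suc n ^ n)) \<le> n * Suc n + 1" by (rule bit_length_power_le)
    finally show ?thesis by simp
  qed
  then have "bit_length (growth a) \<le> ?m a + (?m a * Suc (?m a) + 1) + 2 + bit_length (?r a)" for a
    unfolding growth_def using bit_length_mult[of "dir_bound (?m a)" "?r a"] add_right_mono le_trans by blast
  moreover have "pbnd (\<lambda>a. ?m a + (?m a * Suc (?m a) + 1) + 2 + bit_length (?r a))"
    by (intro pb pbnd_length pbnd_bit_length pt)
  ultimately show ?thesis by (rule pbnd_mono[rotated])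
qed

lemma pbnd_start_size: "pbnd (\<lambda>a. bit_length (start_size a))"
  unfolding start_size_def by (intro pbnd_bit_length pt)

lemma bit_length_power: "bit_length (g ^ n * b) \<le> n * bit_length g + bit_length b"
proof (induction n)
  case (Suc n)
  have "bit_length (g ^ Suc n * b) \<le> bit_length g + bit_length (g ^ n * b)"
    using bit_length_mult[of g "g ^ n * b"] by (simp add: mult.assoc)
  then show ?case using Suc by simp
qed simp

lemma in_LS_bound: "l \<in> set (in_LS a) \<Longrightarrow> row01 (length (in_ps a)) (fst (snd l)) \<and> \<bar>snd (snd l)\<bar> \<le> sum_abs (scaled (in_x a))"
proof -
  assume "l \<in> set (in_LS a)"
  then obtain S where S: "fst (snd l) = rowC (in_ps a) S"
    "snd (snd l) = - ((- dot (rowC (in_ps a) S) (scaled (in_x a))) div common_denom (in_x a))"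
    by (auto simp: in_LS_def in_ls_def)
  have "\<bar>snd (snd l)\<bar> \<le> \<bar>dot (rowC (in_ps a) S) (scaled (in_x a))\<bar>"
    using abs_div_le[of "- dot (rowC (in_ps a) S) (scaled (in_x a))" "common_denom (in_x a)"] by (simp add: S(2))
  also have "\<dots> \<le> sum_abs (scaled (in_x a))" by (rule abs_dot_le) (use row01_rows(2) in simp)
  finally show ?thesis using S(1) row01_rows(2) by simp
qed

text \<open>After \<open>n\<close> rounds all numbers are at most
  \<open>growth a ^ n * start_size a\<close>, and each round records at most one row, so every
  intermediate state is polynomial in size.\<close>

lemma pt_run: "pt run"
proof -
  define \<beta> where "\<beta> a = length (rounds a) * bit_length (growth a) + bit_length (start_size a)" for a
  have \<beta>: "pbnd \<beta>" unfolding \<beta>_def by (intro pb pbnd_length pt_rounds pbnd_growth pbnd_start_size)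
  have m: "pbnd (\<lambda>a. length (in_ps a))" by (intro pbnd_length pt)
  have N: "pbnd (\<lambda>a. length (rounds a))" by (intro pbnd_length pt_rounds)
  define J where "J a n s \<longleftrightarrow> length (fst (snd s)) = length (in_ps a) \<and>
      (\<forall>y\<in>set (fst (snd s)). \<bar>y\<bar> \<le> growth a ^ n * start_size a) \<and> \<bar>fst s\<bar> \<le> growth a ^ n * start_size a \<and>
      length (snd (snd s)) \<le> n \<and> (\<forall>r\<in>set (snd (snd s)). row01 (length (in_ps a)) r)"
    for a n and s :: "int \<times> int list \<times> int list list"
  have st: "0 \<le> start_size a" for a using sum_abs_nonneg by (simp add: start_size_def)
  have gr: "1 \<le> growth a" for a
  proof -
    have "1 * 1 \<le> growth a" unfolding growth_def dir_bound_def
      by (rule mult_mono) (use sum_abs_nonneg[of "scaled (in_x a)"] in auto)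
    then show ?thesis by simp
  qed
  show ?thesis unfolding run_def
  proof (rule pt_foldl[where J = J and G = "\<lambda>a. (\<beta> a + 1) + (1 + length (in_ps a) * (\<beta> a + 2)) +
        (1 + length (rounds a) * (1 + length (in_ps a) * 3 + 1)) + 2"])
    show "pbnd (\<lambda>a. (\<beta> a + 1) + (1 + length (in_ps a) * (\<beta> a + 2)) + (1 + length (rounds a) * (1 + length (in_ps a) * 3 + 1)) + 2)"
      by (intro pb \<beta> m N)
    show "J a 0 (common_denom (in_x a), scaled (in_x a), [])" for a
      using mem_le_sum_abs[of _ "scaled (in_x a)"] sum_abs_nonneg[of "scaled (in_x a)"] by (force simp: J_def start_size_def)
    show "J a (Suc n) (step (fst a, in_ps a, in_LS a, scaled (in_c a)) s)" if "J a n s" for a n s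
    proof -
      let ?A = "growth a ^ n * start_size a"
      have h: "length (fst (snd s)) = length (in_ps a)" "\<And>y. y \<in> set (fst (snd s)) \<Longrightarrow> \<bar>y\<bar> \<le> ?A" "\<bar>fst s\<bar> \<le> ?A"
        "length (snd (snd s)) \<le> n" "\<And>r. r \<in> set (snd (snd s)) \<Longrightarrow> row01 (length (in_ps a)) r" using that by (auto simp: J_def)
      note S = step_size[where vs = "fst a" and cv = "scaled (in_c a)", OF h(1-3) in_LS_bound sum_abs_nonneg, folded growth_def]
      obtain R where R: "snd (snd (step (fst a, in_ps a, in_LS a, scaled (in_c a)) s)) = R @ snd (snd s)" "length R \<le> 1"
        "\<forall>r\<in>set R. row01 (length (in_ps a)) r" using S(4) by blast
      show ?thesis unfolding J_def using S(1-3) R h(4,5) by (auto simp: mult.assoc)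
    qed
    show "sz s \<le> (\<beta> a + 1) + (1 + length (in_ps a) * (\<beta> a + 2)) + (1 + length (rounds a) * (1 + length (in_ps a) * 3 + 1)) + 2"
      if J: "J a n s" and n: "n \<le> length (rounds a)" for a n s
    proof -
      have bl: "bit_length y \<le> \<beta> a" if "\<bar>y\<bar> \<le> growth a ^ n * start_size a" for y
      proof -
        have "bit_length y \<le> bit_length (growth a ^ n * start_size a)" using that by (intro bit_length_mono) linarith
        also have "\<dots> \<le> n * bit_length (growth a) + bit_length (start_size a)" by (rule bit_length_power)
        also have "\<dots> \<le> \<beta> a" unfolding \<beta>_def using n by (intro add_right_mono mult_right_mono) auto
        finally show ?thesis .
      qed
      have 1: "sz (fst s) \<le> \<beta> a + 1" using bl J by (simp add: J_def)
      have "sz (fst (snd s)) \<le> 1 + length (fst (snd s)) * (\<beta> a + 1 + 1)"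
        by (rule sz_list_le) (use bl J in \<open>auto simp: J_def\<close>)
      then have 2: "sz (fst (snd s)) \<le> 1 + length (in_ps a) * (\<beta> a + 2)" using J by (simp add: J_def)
      have "sz r \<le> 1 + length (in_ps a) * 3" if "r \<in> set (snd (snd s))" for r
      proof -
        have r: "row01 (length (in_ps a)) r" using J that by (simp add: J_def)
        have "sz r \<le> 1 + length r * (2 + 1)"
        proof (rule sz_list_le)
          fix y assume "y \<in> set r"
          then have "y = 0 \<or> y = 1" using r by (auto simp: row01_def)
          then show "sz y \<le> 2" by auto
        qed
        then show ?thesis using r by (simp add: row01_def)
      qed
      then have "sz (snd (snd s)) \<le> 1 + length (snd (snd s)) * (1 + length (in_ps a) * 3 + 1)" by (rule sz_list_le)
      also have "\<dots> \<le> 1 + length (rounds a) * (1 + length (in_ps a) * 3 + 1)"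
        using J n by (intro add_left_mono mult_right_mono) (auto simp: J_def)
      finally show ?thesis using 1 2 sz_pair[of s] sz_pair[of "snd s"] by linarith
    qed
  qed (intro pt pt_rounds pt_comp[OF pt_in_LS])+
qed

lemma pt_main: "pt main"
  unfolding main_def by (intro pt pt_comp[OF pt_run])

section \<open>Polynomial-time rounding\<close>

lemma pt_program:
  assumes "pt f"
  obtains P :: program and p :: "nat poly" where
    "\<And>a. \<exists>t. computes_in P (encode a) (encode (f a)) t \<and> t \<le> poly p (val_size (encode a))"
proof -
  obtain P T where P: "P \<noteq> []" "\<And>a. eval P [encode a] (P ! 0) (encode (f a)) (T a)" and T: "pbnd T"
    using assms unfolding pt_def by blast
  obtain k where k: "\<And>a. T a \<le> (sz a + 2) ^ k" using T unfolding pbnd_def by blast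
  show thesis
  \<comment> \<open>The constant 2 pays for the initial call and its argument.\<close>
  proof (rule that[of P "[:2:] + [:2, 1:] ^ k"])
    fix a
    have "eval P [encode a] (Call 0 (Var 0)) (encode (f a)) (1 + T a + 1)"
      by (rule eval.Call[OF eval_Var0]) (use P in auto)
    moreover have "poly ([:2:] + [:2, 1:] ^ k) n = 2 + (n + 2) ^ k" for n :: nat
      by (simp add: poly_power add.commute)
    ultimately show "\<exists>t. computes_in P (encode a) (encode (f a)) t \<and> t \<le> poly ([:2:] + [:2, 1:] ^ k) (val_size (encode a))"
      using k[of a] unfolding computes_in_def by (intro exI[of _ "1 + T a + 1"]) (simp add: sz_def)
  qed
qed

context relaxation
begin

text \<open>Needed because the list of numerators and the given point agree at the edges
  only.\<close>

lemma feas_cong: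
  assumes "\<And>i. i \<in> I \<Longrightarrow> x i = y i" shows "feas x \<longleftrightarrow> feas y"
proof -
  have s: "sum x A = sum y A" if "A \<subseteq> I" for A by (rule sum.cong) (use that assms in auto)
  have "sum x (EI S) = sum y (EI S)" "sum x (cutI S) = sum y (cutI S)" "sum x I = sum y I"
    "(\<Sum>i\<in>I. c i * x i) = (\<Sum>i\<in>I. c i * y i)" for S
    using s[of "EI S"] s[of "cutI S"] s[of I] assms by (auto simp: EI_def cutI_def)
  moreover have "{i \<in> cutI S. 0 < x i} = {i \<in> cutI S. 0 < y i}" for S using assms by (auto simp: cutI_def)
  ultimately show ?thesis using assms unfolding feas_def act_def tight_def stp_def by simp
qed

end

section \<open>Correctness on encoded instances\<close>

lemma denom_pos: "0 < denom r"
  by (simp add: denom_def quotient_of_denom_pos')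

lemma scaled_div:
  assumes "i < length rs"
  shows "real_of_int (scaled rs ! i) / real_of_int (common_denom rs) = of_rat (rs ! i)"
proof -
  have "denom (rs ! i) dvd common_denom rs"
    using assms unfolding common_denom_def by (intro prod_list_dvd) auto
  then have "common_denom rs = denom (rs ! i) * (common_denom rs div denom (rs ! i))" by simp
  moreover have "common_denom rs \<noteq> 0"
    unfolding common_denom_def using denom_pos by (auto simp: prod_list_zero_iff) (metis less_irrefl)
  moreover have "of_rat (rs ! i) = real_of_int (numer (rs ! i)) / real_of_int (denom (rs ! i))"
    using quotient_of_div[of "rs ! i" "numer (rs ! i)" "denom (rs ! i)"]
    by (metis numer_def denom_def of_rat_divide of_rat_of_int_eq prod.collapse)
  moreover obtain e where "e = common_denom rs div denom (rs ! i)" by blast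
  ultimately have "common_denom rs = denom (rs ! i) * e" "e \<noteq> 0" "of_rat (rs ! i) = real_of_int (numer (rs ! i)) / real_of_int (denom (rs ! i))"
    "scaled rs ! i = numer (rs ! i) * e" using assms by (auto simp: scaled_def)
  then show ?thesis using denom_pos[of "rs ! i"] by simp
qed

lemma common_denom_pos: "0 < common_denom rs"
  unfolding common_denom_def using denom_pos by (induction rs) auto

text \<open>Two views of one relaxation are matched: \<open>R\<close> supplies the feasible start
  and reads a tree off the final point, \<open>A\<close> supplies the iteration on lists. The bounds
  computed from the scaled data have to be recognised as the ceilings of the cut values.\<close>

lemma main_correct:
  assumes inst: "laminar_instance V E L b x" and algn: "aligned E L x"
    and V: "distinct vs" "V = set vs"
    and E: "distinct (map (edge_of \<circ> fst) es)" "E = set (map (edge_of \<circ> fst) es)"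
    and xc: "\<And>p q r. (p, q, r) \<in> set es \<Longrightarrow> x (edge_of p) = of_rat q \<and> c (edge_of p) = of_rat r"
    and L: "L = set (map (set \<circ> fst) ls)"
  defines "T \<equiv> main (vs, es, ls)"
  shows "distinct (map edge_of T)" "thin_tree V E L x c (set (map edge_of T))"
proof -
  define a where "a = (vs, es, ls)"
  let ?ps = "in_ps a" let ?m = "length ?ps" let ?ends = "\<lambda>i. edge_of (?ps ! i)"
  have ps: "?ps = map fst es" by (simp add: in_ps_def a_def)
  have emap: "map (edge_of \<circ> fst) es = map edge_of ?ps" by (simp add: ps)
  have Eimg: "?ends ` {..<?m} = E" unfolding E(2) emap by (force simp: set_conv_nth)
  have inj: "inj_on ?ends {..<?m}"
    using E(1) unfolding emap by (auto simp: inj_on_def distinct_conv_nth)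
  interpret R: instance_relaxation V "{..<?m}" ?ends L b x c
    by unfold_locales (use inst algn inj Eimg in auto)
  have es_i: "x (?ends i) = of_rat (in_x a ! i)" "c (?ends i) = of_rat (in_c a ! i)" if "i < ?m" for i
  proof -
    have "es ! i \<in> set es" using that by (simp add: ps)
    then show "x (?ends i) = of_rat (in_x a ! i)" "c (?ends i) = of_rat (in_c a ! i)"
      using xc[of "fst (es ! i)" "fst (snd (es ! i))" "snd (snd (es ! i))"] that
      by (auto simp: in_x_def in_c_def in_ps_def a_def)
  qed
  let ?D = "common_denom (in_x a)" let ?w = "scaled (in_x a)"
  have xw: "real_of_int (?w ! i) / real_of_int ?D = x (?ends i)" if "i < ?m" for i
    using scaled_div[of i "in_x a"] es_i[OF that] that by simp
  have fsts: "map fst (in_ls a) = map fst ls" by (simp add: in_ls_def a_def)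
  have Lset: "L = (\<lambda>l. set (fst l)) ` set (in_ls a)"
  proof -
    have "(\<lambda>l. set (fst l)) ` set (in_ls a) = set ` set (map fst (in_ls a))" by (simp add: image_image)
    also have "\<dots> = L" unfolding fsts L by (simp add: image_image comp_def)
    finally show ?thesis by simp
  qed
  let ?k = "\<lambda>S. \<lceil>sum x (cut_edges (?ends ` {..<?m}) S)\<rceil>"
  have rel: "relaxation (set vs) {..<?m} ?ends ((\<lambda>l. set (fst l)) ` set (in_ls a))"
    using R.relaxation_axioms unfolding V(2) Lset .
  have ends_neq: "fst (?ps ! i) \<noteq> snd (?ps ! i)" if "i < ?m" for i
    using R.ends[of i] that by (auto simp: edge_of_def card_2_iff)
  interpret A: algorithm vs ?ps "in_ls a" ?k "\<lambda>i. c (?ends i)" "\<Sum>e\<in>?ends ` {..<?m}. c e * x e"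
    "scaled (in_c a)" "real_of_int (common_denom (in_c a))"
  proof (intro algorithm.intro algorithm_axioms.intro)
    show "relaxation (set vs) {..<?m} ?ends ((\<lambda>l. set (fst l)) ` set (in_ls a))" by (rule rel)
    show "distinct vs" by (rule V(1))
    show "length (scaled (in_c a)) = ?m" by simp
    show "0 < real_of_int (common_denom (in_c a))" using common_denom_pos by simp
    show "c (?ends i) = real_of_int (scaled (in_c a) ! i) / real_of_int (common_denom (in_c a))" if "i < ?m" for i
      using scaled_div[of i "in_c a"] es_i(2)[OF that] that by simp
    fix l assume "l \<in> set (in_ls a)"
    then obtain S where S: "l = (S, - ((- dot (rowC ?ps S) ?w) div ?D))" by (auto simp: in_ls_def)
    have "sum x (cut_edges (?ends ` {..<?m}) (set S)) = (\<Sum>i\<in>R.cutI (set S). x (?ends i))"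
      by (rule sum_cut_edges_image(1)[OF R.indexed_graph_axioms inj])
    also have "\<dots> = (\<Sum>i\<in>R.cutI (set S). real_of_int (?w ! i) / real_of_int ?D)"
      by (rule sum.cong) (auto simp: xw R.cutI_def)
    also have "\<dots> = real_of_int (\<Sum>i\<in>R.cutI (set S). ?w ! i) / real_of_int ?D" by (simp add: sum_divide_distrib)
    also have "(\<Sum>i\<in>R.cutI (set S). ?w ! i) = dot (rowC ?ps S) ?w"
    proof -
      have "dot (rowC ?ps S) ?w = (\<Sum>i<?m. if i \<in> R.cutI (set S) then ?w ! i else 0)"
      proof -
        have "i \<in> R.cutI (set S) \<longleftrightarrow> (fst (?ps ! i) \<in> set S) \<noteq> (snd (?ps ! i) \<in> set S)" if "i < ?m" for i
          unfolding R.cutI_def using ends_neq[OF that] that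
          by (cases "fst (?ps ! i) \<in> set S"; cases "snd (?ps ! i) \<in> set S") (auto simp: edge_of_def)
        then show ?thesis by (simp add: dot_sum[of _ ?m] rowC_def) (rule sum.cong, auto)
      qed
      also have "\<dots> = sum (\<lambda>i. ?w ! i) ({..<?m} \<inter> R.cutI (set S))" by (simp add: sum.inter_restrict)
      also have "{..<?m} \<inter> R.cutI (set S) = R.cutI (set S)" by (auto simp: R.cutI_def)
      finally show ?thesis by simp
    qed
    finally have "?k (set S) = - (- dot (rowC ?ps S) ?w div ?D)" by (simp only: ceiling_divide_eq_div)
    then show "?k (set (fst l)) = snd l" by (simp add: S)
  qed
  have LS: "in_LS a = A.LS" by (simp add: in_LS_def A.LS_def)
  let ?s0 = "(?D, ?w, []) :: int \<times> int list \<times> int list list"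
  have "R.feas (\<lambda>i. real_of_int (?w ! i) / real_of_int ?D)"
    using R.feas_initial R.feas_cong[of "\<lambda>i. real_of_int (?w ! i) / real_of_int ?D" "\<lambda>i. x (?ends i)"] xw by auto
  then have feas0: "A.feas (\<lambda>i. real_of_int (?w ! i) / real_of_int ?D)" unfolding V(2) Lset .
  have g0: "A.good ?s0" unfolding A.good_def using feas0 common_denom_pos by simp
  have run: "run a = (step (vs, ?ps, A.LS, scaled (in_c a)) ^^ length (rounds a)) ?s0"
    unfolding run_def foldl_const_fun LS by (simp add: a_def)
  have "2 * ?m + length (in_ls a) < length (rounds a)" by (simp add: rounds_def in_ps_def in_ls_def a_def)
  note I = A.iterate_integral[OF g0 this, folded run]
  let ?t = "run a"
  let ?y = "\<lambda>i. real_of_int (fst (snd ?t) ! i) / real_of_int (fst ?t)"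
  have fy: "A.feas ?y" "0 < fst ?t" "length (fst (snd ?t)) = ?m" using I(1) by (auto simp: A.good_def)
  have thin: "thin_tree V (?ends ` {..<?m}) L x c (?ends ` {i \<in> {..<?m}. ?y i = 1})"
    by (rule R.thin_tree_final) (use fy(1) I(2) V(2) Lset in auto)
  have one: "?y i = 1 \<longleftrightarrow> fst (snd ?t) ! i \<noteq> 0" if "i < ?m" for i
  proof -
    have "?y i = 0 \<or> ?y i = 1" using I(2) that unfolding A.integral_def by blast
    then show ?thesis using fy(2) by auto
  qed
  have T: "T = map (\<lambda>i. ?ps ! i) (filter (\<lambda>i. fst (snd ?t) ! i \<noteq> 0) [0..<?m])"
  proof -
    have "zip ?ps (fst (snd ?t)) = map (\<lambda>i. (?ps ! i, fst (snd ?t) ! i)) [0..<?m]"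
      by (rule nth_equalityI) (use fy(3) in auto)
    then show ?thesis unfolding T_def a_def[symmetric] main_def by (simp add: filter_map comp_def)
  qed
  have "map edge_of T = map ?ends (filter (\<lambda>i. fst (snd ?t) ! i \<noteq> 0) [0..<?m])" by (simp add: T comp_def)
  moreover have "inj_on ?ends (set (filter (\<lambda>i. fst (snd ?t) ! i \<noteq> 0) [0..<?m]))"
    by (rule inj_on_subset[OF inj]) auto
  ultimately show "distinct (map edge_of T)" by (simp add: distinct_map)
  have "set (map edge_of T) = ?ends ` {i \<in> {..<?m}. ?y i = 1}"
    unfolding T using one by (auto simp: image_iff)
  then show "thin_tree V E L x c (set (map edge_of T))" using thin Eimg by simp
qed

text \<open>The existence part has a proof of its own, since a program sees only encoded and hence
  rational data, while existence is claimed for real ones.\<close>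

theorem mainTheorem3:
  shows "(\<forall>(V :: 'v set) E L b x c.
            laminar_instance V E L b x \<and> aligned E L x \<and> (\<forall>e\<in>E. 0 \<le> c e) \<longrightarrow>
            (\<exists>T. thin_tree V E L x c T)) \<and>
         (\<exists>(P :: program) (p :: nat poly).
            \<forall>(V :: nat set) E L b x c d.
              laminar_instance V E L b x \<and> aligned E L x \<and> (\<forall>e\<in>E. 0 \<le> c e) \<and>
              encodes_instance d V E L b x c \<longrightarrow>
              (\<exists>r t T. computes_in P d r t \<and> t \<le> poly p (val_size d) \<and>
                       encodes_edge_set r T \<and> thin_tree V E L x c T))"
proof (rule conjI)
  show "\<forall>(V :: 'v set) E L b x c.
            laminar_instance V E L b x \<and> aligned E L x \<and> (\<forall>e\<in>E. 0 \<le> c e) \<longrightarrow>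
            (\<exists>T. thin_tree V E L x c T)"
    using thin_tree_exists by blast
  obtain P :: program and p :: "nat poly" where
    P: "\<And>a. \<exists>t. computes_in P (encode a) (encode (main a)) t \<and> t \<le> poly p (val_size (encode a))"
    using pt_program[OF pt_main] by blast
  have "\<exists>r t T. computes_in P d r t \<and> t \<le> poly p (val_size d) \<and> encodes_edge_set r T \<and> thin_tree V E L x c T"
    if inst: "laminar_instance V E L b x" "aligned E L x" and enc: "encodes_instance d V E L b x c"
    for V :: "nat set" and E L b x c d
  proof -
    obtain vs es ls where e: "distinct vs" "V = set vs" "distinct (map (edge_of \<circ> fst) es)"
      "E = set (map (edge_of \<circ> fst) es)" "\<forall>(p, q, r) \<in> set es. x (edge_of p) = of_rat q \<and> c (edge_of p) = of_rat r"
      "L = set (map (set \<circ> fst) ls)"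
      "d = VPair (enc_list enc_nat vs)
           (VPair (enc_list (enc_pair (enc_pair enc_nat enc_nat) (enc_pair enc_rat enc_rat)) es)
                  (enc_list (enc_pair (enc_list enc_nat) enc_nat) ls))"
      using enc unfolding encodes_instance_def by blast
    \<comment> \<open>The class instances reproduce the prescribed encoding, so the given input is
      literally the code of a triple of lists.\<close>
    have d: "d = encode (vs, es, ls)"
      unfolding e(7) encode_prod_def encode_list_def encode_nat_def encode_rat_def by (simp add: enc_pair_def)
    let ?T = "main (vs, es, ls)"
    have xc: "x (edge_of p) = of_rat q \<and> c (edge_of p) = of_rat r" if "(p, q, r) \<in> set es" for p q r
      using e(5) that by blast
    note M = main_correct[OF inst e(1-4) xc e(6)]
    obtain t where t: "computes_in P d (encode ?T) t" "t \<le> poly p (val_size d)" using P[of "(vs, es, ls)"] d by blast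
    have "encodes_edge_set (encode ?T) (set (map edge_of ?T))" unfolding encodes_edge_set_def
      using M(1) by (intro exI[of _ ?T]) (simp add: encode_list_def encode_prod_def encode_nat_def)
    then show ?thesis using t M(2) by blast
  qed
  then show "\<exists>(P :: program) (p :: nat poly).
            \<forall>(V :: nat set) E L b x c d.
              laminar_instance V E L b x \<and> aligned E L x \<and> (\<forall>e\<in>E. 0 \<le> c e) \<and>
              encodes_instance d V E L b x c \<longrightarrow>
              (\<exists>r t T. computes_in P d r t \<and> t \<le> poly p (val_size d) \<and>
                       encodes_edge_set r T \<and> thin_tree V E L x c T)"
    by (intro exI[of _ P] exI[of _ p]) blast
qed

end
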